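(* There is an equivalence of right $\mathcal{OS}(q,t)$-modules $(\mathbf{G},\omega)$ from $\mathcal{B}(q,t)$ to $\mathcal{DS}(q,t)$, where $\omega$ has components $$\omega_{\mathsf{B}_r,\lambda}\colon\mathbf{G}(\mathsf{B}_r\otimes\lambda)\xrightarrow{\ \eta^{-1}_{\mathbf{G}(\mathsf{B}_r)\otimes\lambda}\ }\mathbf{G}(\mathsf{B}_r)\otimes\lambda$$ for $r\in\mathbb{N}$ and $\lambda$ a word in $\uparrow,\downarrow$.
   Context: Let $k$ be a commutative ring and $q,t\in k^\times$ with $t-t^{-1}$ divisible by $z:=q-q^{-1}$; write $\delta=(t-t^{-1})/(q-q^{-1})$. $\mathbb{N}$ is the set of nonnegative integers. Composition is written right to left. **Oriented skein category.** $\mathcal{OS}(q,t)$ is the strict $k$-linear monoidal category generated by objects $\uparrow,\downarrow$ and morphisms $X_+,X_-\colon\uparrow\uparrow\to\uparrow\uparrow$, $c\colon\mathbf 1\to\downarrow\uparrow$, $d\colon\uparrow\downarrow\to\mathbf 1$, $c'\colon\mathbf 1\to\uparrow\downarrow$, $d'\colon\downarrow\uparrow\to\mathbf 1$ (tensor product of objects written as juxtaposition), subject to: $X_+X_-=1=X_-X_+$; $(X_+\otimes1_\uparrow)(1_\uparrow\otimes X_+)(X_+\otimes1_\uparrow)=(1_\uparrow\otimes X_+)(X_+\otimes1_\uparrow)(1_\uparrow\otimes X_+)$; $L_-R_+=1_{\uparrow\downarrow}$; $R_+L_-=1_{\downarrow\uparrow}$; $X_+-X_-=z\,1_{\uparrow\uparrow}$;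 $(d'\otimes1_\uparrow)(1_\downarrow\otimes X_+)(c\otimes1_\uparrow)=t1_\uparrow=(1_\uparrow\otimes d)(X_+\otimes1_\downarrow)(1_\uparrow\otimes c')$; $d\,c'=\delta1_{\mathbf 1}$; $(d\otimes1_\uparrow)(1_\uparrow\otimes c)=1_\uparrow$; $(1_\downarrow\otimes d)(c\otimes1_\downarrow)=1_\downarrow$. Here $R_\pm=(1_{\downarrow\uparrow}\otimes d)(1_\downarrow\otimes X_\pm\otimes1_\downarrow)(c\otimes1_{\uparrow\downarrow})$, $L_\pm=(d'\otimes1_{\uparrow\downarrow})(1_\downarrow\otimes X_\pm\otimes1_\downarrow)(1_{\downarrow\uparrow}\otimes c')$; put $D_\pm=(1_{\downarrow\downarrow}\otimes d)(1_\downarrow\otimes R_\pm\otimes1_\downarrow)(c\otimes1_{\downarrow\downarrow})$. **Module categories.** A strict right module category ($\mathcal{C}$-module) over a strict $k$-linear monoidal category $\mathcal{C}$ is a $k$-linear category $\mathcal{M}$ with a strict monoidal functor $\mathbf A\colon\mathcal{C}\to\mathcal{E}nd(\mathcal{M})^{\mathrm{rev}}$; write $M\otimes C=\mathbf A(C)(M)$. A morphism of $\mathcal{C}$-modules $\mathcal{M}\to\mathcal{N}$ is a pair $(\mathbf H,\omega)$ of a $k$-linear functor $\mathbf H\colon\mathcal{M}\to\mathcal{N}$ and a natural isomorphism with components $\omega_{M,C}\colon\mathbf H(M\otimes C)\to\mathbf H(M)\otimes C$ such that $(\omega_{M,C}\otimes1_D)\circ\omega_{M\otimes C,D}=\omega_{M,C\otimes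 D}$. An equivalence of $\mathcal{C}$-modules is a morphism of $\mathcal{C}$-modules that is an equivalence of categories. **Disoriented skein category.** $\mathcal{DS}(q,t)$ is the strict right $\mathcal{OS}(q,t)$-module generated by morphisms (toggles) $\tau\colon\downarrow\to\uparrow$, $\bar\tau\colon\uparrow\to\downarrow$: its objects are the words in $\uparrow,\downarrow$; its morphisms are generated, as a $k$-linear category, by the morphisms of $\mathcal{OS}(q,t)$ and morphisms $f\otimes g$ with $f\in\{\tau,\bar\tau\}$, $g\in\mathrm{Mor}(\mathcal{OS}(q,t))$, subject to linearity in $g$, to $(1_Y\otimes g)\circ(f\otimes h)=f\otimes(g\circ h)=(f\otimes g)\circ(1_X\otimes h)$ for $f\colon X\to Y$, and to the following relations and everything obtained from them by composition and the right action: $\tau\bar\tau=1_\uparrow$; $\bar\tau\tau=1_\downarrow$; $(\tau\otimes1_\uparrow)R_-(\tau\otimes1_\downarrow)D_+=X_+(\tau\otimes1_\uparrow)R_-(\tau\otimes1_\downarrow)$; $d'(\bar\tau\otimes1_\uparrow)X_+=q\,d'(\bar\tau\otimes1_\uparrow)$; $X_+(\tau\otimes1_\uparrow)c=q\,(\tau\otimes1_\uparrow)c$. **Toggles on arbitrary strands and $\eta$.** Let $u_\uparrow=R_+$, $u_\downarrow=D_-$, $u_{\lambda\mu}=(u_\lambda\otimes1_\mu)(1_\lambda\otimes u_\mu)\colon\lambda\mu\downarrow\to\downarrow\lambda\mu$, and $w_\uparrow=X_-$, $w_\downarrow=R_+$, $w_{\lambda\mu}=(1_\lambda\otimes w_\mu)(w_\lambda\otimes1_\mu)\colon\uparrow\lambda\mu\to\lambda\mu\uparrow$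 (and $u_{\mathbf 1}=1_\downarrow$, $w_{\mathbf 1}=1_\uparrow$). The toggle on a $\downarrow$ strand with $\lambda$ to its left and $\mu$ to its right is the isomorphism $\big(w_\lambda(\tau\otimes1_\lambda)u_\lambda\big)\otimes1_\mu\colon\lambda\downarrow\mu\to\lambda\uparrow\mu$. Toggles on different strands commute. For a word $\lambda$ of length $\ell(\lambda)$, $\eta_\lambda\colon\lambda\to\uparrow^{\ell(\lambda)}$ is the isomorphism in $\mathcal{DS}(q,t)$ obtained by composing toggles, one on each $\downarrow$ strand of $\lambda$ (identity on the $\uparrow$ strands). **iquantum Brauer category.** $\mathcal{B}(q,t)$ is the $k$-linear category with objects $\mathsf{B}_r$, $r\in\mathbb{N}$, generating morphisms $\mathrm{cup}_r\colon\mathsf{B}_r\to\mathsf{B}_{r+2}$, $\mathrm{cap}_r\colon\mathsf{B}_{r+2}\to\mathsf{B}_r$ and $\sigma_i,\sigma_i^{-1}\colon\mathsf{B}_r\to\mathsf{B}_r$ for $1\le i\le r-1$, with relations, whenever both sides make sense: $\sigma_i\sigma_i^{-1}=1=\sigma_i^{-1}\sigma_i$; $\sigma_i\sigma_{i+1}\sigma_i=\sigma_{i+1}\sigma_i\sigma_{i+1}$; $\sigma_i\sigma_j=\sigma_j\sigma_i$ for $|i-j|>1$; $\sigma_i-\sigma_i^{-1}=z$; $\mathrm{cup}_r\sigma_i=\sigma_{i+2}\mathrm{cup}_r$; $\mathrm{cap}_r\sigma_{i+2}=\sigma_i\mathrm{cap}_r$; $\mathrm{cap}_r\mathrm{cup}_r=\delta1_{\mathsf{B}_r}$;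 $\mathrm{cap}_r\sigma_1=q\,\mathrm{cap}_r$; $\sigma_1\mathrm{cup}_r=q\,\mathrm{cup}_r$; $\mathrm{cap}_r\sigma_2\mathrm{cup}_r=t1_{\mathsf{B}_r}$ ($r\ge1$); $\mathrm{cap}_r\sigma_2\sigma_3\sigma_1^{-1}\sigma_2^{-1}\mathrm{cup}_r=\mathrm{cup}_{r-2}\mathrm{cap}_{r-2}$ ($r\ge2$); $\mathrm{cap}_r\mathrm{cap}_{r+2}\sigma_2^{-1}\sigma_3^{-1}\sigma_1\sigma_2=\mathrm{cap}_r\mathrm{cap}_{r+2}$; $\sigma_2^{-1}\sigma_1^{-1}\sigma_3\sigma_2\mathrm{cup}_{r+2}\mathrm{cup}_r=\mathrm{cup}_{r+2}\mathrm{cup}_r$. It is a strict right $\mathcal{OS}(q,t)$-module: $\uparrow$ and $\downarrow$ act by the endofunctor adding one identity strand on the right ($\mathsf{B}_r\mapsto\mathsf{B}_{r+1}$, $\mathrm{cup}_r\mapsto\mathrm{cup}_{r+1}$, $\mathrm{cap}_r\mapsto\mathrm{cap}_{r+1}$, $\sigma_i^{\pm1}\mapsto\sigma_i^{\pm1}$), and $1_{\mathsf{B}_r}\otimes f$ is: $\sigma_{r+1}^{\pm1}$ for $f=X_\pm$; $(\sigma_r^{-1}\cdots\sigma_1^{-1})(\sigma_{r+1}\cdots\sigma_2)\mathrm{cup}_r$ for $f=c$; $q^{-1}t(\sigma_r\cdots\sigma_1)(\sigma_{r+1}^{-1}\cdots\sigma_2^{-1})\mathrm{cup}_r$ for $f=c'$;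 $\mathrm{cap}_r(\sigma_2^{-1}\cdots\sigma_{r+1}^{-1})(\sigma_1\cdots\sigma_r)$ for $f=d'$; $qt^{-1}\mathrm{cap}_r(\sigma_2\cdots\sigma_{r+1})(\sigma_1^{-1}\cdots\sigma_r^{-1})$ for $f=d$. $\mathbf{G}\colon\mathcal{B}(q,t)\to\mathcal{DS}(q,t)$ is the $k$-linear functor with $\mathsf{B}_r\mapsto\uparrow^{\otimes r}$, $\mathrm{cap}_r\mapsto(d'(\bar\tau\otimes1_\uparrow))\otimes1_{\uparrow^{\otimes r}}$, $\mathrm{cup}_r\mapsto((\tau\otimes1_\uparrow)c)\otimes1_{\uparrow^{\otimes r}}$, $\sigma_i^{\pm1}\mapsto1_{\uparrow^{\otimes(i-1)}}\otimes X_\pm\otimes1_{\uparrow^{\otimes(r-i-1)}}$ on $\mathsf{B}_r$. *)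

theory Defs
  imports Main
begin

section \<open>Linear categories, functors, equivalences\<close>

text \<open>
  The sort \<open>{comm_ring, comm_monoid_mult}\<close> is that of commutative rings with unit in which
  \<open>0 = 1\<close> is not excluded (unlike in \<open>comm_ring_1\<close>).  The inverse of a unit is unique, so
  \<open>unit_inv\<close> is well defined on units.
\<close>

definition unit_inv :: "'k::{comm_ring,comm_monoid_mult} \<Rightarrow> 'k" where
  "unit_inv a = (THE b. a * b = 1)"

text \<open>The objects of a category are all elements of the type \<open>'o\<close>; \<open>cmp C g f\<close> is \<open>g\<close> after \<open>f\<close>.\<close>

record ('o, 'm, 'k) lincat =
  hom :: "'o \<Rightarrow> 'o \<Rightarrow> 'm set"
  ident :: "'o \<Rightarrow> 'm"
  cmp :: "'m \<Rightarrow> 'm \<Rightarrow> 'm"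
  zero_mor :: "'o \<Rightarrow> 'o \<Rightarrow> 'm"
  add_mor :: "'m \<Rightarrow> 'm \<Rightarrow> 'm"
  scale_mor :: "'k \<Rightarrow> 'm \<Rightarrow> 'm"

locale linear_category =
  fixes C :: "('o, 'm, 'k::{comm_ring,comm_monoid_mult}, 'z) lincat_scheme"
  assumes ident_hom: "ident C X \<in> hom C X X"
    and cmp_hom: "\<lbrakk>f \<in> hom C X Y; g \<in> hom C Y Z\<rbrakk> \<Longrightarrow> cmp C g f \<in> hom C X Z"
    and cmp_ident_left: "f \<in> hom C X Y \<Longrightarrow> cmp C (ident C Y) f = f"
    and cmp_ident_right: "f \<in> hom C X Y \<Longrightarrow> cmp C f (ident C X) = f"
    and cmp_assoc: "\<lbrakk>f \<in> hom C X Y; g \<in> hom C Y Z; h \<in> hom C Z W\<rbrakk>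
          \<Longrightarrow> cmp C (cmp C h g) f = cmp C h (cmp C g f)"
    and zero_hom: "zero_mor C X Y \<in> hom C X Y"
    and add_hom: "\<lbrakk>f \<in> hom C X Y; g \<in> hom C X Y\<rbrakk> \<Longrightarrow> add_mor C f g \<in> hom C X Y"
    and scale_hom: "f \<in> hom C X Y \<Longrightarrow> scale_mor C a f \<in> hom C X Y"
    and add_assoc: "\<lbrakk>f \<in> hom C X Y; g \<in> hom C X Y; h \<in> hom C X Y\<rbrakk>
          \<Longrightarrow> add_mor C (add_mor C f g) h = add_mor C f (add_mor C g h)"
    and add_commute: "\<lbrakk>f \<in> hom C X Y; g \<in> hom C X Y\<rbrakk> \<Longrightarrow> add_mor C f g = add_mor C g f"
    and add_zero: "f \<in> hom C X Y \<Longrightarrow> add_mor C f (zero_mor C X Y) = f"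
    and add_inverse: "f \<in> hom C X Y \<Longrightarrow> \<exists>g \<in> hom C X Y. add_mor C f g = zero_mor C X Y"
    and scale_add_right: "\<lbrakk>f \<in> hom C X Y; g \<in> hom C X Y\<rbrakk>
          \<Longrightarrow> scale_mor C a (add_mor C f g) = add_mor C (scale_mor C a f) (scale_mor C a g)"
    and scale_add_left: "f \<in> hom C X Y
          \<Longrightarrow> scale_mor C (a + b) f = add_mor C (scale_mor C a f) (scale_mor C b f)"
    and scale_scale: "f \<in> hom C X Y \<Longrightarrow> scale_mor C a (scale_mor C b f) = scale_mor C (a * b) f"
    and scale_one: "f \<in> hom C X Y \<Longrightarrow> scale_mor C 1 f = f"
    and cmp_add_left: "\<lbrakk>f \<in> hom C X Y; g \<in> hom C Y Z; h \<in> hom C Y Z\<rbrakk>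
          \<Longrightarrow> cmp C (add_mor C g h) f = add_mor C (cmp C g f) (cmp C h f)"
    and cmp_add_right: "\<lbrakk>f \<in> hom C X Y; g \<in> hom C X Y; h \<in> hom C Y Z\<rbrakk>
          \<Longrightarrow> cmp C h (add_mor C f g) = add_mor C (cmp C h f) (cmp C h g)"
    and cmp_scale_left: "\<lbrakk>f \<in> hom C X Y; g \<in> hom C Y Z\<rbrakk>
          \<Longrightarrow> cmp C (scale_mor C a g) f = scale_mor C a (cmp C g f)"
    and cmp_scale_right: "\<lbrakk>f \<in> hom C X Y; g \<in> hom C Y Z\<rbrakk>
          \<Longrightarrow> cmp C g (scale_mor C a f) = scale_mor C a (cmp C g f)"

definition inverse_mors ::
  "('o, 'm, 'k, 'z) lincat_scheme \<Rightarrow> 'o \<Rightarrow> 'o \<Rightarrow> 'm \<Rightarrow> 'm \<Rightarrow> bool" where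
  "inverse_mors C X Y f g \<longleftrightarrow> f \<in> hom C X Y \<and> g \<in> hom C Y X
     \<and> cmp C g f = ident C X \<and> cmp C f g = ident C Y"

definition is_iso :: "('o, 'm, 'k, 'z) lincat_scheme \<Rightarrow> 'o \<Rightarrow> 'o \<Rightarrow> 'm \<Rightarrow> bool" where
  "is_iso C X Y f \<longleftrightarrow> (\<exists>g. inverse_mors C X Y f g)"

locale cat_functor =
  fixes C :: "('o, 'm, 'k, 'z) lincat_scheme"
    and D :: "('p, 'n, 'k, 'y) lincat_scheme"
    and FO :: "'o \<Rightarrow> 'p" and FM :: "'m \<Rightarrow> 'n"
  assumes fun_hom: "f \<in> hom C X Y \<Longrightarrow> FM f \<in> hom D (FO X) (FO Y)"
    and fun_ident: "FM (ident C X) = ident D (FO X)"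
    and fun_cmp: "\<lbrakk>f \<in> hom C X Y; g \<in> hom C Y Z\<rbrakk> \<Longrightarrow> FM (cmp C g f) = cmp D (FM g) (FM f)"

locale linear_functor = cat_functor C D FO FM
  for C :: "('o, 'm, 'k, 'z) lincat_scheme"
    and D :: "('p, 'n, 'k, 'y) lincat_scheme"
    and FO FM +
  assumes fun_add: "\<lbrakk>f \<in> hom C X Y; g \<in> hom C X Y\<rbrakk>
            \<Longrightarrow> FM (add_mor C f g) = add_mor D (FM f) (FM g)"
    and fun_scale: "f \<in> hom C X Y \<Longrightarrow> FM (scale_mor C a f) = scale_mor D a (FM f)"

definition natural_iso ::
  "('o, 'm, 'k, 'z) lincat_scheme \<Rightarrow> ('p, 'n, 'k, 'y) lincat_scheme \<Rightarrow>
   ('o \<Rightarrow> 'p) \<Rightarrow> ('m \<Rightarrow> 'n) \<Rightarrow> ('o \<Rightarrow> 'p) \<Rightarrow> ('m \<Rightarrow> 'n) \<Rightarrow> ('o \<Rightarrow> 'n) \<Rightarrow> bool" where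
  "natural_iso C D FO FM GO GM \<alpha> \<longleftrightarrow>
     (\<forall>X. is_iso D (FO X) (GO X) (\<alpha> X)) \<and>
     (\<forall>X Y. \<forall>f \<in> hom C X Y. cmp D (\<alpha> Y) (FM f) = cmp D (GM f) (\<alpha> X))"

definition equivalence_of_categories ::
  "('o, 'm, 'k, 'z) lincat_scheme \<Rightarrow> ('p, 'n, 'k, 'y) lincat_scheme \<Rightarrow>
   ('o \<Rightarrow> 'p) \<Rightarrow> ('m \<Rightarrow> 'n) \<Rightarrow> bool" where
  "equivalence_of_categories C D FO FM \<longleftrightarrow>
     cat_functor C D FO FM \<and>
     (\<exists>KO KM \<alpha> \<beta>. cat_functor D C KO KM
        \<and> natural_iso C C (\<lambda>X. X) (\<lambda>f. f) (KO \<circ> FO) (KM \<circ> FM) \<alpha>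
        \<and> natural_iso D D (FO \<circ> KO) (FM \<circ> KM) (\<lambda>X. X) (\<lambda>f. f) \<beta>)"


section \<open>Strict monoidal categories and their strict right modules\<close>

record ('o, 'm, 'k) lin_moncat = "('o, 'm, 'k) lincat" +
  unit_ob :: 'o
  tens_ob :: "'o \<Rightarrow> 'o \<Rightarrow> 'o"
  tens_mor :: "'m \<Rightarrow> 'm \<Rightarrow> 'm"

locale linear_monoidal_category = linear_category C
  for C :: "('o, 'm, 'k::{comm_ring,comm_monoid_mult}, 'z) lin_moncat_scheme" +
  assumes tens_ob_assoc: "tens_ob C (tens_ob C X Y) Z = tens_ob C X (tens_ob C Y Z)"
    and tens_ob_unit_left: "tens_ob C (unit_ob C) X = X"
    and tens_ob_unit_right: "tens_ob C X (unit_ob C) = X"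
    and tens_hom: "\<lbrakk>f \<in> hom C X Y; g \<in> hom C Z W\<rbrakk>
          \<Longrightarrow> tens_mor C f g \<in> hom C (tens_ob C X Z) (tens_ob C Y W)"
    and tens_assoc: "\<lbrakk>f \<in> hom C X Y; g \<in> hom C Z W; h \<in> hom C U V\<rbrakk>
          \<Longrightarrow> tens_mor C (tens_mor C f g) h = tens_mor C f (tens_mor C g h)"
    and tens_unit_left: "f \<in> hom C X Y \<Longrightarrow> tens_mor C (ident C (unit_ob C)) f = f"
    and tens_unit_right: "f \<in> hom C X Y \<Longrightarrow> tens_mor C f (ident C (unit_ob C)) = f"
    and tens_ident: "tens_mor C (ident C X) (ident C Y) = ident C (tens_ob C X Y)"
    and tens_cmp: "\<lbrakk>f \<in> hom C X Y; f' \<in> hom C Y Z; g \<in> hom C U V; g' \<in> hom C V W\<rbrakk>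
          \<Longrightarrow> tens_mor C (cmp C f' f) (cmp C g' g) = cmp C (tens_mor C f' g') (tens_mor C f g)"
    and tens_add_left: "\<lbrakk>f \<in> hom C X Y; f' \<in> hom C X Y; g \<in> hom C Z W\<rbrakk>
          \<Longrightarrow> tens_mor C (add_mor C f f') g = add_mor C (tens_mor C f g) (tens_mor C f' g)"
    and tens_add_right: "\<lbrakk>f \<in> hom C X Y; g \<in> hom C Z W; g' \<in> hom C Z W\<rbrakk>
          \<Longrightarrow> tens_mor C f (add_mor C g g') = add_mor C (tens_mor C f g) (tens_mor C f g')"
    and tens_scale_left: "\<lbrakk>f \<in> hom C X Y; g \<in> hom C Z W\<rbrakk>
          \<Longrightarrow> tens_mor C (scale_mor C a f) g = scale_mor C a (tens_mor C f g)"
    and tens_scale_right: "\<lbrakk>f \<in> hom C X Y; g \<in> hom C Z W\<rbrakk>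
          \<Longrightarrow> tens_mor C f (scale_mor C a g) = scale_mor C a (tens_mor C f g)"

text \<open>
  A strict right module is given by a strict linear monoidal functor \<open>A\<close> into the reversed
  category of linear endofunctors of \<open>M\<close>, recorded by its components:
  \<open>act_ob M X c = A(c)(X)\<close>, \<open>act_mor M f c = A(c)(f)\<close> (that is, \<open>f\<close> tensored with the identity of
  \<open>c\<close>) and \<open>act_nat M X g = A(g)\<^sub>X\<close> (the identity of \<open>X\<close> tensored with \<open>g\<close>).
\<close>

record ('o, 'm, 'k, 'c, 'n) lin_rmodule = "('o, 'm, 'k) lincat" +
  act_ob :: "'o \<Rightarrow> 'c \<Rightarrow> 'o"
  act_mor :: "'m \<Rightarrow> 'c \<Rightarrow> 'm"
  act_nat :: "'o \<Rightarrow> 'n \<Rightarrow> 'm"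

locale right_module = S: linear_monoidal_category S + M: linear_category M
  for S :: "('c, 'n, 'k::{comm_ring,comm_monoid_mult}, 'z) lin_moncat_scheme"
    and M :: "('o, 'm, 'k, 'c, 'n, 'y) lin_rmodule_scheme" +
  assumes act_functor: "linear_functor M M (\<lambda>X. act_ob M X c) (\<lambda>f. act_mor M f c)"
    and act_nat_hom: "g \<in> hom S c d \<Longrightarrow> act_nat M X g \<in> hom M (act_ob M X c) (act_ob M X d)"
    and act_nat_natural: "\<lbrakk>g \<in> hom S c d; f \<in> hom M X Y\<rbrakk>
          \<Longrightarrow> cmp M (act_nat M Y g) (act_mor M f c) = cmp M (act_mor M f d) (act_nat M X g)"
    and act_nat_ident: "act_nat M X (ident S c) = ident M (act_ob M X c)"
    and act_nat_cmp: "\<lbrakk>g \<in> hom S c d; h \<in> hom S d e\<rbrakk>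
          \<Longrightarrow> act_nat M X (cmp S h g) = cmp M (act_nat M X h) (act_nat M X g)"
    and act_nat_add: "\<lbrakk>g \<in> hom S c d; h \<in> hom S c d\<rbrakk>
          \<Longrightarrow> act_nat M X (add_mor S g h) = add_mor M (act_nat M X g) (act_nat M X h)"
    and act_nat_scale: "g \<in> hom S c d
          \<Longrightarrow> act_nat M X (scale_mor S a g) = scale_mor M a (act_nat M X g)"
    and act_ob_unit: "act_ob M X (unit_ob S) = X"
    and act_mor_unit: "f \<in> hom M X Y \<Longrightarrow> act_mor M f (unit_ob S) = f"
    and act_ob_tens: "act_ob M X (tens_ob S c d) = act_ob M (act_ob M X c) d"
    and act_mor_tens: "f \<in> hom M X Y
          \<Longrightarrow> act_mor M f (tens_ob S c d) = act_mor M (act_mor M f c) d"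
    and act_nat_tens: "\<lbrakk>g \<in> hom S c c'; h \<in> hom S d d'\<rbrakk>
          \<Longrightarrow> act_nat M X (tens_mor S g h)
                = cmp M (act_nat M (act_ob M X c') h) (act_mor M (act_nat M X g) d)"

locale module_morphism = M: right_module S M + N: right_module S N + H: linear_functor M N HO HM
  for S :: "('c, 'n, 'k::{comm_ring,comm_monoid_mult}, 'z) lin_moncat_scheme"
    and M :: "('o, 'm, 'k, 'c, 'n, 'y) lin_rmodule_scheme"
    and N :: "('p, 'l, 'k, 'c, 'n, 'x) lin_rmodule_scheme"
    and HO :: "'o \<Rightarrow> 'p" and HM :: "'m \<Rightarrow> 'l"
    and \<omega> :: "'o \<Rightarrow> 'c \<Rightarrow> 'l" +
  assumes omega_iso: "is_iso N (HO (act_ob M X c)) (act_ob N (HO X) c) (\<omega> X c)"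
    and omega_natural_left: "f \<in> hom M X Y
          \<Longrightarrow> cmp N (\<omega> Y c) (HM (act_mor M f c)) = cmp N (act_mor N (HM f) c) (\<omega> X c)"
    and omega_natural_right: "g \<in> hom S c d
          \<Longrightarrow> cmp N (\<omega> X d) (HM (act_nat M X g)) = cmp N (act_nat N (HO X) g) (\<omega> X c)"
    and omega_tens: "cmp N (act_mor N (\<omega> X c) d) (\<omega> (act_ob M X c) d) = \<omega> X (tens_ob S c d)"

definition module_equivalence ::
  "('c, 'n, 'k::{comm_ring,comm_monoid_mult}, 'z) lin_moncat_scheme \<Rightarrow>
   ('o, 'm, 'k, 'c, 'n, 'y) lin_rmodule_scheme \<Rightarrow> ('p, 'l, 'k, 'c, 'n, 'x) lin_rmodule_scheme \<Rightarrow>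
   ('o \<Rightarrow> 'p) \<Rightarrow> ('m \<Rightarrow> 'l) \<Rightarrow> ('o \<Rightarrow> 'c \<Rightarrow> 'l) \<Rightarrow> bool" where
  "module_equivalence S M N HO HM \<omega> \<longleftrightarrow>
     module_morphism S M N HO HM \<omega> \<and> equivalence_of_categories M N HO HM"


section \<open>Linear categories by generators and relations\<close>

text \<open>
  Morphisms are formal expressions in the generators modulo the smallest congruence that contains
  the relations and the axioms of a linear category.  \<open>G g X Y\<close> says that \<open>g\<close> is a generator
  \<open>X \<rightarrow> Y\<close>; a pair related by \<open>R\<close> is imposed as a relation only if both sides are well formed
  expressions with the same source and target.
\<close>

datatype ('g, 'o, 'k) cterm =
    CGen 'g
  | CId 'o
  | CComp "('g, 'o, 'k) cterm" "('g, 'o, 'k) cterm"  (infixl "\<star>" 65)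
  | CZero 'o 'o
  | CAdd "('g, 'o, 'k) cterm" "('g, 'o, 'k) cterm"
  | CScale 'k "('g, 'o, 'k) cterm"

inductive ctyp :: "('g \<Rightarrow> 'o \<Rightarrow> 'o \<Rightarrow> bool) \<Rightarrow> ('g, 'o, 'k) cterm \<Rightarrow> 'o \<Rightarrow> 'o \<Rightarrow> bool"
  for G where
  "G g X Y \<Longrightarrow> ctyp G (CGen g) X Y"
| "ctyp G (CId X) X X"
| "\<lbrakk>ctyp G s Y Z; ctyp G t X Y\<rbrakk> \<Longrightarrow> ctyp G (s \<star> t) X Z"
| "ctyp G (CZero X Y) X Y"
| "\<lbrakk>ctyp G s X Y; ctyp G t X Y\<rbrakk> \<Longrightarrow> ctyp G (CAdd s t) X Y"
| "ctyp G s X Y \<Longrightarrow> ctyp G (CScale a s) X Y"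

inductive_set ccong ::
  "('g \<Rightarrow> 'o \<Rightarrow> 'o \<Rightarrow> bool) \<Rightarrow>
   (('g, 'o, 'k::{comm_ring,comm_monoid_mult}) cterm \<Rightarrow> ('g, 'o, 'k) cterm \<Rightarrow> bool) \<Rightarrow>
   (('g, 'o, 'k) cterm \<times> ('g, 'o, 'k) cterm) set"
  for G R where
  rel: "\<lbrakk>R s t; ctyp G s X Y; ctyp G t X Y\<rbrakk> \<Longrightarrow> (s, t) \<in> ccong G R"
| refl: "ctyp G s X Y \<Longrightarrow> (s, s) \<in> ccong G R"
| sym: "(s, t) \<in> ccong G R \<Longrightarrow> (t, s) \<in> ccong G R"
| trans: "\<lbrakk>(s, t) \<in> ccong G R; (t, u) \<in> ccong G R\<rbrakk> \<Longrightarrow> (s, u) \<in> ccong G R"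
| cong_comp: "\<lbrakk>(s, s') \<in> ccong G R; (t, t') \<in> ccong G R; ctyp G s Y Z; ctyp G t X Y\<rbrakk>
    \<Longrightarrow> (s \<star> t, s' \<star> t') \<in> ccong G R"
| cong_add: "\<lbrakk>(s, s') \<in> ccong G R; (t, t') \<in> ccong G R; ctyp G s X Y; ctyp G t X Y\<rbrakk>
    \<Longrightarrow> (CAdd s t, CAdd s' t') \<in> ccong G R"
| cong_scale: "(s, s') \<in> ccong G R \<Longrightarrow> (CScale a s, CScale a s') \<in> ccong G R"
| id_left: "ctyp G s X Y \<Longrightarrow> (CId Y \<star> s, s) \<in> ccong G R"
| id_right: "ctyp G s X Y \<Longrightarrow> (s \<star> CId X, s) \<in> ccong G R"
| comp_assoc: "\<lbrakk>ctyp G s Z W; ctyp G t Y Z; ctyp G u X Y\<rbrakk>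
    \<Longrightarrow> (s \<star> t \<star> u, s \<star> (t \<star> u)) \<in> ccong G R"
| add_assoc: "\<lbrakk>ctyp G s X Y; ctyp G t X Y; ctyp G u X Y\<rbrakk>
    \<Longrightarrow> (CAdd (CAdd s t) u, CAdd s (CAdd t u)) \<in> ccong G R"
| add_commute: "\<lbrakk>ctyp G s X Y; ctyp G t X Y\<rbrakk> \<Longrightarrow> (CAdd s t, CAdd t s) \<in> ccong G R"
| add_zero: "ctyp G s X Y \<Longrightarrow> (CAdd s (CZero X Y), s) \<in> ccong G R"
| add_minus: "ctyp G s X Y \<Longrightarrow> (CAdd s (CScale (- 1) s), CZero X Y) \<in> ccong G R"
| scale_add_right: "\<lbrakk>ctyp G s X Y; ctyp G t X Y\<rbrakk>
    \<Longrightarrow> (CScale a (CAdd s t), CAdd (CScale a s) (CScale a t)) \<in> ccong G R"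
| scale_add_left: "ctyp G s X Y
    \<Longrightarrow> (CScale (a + b) s, CAdd (CScale a s) (CScale b s)) \<in> ccong G R"
| scale_scale: "ctyp G s X Y \<Longrightarrow> (CScale a (CScale b s), CScale (a * b) s) \<in> ccong G R"
| scale_one: "ctyp G s X Y \<Longrightarrow> (CScale 1 s, s) \<in> ccong G R"
| comp_add_left: "\<lbrakk>ctyp G s Y Z; ctyp G t Y Z; ctyp G u X Y\<rbrakk>
    \<Longrightarrow> (CAdd s t \<star> u, CAdd (s \<star> u) (t \<star> u)) \<in> ccong G R"
| comp_add_right: "\<lbrakk>ctyp G s Y Z; ctyp G t X Y; ctyp G u X Y\<rbrakk>
    \<Longrightarrow> (s \<star> CAdd t u, CAdd (s \<star> t) (s \<star> u)) \<in> ccong G R"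
| comp_scale_left: "\<lbrakk>ctyp G s Y Z; ctyp G t X Y\<rbrakk>
    \<Longrightarrow> (CScale a s \<star> t, CScale a (s \<star> t)) \<in> ccong G R"
| comp_scale_right: "\<lbrakk>ctyp G s Y Z; ctyp G t X Y\<rbrakk>
    \<Longrightarrow> (s \<star> CScale a t, CScale a (s \<star> t)) \<in> ccong G R"

definition presented_lincat ::
  "('g \<Rightarrow> 'o \<Rightarrow> 'o \<Rightarrow> bool) \<Rightarrow>
   (('g, 'o, 'k::{comm_ring,comm_monoid_mult}) cterm \<Rightarrow> ('g, 'o, 'k) cterm \<Rightarrow> bool) \<Rightarrow>
   ('o, ('g, 'o, 'k) cterm set, 'k) lincat" where
  "presented_lincat G R = (let E = ccong G R in
     \<lparr> hom = (\<lambda>X Y. {s. ctyp G s X Y} // E),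
       ident = (\<lambda>X. E `` {CId X}),
       cmp = (\<lambda>g f. \<Union>s\<in>g. \<Union>t\<in>f. E `` {s \<star> t}),
       zero_mor = (\<lambda>X Y. E `` {CZero X Y}),
       add_mor = (\<lambda>f g. \<Union>s\<in>f. \<Union>t\<in>g. E `` {CAdd s t}),
       scale_mor = (\<lambda>a f. \<Union>s\<in>f. E `` {CScale a s}) \<rparr>)"

text \<open>The linear extension to expressions of an assignment on objects and on generators.\<close>

primrec cextend ::
  "('o \<Rightarrow> 'p) \<Rightarrow> ('g \<Rightarrow> ('h, 'p, 'k) cterm) \<Rightarrow> ('g, 'o, 'k) cterm \<Rightarrow> ('h, 'p, 'k) cterm" where
  "cextend FO FG (CGen g) = FG g"
| "cextend FO FG (CId X) = CId (FO X)"
| "cextend FO FG (s \<star> t) = cextend FO FG s \<star> cextend FO FG t"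
| "cextend FO FG (CZero X Y) = CZero (FO X) (FO Y)"
| "cextend FO FG (CAdd s t) = CAdd (cextend FO FG s) (cextend FO FG t)"
| "cextend FO FG (CScale a s) = CScale a (cextend FO FG s)"


section \<open>Strict linear monoidal categories by generators and relations\<close>

text \<open>
  As before, with objects the words in the generating objects \<open>'a\<close> and with the axioms of a strict
  monoidal category added to the congruence.
\<close>

datatype ('g, 'a, 'k) mterm =
    MGen 'g
  | MId "'a list"
  | MComp "('g, 'a, 'k) mterm" "('g, 'a, 'k) mterm"  (infixl "\<odot>" 65)
  | MTens "('g, 'a, 'k) mterm" "('g, 'a, 'k) mterm"  (infixl "\<boxtimes>" 70)
  | MZero "'a list" "'a list"
  | MAdd "('g, 'a, 'k) mterm" "('g, 'a, 'k) mterm"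
  | MScale 'k "('g, 'a, 'k) mterm"

inductive mtyp ::
  "('g \<Rightarrow> 'a list \<Rightarrow> 'a list \<Rightarrow> bool) \<Rightarrow> ('g, 'a, 'k) mterm \<Rightarrow> 'a list \<Rightarrow> 'a list \<Rightarrow> bool"
  for G where
  "G g X Y \<Longrightarrow> mtyp G (MGen g) X Y"
| "mtyp G (MId X) X X"
| "\<lbrakk>mtyp G s Y Z; mtyp G t X Y\<rbrakk> \<Longrightarrow> mtyp G (s \<odot> t) X Z"
| "\<lbrakk>mtyp G s X Y; mtyp G t Z W\<rbrakk> \<Longrightarrow> mtyp G (s \<boxtimes> t) (X @ Z) (Y @ W)"
| "mtyp G (MZero X Y) X Y"
| "\<lbrakk>mtyp G s X Y; mtyp G t X Y\<rbrakk> \<Longrightarrow> mtyp G (MAdd s t) X Y"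
| "mtyp G s X Y \<Longrightarrow> mtyp G (MScale a s) X Y"

inductive_set mcong ::
  "('g \<Rightarrow> 'a list \<Rightarrow> 'a list \<Rightarrow> bool) \<Rightarrow>
   (('g, 'a, 'k::{comm_ring,comm_monoid_mult}) mterm \<Rightarrow> ('g, 'a, 'k) mterm \<Rightarrow> bool) \<Rightarrow>
   (('g, 'a, 'k) mterm \<times> ('g, 'a, 'k) mterm) set"
  for G R where
  rel: "\<lbrakk>R s t; mtyp G s X Y; mtyp G t X Y\<rbrakk> \<Longrightarrow> (s, t) \<in> mcong G R"
| refl: "mtyp G s X Y \<Longrightarrow> (s, s) \<in> mcong G R"
| sym: "(s, t) \<in> mcong G R \<Longrightarrow> (t, s) \<in> mcong G R"
| trans: "\<lbrakk>(s, t) \<in> mcong G R; (t, u) \<in> mcong G R\<rbrakk> \<Longrightarrow> (s, u) \<in> mcong G R"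
| cong_comp: "\<lbrakk>(s, s') \<in> mcong G R; (t, t') \<in> mcong G R; mtyp G s Y Z; mtyp G t X Y\<rbrakk>
    \<Longrightarrow> (s \<odot> t, s' \<odot> t') \<in> mcong G R"
| cong_tens: "\<lbrakk>(s, s') \<in> mcong G R; (t, t') \<in> mcong G R\<rbrakk>
    \<Longrightarrow> (s \<boxtimes> t, s' \<boxtimes> t') \<in> mcong G R"
| cong_add: "\<lbrakk>(s, s') \<in> mcong G R; (t, t') \<in> mcong G R; mtyp G s X Y; mtyp G t X Y\<rbrakk>
    \<Longrightarrow> (MAdd s t, MAdd s' t') \<in> mcong G R"
| cong_scale: "(s, s') \<in> mcong G R \<Longrightarrow> (MScale a s, MScale a s') \<in> mcong G R"
| id_left: "mtyp G s X Y \<Longrightarrow> (MId Y \<odot> s, s) \<in> mcong G R"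
| id_right: "mtyp G s X Y \<Longrightarrow> (s \<odot> MId X, s) \<in> mcong G R"
| comp_assoc: "\<lbrakk>mtyp G s Z W; mtyp G t Y Z; mtyp G u X Y\<rbrakk>
    \<Longrightarrow> (s \<odot> t \<odot> u, s \<odot> (t \<odot> u)) \<in> mcong G R"
| add_assoc: "\<lbrakk>mtyp G s X Y; mtyp G t X Y; mtyp G u X Y\<rbrakk>
    \<Longrightarrow> (MAdd (MAdd s t) u, MAdd s (MAdd t u)) \<in> mcong G R"
| add_commute: "\<lbrakk>mtyp G s X Y; mtyp G t X Y\<rbrakk> \<Longrightarrow> (MAdd s t, MAdd t s) \<in> mcong G R"
| add_zero: "mtyp G s X Y \<Longrightarrow> (MAdd s (MZero X Y), s) \<in> mcong G R"
| add_minus: "mtyp G s X Y \<Longrightarrow> (MAdd s (MScale (- 1) s), MZero X Y) \<in> mcong G R"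
| scale_add_right: "\<lbrakk>mtyp G s X Y; mtyp G t X Y\<rbrakk>
    \<Longrightarrow> (MScale a (MAdd s t), MAdd (MScale a s) (MScale a t)) \<in> mcong G R"
| scale_add_left: "mtyp G s X Y
    \<Longrightarrow> (MScale (a + b) s, MAdd (MScale a s) (MScale b s)) \<in> mcong G R"
| scale_scale: "mtyp G s X Y \<Longrightarrow> (MScale a (MScale b s), MScale (a * b) s) \<in> mcong G R"
| scale_one: "mtyp G s X Y \<Longrightarrow> (MScale 1 s, s) \<in> mcong G R"
| comp_add_left: "\<lbrakk>mtyp G s Y Z; mtyp G t Y Z; mtyp G u X Y\<rbrakk>
    \<Longrightarrow> (MAdd s t \<odot> u, MAdd (s \<odot> u) (t \<odot> u)) \<in> mcong G R"
| comp_add_right: "\<lbrakk>mtyp G s Y Z; mtyp G t X Y; mtyp G u X Y\<rbrakk>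
    \<Longrightarrow> (s \<odot> MAdd t u, MAdd (s \<odot> t) (s \<odot> u)) \<in> mcong G R"
| comp_scale_left: "\<lbrakk>mtyp G s Y Z; mtyp G t X Y\<rbrakk>
    \<Longrightarrow> (MScale a s \<odot> t, MScale a (s \<odot> t)) \<in> mcong G R"
| comp_scale_right: "\<lbrakk>mtyp G s Y Z; mtyp G t X Y\<rbrakk>
    \<Longrightarrow> (s \<odot> MScale a t, MScale a (s \<odot> t)) \<in> mcong G R"
| tens_assoc: "\<lbrakk>mtyp G s X Y; mtyp G t Z W; mtyp G u U V\<rbrakk>
    \<Longrightarrow> (s \<boxtimes> t \<boxtimes> u, s \<boxtimes> (t \<boxtimes> u)) \<in> mcong G R"
| tens_unit_left: "mtyp G s X Y \<Longrightarrow> (MId [] \<boxtimes> s, s) \<in> mcong G R"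
| tens_unit_right: "mtyp G s X Y \<Longrightarrow> (s \<boxtimes> MId [], s) \<in> mcong G R"
| tens_ident: "(MId X \<boxtimes> MId Y, MId (X @ Y)) \<in> mcong G R"
| tens_comp: "\<lbrakk>mtyp G s Y Z; mtyp G t X Y; mtyp G s' V W; mtyp G t' U V\<rbrakk>
    \<Longrightarrow> ((s \<odot> t) \<boxtimes> (s' \<odot> t'), (s \<boxtimes> s') \<odot> (t \<boxtimes> t')) \<in> mcong G R"
| tens_add_left: "\<lbrakk>mtyp G s X Y; mtyp G t X Y; mtyp G u Z W\<rbrakk>
    \<Longrightarrow> (MAdd s t \<boxtimes> u, MAdd (s \<boxtimes> u) (t \<boxtimes> u)) \<in> mcong G R"
| tens_add_right: "\<lbrakk>mtyp G s X Y; mtyp G t Z W; mtyp G u Z W\<rbrakk>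
    \<Longrightarrow> (s \<boxtimes> MAdd t u, MAdd (s \<boxtimes> t) (s \<boxtimes> u)) \<in> mcong G R"
| tens_scale_left: "\<lbrakk>mtyp G s X Y; mtyp G t Z W\<rbrakk>
    \<Longrightarrow> (MScale a s \<boxtimes> t, MScale a (s \<boxtimes> t)) \<in> mcong G R"
| tens_scale_right: "\<lbrakk>mtyp G s X Y; mtyp G t Z W\<rbrakk>
    \<Longrightarrow> (s \<boxtimes> MScale a t, MScale a (s \<boxtimes> t)) \<in> mcong G R"

definition presented_lin_moncat ::
  "('g \<Rightarrow> 'a list \<Rightarrow> 'a list \<Rightarrow> bool) \<Rightarrow>
   (('g, 'a, 'k::{comm_ring,comm_monoid_mult}) mterm \<Rightarrow> ('g, 'a, 'k) mterm \<Rightarrow> bool) \<Rightarrow>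
   ('a list, ('g, 'a, 'k) mterm set, 'k) lin_moncat" where
  "presented_lin_moncat G R = (let E = mcong G R in
     \<lparr> hom = (\<lambda>X Y. {s. mtyp G s X Y} // E),
       ident = (\<lambda>X. E `` {MId X}),
       cmp = (\<lambda>g f. \<Union>s\<in>g. \<Union>t\<in>f. E `` {s \<odot> t}),
       zero_mor = (\<lambda>X Y. E `` {MZero X Y}),
       add_mor = (\<lambda>f g. \<Union>s\<in>f. \<Union>t\<in>g. E `` {MAdd s t}),
       scale_mor = (\<lambda>a f. \<Union>s\<in>f. E `` {MScale a s}),
       unit_ob = [],
       tens_ob = (@),
       tens_mor = (\<lambda>f g. \<Union>s\<in>f. \<Union>t\<in>g. E `` {s \<boxtimes> t}) \<rparr>)"


section \<open>The oriented skein category\<close>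

datatype strand = Up | Down

type_synonym word = "strand list"

text \<open>\<open>Cw'\<close> and \<open>Dw'\<close> are the primed generators \<open>c'\<close> and \<open>d'\<close>.\<close>

datatype os_gen = Xpos | Xneg | Cw | Dw | Cw' | Dw'

primrec os_dom :: "os_gen \<Rightarrow> word" where
  "os_dom Xpos = [Up, Up]"
| "os_dom Xneg = [Up, Up]"
| "os_dom Cw = []"
| "os_dom Dw = [Up, Down]"
| "os_dom Cw' = []"
| "os_dom Dw' = [Down, Up]"

primrec os_cod :: "os_gen \<Rightarrow> word" where
  "os_cod Xpos = [Up, Up]"
| "os_cod Xneg = [Up, Up]"
| "os_cod Cw = [Down, Up]"
| "os_cod Dw = []"
| "os_cod Cw' = [Up, Down]"
| "os_cod Dw' = []"

definition os_sig :: "os_gen \<Rightarrow> word \<Rightarrow> word \<Rightarrow> bool" where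
  "os_sig g X Y \<longleftrightarrow> X = os_dom g \<and> Y = os_cod g"

type_synonym 'k os_term = "(os_gen, strand, 'k) mterm"

abbreviation "X\<^sub>p \<equiv> MGen Xpos"
abbreviation "X\<^sub>m \<equiv> MGen Xneg"
abbreviation "c\<^sub>o \<equiv> MGen Cw"
abbreviation "d\<^sub>o \<equiv> MGen Dw"
abbreviation "c\<^sub>o' \<equiv> MGen Cw'"
abbreviation "d\<^sub>o' \<equiv> MGen Dw'"

definition os_R :: "'k os_term \<Rightarrow> 'k os_term" where
  "os_R x = (MId [Down, Up] \<boxtimes> d\<^sub>o) \<odot> (MId [Down] \<boxtimes> x \<boxtimes> MId [Down]) \<odot> (c\<^sub>o \<boxtimes> MId [Up, Down])"

definition os_L :: "'k os_term \<Rightarrow> 'k os_term" where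
  "os_L x = (d\<^sub>o' \<boxtimes> MId [Up, Down]) \<odot> (MId [Down] \<boxtimes> x \<boxtimes> MId [Down]) \<odot> (MId [Down, Up] \<boxtimes> c\<^sub>o')"

definition os_D :: "'k os_term \<Rightarrow> 'k os_term" where
  "os_D x = (MId [Down, Down] \<boxtimes> d\<^sub>o) \<odot> (MId [Down] \<boxtimes> os_R x \<boxtimes> MId [Down])
              \<odot> (c\<^sub>o \<boxtimes> MId [Down, Down])"

abbreviation "R\<^sub>p \<equiv> os_R X\<^sub>p"
abbreviation "R\<^sub>m \<equiv> os_R X\<^sub>m"
abbreviation "L\<^sub>m \<equiv> os_L X\<^sub>m"
abbreviation "D\<^sub>p \<equiv> os_D X\<^sub>p"
abbreviation "D\<^sub>m \<equiv> os_D X\<^sub>m"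

inductive os_rel ::
  "'k::{comm_ring,comm_monoid_mult} \<Rightarrow> 'k \<Rightarrow> 'k \<Rightarrow> 'k os_term \<Rightarrow> 'k os_term \<Rightarrow> bool"
  for q t \<delta> where
  "os_rel q t \<delta> (X\<^sub>p \<odot> X\<^sub>m) (MId [Up, Up])"
| "os_rel q t \<delta> (X\<^sub>m \<odot> X\<^sub>p) (MId [Up, Up])"
| "os_rel q t \<delta>
     ((X\<^sub>p \<boxtimes> MId [Up]) \<odot> (MId [Up] \<boxtimes> X\<^sub>p) \<odot> (X\<^sub>p \<boxtimes> MId [Up]))
     ((MId [Up] \<boxtimes> X\<^sub>p) \<odot> (X\<^sub>p \<boxtimes> MId [Up]) \<odot> (MId [Up] \<boxtimes> X\<^sub>p))"
| "os_rel q t \<delta> (L\<^sub>m \<odot> R\<^sub>p) (MId [Up, Down])"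
| "os_rel q t \<delta> (R\<^sub>p \<odot> L\<^sub>m) (MId [Down, Up])"
| "os_rel q t \<delta> (MAdd X\<^sub>p (MScale (- 1) X\<^sub>m)) (MScale (q - unit_inv q) (MId [Up, Up]))"
| "os_rel q t \<delta>
     ((d\<^sub>o' \<boxtimes> MId [Up]) \<odot> (MId [Down] \<boxtimes> X\<^sub>p) \<odot> (c\<^sub>o \<boxtimes> MId [Up])) (MScale t (MId [Up]))"
| "os_rel q t \<delta>
     ((MId [Up] \<boxtimes> d\<^sub>o) \<odot> (X\<^sub>p \<boxtimes> MId [Down]) \<odot> (MId [Up] \<boxtimes> c\<^sub>o')) (MScale t (MId [Up]))"
| "os_rel q t \<delta> (d\<^sub>o \<odot> c\<^sub>o') (MScale \<delta> (MId []))"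
| "os_rel q t \<delta> ((d\<^sub>o \<boxtimes> MId [Up]) \<odot> (MId [Up] \<boxtimes> c\<^sub>o)) (MId [Up])"
| "os_rel q t \<delta> ((MId [Down] \<boxtimes> d\<^sub>o) \<odot> (c\<^sub>o \<boxtimes> MId [Down])) (MId [Down])"

abbreviation os_cong ::
  "'k::{comm_ring,comm_monoid_mult} \<Rightarrow> 'k \<Rightarrow> 'k \<Rightarrow> ('k os_term \<times> 'k os_term) set" where
  "os_cong q t \<delta> \<equiv> mcong os_sig (os_rel q t \<delta>)"

text \<open>
  The parameter \<open>\<delta>\<close> is explicit because \<open>\<delta> (q - q\<^sup>-\<^sup>1) = t - t\<^sup>-\<^sup>1\<close> need not determine it
  when \<open>q - q\<^sup>-\<^sup>1\<close> is a zero divisor.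
\<close>

definition OS ::
  "'k::{comm_ring,comm_monoid_mult} \<Rightarrow> 'k \<Rightarrow> 'k \<Rightarrow> (word, 'k os_term set, 'k) lin_moncat" where
  "OS q t \<delta> = presented_lin_moncat os_sig (os_rel q t \<delta>)"


section \<open>The disoriented skein category\<close>

datatype toggle = Tau | TauBar

primrec tog_dom :: "toggle \<Rightarrow> strand" where
  "tog_dom Tau = Down"
| "tog_dom TauBar = Up"

primrec tog_cod :: "toggle \<Rightarrow> strand" where
  "tog_cod Tau = Up"
| "tog_cod TauBar = Down"

text \<open>
  A morphism of \<open>OS\<close> occurring in a generator is given by an expression representing it;
  generators formed from expressions for the same morphism are identified by the relations
  \<open>os_eq\<close> and \<open>tog_eq\<close> below.  \<open>Tog f g\<close> stands for the tensor product of \<open>f\<close> and \<open>g\<close>.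
\<close>

datatype 'k ds_gen = Os "'k os_term" | Tog toggle "'k os_term"

inductive ds_sig :: "'k ds_gen \<Rightarrow> word \<Rightarrow> word \<Rightarrow> bool" where
  "mtyp os_sig g X Y \<Longrightarrow> ds_sig (Os g) X Y"
| "mtyp os_sig g X Y \<Longrightarrow> ds_sig (Tog f g) (tog_dom f # X) (tog_cod f # Y)"

type_synonym 'k ds_term = "('k ds_gen, word, 'k) cterm"

abbreviation os :: "'k os_term \<Rightarrow> 'k ds_term" where
  "os g \<equiv> CGen (Os g)"

abbreviation tau :: "word \<Rightarrow> 'k ds_term" where
  "tau \<mu> \<equiv> CGen (Tog Tau (MId \<mu>))"

abbreviation taubar :: "word \<Rightarrow> 'k ds_term" where
  "taubar \<mu> \<equiv> CGen (Tog TauBar (MId \<mu>))"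

text \<open>The action of the identity of a word \<open>\<nu>\<close> on the right.\<close>

primrec ds_gen_right :: "word \<Rightarrow> 'k ds_gen \<Rightarrow> 'k ds_gen" where
  "ds_gen_right \<nu> (Os g) = Os (g \<boxtimes> MId \<nu>)"
| "ds_gen_right \<nu> (Tog f g) = Tog f (g \<boxtimes> MId \<nu>)"

definition ds_right :: "word \<Rightarrow> 'k ds_term \<Rightarrow> 'k ds_term" where
  "ds_right \<nu> = cextend (\<lambda>X. X @ \<nu>) (\<lambda>g. CGen (ds_gen_right \<nu> g))"

inductive ds_toggle_rel ::
  "'k::{comm_ring,comm_monoid_mult} \<Rightarrow> 'k ds_term \<Rightarrow> 'k ds_term \<Rightarrow> bool"
  for q where
  "ds_toggle_rel q (tau [] \<star> taubar []) (CId [Up])"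
| "ds_toggle_rel q (taubar [] \<star> tau []) (CId [Down])"
| "ds_toggle_rel q
     (tau [Up] \<star> os R\<^sub>m \<star> tau [Down] \<star> os D\<^sub>p)
     (os X\<^sub>p \<star> tau [Up] \<star> os R\<^sub>m \<star> tau [Down])"
| "ds_toggle_rel q (os d\<^sub>o' \<star> taubar [Up] \<star> os X\<^sub>p) (CScale q (os d\<^sub>o' \<star> taubar [Up]))"
| "ds_toggle_rel q (os X\<^sub>p \<star> tau [Up] \<star> os c\<^sub>o) (CScale q (tau [Up] \<star> os c\<^sub>o))"

inductive ds_rel ::
  "'k::{comm_ring,comm_monoid_mult} \<Rightarrow> 'k \<Rightarrow> 'k \<Rightarrow> 'k ds_term \<Rightarrow> 'k ds_term \<Rightarrow> bool"
  for q t \<delta> where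
  os_eq: "(g, h) \<in> os_cong q t \<delta> \<Longrightarrow> ds_rel q t \<delta> (os g) (os h)"
| os_id: "ds_rel q t \<delta> (os (MId X)) (CId X)"
| os_comp: "ds_rel q t \<delta> (os (g \<odot> h)) (os g \<star> os h)"
| os_add: "ds_rel q t \<delta> (os (MAdd g h)) (CAdd (os g) (os h))"
| os_scale: "ds_rel q t \<delta> (os (MScale a g)) (CScale a (os g))"
| tog_eq: "(g, h) \<in> os_cong q t \<delta> \<Longrightarrow> ds_rel q t \<delta> (CGen (Tog f g)) (CGen (Tog f h))"
| tog_add: "ds_rel q t \<delta> (CGen (Tog f (MAdd g h))) (CAdd (CGen (Tog f g)) (CGen (Tog f h)))"
| tog_scale: "ds_rel q t \<delta> (CGen (Tog f (MScale a g))) (CScale a (CGen (Tog f g)))"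
| tog_comp_left: "ds_rel q t \<delta> (os (MId [tog_cod f] \<boxtimes> g) \<star> CGen (Tog f h)) (CGen (Tog f (g \<odot> h)))"
| tog_comp_right: "ds_rel q t \<delta> (CGen (Tog f g) \<star> os (MId [tog_dom f] \<boxtimes> h)) (CGen (Tog f (g \<odot> h)))"
| toggle: "ds_toggle_rel q r s \<Longrightarrow> ds_rel q t \<delta> (ds_right \<nu> r) (ds_right \<nu> s)"

abbreviation ds_cong ::
  "'k::{comm_ring,comm_monoid_mult} \<Rightarrow> 'k \<Rightarrow> 'k \<Rightarrow> ('k ds_term \<times> 'k ds_term) set" where
  "ds_cong q t \<delta> \<equiv> ccong ds_sig (ds_rel q t \<delta>)"

definition DS ::
  "'k::{comm_ring,comm_monoid_mult} \<Rightarrow> 'k \<Rightarrow> 'k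
    \<Rightarrow> (word, 'k ds_term set, 'k, word, 'k os_term set) lin_rmodule" where
  "DS q t \<delta> = lincat.extend (presented_lincat ds_sig (ds_rel q t \<delta>))
     (lin_rmodule.fields
        (@)
        (\<lambda>f \<nu>. \<Union>s\<in>f. ds_cong q t \<delta> `` {ds_right \<nu> s})
        (\<lambda>X g. \<Union>s\<in>g. ds_cong q t \<delta> `` {os (MId X \<boxtimes> s)}))"


subsection \<open>Toggles on arbitrary strands\<close>

primrec os_u1 :: "strand \<Rightarrow> 'k os_term" where
  "os_u1 Up = R\<^sub>p"
| "os_u1 Down = D\<^sub>m"

primrec os_u :: "word \<Rightarrow> 'k os_term" where
  "os_u [] = MId [Down]"
| "os_u (x # \<mu>) = (os_u1 x \<boxtimes> MId \<mu>) \<odot> (MId [x] \<boxtimes> os_u \<mu>)"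

primrec os_w1 :: "strand \<Rightarrow> 'k os_term" where
  "os_w1 Up = X\<^sub>m"
| "os_w1 Down = R\<^sub>p"

primrec os_w :: "word \<Rightarrow> 'k os_term" where
  "os_w [] = MId [Up]"
| "os_w (x # \<mu>) = (MId [x] \<boxtimes> os_w \<mu>) \<odot> (os_w1 x \<boxtimes> MId \<mu>)"

definition strand_toggle :: "word \<Rightarrow> word \<Rightarrow> 'k ds_term" where
  "strand_toggle \<kappa> \<mu> = ds_right \<mu> (os (os_w \<kappa>) \<star> tau \<kappa> \<star> os (os_u \<kappa>))"

text \<open>
  Toggles on different strands commute, so the order of composition is immaterial; here the
  strands are toggled from left to right.  Thus \<open>eta_from n \<mu>\<close> toggles the strands of \<open>\<mu>\<close>
  when the \<open>n\<close> strands to their left already point upwards.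
\<close>

primrec eta_from :: "nat \<Rightarrow> word \<Rightarrow> 'k ds_term" where
  "eta_from n [] = CId (replicate n Up)"
| "eta_from n (x # \<mu>) = (case x of
      Up \<Rightarrow> eta_from (Suc n) \<mu>
    | Down \<Rightarrow> eta_from (Suc n) \<mu> \<star> strand_toggle (replicate n Up) \<mu>)"

definition eta :: "'k::{comm_ring,comm_monoid_mult} \<Rightarrow> 'k \<Rightarrow> 'k \<Rightarrow> word \<Rightarrow> 'k ds_term set" where
  "eta q t \<delta> \<mu> = ds_cong q t \<delta> `` {eta_from 0 \<mu>}"


section \<open>The iquantum Brauer category\<close>

text \<open>The object \<open>r\<close> stands for \<open>B\<^sub>r\<close>; \<open>Sig r i\<close> and \<open>SigInv r i\<close> are \<open>\<sigma>\<^sub>i\<close> and its inverse on \<open>B\<^sub>r\<close>.\<close>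

datatype b_gen = Cup nat | Cap nat | Sig nat nat | SigInv nat nat

inductive b_sig :: "b_gen \<Rightarrow> nat \<Rightarrow> nat \<Rightarrow> bool" where
  "b_sig (Cup r) r (r + 2)"
| "b_sig (Cap r) (r + 2) r"
| "\<lbrakk>1 \<le> i; i < r\<rbrakk> \<Longrightarrow> b_sig (Sig r i) r r"
| "\<lbrakk>1 \<le> i; i < r\<rbrakk> \<Longrightarrow> b_sig (SigInv r i) r r"

type_synonym 'k b_term = "(b_gen, nat, 'k) cterm"

abbreviation cup :: "nat \<Rightarrow> 'k b_term" where "cup r \<equiv> CGen (Cup r)"
abbreviation cap :: "nat \<Rightarrow> 'k b_term" where "cap r \<equiv> CGen (Cap r)"
abbreviation sig :: "nat \<Rightarrow> nat \<Rightarrow> 'k b_term" where "sig r i \<equiv> CGen (Sig r i)"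
abbreviation sigi :: "nat \<Rightarrow> nat \<Rightarrow> 'k b_term" where "sigi r i \<equiv> CGen (SigInv r i)"

inductive b_rel ::
  "'k::{comm_ring,comm_monoid_mult} \<Rightarrow> 'k \<Rightarrow> 'k \<Rightarrow> 'k b_term \<Rightarrow> 'k b_term \<Rightarrow> bool"
  for q t \<delta> where
  "b_rel q t \<delta> (sig r i \<star> sigi r i) (CId r)"
| "b_rel q t \<delta> (sigi r i \<star> sig r i) (CId r)"
| "b_rel q t \<delta> (sig r i \<star> sig r (i + 1) \<star> sig r i) (sig r (i + 1) \<star> sig r i \<star> sig r (i + 1))"
| "i + 1 < j \<or> j + 1 < i \<Longrightarrow> b_rel q t \<delta> (sig r i \<star> sig r j) (sig r j \<star> sig r i)"
| "b_rel q t \<delta> (CAdd (sig r i) (CScale (- 1) (sigi r i))) (CScale (q - unit_inv q) (CId r))"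
| "b_rel q t \<delta> (cup r \<star> sig r i) (sig (r + 2) (i + 2) \<star> cup r)"
| "b_rel q t \<delta> (cap r \<star> sig (r + 2) (i + 2)) (sig r i \<star> cap r)"
| "b_rel q t \<delta> (cap r \<star> cup r) (CScale \<delta> (CId r))"
| "b_rel q t \<delta> (cap r \<star> sig (r + 2) 1) (CScale q (cap r))"
| "b_rel q t \<delta> (sig (r + 2) 1 \<star> cup r) (CScale q (cup r))"
| "r \<ge> 1 \<Longrightarrow> b_rel q t \<delta> (cap r \<star> sig (r + 2) 2 \<star> cup r) (CScale t (CId r))"
| "r \<ge> 2 \<Longrightarrow> b_rel q t \<delta>
     (cap r \<star> sig (r + 2) 2 \<star> sig (r + 2) 3 \<star> sigi (r + 2) 1 \<star> sigi (r + 2) 2 \<star> cup r)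
     (cup (r - 2) \<star> cap (r - 2))"
| "b_rel q t \<delta>
     (cap r \<star> cap (r + 2) \<star> sigi (r + 4) 2 \<star> sigi (r + 4) 3 \<star> sig (r + 4) 1 \<star> sig (r + 4) 2)
     (cap r \<star> cap (r + 2))"
| "b_rel q t \<delta>
     (sigi (r + 4) 2 \<star> sigi (r + 4) 1 \<star> sig (r + 4) 3 \<star> sig (r + 4) 2 \<star> cup (r + 2) \<star> cup r)
     (cup (r + 2) \<star> cup r)"

abbreviation b_cong ::
  "'k::{comm_ring,comm_monoid_mult} \<Rightarrow> 'k \<Rightarrow> 'k \<Rightarrow> ('k b_term \<times> 'k b_term) set" where
  "b_cong q t \<delta> \<equiv> ccong b_sig (b_rel q t \<delta>)"

text \<open>Adding \<open>n\<close> identity strands on the right.\<close>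

primrec b_gen_right :: "nat \<Rightarrow> b_gen \<Rightarrow> b_gen" where
  "b_gen_right n (Cup r) = Cup (r + n)"
| "b_gen_right n (Cap r) = Cap (r + n)"
| "b_gen_right n (Sig r i) = Sig (r + n) i"
| "b_gen_right n (SigInv r i) = SigInv (r + n) i"

definition b_right :: "nat \<Rightarrow> 'k b_term \<Rightarrow> 'k b_term" where
  "b_right n = cextend (\<lambda>r. r + n) (\<lambda>g. CGen (b_gen_right n g))"

text \<open>
  \<open>b_prod r s [i\<^sub>1, \<dots>, i\<^sub>m]\<close> is the composite \<open>s r i\<^sub>1 \<star> \<dots> \<star> s r i\<^sub>m\<close> on \<open>B\<^sub>r\<close>.
\<close>

definition b_prod :: "nat \<Rightarrow> (nat \<Rightarrow> nat \<Rightarrow> 'k b_term) \<Rightarrow> nat list \<Rightarrow> 'k b_term" where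
  "b_prod r s ks = foldr (\<lambda>i u. s r i \<star> u) ks (CId r)"

primrec b_act_gen ::
  "'k::{comm_ring,comm_monoid_mult} \<Rightarrow> 'k \<Rightarrow> nat \<Rightarrow> os_gen \<Rightarrow> 'k b_term" where
  "b_act_gen q t r Xpos = sig (r + 2) (r + 1)"
| "b_act_gen q t r Xneg = sigi (r + 2) (r + 1)"
| "b_act_gen q t r Cw =
     b_prod (r + 2) sigi (rev [1..<r + 1]) \<star> b_prod (r + 2) sig (rev [2..<r + 2]) \<star> cup r"
| "b_act_gen q t r Cw' = CScale (unit_inv q * t)
     (b_prod (r + 2) sig (rev [1..<r + 1]) \<star> b_prod (r + 2) sigi (rev [2..<r + 2]) \<star> cup r)"
| "b_act_gen q t r Dw' =
     cap r \<star> b_prod (r + 2) sigi [2..<r + 2] \<star> b_prod (r + 2) sig [1..<r + 1]"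
| "b_act_gen q t r Dw = CScale (q * unit_inv t)
     (cap r \<star> b_prod (r + 2) sig [2..<r + 2] \<star> b_prod (r + 2) sigi [1..<r + 1])"

primrec os_src :: "'k os_term \<Rightarrow> word" where
  "os_src (MGen g) = os_dom g"
| "os_src (MId X) = X"
| "os_src (s \<odot> t) = os_src t"
| "os_src (s \<boxtimes> t) = os_src s @ os_src t"
| "os_src (MZero X Y) = X"
| "os_src (MAdd s t) = os_src s"
| "os_src (MScale a s) = os_src s"

primrec os_tgt :: "'k os_term \<Rightarrow> word" where
  "os_tgt (MGen g) = os_cod g"
| "os_tgt (MId X) = X"
| "os_tgt (s \<odot> t) = os_tgt s"
| "os_tgt (s \<boxtimes> t) = os_tgt s @ os_tgt t"
| "os_tgt (MZero X Y) = Y"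
| "os_tgt (MAdd s t) = os_tgt s"
| "os_tgt (MScale a s) = os_tgt s"

text \<open>
  \<open>b_act q t r g\<close> is the identity of \<open>B\<^sub>r\<close> tensored with \<open>g\<close>.  The clause for tensor products is
  forced by strictness: first act by \<open>s\<close> next to identity strands, one for each letter of the
  source of \<open>u\<close>, then by \<open>u\<close>.
\<close>

primrec b_act ::
  "'k::{comm_ring,comm_monoid_mult} \<Rightarrow> 'k \<Rightarrow> nat \<Rightarrow> 'k os_term \<Rightarrow> 'k b_term" where
  "b_act q t r (MGen g) = b_act_gen q t r g"
| "b_act q t r (MId X) = CId (r + length X)"
| "b_act q t r (s \<odot> u) = b_act q t r s \<star> b_act q t r u"
| "b_act q t r (s \<boxtimes> u) =
     b_act q t (r + length (os_tgt s)) u \<star> b_right (length (os_src u)) (b_act q t r s)"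
| "b_act q t r (MZero X Y) = CZero (r + length X) (r + length Y)"
| "b_act q t r (MAdd s u) = CAdd (b_act q t r s) (b_act q t r u)"
| "b_act q t r (MScale a s) = CScale a (b_act q t r s)"

definition iB ::
  "'k::{comm_ring,comm_monoid_mult} \<Rightarrow> 'k \<Rightarrow> 'k
    \<Rightarrow> (nat, 'k b_term set, 'k, word, 'k os_term set) lin_rmodule" where
  "iB q t \<delta> = lincat.extend (presented_lincat b_sig (b_rel q t \<delta>))
     (lin_rmodule.fields
        (\<lambda>r \<nu>. r + length \<nu>)
        (\<lambda>f \<nu>. \<Union>s\<in>f. b_cong q t \<delta> `` {b_right (length \<nu>) s})
        (\<lambda>r g. \<Union>s\<in>g. b_cong q t \<delta> `` {b_act q t r s}))"


section \<open>The functor from the iquantum Brauer to the disoriented skein category\<close>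

definition G_ob :: "nat \<Rightarrow> word" where
  "G_ob r = replicate r Up"

primrec G_gen :: "b_gen \<Rightarrow> 'k ds_term" where
  "G_gen (Cap r) = ds_right (replicate r Up) (os d\<^sub>o' \<star> taubar [Up])"
| "G_gen (Cup r) = ds_right (replicate r Up) (tau [Up] \<star> os c\<^sub>o)"
| "G_gen (Sig r i) =
     os (MId (replicate (i - 1) Up) \<boxtimes> X\<^sub>p \<boxtimes> MId (replicate (r - i - 1) Up))"
| "G_gen (SigInv r i) =
     os (MId (replicate (i - 1) Up) \<boxtimes> X\<^sub>m \<boxtimes> MId (replicate (r - i - 1) Up))"

definition G_mor ::
  "'k::{comm_ring,comm_monoid_mult} \<Rightarrow> 'k \<Rightarrow> 'k \<Rightarrow> 'k b_term set \<Rightarrow> 'k ds_term set" where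
  "G_mor q t \<delta> f = (\<Union>s\<in>f. ds_cong q t \<delta> `` {cextend G_ob G_gen s})"

end

theory Submission
  imports Defs
begin

text \<open>
  The quasi-inverse of \<open>G\<close> is the strict module functor \<open>F\<close> that sends a morphism \<open>g\<close> of the oriented
  skein category, or \<open>f \<otimes> g\<close> with a toggle \<open>f\<close>, to the action of \<open>g\<close> on \<open>B\<^sub>0\<close> or \<open>B\<^sub>1\<close>.  Then \<open>F G = id\<close>,
  and the toggles \<open>\<eta>\<close> form a natural isomorphism from the identity to \<open>G F\<close>, whose inverse is \<open>\<omega>\<close>.

  Relations are checked with the operators "left composition with a generator at a given position".
  In the Brauer category the relations that involve cups and caps at position \<open>r\<close> reduce to \<open>r = 0\<close> by
  braiding; the exchange of \<open>\<sigma>\<close>, \<open>q\<close>, \<open>t\<close> with their inverses is a symmetry, because the skein relation turns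
  each defining relation into its reflection.  In the disoriented skein category everything follows
  from the fact that toggles on different strands commute and are natural with respect to crossings, cups and
  caps on their left: this gives the relations of the Brauer category for the images under \<open>G\<close>, as
  well as the naturality of \<open>\<eta>\<close>.
\<close>

text \<open>The generating toggles act on the leftmost strand only. With positions counted from the
  left end of the target, identity strands added on the right leave no trace, and one set of
  operator identities serves any number of them. The link between the two categories is this: a cup
  \<open>c\<close> at position \<open>r\<close> whose \<open>Down\<close> strand is toggled equals a
  toggled cup made at the far left and then passed through \<open>r\<close> strands. The Brauer
  relations between two cups, two caps, or a cup and a cap thus say that toggles commute with
  toggles, cups and caps. The scalars in the action of \<open>c'\<close> and \<open>d\<close> have
  the same source: \<open>t\<close> arises from a curl, when \<open>R_+\<close> turns
  \<open>c'\<close> into \<open>t c\<close>, and \<open>q\<close> from interchanging the legs of a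
  toggled cup. Two obstacles shape the calculations. The toggle relation is stated with
  \<open>R_-\<close>, whereas commuting toggles involves \<open>R_+\<close>; and the Brauer
  relations fix one choice of signs of the crossings, whereas \<open>c'\<close> and \<open>d\<close>
  need others. The skein relation bridges both gaps.\<close>

context linear_category begin

text \<open>The multiple by \<open>0\<close> is idempotent for addition, and an idempotent of a
  group is zero.\<close>

lemma scale_zero: assumes f: "f \<in> hom C X Y" shows "scale_mor C 0 f = zero_mor C X Y"
proof -
  let ?z = "scale_mor C 0 f"
  have z: "?z \<in> hom C X Y" using f by (rule scale_hom)
  have zz: "add_mor C ?z ?z = ?z" using scale_add_left[OF f, of 0 0] by simp
  obtain g where g: "g \<in> hom C X Y" "add_mor C ?z g = zero_mor C X Y"
    using add_inverse[OF z] by blast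
  have "?z = add_mor C ?z (add_mor C ?z g)" using add_zero[OF z] g by simp
  also have "\<dots> = add_mor C (add_mor C ?z ?z) g" using add_assoc[OF z z g(1)] by simp
  also have "\<dots> = zero_mor C X Y" using zz g by simp
  finally show ?thesis .
qed

lemma add_right_cancel:
  assumes f: "f \<in> hom C X Y" and g: "g \<in> hom C X Y" and h: "h \<in> hom C X Y"
    and e: "add_mor C f h = add_mor C g h"
  shows "f = g"
proof -
  obtain k where k: "k \<in> hom C X Y" "add_mor C h k = zero_mor C X Y"
    using add_inverse[OF h] by blast
  have "f = add_mor C (add_mor C f h) k"
    using add_assoc[OF f h k(1)] k(2) add_zero[OF f] by simp
  also have "\<dots> = g" using e add_assoc[OF g h k(1)] k(2) add_zero[OF g] by simp
  finally show ?thesis .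
qed

lemma cmp_zero_left: assumes "f \<in> hom C X Y" shows "cmp C (zero_mor C Y Z) f = zero_mor C X Z"
proof -
  have z: "zero_mor C Y Z \<in> hom C Y Z" by (rule zero_hom)
  have "cmp C (zero_mor C Y Z) f = cmp C (scale_mor C 0 (zero_mor C Y Z)) f"
    using scale_zero[OF z] by simp
  also have "\<dots> = zero_mor C X Z"
    using cmp_scale_left[OF assms z] scale_zero[OF cmp_hom[OF assms z]] by simp
  finally show ?thesis .
qed

lemma cmp_zero_right: assumes "g \<in> hom C Y Z" shows "cmp C g (zero_mor C X Y) = zero_mor C X Z"
proof -
  have z: "zero_mor C X Y \<in> hom C X Y" by (rule zero_hom)
  have "cmp C g (zero_mor C X Y) = cmp C g (scale_mor C 0 (zero_mor C X Y))"
    using scale_zero[OF z] by simp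
  also have "\<dots> = zero_mor C X Z"
    using cmp_scale_right[OF z assms] scale_zero[OF cmp_hom[OF z assms]] by simp
  finally show ?thesis .
qed

end

text \<open>Linear functors are only required to respect sums and scalars; zero is \<open>0\<close>
  times any morphism.\<close>

lemma linear_functor_zero:
  assumes "linear_category C" "linear_category D" "linear_functor C D FO FM"
  shows "FM (zero_mor C X Y) = zero_mor D (FO X) (FO Y)"
proof -
  interpret C: linear_category C by fact
  interpret D: linear_category D by fact
  interpret F: linear_functor C D FO FM by fact
  have z: "zero_mor C X Y \<in> hom C X Y" by (rule C.zero_hom)
  show ?thesis
    using F.fun_scale[OF z, of 0] C.scale_zero[OF z] D.scale_zero[OF F.fun_hom[OF z]] by simp
qed

section \<open>Presented linear categories\<close>

inductive_simps ctyp_simps: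
  "ctyp G (CGen g) X Y" "ctyp G (CId Z) X Y" "ctyp G (s \<star> t) X Y" "ctyp G (CZero Z W) X Y"
  "ctyp G (CAdd s t) X Y" "ctyp G (CScale a s) X Y"

text \<open>\<open>gen_unique\<close> makes the type of a term unique, so a congruence class has one
  source and one target. Transitivity of the congruence respects types for this reason only.\<close>

locale presentation =
  fixes G :: "'g \<Rightarrow> 'o \<Rightarrow> 'o \<Rightarrow> bool"
    and R :: "('g, 'o, 'k::{comm_ring,comm_monoid_mult}) cterm \<Rightarrow> ('g, 'o, 'k) cterm \<Rightarrow> bool"
  assumes gen_unique: "\<lbrakk>G g X Y; G g X' Y'\<rbrakk> \<Longrightarrow> X = X' \<and> Y = Y'"
begin

abbreviation cat where "cat \<equiv> presented_lincat G R"

definition cls :: "('g, 'o, 'k) cterm \<Rightarrow> ('g, 'o, 'k) cterm set" where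
  "cls s = ccong G R `` {s}"

lemma ctyp_unique: "ctyp G s X Y \<Longrightarrow> ctyp G s X' Y' \<Longrightarrow> X = X' \<and> Y = Y'"
  by (induction s arbitrary: X Y X' Y') (auto simp: ctyp_simps dest: gen_unique)

lemma ccong_typed: "(s, t) \<in> ccong G R \<Longrightarrow> \<exists>X Y. ctyp G s X Y \<and> ctyp G t X Y"
proof (induction rule: ccong.induct)
  case trans then show ?case by (metis ctyp_unique)
next
  case cong_comp then show ?case by (metis ctyp_unique ctyp.intros(3))
next
  case cong_add then show ?case by (metis ctyp_unique ctyp.intros(5))
qed (meson ctyp.intros)+

lemma ccong_typ: "(s, t) \<in> ccong G R \<Longrightarrow> ctyp G s X Y \<longleftrightarrow> ctyp G t X Y"
  using ccong_typed[of s t] ctyp_unique by blast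

text \<open>The congruence is reflexive on well-typed terms only. The class of an ill-typed term is
  therefore empty, and \<open>{}\<close> serves as the undefined value throughout.\<close>

lemma cls_untyped: "(\<And>X Y. \<not> ctyp G s X Y) \<Longrightarrow> cls s = {}"
  unfolding cls_def using ccong_typed[of s] by blast

lemma cls_empty: "cls s = {} \<Longrightarrow> \<not> ctyp G s X Y"
  unfolding cls_def using ccong.refl[of G s X Y R] by auto

lemma cls_eq: "(s, t) \<in> ccong G R \<Longrightarrow> cls s = cls t"
  unfolding cls_def by (auto intro: ccong.trans ccong.sym)

lemma cls_rel: "R s t \<Longrightarrow> ctyp G s X Y \<Longrightarrow> ctyp G t X Y \<Longrightarrow> cls s = cls t"
  by (rule cls_eq) (rule ccong.rel)

lemma cls_eqD: "cls s = cls t \<Longrightarrow> ctyp G s X Y \<Longrightarrow> (s, t) \<in> ccong G R"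
  using ccong.refl[of G t X Y R] ccong.refl[of G s X Y R] ccong.sym[of t s G R] unfolding cls_def by auto

lemma in_cls: "s' \<in> cls s \<longleftrightarrow> (s, s') \<in> ccong G R"
  by (simp add: cls_def)

lemma self_in_cls: "ctyp G s X Y \<Longrightarrow> s \<in> cls s"
  by (simp add: in_cls ccong.refl)

text \<open>Two ill-typed terms have equal classes because both are empty, so it suffices to prove
  the congruence under a typing assumption.\<close>

lemma cls_eqI:
  assumes "\<And>X Y. ctyp G s X Y \<Longrightarrow> (s, t) \<in> ccong G R"
    and "\<And>X Y. ctyp G t X Y \<Longrightarrow> \<exists>X' Y'. ctyp G s X' Y'"
  shows "cls s = cls t"
proof (cases "\<exists>X Y. ctyp G s X Y")
  case True then show ?thesis using assms(1) cls_eq by blast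
next
  case False
  then have "cls s = {}" "cls t = {}" using assms(2) by (auto intro!: cls_untyped)
  then show ?thesis by simp
qed

lemma
  shows cls_cong_comp: "cls s = cls s' \<Longrightarrow> cls t = cls t' \<Longrightarrow> cls (s \<star> t) = cls (s' \<star> t')"
    and cls_cong_add: "cls s = cls s' \<Longrightarrow> cls t = cls t' \<Longrightarrow> cls (CAdd s t) = cls (CAdd s' t')"
    and cls_cong_scale: "cls s = cls s' \<Longrightarrow> cls (CScale a s) = cls (CScale a s')"
proof -
  have tps: "ctyp G s X Y \<longleftrightarrow> ctyp G s' X Y" if "cls s = cls s'" for s s' X Y
    using cls_eqD[OF that] cls_eqD[OF that[symmetric]] ccong_typ by blast
  show "cls (s \<star> t) = cls (s' \<star> t')" if e: "cls s = cls s'" "cls t = cls t'"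
  proof (rule cls_eqI)
    fix X Z assume "ctyp G (s \<star> t) X Z"
    then obtain Y where st: "ctyp G s Y Z" "ctyp G t X Y" by (auto simp: ctyp_simps)
    show "(s \<star> t, s' \<star> t') \<in> ccong G R"
      by (rule ccong.cong_comp[OF cls_eqD[OF e(1) st(1)] cls_eqD[OF e(2) st(2)] st])
  qed (auto simp: ctyp_simps tps[OF e(1)] tps[OF e(2)])
  show "cls (CAdd s t) = cls (CAdd s' t')" if e: "cls s = cls s'" "cls t = cls t'"
  proof (rule cls_eqI)
    fix X Y assume "ctyp G (CAdd s t) X Y"
    then have st: "ctyp G s X Y" "ctyp G t X Y" by (auto simp: ctyp_simps)
    show "(CAdd s t, CAdd s' t') \<in> ccong G R"
      by (rule ccong.cong_add[OF cls_eqD[OF e(1) st(1)] cls_eqD[OF e(2) st(2)] st])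
  qed (auto simp: ctyp_simps tps[OF e(1)] tps[OF e(2)])
  show "cls (CScale a s) = cls (CScale a s')" if e: "cls s = cls s'"
  proof (rule cls_eqI)
    fix X Y assume "ctyp G (CScale a s) X Y"
    then have s: "ctyp G s X Y" by (auto simp: ctyp_simps)
    show "(CScale a s, CScale a s') \<in> ccong G R"
      by (rule ccong.cong_scale[OF cls_eqD[OF e s]])
  qed (auto simp: ctyp_simps tps[OF e])
qed

lemma
  shows ident_cls: "ident cat X = cls (CId X)"
    and zero_cls: "zero_mor cat X Y = cls (CZero X Y)"
    and cmp_union: "cmp cat g f = (\<Union>s\<in>g. \<Union>t\<in>f. cls (s \<star> t))"
    and add_union: "add_mor cat g f = (\<Union>s\<in>g. \<Union>t\<in>f. cls (CAdd s t))"
    and scale_union: "scale_mor cat a f = (\<Union>s\<in>f. cls (CScale a s))"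
  by (simp_all add: presented_lincat_def Let_def cls_def)

lemma hom_cls: "hom cat X Y = {cls s |s. ctyp G s X Y}"
  by (auto simp: presented_lincat_def Let_def quotient_def cls_def)

lemma cls_in_hom [simp]: "cls s \<in> hom cat X Y \<longleftrightarrow> ctyp G s X Y"
proof
  assume "cls s \<in> hom cat X Y"
  then obtain t where t: "cls t = cls s" "ctyp G t X Y" by (auto simp: hom_cls)
  show "ctyp G s X Y" using ccong_typ[OF cls_eqD[OF t]] t(2) by blast
qed (auto simp: hom_cls)

lemma hom_obtain: assumes "f \<in> hom cat X Y" obtains s where "f = cls s" "ctyp G s X Y"
  using assms by (auto simp: hom_cls)

lemma untyped_in: "s' \<in> cls s \<Longrightarrow> cls s' = cls s"
  by (simp add: in_cls cls_eq)

lemma cls_empty_comp: "cls s = {} \<or> cls t = {} \<Longrightarrow> cls (s \<star> t) = {}"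
  by (rule cls_untyped) (use cls_empty in \<open>auto simp: ctyp_simps\<close>)

lemma cls_empty_add: "cls s = {} \<or> cls t = {} \<Longrightarrow> cls (CAdd s t) = {}"
  by (rule cls_untyped) (use cls_empty in \<open>auto simp: ctyp_simps\<close>)

lemma cls_empty_scale: "cls s = {} \<Longrightarrow> cls (CScale a s) = {}"
  by (rule cls_untyped) (use cls_empty in \<open>auto simp: ctyp_simps\<close>)

text \<open>The union over representatives is a union of equal sets, unless one of the classes is
  empty; in that case the composite is ill-typed and both sides are empty.\<close>

lemma cmp_cls: "cmp cat (cls s) (cls t) = cls (s \<star> t)"
proof (cases "cls s = {} \<or> cls t = {}")
  case True then show ?thesis using cls_empty_comp by (auto simp: cmp_union)
next
  case False
  have "cls (s' \<star> t') = cls (s \<star> t)" if "s' \<in> cls s" "t' \<in> cls t" for s' t'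
    using that by (intro cls_cong_comp) (auto simp: untyped_in)
  with False show ?thesis unfolding cmp_union by blast
qed

lemma add_cls: "add_mor cat (cls s) (cls t) = cls (CAdd s t)"
proof (cases "cls s = {} \<or> cls t = {}")
  case True then show ?thesis using cls_empty_add by (auto simp: add_union)
next
  case False
  have "cls (CAdd s' t') = cls (CAdd s t)" if "s' \<in> cls s" "t' \<in> cls t" for s' t'
    using that by (intro cls_cong_add) (auto simp: untyped_in)
  with False show ?thesis unfolding add_union by blast
qed

lemma scale_cls: "scale_mor cat a (cls s) = cls (CScale a s)"
proof (cases "cls s = {}")
  case True then show ?thesis using cls_empty_scale by (auto simp: scale_union)
next
  case False
  have "cls (CScale a s') = cls (CScale a s)" if "s' \<in> cls s" for s'
    using that by (intro cls_cong_scale) (auto simp: untyped_in)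
  with False show ?thesis unfolding scale_union by blast
qed

lemma cls_assoc: "cls (s \<star> t \<star> u) = cls (s \<star> (t \<star> u))"
  by (rule cls_eqI) (auto simp: ctyp_simps intro: ccong.comp_assoc)

lemma cls_comp_left: "(\<Union>x\<in>cls s. cls (x \<star> u)) = cls (s \<star> u)"
proof (cases "cls s = {}")
  case True then show ?thesis using cls_empty_comp by auto
next
  case False
  have "cls (x \<star> u) = cls (s \<star> u)" if "x \<in> cls s" for x
    using that by (intro cls_cong_comp) (auto simp: untyped_in)
  with False show ?thesis by blast
qed

lemma cls_comp_right: "(\<Union>x\<in>cls s. cls (u \<star> x)) = cls (u \<star> s)"
proof (cases "cls s = {}")
  case True then show ?thesis using cls_empty_comp by auto
next
  case False
  have "cls (u \<star> x) = cls (u \<star> s)" if "x \<in> cls s" for x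
    using that by (intro cls_cong_comp) (auto simp: untyped_in)
  with False show ?thesis by blast
qed

text \<open>Ill-typed composites give the empty set, so associativity needs no typing hypotheses.\<close>

lemma cmp_assoc: "cmp cat (cmp cat h g) f = cmp cat h (cmp cat g f)"
proof -
  have "cmp cat (cmp cat h g) f = (\<Union>s\<in>h. \<Union>t\<in>g. \<Union>u\<in>f. \<Union>x\<in>cls (s \<star> t). cls (x \<star> u))"
    unfolding cmp_union by blast
  also have "\<dots> = (\<Union>s\<in>h. \<Union>t\<in>g. \<Union>u\<in>f. cls (s \<star> t \<star> u))" by (simp only: cls_comp_left)
  also have "\<dots> = (\<Union>s\<in>h. \<Union>t\<in>g. \<Union>u\<in>f. cls (s \<star> (t \<star> u)))" by (simp only: cls_assoc)
  also have "\<dots> = (\<Union>s\<in>h. \<Union>t\<in>g. \<Union>u\<in>f. \<Union>x\<in>cls (t \<star> u). cls (s \<star> x))" by (simp only: cls_comp_right)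
  also have "\<dots> = cmp cat h (cmp cat g f)"
    unfolding cmp_union by blast
  finally show ?thesis .
qed

lemma cmp_empty [simp]: "cmp cat {} f = {}" "cmp cat f {} = {}"
  by (auto simp: cmp_union)

lemma scale_empty [simp]: "scale_mor cat a {} = {}"
  by (auto simp: scale_union)

text \<open>Every axiom is a typing rule or a clause of the congruence. Only the additive inverse
  asks for a witness, the multiple by \<open>- 1\<close>.\<close>

lemma linear_category_cat: "linear_category cat"
proof
  fix X Y f assume f: "f \<in> hom cat X Y"
  then obtain s where s: "f = cls s" "ctyp G s X Y" by (rule hom_obtain)
  show "\<exists>g \<in> hom cat X Y. add_mor cat f g = zero_mor cat X Y"
  proof (rule bexI)
    show "add_mor cat f (cls (CScale (- 1) s)) = zero_mor cat X Y"
      unfolding s(1) add_cls zero_cls by (rule cls_eq[OF ccong.add_minus[OF s(2)]])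
  qed (simp add: s ctyp_simps)
qed (((elim hom_obtain)?, hypsubst?, simp only: cls_in_hom ident_cls zero_cls cmp_cls add_cls scale_cls,
    (((rule ctyp.intros)+; assumption) | (rule cls_eq, rule ccong.id_left ccong.id_right ccong.comp_assoc
      ccong.add_assoc ccong.add_commute ccong.add_zero ccong.scale_add_right ccong.scale_add_left
      ccong.scale_scale ccong.scale_one ccong.comp_add_left ccong.comp_add_right
      ccong.comp_scale_left ccong.comp_scale_right; assumption)))+)

lemma cmp_ident_left: "f \<in> hom cat X Y \<Longrightarrow> cmp cat (ident cat Y) f = f"
  and cmp_ident_right: "f \<in> hom cat X Y \<Longrightarrow> cmp cat f (ident cat X) = f"
  by (rule linear_category.cmp_ident_left[OF linear_category_cat], assumption)
    (rule linear_category.cmp_ident_right[OF linear_category_cat], assumption)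

lemma hom_unique:
  assumes "f \<in> hom cat X Y" "f \<in> hom cat X' Y'" shows "X = X' \<and> Y = Y'"
proof -
  obtain s where "f = cls s" "ctyp G s X Y" using assms(1) by (rule hom_obtain)
  with assms(2) have "ctyp G s X Y" "ctyp G s X' Y'" by simp_all
  then show ?thesis by (rule ctyp_unique)
qed

lemma hom_nonempty: "f \<in> hom cat X Y \<Longrightarrow> f \<noteq> {}"
  using cls_empty by (elim hom_obtain) blast

end

text \<open>Commuting squares are closed under composition, sums and scalars, so naturality need
  only be tested on generators. With identities as components the same statement shows that two
  functors agree on morphisms.\<close>

lemma (in presentation) natural_extend:
  assumes D: "linear_category D"
    and F: "linear_functor cat D FO FM" and F': "linear_functor cat D FO' FM'"
    and a: "\<And>X. \<alpha> X \<in> hom D (FO X) (FO' X)"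
    and gen: "\<And>g X Y. G g X Y \<Longrightarrow> cmp D (\<alpha> Y) (FM (cls (CGen g))) = cmp D (FM' (cls (CGen g))) (\<alpha> X)"
    and f: "f \<in> hom cat X Y"
  shows "cmp D (\<alpha> Y) (FM f) = cmp D (FM' f) (\<alpha> X)"
proof -
  interpret D: linear_category D by fact
  interpret C: linear_category cat by (rule linear_category_cat)
  interpret F: linear_functor cat D FO FM by fact
  interpret F': linear_functor cat D FO' FM' by fact
  obtain s where s: "f = cls s" "ctyp G s X Y" using f by (rule hom_obtain)
  have "cmp D (\<alpha> Y) (FM (cls s)) = cmp D (FM' (cls s)) (\<alpha> X)"
    using s(2)
  proof (induction rule: ctyp.induct)
    case (2 X)
    then show ?case
      using F.fun_ident[of X] F'.fun_ident[of X] D.cmp_ident_left[OF a] D.cmp_ident_right[OF a]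
      by (simp add: ident_cls)
  next
    case (3 s Y Z t X)
    have h: "cls s \<in> hom cat Y Z" "cls t \<in> hom cat X Y" using 3 by auto
    note m = F.fun_hom[OF h(1)] F.fun_hom[OF h(2)] F'.fun_hom[OF h(1)] F'.fun_hom[OF h(2)]
    have "cmp D (\<alpha> Z) (FM (cls (s \<star> t))) = cmp D (cmp D (\<alpha> Z) (FM (cls s))) (FM (cls t))"
      using F.fun_cmp[OF h(2,1)] D.cmp_assoc[OF m(2,1) a] by (simp add: cmp_cls)
    also have "\<dots> = cmp D (FM' (cls s)) (cmp D (\<alpha> Y) (FM (cls t)))"
      using D.cmp_assoc[OF m(2) a m(3)] 3 by simp
    also have "\<dots> = cmp D (FM' (cls (s \<star> t))) (\<alpha> X)"
      using F'.fun_cmp[OF h(2,1)] D.cmp_assoc[OF a m(4,3)] 3 by (simp add: cmp_cls)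
    finally show ?case .
  next
    case (4 X Y)
    show ?case
      by (simp only: zero_cls[symmetric] linear_functor_zero[OF linear_category_cat D F]
          linear_functor_zero[OF linear_category_cat D F'] D.cmp_zero_left[OF a]
          D.cmp_zero_right[OF a])
  next
    case (5 s X Y t)
    have h: "cls s \<in> hom cat X Y" "cls t \<in> hom cat X Y" using 5 by auto
    show ?case
      by (simp only: add_cls[symmetric] F.fun_add[OF h] F'.fun_add[OF h] 5
        D.cmp_add_right[OF F.fun_hom[OF h(1)] F.fun_hom[OF h(2)] a]
        D.cmp_add_left[OF a F'.fun_hom[OF h(1)] F'.fun_hom[OF h(2)]])
  next
    case (6 s X Y b)
    have h: "cls s \<in> hom cat X Y" using 6 by auto
    show ?case
      by (simp only: scale_cls[symmetric] F.fun_scale[OF h] F'.fun_scale[OF h] 6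
        D.cmp_scale_right[OF F.fun_hom[OF h] a] D.cmp_scale_left[OF a F'.fun_hom[OF h]])
  qed (rule gen)
  then show ?thesis using s by simp
qed

text \<open>Data for a functor between presented categories: images of the generators that respect
  types and relations. \<open>G\<close>, its quasi-inverse and both right actions by words are
  instances.\<close>

locale presentation_map = P: presentation G R + Q: presentation G' R'
  for G :: "'g \<Rightarrow> 'o \<Rightarrow> 'o \<Rightarrow> bool" and R :: "('g, 'o, 'k::{comm_ring,comm_monoid_mult}) cterm \<Rightarrow> _"
    and G' :: "'h \<Rightarrow> 'p \<Rightarrow> 'p \<Rightarrow> bool" and R' :: "('h, 'p, 'k) cterm \<Rightarrow> _" +
  fixes FO :: "'o \<Rightarrow> 'p" and FG :: "'g \<Rightarrow> ('h, 'p, 'k) cterm"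
  assumes gen_typ: "G g X Y \<Longrightarrow> ctyp G' (FG g) (FO X) (FO Y)"
    and rel_eq: "\<lbrakk>R s t; ctyp G s X Y; ctyp G t X Y\<rbrakk>
      \<Longrightarrow> Q.cls (cextend FO FG s) = Q.cls (cextend FO FG t)"
begin

lemma ctyp_extend: "ctyp G s X Y \<Longrightarrow> ctyp G' (cextend FO FG s) (FO X) (FO Y)"
  by (induction rule: ctyp.induct) (auto simp: gen_typ ctyp_simps)

lemma cls_extend: "(s, t) \<in> ccong G R \<Longrightarrow> Q.cls (cextend FO FG s) = Q.cls (cextend FO FG t)"
proof (induction rule: ccong.induct)
  case (rel s t X Y) then show ?case by (rule rel_eq)
next
  case (cong_comp s s' t t' Y Z X) then show ?case unfolding cextend.simps by (intro Q.cls_cong_comp)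
next
  case (cong_add s s' t t' X Y) then show ?case unfolding cextend.simps by (intro Q.cls_cong_add)
next
  case (cong_scale s s' a) then show ?case unfolding cextend.simps by (intro Q.cls_cong_scale)
next
  case refl show ?case by (rule HOL.refl)
next
  case sym then show ?case by simp
next
  case trans then show ?case by simp
qed (simp_all only: cextend.simps, (rule Q.cls_eq, rule ccong.id_left ccong.id_right ccong.comp_assoc
      ccong.add_assoc ccong.add_commute ccong.add_zero ccong.add_minus ccong.scale_add_right
      ccong.scale_add_left ccong.scale_scale ccong.scale_one ccong.comp_add_left
      ccong.comp_add_right ccong.comp_scale_left ccong.comp_scale_right;
      erule ctyp_extend)+)

text \<open>The union over representatives has the form in which \<open>G_mor\<close> and the
  actions of words are defined; \<open>cls_extend\<close> shows that it is a single class.\<close>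

definition map_mor where "map_mor f = (\<Union>s\<in>f. Q.cls (cextend FO FG s))"

lemma map_cls: assumes "ctyp G s X Y" shows "map_mor (P.cls s) = Q.cls (cextend FO FG s)"
proof -
  have "Q.cls (cextend FO FG s') = Q.cls (cextend FO FG s)" if "s' \<in> P.cls s" for s'
    using cls_extend that by (auto simp: P.in_cls)
  then show ?thesis unfolding map_mor_def using P.self_in_cls[OF assms] by blast
qed

lemma functor_map: "linear_functor P.cat Q.cat FO map_mor"
proof
  show "map_mor f \<in> hom Q.cat (FO X) (FO Y)" if "f \<in> hom P.cat X Y" for f X Y
    using that by (elim P.hom_obtain) (simp add: map_cls ctyp_extend)
  show "map_mor (ident P.cat X) = ident Q.cat (FO X)" for X
    by (simp add: P.ident_cls Q.ident_cls map_cls[OF ctyp.intros(2)])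
  show "map_mor (cmp P.cat g f) = cmp Q.cat (map_mor g) (map_mor f)"
    if "f \<in> hom P.cat X Y" "g \<in> hom P.cat Y Z" for f g X Y Z
    using that
    by (elim P.hom_obtain) (simp add: P.cmp_cls Q.cmp_cls map_cls map_cls[OF ctyp.intros(3)])
  show "map_mor (add_mor P.cat f g) = add_mor Q.cat (map_mor f) (map_mor g)"
    if "f \<in> hom P.cat X Y" "g \<in> hom P.cat X Y" for f g X Y
    using that
    by (elim P.hom_obtain) (simp add: P.add_cls Q.add_cls map_cls map_cls[OF ctyp.intros(5)])
  show "map_mor (scale_mor P.cat a f) = scale_mor Q.cat a (map_mor f)"
    if "f \<in> hom P.cat X Y" for a f X Y
    using that
    by (elim P.hom_obtain) (simp add: P.scale_cls Q.scale_cls map_cls map_cls[OF ctyp.intros(6)])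
qed

end

section \<open>Presented monoidal categories\<close>

inductive_simps mtyp_simps:
  "mtyp G (MGen g) X Y" "mtyp G (MId Z) X Y" "mtyp G (s \<odot> t) X Y" "mtyp G (s \<boxtimes> t) X Y"
  "mtyp G (MZero Z W) X Y" "mtyp G (MAdd s t) X Y" "mtyp G (MScale a s) X Y"

locale monoidal_presentation =
  fixes G :: "'g \<Rightarrow> 'a list \<Rightarrow> 'a list \<Rightarrow> bool"
    and R :: "('g, 'a, 'k::{comm_ring,comm_monoid_mult}) mterm \<Rightarrow> ('g, 'a, 'k) mterm \<Rightarrow> bool"
  assumes gen_unique: "\<lbrakk>G g X Y; G g X' Y'\<rbrakk> \<Longrightarrow> X = X' \<and> Y = Y'"
begin

abbreviation cat where "cat \<equiv> presented_lin_moncat G R"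

definition cls :: "('g, 'a, 'k) mterm \<Rightarrow> ('g, 'a, 'k) mterm set" where
  "cls s = mcong G R `` {s}"

lemma mtyp_unique: "mtyp G s X Y \<Longrightarrow> mtyp G s X' Y' \<Longrightarrow> X = X' \<and> Y = Y'"
  by (induction s arbitrary: X Y X' Y') (auto simp: mtyp_simps dest: gen_unique, blast+)

lemma mcong_typed: "(s, t) \<in> mcong G R \<Longrightarrow> \<exists>X Y. mtyp G s X Y \<and> mtyp G t X Y"
proof (induction rule: mcong.induct)
  case trans then show ?case by (metis mtyp_unique)
next
  case cong_comp then show ?case by (metis mtyp_unique mtyp.intros(3))
next
  case cong_tens then show ?case by (meson mtyp.intros(4))
next
  case cong_add then show ?case by (metis mtyp_unique mtyp.intros(6))
next
  case (tens_assoc s X Y t Z W u U V)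
  \<comment> \<open>The typing rules give the two sides the types \<open>(X @ Z) @ U\<close> and
    \<open>X @ Z @ U\<close>, which are equal but not syntactically so.\<close>
  have "mtyp G (s \<boxtimes> t \<boxtimes> u) ((X @ Z) @ U) ((Y @ W) @ V)" using tens_assoc by (intro mtyp.intros)
  moreover have "mtyp G (s \<boxtimes> (t \<boxtimes> u)) (X @ Z @ U) (Y @ W @ V)" using tens_assoc by (intro mtyp.intros)
  ultimately show ?case by auto
next
  case (tens_unit_left s X Y)
  then show ?case using mtyp.intros(4)[OF mtyp.intros(2)[of G "[]"] tens_unit_left] by auto
next
  case (tens_unit_right s X Y)
  then show ?case using mtyp.intros(4)[OF tens_unit_right mtyp.intros(2)[of G "[]"]] by auto
qed (meson mtyp.intros)+

lemma mcong_typ: "(s, t) \<in> mcong G R \<Longrightarrow> mtyp G s X Y \<longleftrightarrow> mtyp G t X Y"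
  using mcong_typed[of s t] mtyp_unique by blast

lemma cls_eq: "(s, t) \<in> mcong G R \<Longrightarrow> cls s = cls t"
  unfolding cls_def by (auto intro: mcong.trans mcong.sym)

lemma in_cls: "s' \<in> cls s \<longleftrightarrow> (s, s') \<in> mcong G R"
  by (simp add: cls_def)

lemma self_in_cls: "mtyp G s X Y \<Longrightarrow> s \<in> cls s"
  unfolding in_cls by (rule mcong.refl)

lemma cls_eqD: "cls s = cls t \<Longrightarrow> mtyp G s X Y \<Longrightarrow> (s, t) \<in> mcong G R"
  using self_in_cls[of s X Y] mcong.sym[of t s G R] by (simp add: in_cls)

lemma
  shows ident_cls: "ident cat X = cls (MId X)"
    and zero_cls: "zero_mor cat X Y = cls (MZero X Y)"
    and unit_ob_cat: "unit_ob cat = []"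
    and tens_ob_cat: "tens_ob cat X Y = X @ Y"
    and cmp_union: "cmp cat g f = (\<Union>s\<in>g. \<Union>t\<in>f. cls (s \<odot> t))"
    and add_union: "add_mor cat g f = (\<Union>s\<in>g. \<Union>t\<in>f. cls (MAdd s t))"
    and tens_union: "tens_mor cat g f = (\<Union>s\<in>g. \<Union>t\<in>f. cls (s \<boxtimes> t))"
    and scale_union: "scale_mor cat a f = (\<Union>s\<in>f. cls (MScale a s))"
  by (simp_all add: presented_lin_moncat_def Let_def cls_def)

lemma hom_cls: "hom cat X Y = {cls s |s. mtyp G s X Y}"
  by (auto simp: presented_lin_moncat_def Let_def quotient_def cls_def)

lemma cls_in_hom [simp]: "cls s \<in> hom cat X Y \<longleftrightarrow> mtyp G s X Y"
proof
  assume "cls s \<in> hom cat X Y"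
  then obtain t where t: "cls t = cls s" "mtyp G t X Y" by (auto simp: hom_cls)
  show "mtyp G s X Y" using mcong_typ[OF cls_eqD[OF t]] t(2) by blast
qed (auto simp: hom_cls)

lemma hom_obtain: assumes "f \<in> hom cat X Y" obtains s where "f = cls s" "mtyp G s X Y"
  using assms by (auto simp: hom_cls)

lemma cls_untyped: "(\<And>X Y. \<not> mtyp G s X Y) \<Longrightarrow> cls s = {}"
  unfolding cls_def using mcong_typed[of s] by blast

lemma cls_empty: "cls s = {} \<Longrightarrow> \<not> mtyp G s X Y"
  using self_in_cls[of s X Y] by auto

lemma cls_in: "s' \<in> cls s \<Longrightarrow> cls s' = cls s"
  by (simp add: in_cls cls_eq)

lemma cls_eqI:
  assumes "\<And>X Y. mtyp G s X Y \<Longrightarrow> (s, t) \<in> mcong G R"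
    and "\<And>X Y. mtyp G t X Y \<Longrightarrow> \<exists>X' Y'. mtyp G s X' Y'"
  shows "cls s = cls t"
proof (cases "\<exists>X Y. mtyp G s X Y")
  case True then show ?thesis using assms(1) cls_eq by blast
next
  case False
  then have "cls s = {}" "cls t = {}" using assms(2) by (auto intro!: cls_untyped)
  then show ?thesis by simp
qed

lemma
  shows cls_cong_comp: "cls s = cls s' \<Longrightarrow> cls t = cls t' \<Longrightarrow> cls (s \<odot> t) = cls (s' \<odot> t')"
    and cls_cong_add: "cls s = cls s' \<Longrightarrow> cls t = cls t' \<Longrightarrow> cls (MAdd s t) = cls (MAdd s' t')"
    and cls_cong_tens: "cls s = cls s' \<Longrightarrow> cls t = cls t' \<Longrightarrow> cls (s \<boxtimes> t) = cls (s' \<boxtimes> t')"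
    and cls_cong_scale: "cls s = cls s' \<Longrightarrow> cls (MScale a s) = cls (MScale a s')"
proof -
  have tps: "mtyp G s X Y \<longleftrightarrow> mtyp G s' X Y" if "cls s = cls s'" for s s' X Y
    using cls_eqD[OF that] cls_eqD[OF that[symmetric]] mcong_typ by blast
  show "cls (s \<odot> t) = cls (s' \<odot> t')" if e: "cls s = cls s'" "cls t = cls t'"
  proof (rule cls_eqI)
    fix X Z assume "mtyp G (s \<odot> t) X Z"
    then obtain Y where st: "mtyp G s Y Z" "mtyp G t X Y" by (auto simp: mtyp_simps)
    show "(s \<odot> t, s' \<odot> t') \<in> mcong G R"
      by (rule mcong.cong_comp[OF cls_eqD[OF e(1) st(1)] cls_eqD[OF e(2) st(2)] st])
  qed (auto simp: mtyp_simps tps[OF e(1)] tps[OF e(2)])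
  show "cls (s \<boxtimes> t) = cls (s' \<boxtimes> t')" if e: "cls s = cls s'" "cls t = cls t'"
  proof (rule cls_eqI)
    fix X Z assume "mtyp G (s \<boxtimes> t) X Z"
    then obtain Y Y' V V' where st: "mtyp G s Y Y'" "mtyp G t V V'" by (auto simp: mtyp_simps)
    show "(s \<boxtimes> t, s' \<boxtimes> t') \<in> mcong G R"
      by (rule mcong.cong_tens[OF cls_eqD[OF e(1) st(1)] cls_eqD[OF e(2) st(2)]])
  qed (auto simp: mtyp_simps tps[OF e(1)] tps[OF e(2)])
  show "cls (MAdd s t) = cls (MAdd s' t')" if e: "cls s = cls s'" "cls t = cls t'"
  proof (rule cls_eqI)
    fix X Y assume "mtyp G (MAdd s t) X Y"
    then have st: "mtyp G s X Y" "mtyp G t X Y" by (auto simp: mtyp_simps)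
    show "(MAdd s t, MAdd s' t') \<in> mcong G R"
      by (rule mcong.cong_add[OF cls_eqD[OF e(1) st(1)] cls_eqD[OF e(2) st(2)] st])
  qed (auto simp: mtyp_simps tps[OF e(1)] tps[OF e(2)])
  show "cls (MScale a s) = cls (MScale a s')" if e: "cls s = cls s'"
  proof (rule cls_eqI)
    fix X Y assume "mtyp G (MScale a s) X Y"
    then have s: "mtyp G s X Y" by (auto simp: mtyp_simps)
    show "(MScale a s, MScale a s') \<in> mcong G R"
      by (rule mcong.cong_scale[OF cls_eqD[OF e s]])
  qed (auto simp: mtyp_simps tps[OF e])
qed

lemma cmp_cls: "cmp cat (cls s) (cls t) = cls (s \<odot> t)"
proof (cases "cls s = {} \<or> cls t = {}")
  case True
  then have "cls (s \<odot> t) = {}"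
    by (intro cls_untyped) (use cls_empty in \<open>auto simp: mtyp_simps\<close>)
  with True show ?thesis by (auto simp: cmp_union)
next
  case False
  have "cls (s' \<odot> t') = cls (s \<odot> t)" if "s' \<in> cls s" "t' \<in> cls t" for s' t'
    using that by (intro cls_cong_comp) (auto simp: cls_in)
  with False show ?thesis unfolding cmp_union by blast
qed

lemma add_cls: "add_mor cat (cls s) (cls t) = cls (MAdd s t)"
proof (cases "cls s = {} \<or> cls t = {}")
  case True
  then have "cls (MAdd s t) = {}"
    by (intro cls_untyped) (use cls_empty in \<open>auto simp: mtyp_simps\<close>)
  with True show ?thesis by (auto simp: add_union)
next
  case False
  have "cls (MAdd s' t') = cls (MAdd s t)" if "s' \<in> cls s" "t' \<in> cls t" for s' t'
    using that by (intro cls_cong_add) (auto simp: cls_in)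
  with False show ?thesis unfolding add_union by blast
qed

lemma tens_cls: "tens_mor cat (cls s) (cls t) = cls (s \<boxtimes> t)"
proof (cases "cls s = {} \<or> cls t = {}")
  case True
  then have "cls (s \<boxtimes> t) = {}"
    by (intro cls_untyped) (use cls_empty in \<open>auto simp: mtyp_simps\<close>)
  with True show ?thesis by (auto simp: tens_union)
next
  case False
  have "cls (s' \<boxtimes> t') = cls (s \<boxtimes> t)" if "s' \<in> cls s" "t' \<in> cls t" for s' t'
    using that by (intro cls_cong_tens) (auto simp: cls_in)
  with False show ?thesis unfolding tens_union by blast
qed

lemma scale_cls: "scale_mor cat a (cls s) = cls (MScale a s)"
proof (cases "cls s = {}")
  case True
  then have "cls (MScale a s) = {}"
    by (intro cls_untyped) (use cls_empty in \<open>auto simp: mtyp_simps\<close>)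
  with True show ?thesis by (auto simp: scale_union)
next
  case False
  have "cls (MScale a s') = cls (MScale a s)" if "s' \<in> cls s" for s'
    using that by (intro cls_cong_scale) (auto simp: cls_in)
  with False show ?thesis unfolding scale_union by blast
qed

lemma linear_monoidal_category_cat: "linear_monoidal_category cat"
proof
  fix X Y f assume f: "f \<in> hom cat X Y"
  then obtain s where s: "f = cls s" "mtyp G s X Y" by (rule hom_obtain)
  show "\<exists>g \<in> hom cat X Y. add_mor cat f g = zero_mor cat X Y"
  proof (rule bexI)
    show "add_mor cat f (cls (MScale (- 1) s)) = zero_mor cat X Y"
      unfolding s(1) add_cls zero_cls
      by (rule cls_eq[OF mcong.add_minus[OF s(2)]])
  qed (simp add: s mtyp_simps)
next
  fix X Y show "tens_mor cat (ident cat X) (ident cat Y) = ident cat (tens_ob cat X Y)"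
    by (simp add: ident_cls tens_ob_cat tens_cls
        cls_eq[OF mcong.tens_ident])
next
  show "tens_ob cat (tens_ob cat X Y) Z = tens_ob cat X (tens_ob cat Y Z)"
    "tens_ob cat (unit_ob cat) X = X" "tens_ob cat X (unit_ob cat) = X" for X Y Z
    by (simp_all add: tens_ob_cat unit_ob_cat)
qed (((elim hom_obtain)?, hypsubst?,
    (simp only: cls_in_hom ident_cls zero_cls unit_ob_cat tens_ob_cat
      cmp_cls add_cls tens_cls scale_cls),
    (((rule mtyp.intros)+; assumption) |
     (rule cls_eq, rule mcong.id_left mcong.id_right mcong.comp_assoc
      mcong.add_assoc mcong.add_commute mcong.add_zero mcong.scale_add_right mcong.scale_add_left
      mcong.scale_scale mcong.scale_one mcong.comp_add_left mcong.comp_add_right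
      mcong.comp_scale_left mcong.comp_scale_right mcong.tens_assoc mcong.tens_unit_left
      mcong.tens_unit_right mcong.tens_comp mcong.tens_add_left mcong.tens_add_right
      mcong.tens_scale_left mcong.tens_scale_right; assumption)))+)

end

section \<open>Braiding, cup and cap operators\<close>

text \<open>
  Left composition with a generator is an operator on morphisms; since the target of a morphism is
  determined by the morphism, the operators \<open>S i\<close>, \<open>Si i\<close> (crossing the strands at positions \<open>i\<close> and
  \<open>i + 1\<close>, counted from \<open>0\<close>), \<open>U\<close> (cup) and \<open>K\<close> (cap) need no index for the number of strands.  An operator
  applied where it makes no sense gives \<open>bot\<close>, which makes many of the laws unconditional.
\<close>

locale strand_operators =
  fixes st :: "'m \<Rightarrow> (nat \<times> 's) option" and bot :: 'm
    and S Si :: "nat \<Rightarrow> 'm \<Rightarrow> 'm" and U K :: "'m \<Rightarrow> 'm"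
    and sc :: "'k::{comm_ring,comm_monoid_mult} \<Rightarrow> 'm \<Rightarrow> 'm"
    and q qi t ti \<delta> :: 'k
  assumes st_bot: "st bot = None"
    and sc_bot [simp]: "sc a bot = bot"
    and S_out: "(\<And>n s. st x = Some (n, s) \<Longrightarrow> n \<le> Suc i) \<Longrightarrow> S i x = bot"
    and Si_out: "(\<And>n s. st x = Some (n, s) \<Longrightarrow> n \<le> Suc i) \<Longrightarrow> Si i x = bot"
    and U_out: "st x = None \<Longrightarrow> U x = bot"
    and K_out: "(\<And>n s. st x = Some (n, s) \<Longrightarrow> n \<le> 1) \<Longrightarrow> K x = bot"
    and S_in: "st x = Some (n, s) \<Longrightarrow> Suc i < n \<Longrightarrow> st (S i x) = Some (n, s)"
    and Si_in: "st x = Some (n, s) \<Longrightarrow> Suc i < n \<Longrightarrow> st (Si i x) = Some (n, s)"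
    and U_in: "st x = Some (n, s) \<Longrightarrow> st (U x) = Some (Suc (Suc n), s)"
    and K_in: "st x = Some (n, s) \<Longrightarrow> 2 \<le> n \<Longrightarrow> st (K x) = Some (n - 2, s)"
    and sc_in: "st x = Some (n, s) \<Longrightarrow> st (sc a x) = Some (n, s)"
    and S_Si': "st x = Some (n, s) \<Longrightarrow> Suc i < n \<Longrightarrow> S i (Si i x) = x"
    and Si_S': "st x = Some (n, s) \<Longrightarrow> Suc i < n \<Longrightarrow> Si i (S i x) = x"
    and S_sc': "st x = Some (n, s) \<Longrightarrow> Suc i < n \<Longrightarrow> S i (sc a x) = sc a (S i x)"
    and U_sc': "st x = Some (n, s) \<Longrightarrow> U (sc a x) = sc a (U x)"
    and K_sc': "st x = Some (n, s) \<Longrightarrow> 2 \<le> n \<Longrightarrow> K (sc a x) = sc a (K x)"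
    and sc_sc': "st x = Some (n, s) \<Longrightarrow> sc a (sc b x) = sc (a * b) x"
    and sc_1': "st x = Some (n, s) \<Longrightarrow> sc 1 x = x"
    and braid: "st x = Some (n, s) \<Longrightarrow> Suc (Suc i) < n
      \<Longrightarrow> S i (S (Suc i) (S i x)) = S (Suc i) (S i (S (Suc i) x))"
    and far: "st x = Some (n, s) \<Longrightarrow> Suc j < n \<Longrightarrow> Suc i < j \<Longrightarrow> S i (S j x) = S j (S i x)"
    and US: "st x = Some (n, s) \<Longrightarrow> Suc i < n \<Longrightarrow> U (S i x) = S (Suc (Suc i)) (U x)"
    and KS: "st x = Some (n, s) \<Longrightarrow> Suc (Suc (Suc i)) < n \<Longrightarrow> K (S (Suc (Suc i)) x) = S i (K x)"
    and KU: "st x = Some (n, s) \<Longrightarrow> K (U x) = sc \<delta> x"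
    and KS0: "st x = Some (n, s) \<Longrightarrow> 2 \<le> n \<Longrightarrow> K (S 0 x) = sc q (K x)"
    and S0U: "st x = Some (n, s) \<Longrightarrow> S 0 (U x) = sc q (U x)"
    and KSU: "st x = Some (n, s) \<Longrightarrow> 1 \<le> n \<Longrightarrow> K (S 1 (U x)) = sc t x"
    and qqi: "q * qi = 1" and tti: "t * ti = 1"
begin

text \<open>\<open>has 0 x\<close> is not vacuous: it says that \<open>st x\<close> is
  defined.\<close>

definition has :: "nat \<Rightarrow> 'm \<Rightarrow> bool" where
  "has k x \<longleftrightarrow> (case st x of None \<Rightarrow> False | Some (n, s) \<Rightarrow> k \<le> n)"

lemma hasE: assumes "has k x" obtains n s where "st x = Some (n, s)" "k \<le> n"
  using assms by (auto simp: has_def split: option.splits)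

lemma outs:
  "\<not> has (Suc (Suc i)) x \<Longrightarrow> S i x = bot" "\<not> has (Suc (Suc i)) x \<Longrightarrow> Si i x = bot"
  "\<not> has 0 x \<Longrightarrow> U x = bot" "\<not> has 2 x \<Longrightarrow> K x = bot"
  by (auto simp: has_def split: option.splits intro!: S_out Si_out U_out K_out)

lemma bots [simp]: "S i bot = bot" "Si i bot = bot" "U bot = bot" "K bot = bot"
  by (simp_all add: outs has_def st_bot)

lemma st_simps:
  "st (S i x) = (case st x of None \<Rightarrow> None | Some (n, s) \<Rightarrow> if Suc i < n then Some (n, s) else None)"
  "st (Si i x) = (case st x of None \<Rightarrow> None | Some (n, s) \<Rightarrow> if Suc i < n then Some (n, s) else None)"
  "st (U x) = (case st x of None \<Rightarrow> None | Some (n, s) \<Rightarrow> Some (Suc (Suc n), s))"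
  "st (K x) = (case st x of None \<Rightarrow> None | Some (n, s) \<Rightarrow> if 2 \<le> n then Some (n - 2, s) else None)"
  by (auto simp: S_in Si_in U_in K_in outs has_def st_bot split: option.splits)

lemma st_sc: "st x \<noteq> None \<Longrightarrow> st (sc a x) = st x"
  by (auto simp: sc_in)

lemma S_Si: "has (Suc (Suc i)) x \<Longrightarrow> S i (Si i x) = x"
  and Si_S: "has (Suc (Suc i)) x \<Longrightarrow> Si i (S i x) = x"
  and S_sc: "has (Suc (Suc i)) x \<Longrightarrow> S i (sc a x) = sc a (S i x)"
  and U_sc: "has 0 x \<Longrightarrow> U (sc a x) = sc a (U x)"
  and K_sc: "has 2 x \<Longrightarrow> K (sc a x) = sc a (K x)"
  and sc_sc: "has 0 x \<Longrightarrow> sc a (sc b x) = sc (a * b) x"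
  and sc_1: "has 0 x \<Longrightarrow> sc 1 x = x"
  by (auto elim!: hasE intro: S_Si' Si_S' S_sc' U_sc' K_sc' sc_sc' sc_1')

lemma has_simps:
  "has k (S i x) \<longleftrightarrow> has k x \<and> has (Suc (Suc i)) x" "has k (Si i x) \<longleftrightarrow> has k x \<and> has (Suc (Suc i)) x"
  "has k (U x) \<longleftrightarrow> has (k - 2) x" "has k (K x) \<longleftrightarrow> has (Suc (Suc k)) x" "has 0 x \<Longrightarrow> has k (sc a x) \<longleftrightarrow> has k x"
  "\<not> has k bot"
  by (auto simp: has_def st_simps st_sc st_bot split: option.splits)

lemma has_mono: "has k x \<Longrightarrow> l \<le> k \<Longrightarrow> has l x"
  by (auto simp: has_def split: option.splits)

lemma has1E: assumes "has 1 x" obtains n s where "st x = Some (Suc n, s)"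
  using assms by (elim hasE) (metis Suc_le_D One_nat_def)

lemma has2E: assumes "has 2 x" obtains n s where "st x = Some (Suc (Suc n), s)"
  using assms by (elim hasE) (metis Suc_le_D Suc_le_mono numeral_2_eq_2)

lemmas ev = has_def st_simps st_sc

lemmas inv = S_Si Si_S

lemma qiq: "qi * q = 1" and tit: "ti * t = 1"
  using qqi tti by (simp_all add: mult.commute)

section \<open>Relations that involve inverse crossings\<close>

lemma Si_sc: assumes "has (Suc (Suc i)) x" shows "Si i (sc a x) = sc a (Si i x)"
proof -
  obtain n s where [simp]: "st x = Some (n, s)" "Suc i < n" "Suc (Suc i) \<le> n" using assms by (auto elim!: hasE)
  have "Si i (S i (sc a (Si i x))) = sc a (Si i x)" by (rule Si_S) (simp add: ev)
  moreover have "S i (sc a (Si i x)) = sc a x" by (simp add: ev inv S_sc)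
  ultimately show ?thesis by simp
qed

text \<open>Out of range both sides are \<open>bot\<close>, which turns the braid relation into an
  equation for all \<open>x\<close>; the same case split recurs below.\<close>

lemma S_braid: "S i (S (Suc i) (S i x)) = S (Suc i) (S i (S (Suc i) x))"
proof (cases "has (Suc (Suc (Suc i))) x")
  case True then show ?thesis by (auto elim!: hasE intro: braid)
next
  case False
  then show ?thesis by (cases "st x"; cases "has (Suc (Suc i)) x") (auto simp: outs ev)
qed

text \<open>Cancels \<open>S (Suc i)\<close> from the braid relation at \<open>Si i x\<close>. The
  other mixed forms arise in the same way from a braid relation at a suitable argument.\<close>

lemma braid3: "S i (S (Suc i) (Si i x)) = Si (Suc i) (S i (S (Suc i) x))"
proof (cases "has (Suc (Suc (Suc i))) x")
  case True
  then obtain n s where [simp]: "st x = Some (n, s)" "Suc (Suc i) < n" "Suc i < n"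
      "Suc (Suc (Suc i)) \<le> n" "Suc (Suc i) \<le> n" by (auto elim!: hasE)
  have "Si (Suc i) (S (Suc i) (S i (S (Suc i) (Si i x)))) = S i (S (Suc i) (Si i x))" by (rule Si_S) (simp add: ev)
  moreover have "S (Suc i) (S i (S (Suc i) (Si i x))) = S i (S (Suc i) x)" using S_braid[of i "Si i x"] by (simp add: ev inv)
  ultimately show ?thesis by simp
next
  case False
  then show ?thesis by (cases "st x"; cases "has (Suc (Suc i)) x") (auto simp: outs ev)
qed

lemma braid4: "Si i (S (Suc i) (S i x)) = S (Suc i) (S i (Si (Suc i) x))"
proof (cases "has (Suc (Suc (Suc i))) x")
  case True
  then obtain n s where [simp]: "st x = Some (n, s)" "Suc (Suc i) < n" "Suc i < n"
      "Suc (Suc (Suc i)) \<le> n" "Suc (Suc i) \<le> n" by (auto elim!: hasE)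
  have "Si i (S i (S (Suc i) (S i (Si (Suc i) x)))) = S (Suc i) (S i (Si (Suc i) x))" by (rule Si_S) (simp add: ev)
  moreover have "S i (S (Suc i) (S i (Si (Suc i) x))) = S (Suc i) (S i x)" using S_braid[of i "Si (Suc i) x"] by (simp add: ev inv)
  ultimately show ?thesis by simp
next
  case False
  then show ?thesis by (cases "st x"; cases "has (Suc (Suc i)) x") (auto simp: outs ev)
qed

text \<open>Both sides are inverse to the same braid word: it is applied to the right-hand side and
  rewritten by \<open>S_braid\<close>.\<close>

lemma Si_braid: "Si i (Si (Suc i) (Si i x)) = Si (Suc i) (Si i (Si (Suc i) x))"
proof (cases "has (Suc (Suc (Suc i))) x")
  case True
  then obtain n s where [simp]: "st x = Some (n, s)" "Suc (Suc i) < n" "Suc i < n"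
      "Suc (Suc (Suc i)) \<le> n" "Suc (Suc i) \<le> n" by (auto elim!: hasE)
  let ?y = "Si (Suc i) (Si i (Si (Suc i) x))"
  have "Si i (Si (Suc i) (Si i (S i (S (Suc i) (S i ?y))))) = ?y" by (simp add: ev inv)
  moreover have "S i (S (Suc i) (S i ?y)) = x" unfolding S_braid by (simp add: ev inv)
  ultimately show ?thesis by simp
next
  case False
  then show ?thesis by (cases "st x"; cases "has (Suc (Suc i)) x") (auto simp: outs ev)
qed

lemma braid5: "S i (Si (Suc i) (Si i x)) = Si (Suc i) (Si i (S (Suc i) x))"
proof (cases "has (Suc (Suc (Suc i))) x")
  case True
  then obtain n s where [simp]: "st x = Some (n, s)" "Suc (Suc i) < n" "Suc i < n"
      "Suc (Suc (Suc i)) \<le> n" "Suc (Suc i) \<le> n" by (auto elim!: hasE)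
  have "S i (Si i (Si (Suc i) (Si i (S (Suc i) x)))) = Si (Suc i) (Si i (S (Suc i) x))" by (rule S_Si) (simp add: ev)
  moreover have "Si i (Si (Suc i) (Si i (S (Suc i) x))) = Si (Suc i) (Si i x)" using Si_braid[of i "S (Suc i) x"] by (simp add: ev inv)
  ultimately show ?thesis by simp
next
  case False
  then show ?thesis by (cases "st x"; cases "has (Suc (Suc i)) x") (auto simp: outs ev)
qed

lemma braid6: "Si i (Si (Suc i) (S i x)) = S (Suc i) (Si i (Si (Suc i) x))"
proof (cases "has (Suc (Suc (Suc i))) x")
  case True
  then obtain n s where [simp]: "st x = Some (n, s)" "Suc (Suc i) < n" "Suc i < n"
      "Suc (Suc (Suc i)) \<le> n" "Suc (Suc i) \<le> n" by (auto elim!: hasE)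
  have "S (Suc i) (Si (Suc i) (Si i (Si (Suc i) (S i x)))) = Si i (Si (Suc i) (S i x))" by (rule S_Si) (simp add: ev)
  moreover have "Si (Suc i) (Si i (Si (Suc i) (S i x))) = Si i (Si (Suc i) x)" using Si_braid[of i "S i x"] by (simp add: ev inv)
  ultimately show ?thesis by simp
next
  case False
  then show ?thesis by (cases "st x"; cases "has (Suc (Suc i)) x") (auto simp: outs ev)
qed

lemma far_S: assumes "Suc i < j" shows "S i (S j x) = S j (S i x)"
proof (cases "has (Suc (Suc j)) x")
  case True then show ?thesis using assms by (auto elim!: hasE intro: far)
next
  case False then show ?thesis using assms
    by (cases "st x"; cases "has (Suc (Suc i)) x") (auto simp: outs ev)
qed

lemma far_S_Si: assumes ij: "Suc i < j" shows "S i (Si j x) = Si j (S i x)"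
proof (cases "has (Suc (Suc j)) x")
  case True
  then obtain n s where [simp]: "st x = Some (n, s)" "Suc j < n" "Suc i < n" "Suc (Suc j) \<le> n" "Suc (Suc i) \<le> n"
    using ij by (auto elim!: hasE)
  have "Si j (S j (S i (Si j x))) = S i (Si j x)" by (rule Si_S) (simp add: ev)
  moreover have "S j (S i (Si j x)) = S i x" using far_S[OF ij, of "Si j x"] by (simp add: ev inv)
  ultimately show ?thesis by simp
next
  case False then show ?thesis using ij
    by (cases "st x"; cases "has (Suc (Suc i)) x") (auto simp: outs ev)
qed

lemma far_Si_S: assumes ij: "Suc i < j" shows "Si i (S j x) = S j (Si i x)"
proof (cases "has (Suc (Suc j)) x")
  case True
  then obtain n s where [simp]: "st x = Some (n, s)" "Suc j < n" "Suc i < n" "Suc (Suc j) \<le> n" "Suc (Suc i) \<le> n"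
    using ij by (auto elim!: hasE)
  have "Si i (S i (S j (Si i x))) = S j (Si i x)" by (rule Si_S) (simp add: ev)
  moreover have "S i (S j (Si i x)) = S j x" using far_S[OF ij, of "Si i x"] by (simp add: ev inv)
  ultimately show ?thesis by simp
next
  case False then show ?thesis using ij
    by (cases "st x"; cases "has (Suc (Suc i)) x") (auto simp: outs ev)
qed

lemma far_Si: assumes ij: "Suc i < j" shows "Si i (Si j x) = Si j (Si i x)"
proof (cases "has (Suc (Suc j)) x")
  case True
  then obtain n s where [simp]: "st x = Some (n, s)" "Suc j < n" "Suc i < n" "Suc (Suc j) \<le> n" "Suc (Suc i) \<le> n"
    using ij by (auto elim!: hasE)
  have "Si j (S j (Si i (Si j x))) = Si i (Si j x)" by (rule Si_S) (simp add: ev)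
  moreover have "S j (Si i (Si j x)) = Si i x" using far_Si_S[OF ij, of "Si j x"] by (simp add: ev inv)
  ultimately show ?thesis by simp
next
  case False then show ?thesis using ij
    by (cases "st x"; cases "has (Suc (Suc i)) x") (auto simp: outs ev)
qed

lemma U_S: "U (S i x) = S (Suc (Suc i)) (U x)"
proof (cases "has (Suc (Suc i)) x")
  case True then show ?thesis by (auto elim!: hasE intro: US)
next
  case False then show ?thesis by (cases "st x") (auto simp: outs ev)
qed

lemma U_Si: "U (Si i x) = Si (Suc (Suc i)) (U x)"
proof (cases "has (Suc (Suc i)) x")
  case True
  then obtain n s where [simp]: "st x = Some (n, s)" "Suc i < n" "Suc (Suc i) \<le> n" by (auto elim!: hasE)
  have "Si (Suc (Suc i)) (S (Suc (Suc i)) (U (Si i x))) = U (Si i x)" by (rule Si_S) (simp add: ev)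
  then show ?thesis by (simp add: U_S[symmetric] ev inv)
next
  case False then show ?thesis by (cases "st x") (auto simp: outs ev)
qed

lemma K_S: "K (S (Suc (Suc i)) x) = S i (K x)"
proof (cases "has (Suc (Suc (Suc (Suc i)))) x")
  case True then show ?thesis by (auto elim!: hasE intro: KS)
next
  case False then show ?thesis by (cases "st x"; cases "has 2 x") (auto simp: outs ev)
qed

lemma K_Si: "K (Si (Suc (Suc i)) x) = Si i (K x)"
proof (cases "has (Suc (Suc (Suc (Suc i)))) x")
  case True
  then obtain n s where [simp]: "st x = Some (n, s)" "Suc (Suc (Suc i)) < n"
      "Suc (Suc (Suc (Suc i))) \<le> n" by (auto elim!: hasE)
  then have [simp]: "Suc i < n - 2" "Suc (Suc i) \<le> n - 2" "2 \<le> n" by linarith+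
  have "Si i (S i (K (Si (Suc (Suc i)) x))) = K (Si (Suc (Suc i)) x)" by (rule Si_S) (simp add: ev)
  then show ?thesis by (simp add: K_S[symmetric] ev inv)
next
  case False then show ?thesis by (cases "st x"; cases "has 2 x") (auto simp: outs ev)
qed

lemma sc_qi_q: "has 0 x \<Longrightarrow> sc qi (sc q x) = x" and sc_q_qi: "has 0 x \<Longrightarrow> sc q (sc qi x) = x"
  by (simp_all add: sc_sc qiq qqi sc_1)

lemma K_S0: "K (S 0 x) = sc q (K x)"
proof (cases "has 2 x")
  case True then show ?thesis by (auto elim!: hasE intro: KS0)
next
  case False then show ?thesis by (cases "st x") (auto simp: outs ev)
qed

lemma K_Si0: "K (Si 0 x) = sc qi (K x)"
proof (cases "has 2 x")
  case True
  then obtain n s where [simp]: "st x = Some (Suc (Suc n), s)" by (rule has2E)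
  have "sc qi (K x) = sc qi (K (S 0 (Si 0 x)))" by (simp add: ev inv)
  also have "\<dots> = K (Si 0 x)" unfolding K_S0 by (rule sc_qi_q) (simp add: ev)
  finally show ?thesis ..
next
  case False then show ?thesis by (cases "st x") (auto simp: outs ev)
qed

lemma S0_U: "S 0 (U x) = sc q (U x)"
  by (cases "st x") (auto simp: S0U outs ev)

lemma Si0_U: "Si 0 (U x) = sc qi (U x)"
proof (cases "st x")
  case (Some p)
  then obtain n s where [simp]: "st x = Some (n, s)" by (cases p) auto
  have "sc qi (U x) = Si 0 (S 0 (sc qi (U x)))" by (simp add: ev inv)
  also have "S 0 (sc qi (U x)) = U x" by (simp add: S_sc S0_U sc_qi_q ev)
  finally show ?thesis ..
qed (simp add: outs ev)

end

text \<open>Morphisms with the same value of \<open>st\<close> have the same source and target and can be added.\<close>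

locale skein_operators = strand_operators st bot S Si U K sc q qi t ti \<delta>
  for st :: "'m \<Rightarrow> (nat \<times> 's) option" and bot :: 'm
    and S Si :: "nat \<Rightarrow> 'm \<Rightarrow> 'm" and U K :: "'m \<Rightarrow> 'm"
    and sc :: "'k::{comm_ring,comm_monoid_mult} \<Rightarrow> 'm \<Rightarrow> 'm"
    and q qi t ti \<delta> :: 'k +
  fixes ad :: "'m \<Rightarrow> 'm \<Rightarrow> 'm"
  assumes ad_assoc: "ad (ad x y) w = ad x (ad y w)"
    and ad_commute: "ad x y = ad y x"
    and ad_cancel: "\<lbrakk>st w = Some p; st x = Some p; st y = Some p; ad x w = ad y w\<rbrakk> \<Longrightarrow> x = y"
    and ad_in: "st x = Some p \<Longrightarrow> st y = Some p \<Longrightarrow> st (ad x y) = Some p"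
    and sc_plus: "st x = Some p \<Longrightarrow> sc (a + b) x = ad (sc a x) (sc b x)"
    and sc_ad: "st x = Some p \<Longrightarrow> st y = Some p \<Longrightarrow> sc a (ad x y) = ad (sc a x) (sc a y)"
    and S_ad': "\<lbrakk>st x = Some (n, s); st y = Some (n, s); Suc i < n\<rbrakk> \<Longrightarrow> S i (ad x y) = ad (S i x) (S i y)"
    and K_ad': "\<lbrakk>st x = Some (n, s); st y = Some (n, s); 2 \<le> n\<rbrakk> \<Longrightarrow> K (ad x y) = ad (K x) (K y)"
    and skein: "st x = Some (n, s) \<Longrightarrow> Suc i < n \<Longrightarrow> S i x = ad (Si i x) (sc (q - qi) x)"
    and tz: "t = ti + \<delta> * (q - qi)"
begin

abbreviation z where "z \<equiv> q - qi"

lemma ad_left_commute: "ad x (ad y w) = ad y (ad x w)"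
  using ad_assoc ad_commute by metis

lemmas ad_ac = ad_assoc ad_commute ad_left_commute

lemma st_ad: "st x = st y \<Longrightarrow> st y \<noteq> None \<Longrightarrow> st (ad x y) = st y"
  using ad_in by auto

lemma S_ad: "has (Suc (Suc i)) x \<Longrightarrow> st x = st y \<Longrightarrow> S i (ad x y) = ad (S i x) (S i y)"
  and K_ad: "has 2 x \<Longrightarrow> st x = st y \<Longrightarrow> K (ad x y) = ad (K x) (K y)"
  by (auto elim!: hasE intro: S_ad' K_ad')

lemma Si_ad: assumes "has (Suc (Suc i)) x" and "st x = st y" shows "Si i (ad x y) = ad (Si i x) (Si i y)"
proof -
  obtain n s where [simp]: "st x = Some (n, s)" "Suc i < n" "Suc (Suc i) \<le> n" using assms(1) by (auto elim!: hasE)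
  have [simp]: "st y = Some (n, s)" using assms(2) by simp
  have "Si i (ad x y) = Si i (ad (S i (Si i x)) (S i (Si i y)))" by (simp add: ev inv)
  also have "\<dots> = Si i (S i (ad (Si i x) (Si i y)))" by (simp add: ev S_ad)
  also have "\<dots> = ad (Si i x) (Si i y)" by (rule Si_S) (simp add: ev st_ad)
  finally show ?thesis .
qed

lemmas lin = S_ad Si_ad K_ad S_sc Si_sc K_sc

text \<open>Resolving the positive crossing gives
  \<open>t x = K (Si 1 (U x)) + z \<delta> x\<close>, and the parameter relation \<open>tz\<close>
  says that \<open>t - z \<delta>\<close> is \<open>ti\<close>.\<close>

lemma K_Si_U: assumes "has 1 x" shows "K (Si 1 (U x)) = sc ti x"
proof -
  obtain n s where [simp]: "st x = Some (Suc n, s)" using assms by (rule has1E)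
  have "K (S 1 (U x)) = ad (K (Si 1 (U x))) (sc (\<delta> * z) x)"
    by (subst skein[of "U x" "Suc (Suc (Suc n))" s]) (simp_all add: ev lin KU sc_sc mult.commute)
  moreover have "K (S 1 (U x)) = sc t x" by (rule KSU[of x "Suc n" s]) simp_all
  moreover have "sc t x = ad (sc ti x) (sc (\<delta> * z) x)"
    unfolding tz by (rule sc_plus[of x "(Suc n, s)"]) simp
  ultimately have "ad (K (Si 1 (U x))) (sc (\<delta> * z) x) = ad (sc ti x) (sc (\<delta> * z) x)" by simp
  then show ?thesis by (rule ad_cancel[rotated 3, of _ _ _ "(Suc n, s)"]) (simp_all add: ev)
qed

text \<open>Both sides come from \<open>?A\<close> by making one of its two crossings
  \<open>S 1\<close> negative through the skein relation. The correction terms are the same multiple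
  of \<open>S 0 x\<close>, hence cancel.\<close>

lemma pass_U:
  assumes x: "has 2 x"
  shows "K (Si 1 (Si 0 (S 2 (S 1 (U x))))) = K (S 1 (S 2 (Si 0 (Si 1 (U x)))))" (is "?W = ?Z")
proof -
  obtain m s where [simp]: "st x = Some (Suc (Suc m), s)" using x by (rule has2E)
  let ?n = "Suc (Suc (Suc (Suc m)))"
  let ?A = "K (S 1 (S 2 (Si 0 (S 1 (U x)))))" and ?s = "sc (z * (qi * t)) (S 0 x)"
  have a: "K (S 1 (S 2 (U x))) = sc t (S 0 x)"
    using KSU[of "S 0 x"] by (simp add: U_S[symmetric] numeral_2_eq_2 ev)
  have "?A = ad ?Z (sc z (K (S 1 (S 2 (Si 0 (U x))))))"
    by (subst skein[of "U x" ?n s 1]) (simp_all add: ev lin)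
  also have "K (S 1 (S 2 (Si 0 (U x)))) = sc (qi * t) (S 0 x)"
    by (simp add: Si0_U ev lin a sc_sc del: One_nat_def)
  finally have 1: "?A = ad ?Z ?s" by (simp add: sc_sc ev)
  have "?A = K (S 1 (Si 0 (S 2 (S 1 (U x)))))" by (simp add: far_Si_S)
  \<comment> \<open>Here the crossing next to the cap is resolved, above the one next to the
    cup.\<close>
  also have "\<dots> = ad ?W (sc z (K (Si 0 (S 2 (S 1 (U x))))))"
    by (subst skein[of _ ?n s 1]) (simp_all add: ev lin)
  also have "K (Si 0 (S 2 (S 1 (U x)))) = sc (qi * t) (S 0 x)"
    using K_S[of 0 "S 1 (U x)"] KSU[of x]
    by (simp add: K_Si0 lin sc_sc numeral_2_eq_2 ev)
  finally have 2: "?A = ad ?W ?s" by (simp add: sc_sc ev)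
  show ?thesis
    by (rule ad_cancel[of ?s "(Suc (Suc m), s)"]) (use 1 2 in \<open>simp_all add: ev\<close>)
qed

text \<open>The two sides differ in the signs of the two middle crossings. Once the crossing next to
  the cup has been made positive, resolving the positive middle crossing on either side leads to the
  same term \<open>?B\<close>. All remaining terms can be computed, and they match because
  \<open>q = qi + z\<close>.\<close>

lemma pass_U_mirror:
  assumes x: "has 2 x"
  shows "K (S 1 (S 0 (Si 2 (Si 1 (U x))))) = K (S 1 (S 2 (Si 0 (Si 1 (U x)))))" (is "?W' = ?W")
proof -
  obtain m s where [simp]: "st x = Some (Suc (Suc m), s)" using x by (rule has2E)
  let ?n = "Suc (Suc (Suc (Suc m)))"
  let ?A' = "K (S 1 (S 0 (Si 2 (S 1 (U x)))))" and ?A = "K (S 1 (S 2 (Si 0 (S 1 (U x)))))"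
    and ?B = "K (S 1 (Si 0 (Si 2 (S 1 (U x)))))"
    and ?D1 = "K (S 1 (Si 2 (S 1 (U x))))" and ?D2 = "K (S 1 (Si 0 (S 1 (U x))))"
  have a: "K (S 1 (S 2 (U x))) = sc t (S 0 x)"
    using KSU[of "S 0 x"] by (simp add: U_S[symmetric] numeral_2_eq_2 ev)
  have b: "K (S 1 (Si 2 (U x))) = sc t (Si 0 x)"
    using KSU[of "Si 0 x"] by (simp add: U_Si[symmetric] numeral_2_eq_2 ev)
  have A': "?A' = ad ?W' (sc (z * (q * t)) (Si 0 x))"
  proof -
    have "?A' = ad ?W' (sc z (K (S 1 (S 0 (Si 2 (U x))))))"
      by (subst skein[of "U x" ?n s 1]) (simp_all add: ev lin)
    also have "K (S 1 (S 0 (Si 2 (U x)))) = sc (q * t) (Si 0 x)"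
      by (simp add: far_S_Si S0_U ev lin b sc_sc del: One_nat_def)
    finally show ?thesis by (simp add: sc_sc ev)
  qed
  have A: "?A = ad ?W (sc (z * (qi * t)) (S 0 x))"
  proof -
    have "?A = ad ?W (sc z (K (S 1 (S 2 (Si 0 (U x))))))"
      by (subst skein[of "U x" ?n s 1]) (simp_all add: ev lin)
    also have "K (S 1 (S 2 (Si 0 (U x)))) = sc (qi * t) (S 0 x)"
      by (simp add: Si0_U ev lin a sc_sc del: One_nat_def)
    finally show ?thesis by (simp add: sc_sc ev)
  qed
  \<comment> \<open>The positive middle crossing is \<open>S 0\<close> in \<open>?A'\<close> and
    \<open>S 2\<close> in \<open>?A\<close>; after its resolution both middle crossings are
    negative.\<close>
  have AB': "?A' = ad ?B (sc z ?D1)"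
    by (subst skein[of _ ?n s 0]) (simp_all add: ev lin)
  have AB: "?A = ad ?B (sc z ?D2)"
    by (subst skein[of _ ?n s 2]) (simp_all add: ev lin far_Si[of 0 2])
  have D1: "?D1 = ad (sc ti x) (sc (z * t) (Si 0 x))"
  proof -
    have "?D1 = ad (K (S 1 (Si 2 (Si 1 (U x))))) (sc z (K (S 1 (Si 2 (U x)))))"
      by (subst skein[of "U x" ?n s 1]) (simp_all add: ev lin)
    also have "S 1 (Si 2 (Si 1 (U x))) = Si 2 (Si 1 (S 2 (U x)))"
      using braid5[of 1] by (simp add: numeral_2_eq_2)
    also have "K (Si 2 (Si 1 (S 2 (U x)))) = sc ti x"
      using U_S[of 0 x] K_Si[of 0] K_Si_U[of "S 0 x"] by (simp add: Si_sc numeral_2_eq_2 ev inv)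
    also note b
    finally show ?thesis by (simp add: sc_sc ev)
  qed
  have D2: "?D2 = ad (sc ti x) (sc (z * (qi * t)) x)"
  proof -
    have "?D2 = ad (K (S 1 (Si 0 (Si 1 (U x))))) (sc z (K (S 1 (Si 0 (U x)))))"
      by (subst skein[of "U x" ?n s 1]) (simp_all add: ev lin)
    also have "S 1 (Si 0 (Si 1 (U x))) = Si 0 (Si 1 (S 0 (U x)))"
      using braid6[of 0] by simp
    also have "K (Si 0 (Si 1 (S 0 (U x)))) = sc ti x"
      using K_Si_U[of x] by (simp add: K_Si0 S0_U lin sc_sc sc_1 qiq qqi mult.assoc[symmetric] ev)
    also have "K (S 1 (Si 0 (U x))) = sc (qi * t) x"
      using KSU[of x] by (simp add: Si0_U lin sc_sc ev)
    finally show ?thesis by (simp add: sc_sc ev)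
  qed
  have S0: "S 0 x = ad (Si 0 x) (sc z x)" by (rule skein[of x "Suc (Suc m)" s 0]) auto
  have "z * (q * t) = z * (qi * t) + z * (z * t)" by (simp add: algebra_simps)
  then have qt: "sc (z * (q * t)) (Si 0 x) = ad (sc (z * (qi * t)) (Si 0 x)) (sc (z * (z * t)) (Si 0 x))"
    using sc_plus[of "Si 0 x" "(Suc (Suc m), s)"] by (simp add: ev)
  \<comment> \<open>Both \<open>?A' + z ?D2\<close> and \<open>?A + z ?D1\<close> equal
    \<open>?B + z ?D1 + z ?D2\<close>. They are also \<open>?W'\<close> and \<open>?W\<close> plus
    the common remainder \<open>?T\<close>, which can be cancelled.\<close>
  let ?T = "ad (sc (z * (q * t)) (Si 0 x)) (sc z ?D2)"
  have "ad ?W' ?T = ad ?A' (sc z ?D2)" by (simp only: A' ad_assoc)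
  also have "\<dots> = ad ?A (sc z ?D1)" by (simp only: AB AB' ad_ac)
  also have "\<dots> = ad ?W (ad (sc (z * (qi * t)) (S 0 x)) (sc z ?D1))" by (simp only: A ad_assoc)
  also have "ad (sc (z * (qi * t)) (S 0 x)) (sc z ?D1) = ?T"
    unfolding D1 D2 qt S0
    by (simp add: sc_ad[of _ "(Suc (Suc m), s)"] ev sc_sc ad_ac mult_ac)
  finally show ?thesis
    by (rule ad_cancel[of ?T "(Suc (Suc m), s)", rotated 3]) (simp_all add: ev D2 st_ad)
qed

end

section \<open>Exchange of crossings with inverse crossings\<close>

context skein_operators begin

lemma ad_sc_0: assumes x: "st x = Some p" and y: "st y = Some p" shows "ad y (sc 0 x) = y"
proof -
  obtain n s where p: "p = (n, s)" by (cases p)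
  have "ad (sc 0 x) (sc 0 x) = sc 0 x" using sc_plus[OF x, of 0 0] by simp
  then have "ad (ad y (sc 0 x)) (sc 0 x) = ad y (sc 0 x)" by (simp add: ad_assoc)
  then show ?thesis
    by (rule ad_cancel[of "sc 0 x" p, rotated 3]) (use x y in \<open>auto simp: p sc_in ad_in\<close>)
qed

text \<open>\<open>\<delta>\<close> stays the same because \<open>t - ti\<close> and
  \<open>q - qi\<close> both change sign. Beyond the braid calculus and the skein relation read
  backwards, the only input is \<open>K_Si_U\<close>.\<close>

lemma mirror: "skein_operators st bot Si S U K sc qi q ti t \<delta> ad"
proof
  fix x n s i assume x: "st x = Some (n, s)"
  show "Suc (Suc i) < n \<Longrightarrow> Si i (Si (Suc i) (Si i x)) = Si (Suc i) (Si i (Si (Suc i) x))"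
    by (rule Si_braid)
  show "K (Si 1 (U x)) = sc ti x" if "1 \<le> n"
    using that x by (intro K_Si_U) (simp add: ev)
  show "Si i x = ad (S i x) (sc (qi - q) x)" if i: "Suc i < n"
  proof -
    have "ad (sc (qi - q) x) (sc (q - qi) x) = sc 0 x"
      using sc_plus[OF x, of "qi - q" "q - qi"] by simp
    then have "ad (ad (S i x) (sc (qi - q) x)) (sc (q - qi) x) = S i x"
      using ad_sc_0[OF x S_in[OF x i]] by (simp add: ad_assoc)
    also have "\<dots> = ad (Si i x) (sc (q - qi) x)" by (rule skein[OF x i])
    finally have "ad (ad (S i x) (sc (qi - q) x)) (sc (q - qi) x) = ad (Si i x) (sc (q - qi) x)" .
    then have "ad (S i x) (sc (qi - q) x) = Si i x"
      by (rule ad_cancel[of "sc (q - qi) x" "(n, s)", rotated 3]) (use x i in \<open>simp_all add: ev ad_in\<close>)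
    then show ?thesis by (rule HOL.sym)
  qed
  show "Suc j < n \<Longrightarrow> Suc i < j \<Longrightarrow> Si i (Si j x) = Si j (Si i x)" for j by (rule far_Si)
  show "K (Si (Suc (Suc i)) x) = Si i (K x)" by (rule K_Si)
  show "U (Si i x) = Si (Suc (Suc i)) (U x)" by (rule U_Si)
  show "K (Si 0 x) = sc qi (K x)" by (rule K_Si0)
  show "Si 0 (U x) = sc qi (U x)" by (rule Si0_U)
  show "Si i (ad x y) = ad (Si i x) (Si i y)" if "st y = Some (n, s)" "Suc i < n" for y
    using that x by (intro Si_ad) (auto simp: ev)
  show "Suc i < n \<Longrightarrow> Si i (sc a x) = sc a (Si i x)" for a
    using x by (intro Si_sc) (auto simp: ev)
next
  show "ti = t + \<delta> * (qi - q)" unfolding tz by (simp add: algebra_simps)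
  show "qi * q = 1" "ti * t = 1" by (simp_all add: qiq tit)
qed ((rule st_bot sc_bot Si_in S_in U_in K_in sc_in S_Si' Si_S' U_sc' K_sc' sc_sc' sc_1' KU Si_out S_out U_out
    K_out ad_assoc ad_commute ad_cancel ad_in sc_plus sc_ad K_ad'; assumption?)+)

text \<open>The hypothesis says that \<open>S 2\<close> and \<open>S 0\<close> agree on
  \<open>S 1 ?y\<close>. They also agree on \<open>?y\<close>, where both are \<open>q\<close>. By
  the skein relation they agree on \<open>Si 1 ?y\<close>, which is the mirrored statement.\<close>

lemma UU_mirror:
  assumes x: "st x = Some (n, s)" and UU: "Si 1 (Si 0 (S 2 (S 1 (U (U x))))) = U (U x)"
  shows "S 1 (S 0 (Si 2 (Si 1 (U (U x))))) = U (U x)"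
proof -
  let ?y = "U (U x)" and ?n = "Suc (Suc (Suc (Suc n)))"
  note [simp] = x
  have "S 0 (S 1 (Si 1 (Si 0 (S 2 (S 1 ?y))))) = S 2 (S 1 ?y)" by (simp add: ev inv)
  then have e: "S 2 (S 1 ?y) = S 0 (S 1 ?y)" by (simp only: UU)
  have S2: "S 2 ?y = S 0 ?y"
    using U_S[of 0 "U x"] by (simp add: S0_U numeral_2_eq_2 U_sc ev)
  have sk: "S 1 ?y = ad (Si 1 ?y) (sc z ?y)" by (rule skein[of _ ?n s]) (simp_all add: ev)
  have "ad (S 2 (Si 1 ?y)) (sc z (S 0 ?y)) = S 2 (S 1 ?y)"
    unfolding sk by (simp add: ev lin S2)
  also have "\<dots> = ad (S 0 (Si 1 ?y)) (sc z (S 0 ?y))"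
    unfolding e unfolding sk by (simp add: ev lin)
  finally have "S 2 (Si 1 ?y) = S 0 (Si 1 ?y)"
    by (rule ad_cancel[of "sc z (S 0 ?y)" "(?n, s)", rotated 3]) (simp_all add: ev)
  then have "Si 2 (S 2 (Si 1 ?y)) = S 0 (Si 2 (Si 1 ?y))" by (simp add: far_S_Si)
  then have "S 0 (Si 2 (Si 1 ?y)) = Si 1 ?y" by (simp add: ev inv)
  then show ?thesis by (simp add: ev inv)
qed

text \<open>Dual to \<open>UU_mirror\<close>. Since the caps are applied last, the relation must be
  at hand for every \<open>y\<close> with as many strands as \<open>x\<close>, not only for
  \<open>x\<close>.\<close>

lemma KK_mirror:
  assumes x: "st x = Some (Suc (Suc (Suc (Suc n))), s)"
    and KK: "\<And>y. st y = Some (Suc (Suc (Suc (Suc n))), s) \<Longrightarrow> K (K (Si 1 (Si 2 (S 0 (S 1 y))))) = K (K y)"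
  shows "K (K (S 1 (S 2 (Si 0 (Si 1 x))))) = K (K x)"
proof -
  let ?n = "Suc (Suc (Suc (Suc n)))"
  \<comment> \<open>At \<open>Si 1 (Si 0 y)\<close> the positive crossings of the hypothesis
    cancel.\<close>
  have i: "K (K (Si 1 (Si 2 y))) = K (K (Si 1 (Si 0 y)))" if [simp]: "st y = Some (?n, s)" for y
    using KK[of "Si 1 (Si 0 y)"] by (simp add: ev inv)
  have two: "K (K (Si 2 y)) = K (K (Si 0 y))" if [simp]: "st y = Some (?n, s)" for y
    using K_Si[of 0 y] by (simp add: K_Si0 numeral_2_eq_2 ev lin)
  have j: "K (K (S 1 (Si 2 y))) = K (K (S 1 (Si 0 y)))" if [simp]: "st y = Some (?n, s)" for y
  proof -
    have "K (K (S 1 (Si 2 y))) = ad (K (K (Si 1 (Si 2 y)))) (sc z (K (K (Si 2 y))))"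
      by (subst skein[of _ ?n s]) (simp_all add: ev lin)
    also have "\<dots> = ad (K (K (Si 1 (Si 0 y)))) (sc z (K (K (Si 0 y))))"
      by (simp only: i[OF that] two[OF that])
    also have "\<dots> = K (K (S 1 (Si 0 y)))"
      by (subst skein[of "Si 0 y" ?n s]) (simp_all add: ev lin)
    finally show ?thesis .
  qed
  have [simp]: "st x = Some (?n, s)" by (rule x)
  define u where "u = Si 0 (Si 1 x)"
  have [simp]: "st u = Some (?n, s)" by (simp add: u_def ev)
  have "Si 2 (S 0 (S 2 u)) = S 0 u" "Si 0 (S 0 (S 2 u)) = S 2 u"
    by (simp add: far_S[of 0 2 u] ev inv, simp add: ev inv)
  then have "K (K (S 1 (S 2 u))) = K (K (S 1 (S 0 u)))"
    using j[of "S 0 (S 2 u)"] by (simp add: ev)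
  then show ?thesis by (simp add: u_def ev inv)
qed

end

section \<open>Cups and caps at arbitrary positions\<close>

text \<open>
  The cup \<open>U\<close> is created on the left; \<open>pass_cup r\<close> then moves the \<open>r\<close> strands on its right across it to the
  left, and dually for \<open>pass_cap\<close>.  Exchanging the two families of crossings gives the other variant.
\<close>

primrec pass_cup :: "(nat \<Rightarrow> 'm \<Rightarrow> 'm) \<Rightarrow> (nat \<Rightarrow> 'm \<Rightarrow> 'm) \<Rightarrow> ('m \<Rightarrow> 'm) \<Rightarrow> nat \<Rightarrow> 'm \<Rightarrow> 'm" where
  "pass_cup S Si U 0 x = U x"
| "pass_cup S Si U (Suc r) x = Si r (S (Suc r) (pass_cup S Si U r x))"

primrec pass_cap :: "(nat \<Rightarrow> 'm \<Rightarrow> 'm) \<Rightarrow> (nat \<Rightarrow> 'm \<Rightarrow> 'm) \<Rightarrow> ('m \<Rightarrow> 'm) \<Rightarrow> nat \<Rightarrow> 'm \<Rightarrow> 'm" where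
  "pass_cap S Si K 0 x = K x"
| "pass_cap S Si K (Suc r) x = pass_cap S Si K r (Si (Suc r) (S r x))"

text \<open>Sums no longer appear. The relations are listed with all sign patterns so that the
  assumptions are closed under exchange of \<open>S\<close> and \<open>Si\<close>; every statement
  about \<open>C\<close> and \<open>E\<close> then has a counterpart for \<open>Cb\<close> and
  \<open>Eb\<close>.\<close>

locale brauer_operators = strand_operators st bot S Si U K sc q qi t ti \<delta>
  for st :: "'m \<Rightarrow> (nat \<times> 's) option" and bot :: 'm
    and S Si :: "nat \<Rightarrow> 'm \<Rightarrow> 'm" and U K :: "'m \<Rightarrow> 'm"
    and sc :: "'k::{comm_ring,comm_monoid_mult} \<Rightarrow> 'm \<Rightarrow> 'm"
    and q qi t ti \<delta> :: 'k +
  assumes KSiU: "st x = Some (n, s) \<Longrightarrow> 1 \<le> n \<Longrightarrow> K (Si 1 (U x)) = sc ti x"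
    and UU': "st x = Some (n, s) \<Longrightarrow> Si 1 (Si 0 (S 2 (S 1 (U (U x))))) = U (U x)"
    and UUm': "st x = Some (n, s) \<Longrightarrow> S 1 (S 0 (Si 2 (Si 1 (U (U x))))) = U (U x)"
    and KK': "st x = Some (n, s) \<Longrightarrow> 4 \<le> n \<Longrightarrow> K (K (Si 1 (Si 2 (S 0 (S 1 x))))) = K (K x)"
    and KKm': "st x = Some (n, s) \<Longrightarrow> 4 \<le> n \<Longrightarrow> K (K (S 1 (S 2 (Si 0 (Si 1 x))))) = K (K x)"
    and KU1: "st x = Some (n, s) \<Longrightarrow> 2 \<le> n \<Longrightarrow> K (Si 1 (Si 0 (S 2 (S 1 (U x))))) = U (K x)"
    and KU2: "st x = Some (n, s) \<Longrightarrow> 2 \<le> n \<Longrightarrow> K (S 1 (S 0 (Si 2 (Si 1 (U x))))) = U (K x)"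
    and KU3: "st x = Some (n, s) \<Longrightarrow> 2 \<le> n \<Longrightarrow> K (Si 1 (Si 2 (S 0 (S 1 (U x))))) = U (K x)"
    and KU4: "st x = Some (n, s) \<Longrightarrow> 2 \<le> n \<Longrightarrow> K (S 1 (S 2 (Si 0 (Si 1 (U x))))) = U (K x)"
begin

lemma mirror: "brauer_operators st bot Si S U K sc qi q ti t \<delta>"
proof
  fix x n s i assume x: "st x = Some (n, s)"
  show "Suc (Suc i) < n \<Longrightarrow> Si i (Si (Suc i) (Si i x)) = Si (Suc i) (Si i (Si (Suc i) x))"
    by (rule Si_braid)
  show "Suc j < n \<Longrightarrow> Suc i < j \<Longrightarrow> Si i (Si j x) = Si j (Si i x)" for j by (rule far_Si)
  show "K (Si (Suc (Suc i)) x) = Si i (K x)" by (rule K_Si)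
  show "U (Si i x) = Si (Suc (Suc i)) (U x)" by (rule U_Si)
  show "K (Si 0 x) = sc qi (K x)" by (rule K_Si0)
  show "Si 0 (U x) = sc qi (U x)" by (rule Si0_U)
  show "Suc i < n \<Longrightarrow> Si i (sc a x) = sc a (Si i x)" for a
    using x by (intro Si_sc) (auto simp: ev)
next
  show "qi * q = 1" "ti * t = 1" by (simp_all add: qiq tit)
qed ((rule st_bot sc_bot Si_in S_in U_in K_in sc_in S_Si' Si_S' U_sc' K_sc' sc_sc' sc_1' KU Si_out
    S_out U_out K_out KSiU KSU UU' UUm' KK' KKm' KU1 KU2 KU3 KU4; assumption?)+)

abbreviation C where "C \<equiv> pass_cup S Si U"
abbreviation Cb where "Cb \<equiv> pass_cup Si S U"
abbreviation E where "E \<equiv> pass_cap S Si K"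
abbreviation Eb where "Eb \<equiv> pass_cap Si S K"

lemma UU: "Si 1 (Si 0 (S 2 (S 1 (U (U x))))) = U (U x)"
  by (cases "st x") (auto simp: UU'[unfolded One_nat_def] outs ev)

lemma KK: "K (K (Si 1 (Si 2 (S 0 (S 1 x))))) = K (K x)"
proof (cases "has 4 x")
  case True then show ?thesis by (auto elim!: hasE intro: KK'[unfolded One_nat_def])
next
  case False then show ?thesis
    by (cases "st x"; cases "has 2 x"; cases "has 3 x") (auto simp: outs ev)
qed

lemma KU_any:
  "K (Si 1 (Si 0 (S 2 (S 1 (U x))))) = U (K x)"
  "K (Si 1 (Si 2 (S 0 (S 1 (U x))))) = U (K x)"
  by (cases "has 2 x"; cases "st x"; auto elim!: hasE intro: KU1[unfolded One_nat_def] KU3[unfolded One_nat_def] simp: outs ev)+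

lemma st_C: "st (C r x) = (case st x of None \<Rightarrow> None | Some (n, s) \<Rightarrow> if r \<le> n then Some (Suc (Suc n), s) else None)"
  by (induction r) (auto simp: st_simps split: option.splits)

lemma st_E: "st (E r x) = (case st x of None \<Rightarrow> None | Some (n, s) \<Rightarrow> if Suc (Suc r) \<le> n then Some (n - 2, s) else None)"
  by (induction r arbitrary: x) (auto simp: st_simps split: option.splits)

lemma C_bot [simp]: "C r bot = bot" and E_bot [simp]: "E r bot = bot"
proof -
  show "C r bot = bot" by (induction r) auto
  show "E r bot = bot" by (induction r) auto
qed

lemma E_sc: "has (Suc (Suc r)) x \<Longrightarrow> E r (sc a x) = sc a (E r x)"
proof (induction r arbitrary: x)
  case (Suc r)
  then obtain n s where [simp]: "st x = Some (n, s)" "Suc (Suc (Suc r)) \<le> n" "Suc (Suc r) \<le> n"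
     "Suc (Suc r) < n" "Suc r < n"
    by (auto elim!: hasE)
  show ?case by (simp add: S_sc Si_sc ev Suc.IH)
next
  case 0
  then show ?case using K_sc by (simp add: numeral_2_eq_2)
qed

lemma C_S_ge: "r \<le> i \<Longrightarrow> C r (S i x) = S (Suc (Suc i)) (C r x)"
proof (induction r)
  case (Suc r)
  then show ?case using far_S[of "Suc r" "Suc (Suc i)"] by (simp add: far_Si_S)
qed (simp add: U_S)

lemma C_Si_ge: "r \<le> i \<Longrightarrow> C r (Si i x) = Si (Suc (Suc i)) (C r x)"
proof (induction r)
  case (Suc r)
  then show ?case using far_Si[of r "Suc (Suc i)"] by (simp add: far_S_Si)
qed (simp add: U_Si)

text \<open>A crossing of strands that have already passed the cup commutes with the later passages.
  The one real case is the crossing of the last two strands that pass, a consequence of the braid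
  relations. For \<open>Suc i = r\<close> the crossing would straddle the cup.\<close>

lemma C_S_less: "Suc i < r \<Longrightarrow> C r (S i x) = S i (C r x)"
proof (induction r)
  case (Suc r)
  show ?case
  proof (cases "Suc i < r")
    case True
    then show ?thesis using Suc far_S[of i "Suc r"] by (simp add: far_S_Si)
  next
    case False
    then have r: "r = Suc i" using Suc.prems by simp
    let ?a = i and ?b = "Suc i" and ?c = "Suc (Suc i)" and ?y = "C i x"
    \<comment> \<open>Before the last two passages the crossing is still to the right of the cup,
      where it sits two places further, at \<open>?c\<close>.\<close>
    have "C (Suc r) (S i x) = Si ?b (S ?c (Si ?a (S ?b (S ?c ?y))))"
      by (simp add: r C_S_ge)
    also have "\<dots> = Si ?b (Si ?a (S ?c (S ?b (S ?c ?y))))" by (simp add: far_Si_S)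
    also have "\<dots> = Si ?b (Si ?a (S ?b (S ?c (S ?b ?y))))" by (simp add: S_braid)
    also have "\<dots> = S ?a (Si ?b (Si ?a (S ?c (S ?b ?y))))" by (simp add: braid5)
    also have "\<dots> = S i (C (Suc r) x)" by (simp add: r far_Si_S)
    finally show ?thesis .
  qed
qed simp

text \<open>Cancels a crossing from \<open>C_S_less\<close>. Cancellation works in range only, so
  the remaining case shows that both sides are \<open>bot\<close>.\<close>

lemma C_Si_less: assumes i: "Suc i < r" shows "C r (Si i x) = Si i (C r x)"
proof (cases "has r x")
  case True
  then obtain n s where [simp]: "st x = Some (n, s)" "r \<le> n" "Suc i < n" "Suc (Suc i) \<le> n" "i \<le> n"
    using i by (auto elim!: hasE)
  have "Si i (S i (C r (Si i x))) = C r (Si i x)" by (rule Si_S) (simp add: ev st_C)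
  moreover have "S i (C r (Si i x)) = C r x"
    by (simp add: C_S_less[OF i, symmetric] S_Si ev)
  ultimately show ?thesis by simp
next
  case False
  then have "st (C r x) = None" by (auto simp: st_C has_def split: option.splits)
  then have "Si i (C r x) = bot" by (simp add: outs ev)
  moreover have "C r (Si i x) = bot"
  proof -
    have "st (C r (Si i x)) = None" using False by (auto simp: st_C ev split: option.splits)
    obtain k where k: "r = Suc k" using i by (cases r) auto
    have "\<not> has (Suc (Suc (Suc k))) (C k (Si i x))"
      using False by (auto simp: k st_C ev split: option.splits)
    then show ?thesis by (simp add: k outs)
  qed
  ultimately show ?thesis by simp
qed

text \<open>The base case is the relation \<open>UU\<close> between two cups; further passages take
  place to the right of the cup made by the outer \<open>U\<close> and commute with it.\<close>

lemma C_U: "C (Suc (Suc r)) (U x) = U (C r x)"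
proof (induction r)
  case 0 show ?case using UU[of x] by (simp add: far_Si_S numeral_2_eq_2)
next
  case (Suc r) then show ?case by (simp add: U_S U_Si)
qed

text \<open>The base case is a relation between a cup and a cap: two strands pass a cup and are then
  capped, which amounts to capping them before the cup is made.\<close>

lemma K_C: "K (C (Suc (Suc r)) x) = C r (K x)"
proof (induction r)
  case 0 show ?case using KU_any(1)[of x] by (simp add: far_Si_S numeral_2_eq_2)
next
  case (Suc r) then show ?case by (simp add: K_S K_Si)
qed

lemma E_S_ge: "r \<le> i \<Longrightarrow> E r (S (Suc (Suc i)) x) = S i (E r x)"
proof (induction r arbitrary: x)
  case (Suc r)
  then show ?case using far_S[of r "Suc (Suc i)" x] by (simp add: far_Si_S)
qed (simp add: K_S)

lemma E_Si_ge: "r \<le> i \<Longrightarrow> E r (Si (Suc (Suc i)) x) = Si i (E r x)"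
proof (induction r arbitrary: x)
  case (Suc r)
  then show ?case using far_Si[of "Suc r" "Suc (Suc i)"] by (simp add: far_S_Si)
qed (simp add: K_Si)

text \<open>The argument for \<open>C_S_less\<close> turned upside down, with the mixed braid
  relation \<open>braid6\<close> in place of \<open>braid5\<close>.\<close>

lemma E_S_less: "Suc i < r \<Longrightarrow> E r (S i x) = S i (E r x)"
proof (induction r arbitrary: x)
  case (Suc r)
  show ?case
  proof (cases "Suc i < r")
    case True
    have "E (Suc r) (S i x) = E r (S i (Si (Suc r) (S r x)))"
      using True far_S[of i r x] by (simp add: far_S_Si)
    then show ?thesis using Suc.IH[OF True] by simp
  next
    case False
    then have r: "r = Suc i" using Suc.prems by simp
    let ?a = i and ?b = "Suc i" and ?c = "Suc (Suc i)"
    have "E (Suc r) (S i x) = E i (Si ?b (S ?a (Si ?c (S ?b (S ?a x)))))" by (simp add: r)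
    also have "S ?a (Si ?c (S ?b (S ?a x))) = Si ?c (S ?a (S ?b (S ?a x)))"
      by (simp add: far_S_Si)
    also have "S ?a (S ?b (S ?a x)) = S ?b (S ?a (S ?b x))" by (rule S_braid)
    also have "Si ?b (Si ?c (S ?b (S ?a (S ?b x)))) = S ?c (Si ?b (Si ?c (S ?a (S ?b x))))"
      by (rule braid6)
    also have "E i \<dots> = S i (E i (Si ?b (Si ?c (S ?a (S ?b x)))))" by (rule E_S_ge) simp
    also have "\<dots> = S i (E (Suc r) x)" by (simp add: r far_S_Si)
    finally show ?thesis .
  qed
qed simp

lemma E_Si_less: assumes i: "Suc i < r" shows "E r (Si i x) = Si i (E r x)"
proof (cases "has (Suc (Suc r)) x")
  case True
  then obtain n s where [simp]: "st x = Some (n, s)" and n: "Suc (Suc r) \<le> n"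
    by (auto elim!: hasE)
  have [simp]: "Suc i < n" "Suc (Suc i) \<le> n" "Suc (Suc i) \<le> n - 2" using n i by linarith+
  have "Si i (S i (E r (Si i x))) = E r (Si i x)" using n by (intro Si_S) (simp add: ev st_E)
  moreover have "S i (E r (Si i x)) = E r x"
    by (simp add: E_S_less[OF i, symmetric] S_Si ev)
  ultimately show ?thesis by simp
next
  case False
  have E_out: "E k y = bot" if "\<not> has (Suc (Suc k)) y" for k y
    using that
  proof (induction k arbitrary: y)
    case 0 then show ?case by (simp add: outs numeral_2_eq_2)
  next
    case (Suc k)
    then have "Si (Suc k) (S k y) = bot" by (intro outs) (simp add: has_simps)
    then show ?case by simp
  qed
  have "E r (Si i x) = bot" "E r x = bot" using False by (auto intro!: E_out simp: has_simps)
  then show ?thesis by simp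
qed

lemma E_U: "E (Suc (Suc r)) (U x) = U (E r x)"
proof (induction r arbitrary: x)
  case 0 show ?case using KU_any(2)[of x] by (simp add: far_S_Si numeral_2_eq_2)
next
  case (Suc r) then show ?case by (simp add: U_S[symmetric] U_Si[symmetric])
qed

lemma E_K: "K (E (Suc (Suc r)) x) = E r (K x)"
proof (induction r arbitrary: x)
  case 0 show ?case using KK[of x] by (simp add: far_S_Si numeral_2_eq_2)
next
  case (Suc r)
  have "K (E (Suc (Suc (Suc r))) x) = E r (K (Si (Suc (Suc (Suc r))) (S (Suc (Suc r)) x)))"
    using Suc.IH[of "Si (Suc (Suc (Suc r))) (S (Suc (Suc r)) x)"] by simp
  then show ?case by (simp add: K_S K_Si)
qed

text \<open>Read off from the mirrored locale. There \<open>S\<close> and \<open>Si\<close> have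
  changed places, so a rule for \<open>S\<close> here is the rule for \<open>Si\<close>
  there.\<close>

lemma Eb_S_ge: "r \<le> i \<Longrightarrow> Eb r (S (Suc (Suc i)) x) = S i (Eb r x)"
  and Eb_Si_ge: "r \<le> i \<Longrightarrow> Eb r (Si (Suc (Suc i)) x) = Si i (Eb r x)"
  and Eb_S_less: "Suc i < r \<Longrightarrow> Eb r (S i x) = S i (Eb r x)"
  and Eb_Si_less: "Suc i < r \<Longrightarrow> Eb r (Si i x) = Si i (Eb r x)"
  and Cb_Si_ge: "r \<le> i \<Longrightarrow> Cb r (Si i x) = Si (Suc (Suc i)) (Cb r x)"
  and Cb_S_less: "Suc i < r \<Longrightarrow> Cb r (S i x) = S i (Cb r x)"
  and Cb_Si_less: "Suc i < r \<Longrightarrow> Cb r (Si i x) = Si i (Cb r x)"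
  and st_Cb: "st (Cb r x) = (case st x of None \<Rightarrow> None | Some (n, s) \<Rightarrow>
    if r \<le> n then Some (Suc (Suc n), s) else None)"
  and st_Eb: "st (Eb r x) = (case st x of None \<Rightarrow> None | Some (n, s) \<Rightarrow>
    if Suc (Suc r) \<le> n then Some (n - 2, s) else None)"
  and Cb_U: "Cb (Suc (Suc r)) (U x) = U (Cb r x)"
  and K_Cb: "K (Cb (Suc (Suc r)) x) = Cb r (K x)"
  and Eb_U: "Eb (Suc (Suc r)) (U x) = U (Eb r x)"
  and Eb_K: "K (Eb (Suc (Suc r)) x) = Eb r (K x)"
proof -
  interpret m: brauer_operators st bot Si S U K sc qi q ti t \<delta> by (rule mirror)
  show "r \<le> i \<Longrightarrow> Eb r (S (Suc (Suc i)) x) = S i (Eb r x)" by (rule m.E_Si_ge)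
  show "r \<le> i \<Longrightarrow> Eb r (Si (Suc (Suc i)) x) = Si i (Eb r x)" by (rule m.E_S_ge)
  show "Suc i < r \<Longrightarrow> Eb r (S i x) = S i (Eb r x)" by (rule m.E_Si_less)
  show "Suc i < r \<Longrightarrow> Eb r (Si i x) = Si i (Eb r x)" by (rule m.E_S_less)
  show "r \<le> i \<Longrightarrow> Cb r (Si i x) = Si (Suc (Suc i)) (Cb r x)" by (rule m.C_S_ge)
  show "Suc i < r \<Longrightarrow> Cb r (S i x) = S i (Cb r x)" by (rule m.C_Si_less)
  show "Suc i < r \<Longrightarrow> Cb r (Si i x) = Si i (Cb r x)" by (rule m.C_S_less)
  show "st (Cb r x) = (case st x of None \<Rightarrow> None | Some (n, s) \<Rightarrow>
    if r \<le> n then Some (Suc (Suc n), s) else None)" by (rule m.st_C)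
  show "st (Eb r x) = (case st x of None \<Rightarrow> None | Some (n, s) \<Rightarrow>
    if Suc (Suc r) \<le> n then Some (n - 2, s) else None)" by (rule m.st_E)
  show "Cb (Suc (Suc r)) (U x) = U (Cb r x)" by (rule m.C_U)
  show "K (Cb (Suc (Suc r)) x) = Cb r (K x)" by (rule m.K_C)
  show "Eb (Suc (Suc r)) (U x) = U (Eb r x)" by (rule m.E_U)
  show "K (Eb (Suc (Suc r)) x) = Eb r (K x)" by (rule m.E_K)
qed

section \<open>Oriented skein relations for passing cups and caps\<close>

lemma stE: assumes "has r x" obtains k s where "st x = Some (r + k, s)"
  using assms by (auto elim!: hasE simp: le_iff_add)

lemmas evs = ev st_C st_E st_Cb st_Eb

lemma KSU': "has 1 x \<Longrightarrow> K (S (Suc 0) (U x)) = sc t x"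
  using KSU by (auto elim!: hasE)

lemma KSiU': "has 1 x \<Longrightarrow> K (Si (Suc 0) (U x)) = sc ti x"
  using KSiU by (auto elim!: hasE)

text \<open>A cup at position \<open>r + 1\<close> under a mirrored cap at position \<open>r\<close>
  is a zigzag of \<open>c\<close> and \<open>d\<close>, up to the scalar in the action of
  \<open>d\<close>. For \<open>r = 0\<close> the factor \<open>qi\<close> comes from the twisted cap
  and \<open>t\<close> from the curl. In the induction step the braid relations turn the composite
  for \<open>Suc r\<close> into the one for \<open>r\<close> conjugated by the crossing
  \<open>S r\<close>.\<close>

lemma zigzag1: "has (Suc r) x \<Longrightarrow> Eb r (C (Suc r) x) = sc (qi * t) x"
proof (induction r arbitrary: x)
  case 0
  then obtain k s where [simp]: "st x = Some (Suc 0 + k, s)" by (rule stE)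
  show ?case using 0 by (simp add: K_Si0 KSU' sc_sc evs)
next
  case (Suc r)
  from Suc.prems obtain k s where [simp]: "st x = Some (Suc (Suc r) + k, s)" by (rule stE)
  let ?b = "Suc r" and ?c = "Suc (Suc r)" and ?y = "C r x"
  have "Eb (Suc r) (C (Suc (Suc r)) x) = Eb r (S ?b (Si r (Si ?b (S ?c (Si r (S ?b ?y))))))"
    by simp
  also have "S ?c (Si r (S ?b ?y)) = Si r (S ?c (S ?b ?y))" by (simp add: far_Si_S)
  also have "Si r (Si ?b (Si r (S ?c (S ?b ?y)))) = Si ?b (Si r (Si ?b (S ?c (S ?b ?y))))"
    by (rule Si_braid)
  also have "S ?b \<dots> = Si r (Si ?b (S ?c (S ?b ?y)))" by (rule S_Si) (simp add: evs)
  also have "Si ?b (S ?c (S ?b ?y)) = S ?c (S ?b (Si ?c ?y))" by (rule braid4)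
  also have "Si r \<dots> = S ?c (Si r (S ?b (Si ?c ?y)))" by (simp add: far_Si_S)
  also have "Si ?c ?y = C r (Si r x)" by (rule C_Si_ge[symmetric]) simp
  also have "Eb r (S ?c (Si r (S ?b (C r (Si r x))))) = S r (Eb r (C (Suc r) (Si r x)))"
    by (simp add: Eb_S_ge)
  also have "\<dots> = S r (sc (qi * t) (Si r x))" by (subst Suc.IH) (simp_all add: evs)
  also have "\<dots> = sc (qi * t) x" by (simp add: S_sc inv evs)
  finally show ?case .
qed

text \<open>The other zigzag of \<open>c\<close> and \<open>d\<close>. The induction step again
  conjugates by a crossing, this time by \<open>Si r\<close>.\<close>

lemma zigzag2: "has (Suc r) x \<Longrightarrow> Eb (Suc r) (C r x) = sc (qi * t) x"
proof (induction r arbitrary: x)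
  case 0
  then obtain k s where [simp]: "st x = Some (Suc 0 + k, s)" by (rule stE)
  have "K (S 1 (Si 0 (U x))) = sc (qi * t) x"
    using 0 by (simp add: Si0_U KSU' S_sc K_sc sc_sc evs)
  then show ?case by simp
next
  case (Suc r)
  from Suc.prems obtain k s where [simp]: "st x = Some (Suc (Suc r) + k, s)" by (rule stE)
  let ?b = "Suc r" and ?c = "Suc (Suc r)" and ?y = "C r x"
  have "Eb (Suc (Suc r)) (C (Suc r) x) = Eb r (S ?b (Si r (S ?c (Si ?b (Si r (S ?b ?y))))))"
    by simp
  also have "Si r (S ?c (Si ?b (Si r (S ?b ?y)))) = S ?c (Si r (Si ?b (Si r (S ?b ?y))))"
    by (rule far_Si_S) simp
  also have "Si r (Si ?b (Si r (S ?b ?y))) = Si ?b (Si r (Si ?b (S ?b ?y)))" by (rule Si_braid)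
  also have "Si ?b (S ?b ?y) = ?y" by (rule Si_S) (simp add: evs)
  also have "S ?b (S ?c (Si ?b (Si r ?y))) = Si ?c (S ?b (S ?c (Si r ?y)))" by (rule braid3)
  also have "S ?c (Si r ?y) = Si r (S ?c ?y)" by (simp add: far_Si_S)
  also have "S ?c ?y = C r (S r x)" by (rule C_S_ge[symmetric]) simp
  also have "Eb r (Si ?c (S ?b (Si r (C r (S r x))))) = Si r (Eb (Suc r) (C r (S r x)))"
    by (simp add: Eb_Si_ge)
  also have "\<dots> = Si r (sc (qi * t) (S r x))" by (subst Suc.IH) (simp_all add: evs)
  also have "\<dots> = sc (qi * t) x" by (simp add: Si_sc inv evs)
  finally show ?case .
qed

text \<open>The crossings of a mirrored cup and a mirrored cap at the same position cancel in
  pairs.\<close>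

lemma loop: "has r x \<Longrightarrow> Eb r (Cb r x) = sc \<delta> x"
proof (induction r)
  case 0 then show ?case by (auto elim!: hasE simp: KU)
next
  case (Suc r)
  then obtain k s where [simp]: "st x = Some (Suc r + k, s)" by (auto elim: stE)
  show ?case using Suc.IH by (simp add: inv evs)
qed

lemma curl1: "has (Suc r) x \<Longrightarrow> E r (S (Suc r) (C r x)) = sc t x"
proof (induction r arbitrary: x)
  case 0 then show ?case by (simp add: KSU')
next
  case (Suc r)
  from Suc.prems obtain k s where [simp]: "st x = Some (Suc (Suc r) + k, s)" by (rule stE)
  let ?b = "Suc r" and ?c = "Suc (Suc r)" and ?y = "C r x"
  have "E (Suc r) (S (Suc (Suc r)) (C (Suc r) x)) = E r (Si ?b (S r (S ?c (Si r (S ?b ?y)))))"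
    by simp
  also have "S ?c (Si r (S ?b ?y)) = Si r (S ?c (S ?b ?y))" by (simp add: far_Si_S)
  also have "S r \<dots> = S ?c (S ?b ?y)" by (rule S_Si) (simp add: evs)
  also have "Si ?b (S ?c (S ?b ?y)) = S ?c (S ?b (Si ?c ?y))" by (rule braid4)
  also have "Si ?c ?y = C r (Si r x)" by (rule C_Si_ge[symmetric]) simp
  also have "E r (S ?c (S ?b (C r (Si r x)))) = S r (E r (S ?b (C r (Si r x))))"
    by (rule E_S_ge) simp
  also have "\<dots> = S r (sc t (Si r x))" by (subst Suc.IH) (simp_all add: evs)
  also have "\<dots> = sc t x" by (simp add: S_sc inv evs)
  finally show ?case .
qed

text \<open>For \<open>r = 0\<close> a twist of the cup and a twist of the cap contribute
  \<open>q\<close> and \<open>qi\<close>, which cancel and leave the curl \<open>t\<close>. The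
  induction step is a conjugation as in \<open>zigzag1\<close>.\<close>

lemma curl2: "has (Suc r) x \<Longrightarrow> Eb (Suc r) (S r (Cb (Suc r) x)) = sc t x"
proof (induction r arbitrary: x)
  case 0
  then obtain k s where [simp]: "st x = Some (Suc 0 + k, s)" by (rule stE)
  have "Eb (Suc 0) (S 0 (Cb (Suc 0) x)) = K (S 1 (S 0 (Si 1 (U x))))" by (simp add: inv evs)
  also have "S 1 (S 0 (Si 1 (U x))) = Si 0 (S 1 (S 0 (U x)))" using braid4[of 0] by simp
  also have "K \<dots> = sc t x"
    using 0 by (simp add: K_Si0 S0_U KSU' S_sc K_sc sc_sc mult.assoc[symmetric] qiq evs)
  finally show ?case .
next
  case (Suc r)
  from Suc.prems obtain k s where [simp]: "st x = Some (Suc (Suc r) + k, s)" by (rule stE)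
  let ?b = "Suc r" and ?c = "Suc (Suc r)" and ?y = "Cb r x"
  have P: "Eb (Suc r) (S r (Cb (Suc r) v)) = Eb r (S ?b (S r (Si ?b (Cb r v))))"
    if "st v = Some (Suc (Suc r) + k, s)" for v
    using that by (simp add: inv evs)
  have "Eb (Suc (Suc r)) (S (Suc r) (Cb (Suc (Suc r)) x))
      = Eb r (S ?b (Si r (S ?c (Si ?b (S ?b (S ?b (Si ?c (S r (Si ?b ?y)))))))))"
    by simp
  also have "Si ?b (S ?b (S ?b (Si ?c (S r (Si ?b ?y))))) = S ?b (Si ?c (S r (Si ?b ?y)))"
    by (rule Si_S) (simp add: evs)
  also have "Si r (S ?c (S ?b (Si ?c (S r (Si ?b ?y))))) = S ?c (Si r (S ?b (Si ?c (S r (Si ?b ?y)))))"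
    by (rule far_Si_S) simp
  also have "Si ?c (S r (Si ?b ?y)) = S r (Si ?c (Si ?b ?y))" by (simp add: far_S_Si)
  also have "Si r (S ?b (S r (Si ?c (Si ?b ?y)))) = S ?b (S r (Si ?b (Si ?c (Si ?b ?y))))"
    by (rule braid4)
  also have "Si ?b (Si ?c (Si ?b ?y)) = Si ?c (Si ?b (Si ?c ?y))" by (rule Si_braid)
  also have "S r \<dots> = Si ?c (S r (Si ?b (Si ?c ?y)))" by (simp add: far_S_Si)
  also have "S ?b (S ?c (S ?b (Si ?c (S r (Si ?b (Si ?c ?y))))))
      = S ?c (S ?b (S ?c (Si ?c (S r (Si ?b (Si ?c ?y))))))" by (rule S_braid)
  also have "S ?c (Si ?c (S r (Si ?b (Si ?c ?y)))) = S r (Si ?b (Si ?c ?y))"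
    by (rule S_Si) (simp add: evs)
  also have "Si ?c ?y = Cb r (Si r x)" by (rule Cb_Si_ge[symmetric]) simp
  also have "Eb r (S ?c (S ?b (S r (Si ?b (Cb r (Si r x)))))) = S r (Eb r (S ?b (S r (Si ?b (Cb r (Si r x))))))"
    by (rule Eb_S_ge) simp
  also have "\<dots> = S r (Eb (Suc r) (S r (Cb (Suc r) (Si r x))))" by (subst P) (simp_all add: evs)
  also have "\<dots> = S r (sc t (Si r x))" by (subst Suc.IH) (simp_all add: evs)
  also have "\<dots> = sc t x" by (simp add: S_sc inv evs)
  finally show ?case .
qed

text \<open>This is the composite that defines \<open>R_+\<close>. With the scalar of
  \<open>d\<close> included it acts as one positive crossing, so orientations leave no trace in the
  Brauer category.\<close>

lemma cross_right: "has (Suc (Suc r)) x \<Longrightarrow> Eb (Suc (Suc r)) (S (Suc r) (C r x)) = sc (qi * t) (S r x)"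
proof (induction r arbitrary: x)
  case 0
  then obtain k s where [simp]: "st x = Some (Suc (Suc 0) + k, s)" by (rule stE)
  have "Eb (Suc (Suc 0)) (S (Suc 0) (C 0 x)) = K (S 1 (Si 0 (S 2 (Si 1 (S 1 (U x))))))"
    by (simp add: numeral_2_eq_2)
  also have "Si 1 (S 1 (U x)) = U x" by (rule Si_S) (simp add: evs)
  also have "S 2 (U x) = U (S 0 x)" using U_S[of 0 x] by (simp add: numeral_2_eq_2)
  also have "K (S 1 (Si 0 (U (S 0 x)))) = sc (qi * t) (S 0 x)"
    by (simp add: Si0_U KSU' S_sc K_sc sc_sc evs)
  finally show ?case .
next
  case (Suc r)
  from Suc.prems obtain k s where [simp]: "st x = Some (Suc (Suc (Suc r)) + k, s)" by (rule stE)
  let ?b = "Suc r" and ?c = "Suc (Suc r)" and ?d = "Suc (Suc (Suc r))" and ?y = "C r x"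
  have "Eb (Suc (Suc (Suc r))) (S (Suc (Suc r)) (C (Suc r) x))
    = Eb (Suc (Suc r)) (S ?d (Si ?c (S ?c (Si r (S ?b ?y)))))" by simp
  also have "Si ?c (S ?c (Si r (S ?b ?y))) = Si r (S ?b ?y)" by (rule Si_S) (simp add: evs)
  also have "S ?d \<dots> = Si r (S ?d (S ?b ?y))" by (simp add: far_Si_S)
  also have "S ?d (S ?b ?y) = S ?b (S ?d ?y)" by (rule far_S[symmetric]) simp
  also have "S ?d ?y = C r (S ?b x)" by (rule C_S_ge[symmetric]) simp
  also have "Eb (Suc (Suc r)) (Si r (S ?b (C r (S ?b x)))) = Si r (Eb (Suc (Suc r)) (S ?b (C r (S ?b x))))"
    by (rule Eb_Si_less) simp
  also have "\<dots> = Si r (sc (qi * t) (S r (S ?b x)))" by (subst Suc.IH) (simp_all add: evs)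
  also have "\<dots> = sc (qi * t) (S (Suc r) x)" by (simp add: Si_sc inv evs)
  finally show ?case .
qed

text \<open>The composite that defines \<open>L_-\<close>; with the scalar of \<open>c'\<close>
  included it acts as the inverse crossing, hence as the inverse of \<open>R_+\<close>.\<close>

lemma cross_left: "has (Suc (Suc r)) x \<Longrightarrow> E r (Si (Suc r) (Cb (Suc (Suc r)) x)) = sc (q * ti) (Si r x)"
proof (induction r arbitrary: x)
  case 0
  then obtain k s where [simp]: "st x = Some (Suc (Suc 0) + k, s)" by (rule stE)
  have "E 0 (Si (Suc 0) (Cb (Suc (Suc 0)) x)) = K (Si 1 (S 1 (Si 2 (S 0 (Si 1 (U x))))))"
    by (simp add: numeral_2_eq_2)
  also have "Si 1 (S 1 (Si 2 (S 0 (Si 1 (U x))))) = Si 2 (S 0 (Si 1 (U x)))"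
    by (rule Si_S) (simp add: evs)
  also have "K \<dots> = sc (q * ti) (Si 0 x)"
    using K_Si[of 0] by (simp add: K_S0 KSiU' Si_sc sc_sc evs numeral_2_eq_2)
  finally show ?case .
next
  case (Suc r)
  from Suc.prems obtain k s where [simp]: "st x = Some (Suc (Suc (Suc r)) + k, s)" by (rule stE)
  let ?b = "Suc r" and ?c = "Suc (Suc r)" and ?d = "Suc (Suc (Suc r))" and ?y = "Cb (Suc (Suc r)) x"
  have "E (Suc r) (Si (Suc (Suc r)) (Cb (Suc (Suc (Suc r))) x))
    = E r (Si ?b (S r (Si ?c (S ?c (Si ?d ?y)))))" by simp
  also have "Si ?c (S ?c (Si ?d ?y)) = Si ?d ?y" by (rule Si_S) (simp add: evs)
  also have "S r \<dots> = Si ?d (S r ?y)" by (simp add: far_S_Si)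
  also have "Si ?b \<dots> = Si ?d (Si ?b (S r ?y))" by (rule far_Si) simp
  also have "S r ?y = Cb (Suc (Suc r)) (S r x)" by (rule Cb_S_less[symmetric]) simp
  also have "E r (Si ?d (Si ?b (Cb (Suc (Suc r)) (S r x)))) = Si ?b (E r (Si ?b (Cb (Suc (Suc r)) (S r x))))"
    by (rule E_Si_ge) simp
  also have "\<dots> = Si ?b (sc (q * ti) (Si r (S r x)))" by (subst Suc.IH) (simp_all add: evs)
  also have "\<dots> = sc (q * ti) (Si (Suc r) x)" by (simp add: Si_sc inv evs)
  finally show ?case .
qed

end

section \<open>Operators on the iquantum Brauer category\<close>

context presentation begin

text \<open>Stated for arbitrary sets of terms, in the form in which the locale of skein operators
  asks for it; ill-typed sums contribute nothing.\<close>

lemma add_commute_cat: "add_mor cat f g = add_mor cat g f"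
proof -
  have "cls (CAdd s t) = cls (CAdd t s)" for s t
    by (rule cls_eqI) (auto simp: ctyp_simps intro: ccong.add_commute)
  then show ?thesis unfolding add_union by blast
qed

lemma add_assoc_cat: "add_mor cat (add_mor cat f g) h = add_mor cat f (add_mor cat g h)"
proof -
  have left: "(\<Union>x\<in>cls s. cls (CAdd x u)) = cls (CAdd s u)" for s u
    using add_cls[of s u] add_union[of "cls s" "cls u"]
  proof -
    have "cls (CAdd x u) = cls (CAdd s u)" if "x \<in> cls s" for x
      using that by (intro cls_cong_add) (auto simp: untyped_in)
    then show ?thesis using cls_empty_add[of s u] by blast
  qed
  have right: "(\<Union>x\<in>cls s. cls (CAdd u x)) = cls (CAdd u s)" for s u
  proof -
    have "cls (CAdd u x) = cls (CAdd u s)" if "x \<in> cls s" for x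
      using that by (intro cls_cong_add) (auto simp: untyped_in)
    then show ?thesis using cls_empty_add[of u s] by blast
  qed
  have "cls (CAdd (CAdd s t) u) = cls (CAdd s (CAdd t u))" for s t u
    by (rule cls_eqI) (auto simp: ctyp_simps intro: ccong.add_assoc)
  moreover have "add_mor cat (add_mor cat f g) h = (\<Union>s\<in>f. \<Union>t\<in>g. \<Union>u\<in>h. \<Union>x\<in>cls (CAdd s t). cls (CAdd x u))"
    unfolding add_union by blast
  moreover have "add_mor cat f (add_mor cat g h) = (\<Union>s\<in>f. \<Union>t\<in>g. \<Union>u\<in>h. \<Union>x\<in>cls (CAdd t u). cls (CAdd s x))"
    unfolding add_union by blast
  ultimately show ?thesis by (simp only: left right)
qed

text \<open>The target comes first, since left composition acts on it.\<close>

definition ends :: "('g, 'o, 'k) cterm set \<Rightarrow> ('o \<times> 'o) option" where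
  "ends x = (if \<exists>X Y. x \<in> hom cat X Y then Some (THE p. x \<in> hom cat (snd p) (fst p)) else None)"

lemma ends_hom: assumes x: "x \<in> hom cat X Y" shows "ends x = Some (Y, X)"
proof -
  have "(THE p. x \<in> hom cat (snd p) (fst p)) = (Y, X)"
  proof (rule the_equality)
    fix p assume "x \<in> hom cat (snd p) (fst p)"
    from hom_unique[OF x this] show "p = (Y, X)" by (simp add: prod_eq_iff)
  qed (simp add: x)
  moreover have "\<exists>X Y. x \<in> hom cat X Y" using x by blast
  ultimately show ?thesis by (simp add: ends_def)
qed

lemma ends_iff: "ends x = Some (Y, X) \<longleftrightarrow> x \<in> hom cat X Y"
proof
  assume e: "ends x = Some (Y, X)"
  then obtain X' Y' where x: "x \<in> hom cat X' Y'" by (auto simp: ends_def split: if_splits)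
  then show "x \<in> hom cat X Y" using e ends_hom[OF x] by simp
qed (rule ends_hom)

lemma ends_empty [simp]: "ends {} = None"
  using hom_nonempty[of "{}"] by (auto simp: ends_def)

sublocale cat: linear_category cat
  by (rule linear_category_cat)

lemma cmp_rel: "\<lbrakk>R s t; ctyp G s X Y; ctyp G t X Y\<rbrakk> \<Longrightarrow> cmp cat (cls s) x = cmp cat (cls t) x"
  by (simp add: cls_rel)

lemma cmp_cls_comp: "cmp cat (cls (s \<star> t)) x = cmp cat (cls s) (cmp cat (cls t) x)"
  by (simp add: cmp_cls[symmetric] cmp_assoc)

lemma cmp_cls_id: "x \<in> hom cat X Y \<Longrightarrow> cmp cat (cls (CId Y)) x = x"
  using cmp_ident_left by (simp add: ident_cls)

lemma cmp_cls_scale: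
  assumes "ctyp G s Y Z" "x \<in> hom cat X Y"
  shows "cmp cat (cls (CScale a s)) x = scale_mor cat a (cmp cat (cls s) x)"
  using cat.cmp_scale_left[of x X Y "cls s" Z a] assms by (simp add: scale_cls)

lemma cmp_cls_add:
  assumes "ctyp G s Y Z" "ctyp G s' Y Z" "x \<in> hom cat X Y"
  shows "cmp cat (cls (CAdd s s')) x = add_mor cat (cmp cat (cls s) x) (cmp cat (cls s') x)"
  using cat.cmp_add_left[of x X Y "cls s" Z "cls s'"] assms by (simp add: add_cls)

end

lemma b_sig_simps [simp]:
  "b_sig (Cup r) m n \<longleftrightarrow> m = r \<and> n = r + 2"
  "b_sig (Cap r) m n \<longleftrightarrow> m = r + 2 \<and> n = r"
  "b_sig (Sig r i) m n \<longleftrightarrow> 1 \<le> i \<and> i < r \<and> m = r \<and> n = r"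
  "b_sig (SigInv r i) m n \<longleftrightarrow> 1 \<le> i \<and> i < r \<and> m = r \<and> n = r"
  by (auto simp: b_sig.simps)

section \<open>Left composition with the Brauer generators\<close>

locale skein_parameters =
  fixes q t \<delta> :: "'k::{comm_ring,comm_monoid_mult}"
  assumes q_unit: "q * unit_inv q = 1" and t_unit: "t * unit_inv t = 1"
    and delta: "t - unit_inv t = \<delta> * (q - unit_inv q)"

sublocale skein_parameters \<subseteq> bp: presentation b_sig "b_rel q t \<delta>"
proof
  show "b_sig g X Y \<Longrightarrow> b_sig g X' Y' \<Longrightarrow> X = X' \<and> Y = Y'" for g X Y X' Y' by (cases g) auto
qed

context skein_parameters begin

abbreviation "qi \<equiv> unit_inv q"
abbreviation "ti \<equiv> unit_inv t"

abbreviation Bcls where "Bcls \<equiv> bp.cls"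
abbreviation Bcmp where "Bcmp \<equiv> cmp bp.cat"

text \<open>One operator for a whole family of generators: the target of the argument selects the
  member of the family.\<close>

definition b_op :: "nat \<Rightarrow> (nat \<Rightarrow> 'k b_term) \<Rightarrow> 'k b_term set \<Rightarrow> 'k b_term set" where
  "b_op k s x = (case bp.ends x of None \<Rightarrow> {} | Some (n, _) \<Rightarrow> if k \<le> n then Bcmp (Bcls (s n)) x else {})"

definition "bS i = b_op (Suc (Suc i)) (\<lambda>n. sig n (Suc i))"
definition "bSi i = b_op (Suc (Suc i)) (\<lambda>n. sigi n (Suc i))"
definition "bU = b_op 0 (\<lambda>n. cup n)"
text \<open>The guard \<open>2\<close> keeps the subtraction from truncating.\<close>

definition "bK = b_op 2 (\<lambda>n. cap (n - 2))"

lemmas b_op_defs = bS_def bSi_def bU_def bK_def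

lemma b_op_eq: "x \<in> hom bp.cat m n \<Longrightarrow> k \<le> n \<Longrightarrow> b_op k s x = Bcmp (Bcls (s n)) x"
  by (simp add: b_op_def bp.ends_iff[symmetric])

lemma b_op_out: "(\<And>n s. bp.ends x = Some (n, s) \<Longrightarrow> n < k) \<Longrightarrow> b_op k s x = {}"
  by (auto simp: b_op_def split: option.splits)

lemma b_cmp_hom: "x \<in> hom bp.cat m n \<Longrightarrow> ctyp b_sig s n l \<Longrightarrow> Bcmp (Bcls s) x \<in> hom bp.cat m l"
  by (rule bp.cat.cmp_hom) simp_all

lemma b_ctyp [simp]:
  "1 \<le> i \<Longrightarrow> i < n \<Longrightarrow> ctyp b_sig (sig n i) n n" "1 \<le> i \<Longrightarrow> i < n \<Longrightarrow> ctyp b_sig (sigi n i) n n"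
  "ctyp b_sig (cup n) n (Suc (Suc n))" "ctyp b_sig (cap n) (Suc (Suc n)) n"
  by (auto simp: ctyp_simps)

lemma bS_eq: "x \<in> hom bp.cat m n \<Longrightarrow> Suc i < n \<Longrightarrow> bS i x = Bcmp (Bcls (sig n (Suc i))) x"
  and bSi_eq: "x \<in> hom bp.cat m n \<Longrightarrow> Suc i < n \<Longrightarrow> bSi i x = Bcmp (Bcls (sigi n (Suc i))) x"
  and bU_eq: "x \<in> hom bp.cat m n \<Longrightarrow> bU x = Bcmp (Bcls (cup n)) x"
  and bK_eq: "x \<in> hom bp.cat m (Suc (Suc n)) \<Longrightarrow> bK x = Bcmp (Bcls (cap n)) x"
  by (simp_all add: b_op_eq b_op_defs)

lemma bS_hom: "x \<in> hom bp.cat m n \<Longrightarrow> Suc i < n \<Longrightarrow> bS i x \<in> hom bp.cat m n"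
  and bSi_hom: "x \<in> hom bp.cat m n \<Longrightarrow> Suc i < n \<Longrightarrow> bSi i x \<in> hom bp.cat m n"
  and bU_hom: "x \<in> hom bp.cat m n \<Longrightarrow> bU x \<in> hom bp.cat m (Suc (Suc n))"
  and bK_hom: "x \<in> hom bp.cat m (Suc (Suc n)) \<Longrightarrow> bK x \<in> hom bp.cat m n"
  by (simp_all add: bS_eq bSi_eq bU_eq bK_eq b_cmp_hom)

lemma b_eqI:
  assumes "b_rel q t \<delta> s u" "ctyp b_sig s n l" "ctyp b_sig u n l"
  shows "Bcmp (Bcls s) x = Bcmp (Bcls u) x"
  using assms by (rule bp.cmp_rel)

lemma b_cmp_scale_id: "x \<in> hom bp.cat m n \<Longrightarrow> Bcmp (Bcls (CScale a (CId n))) x = scale_mor bp.cat a x"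
  using bp.cmp_cls_scale[OF ctyp.intros(2)] by (simp add: bp.cmp_cls_id)

text \<open>Each assumption is a defining relation composed with \<open>x\<close>. Positions drop by
  one because the indices of \<open>sig\<close> start at \<open>1\<close>.\<close>

lemma b_strand_operators:
  "strand_operators bp.ends {} bS bSi bU bK (scale_mor bp.cat) q qi t ti \<delta>"
proof
  fix x :: "'k b_term set" and n s i :: nat
  show "bp.ends {} = None" "scale_mor bp.cat a {} = {}" for a by simp_all
  show "(\<And>n s. bp.ends x = Some (n, s) \<Longrightarrow> n \<le> Suc i) \<Longrightarrow> bS i x = {}"
    "(\<And>n s. bp.ends x = Some (n, s) \<Longrightarrow> n \<le> Suc i) \<Longrightarrow> bSi i x = {}"
    "bp.ends x = None \<Longrightarrow> bU x = {}"
    "(\<And>n s. bp.ends x = Some (n, s) \<Longrightarrow> n \<le> 1) \<Longrightarrow> bK x = {}"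
    unfolding b_op_defs by (rule b_op_out; fastforce)+
  show "q * qi = 1" "t * ti = 1" by (rule q_unit t_unit)+
  assume "bp.ends x = Some (n, s)"
  then have x: "x \<in> hom bp.cat s n" by (simp add: bp.ends_iff)
  note sc = bp.cat.scale_hom[OF x] and U = bU_hom[OF x]
  have K: "\<exists>m. n = Suc (Suc m)" if "2 \<le> n" using that by presburger
  show "Suc i < n \<Longrightarrow> bp.ends (bS i x) = Some (n, s)" "Suc i < n \<Longrightarrow> bp.ends (bSi i x) = Some (n, s)"
    "bp.ends (bU x) = Some (Suc (Suc n), s)"
    by (simp_all add: bp.ends_iff bS_hom[OF x] bSi_hom[OF x] U)
  show "2 \<le> n \<Longrightarrow> bp.ends (bK x) = Some (n - 2, s)"
    using K x by (auto simp: bp.ends_iff intro: bK_hom)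
  show "bp.ends (scale_mor bp.cat a x) = Some (n, s)" for a
    by (simp add: bp.ends_iff sc)
  show "bS i (bSi i x) = x" if i: "Suc i < n"
  proof -
    have "bS i (bSi i x) = Bcmp (Bcls (sig n (Suc i) \<star> sigi n (Suc i))) x"
      unfolding bS_eq[OF bSi_hom[OF x i] i] unfolding bSi_eq[OF x i] unfolding bp.cmp_cls_comp ..
    also have "\<dots> = Bcmp (Bcls (CId n)) x"
      using i by (intro b_eqI[OF b_rel.intros(1)]) (auto simp: ctyp_simps)
    also have "\<dots> = x" by (rule bp.cmp_cls_id[OF x])
    finally show ?thesis .
  qed
  show "bSi i (bS i x) = x" if i: "Suc i < n"
  proof -
    have "bSi i (bS i x) = Bcmp (Bcls (sigi n (Suc i) \<star> sig n (Suc i))) x"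
      unfolding bSi_eq[OF bS_hom[OF x i] i] unfolding bS_eq[OF x i] unfolding bp.cmp_cls_comp ..
    also have "\<dots> = Bcmp (Bcls (CId n)) x"
      using i by (intro b_eqI[OF b_rel.intros(2)]) (auto simp: ctyp_simps)
    also have "\<dots> = x" by (rule bp.cmp_cls_id[OF x])
    finally show ?thesis .
  qed
  show "Suc i < n \<Longrightarrow> bS i (scale_mor bp.cat a x) = scale_mor bp.cat a (bS i x)"
    "bU (scale_mor bp.cat a x) = scale_mor bp.cat a (bU x)" for a
    by (simp_all add: bS_eq[OF x] bS_eq[OF sc] bU_eq[OF x] bU_eq[OF sc]
      bp.cat.cmp_scale_right[OF x, of _ n] bp.cat.cmp_scale_right[OF x, of _ "Suc (Suc n)"])
  show "bK (scale_mor bp.cat a x) = scale_mor bp.cat a (bK x)" if n2: "2 \<le> n" for a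
  proof -
    obtain m where m: "n = Suc (Suc m)" using K[OF n2] by blast
    show ?thesis
      unfolding bK_eq[OF sc[unfolded m]] unfolding bK_eq[OF x[unfolded m]]
      by (rule bp.cat.cmp_scale_right[OF x[unfolded m], of _ m]) simp
  qed
  show "scale_mor bp.cat a (scale_mor bp.cat b x) = scale_mor bp.cat (a * b) x"
    "scale_mor bp.cat 1 x = x" for a b
    using x by (rule bp.cat.scale_scale bp.cat.scale_one)+
  show "bS i (bS (Suc i) (bS i x)) = bS (Suc i) (bS i (bS (Suc i) x))" if i: "Suc (Suc i) < n"
  proof -
    have i': "Suc i < n" using i by simp
    have "bS i (bS (Suc i) (bS i x)) = Bcmp (Bcls (sig n (Suc i) \<star> sig n (Suc i + 1) \<star> sig n (Suc i))) x"
      unfolding bS_eq[OF bS_hom[OF bS_hom[OF x i'] i] i'] unfolding bS_eq[OF bS_hom[OF x i'] i] unfolding bS_eq[OF x i'] unfolding bp.cmp_cls_comp by simp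
    also have "\<dots> = Bcmp (Bcls (sig n (Suc i + 1) \<star> sig n (Suc i) \<star> sig n (Suc i + 1))) x"
      using i by (intro b_eqI[OF b_rel.intros(3)]) (auto simp: ctyp_simps)
    also have "\<dots> = bS (Suc i) (bS i (bS (Suc i) x))"
      unfolding bS_eq[OF bS_hom[OF bS_hom[OF x i] i'] i] unfolding bS_eq[OF bS_hom[OF x i] i'] unfolding bS_eq[OF x i] unfolding bp.cmp_cls_comp by simp
    finally show ?thesis .
  qed
  show "bS i (bS j x) = bS j (bS i x)" if j: "Suc j < n" "Suc i < j" for j
  proof -
    have i: "Suc i < n" using j by simp
    have "bS i (bS j x) = Bcmp (Bcls (sig n (Suc i) \<star> sig n (Suc j))) x"
      unfolding bS_eq[OF bS_hom[OF x j(1)] i] unfolding bS_eq[OF x j(1)] unfolding bp.cmp_cls_comp ..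
    also have "\<dots> = Bcmp (Bcls (sig n (Suc j) \<star> sig n (Suc i))) x"
      using i j by (intro b_eqI[OF b_rel.intros(4)]) (auto simp: ctyp_simps)
    also have "\<dots> = bS j (bS i x)"
      unfolding bS_eq[OF bS_hom[OF x i] j(1)] unfolding bS_eq[OF x i] unfolding bp.cmp_cls_comp ..
    finally show ?thesis .
  qed
  show "bU (bS i x) = bS (Suc (Suc i)) (bU x)" if i: "Suc i < n"
  proof -
    have i': "Suc (Suc (Suc i)) < Suc (Suc n)" using i by simp
    have "bU (bS i x) = Bcmp (Bcls (cup n \<star> sig n (Suc i))) x"
      unfolding bU_eq[OF bS_hom[OF x i]] unfolding bS_eq[OF x i] unfolding bp.cmp_cls_comp ..
    also have "\<dots> = Bcmp (Bcls (sig (n + 2) (Suc i + 2) \<star> cup n)) x"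
      using i by (intro b_eqI[OF b_rel.intros(6)]) (auto simp: ctyp_simps)
    also have "\<dots> = bS (Suc (Suc i)) (bU x)"
      unfolding bS_eq[OF U i'] unfolding bU_eq[OF x] unfolding bp.cmp_cls_comp by simp
    finally show ?thesis .
  qed
  show "bK (bS (Suc (Suc i)) x) = bS i (bK x)" if i: "Suc (Suc (Suc i)) < n"
  proof -
    obtain m where m: "n = Suc (Suc m)" using K i by fastforce
    note x' = x[unfolded m] and i' = i[unfolded m]
    have i'': "Suc i < m" using i' by simp
    have "bK (bS (Suc (Suc i)) x) = Bcmp (Bcls (cap m \<star> sig (m + 2) (Suc i + 2))) x"
      unfolding bK_eq[OF bS_hom[OF x' i']] unfolding bS_eq[OF x' i'] unfolding bp.cmp_cls_comp by simp
    also have "\<dots> = Bcmp (Bcls (sig m (Suc i) \<star> cap m)) x"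
      using i'' by (intro b_eqI[OF b_rel.intros(7)]) (auto simp: ctyp_simps)
    also have "\<dots> = bS i (bK x)"
      unfolding bS_eq[OF bK_hom[OF x'] i''] unfolding bK_eq[OF x'] unfolding bp.cmp_cls_comp ..
    finally show ?thesis .
  qed
  show "bK (bU x) = scale_mor bp.cat \<delta> x"
  proof -
    have "bK (bU x) = Bcmp (Bcls (cap n \<star> cup n)) x"
      unfolding bK_eq[OF U] unfolding bU_eq[OF x] unfolding bp.cmp_cls_comp ..
    also have "\<dots> = Bcmp (Bcls (CScale \<delta> (CId n))) x"
      by (intro b_eqI[OF b_rel.intros(8)]) (auto simp: ctyp_simps)
    finally show ?thesis using b_cmp_scale_id[OF x] by simp
  qed
  show "bK (bS 0 x) = scale_mor bp.cat q (bK x)" if n2: "2 \<le> n"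
  proof -
    obtain m where m: "n = Suc (Suc m)" using K[OF n2] by blast
    note x' = x[unfolded m]
    have i: "Suc 0 < Suc (Suc m)" by simp
    have "bK (bS 0 x) = Bcmp (Bcls (cap m \<star> sig (m + 2) 1)) x"
      unfolding bK_eq[OF bS_hom[OF x' i]] unfolding bS_eq[OF x' i] unfolding bp.cmp_cls_comp by simp
    also have "\<dots> = Bcmp (Bcls (CScale q (cap m))) x"
      by (intro b_eqI[OF b_rel.intros(9)]) (auto simp: ctyp_simps)
    also have "\<dots> = scale_mor bp.cat q (bK x)"
      unfolding bK_eq[OF x'] by (rule bp.cmp_cls_scale[OF b_ctyp(4) x'])
    finally show ?thesis .
  qed
  show "bS 0 (bU x) = scale_mor bp.cat q (bU x)"
  proof -
    have i: "Suc 0 < Suc (Suc n)" by simp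
    have "bS 0 (bU x) = Bcmp (Bcls (sig (n + 2) 1 \<star> cup n)) x"
      unfolding bS_eq[OF U i] unfolding bU_eq[OF x] unfolding bp.cmp_cls_comp by simp
    also have "\<dots> = Bcmp (Bcls (CScale q (cup n))) x"
      by (intro b_eqI[OF b_rel.intros(10)]) (auto simp: ctyp_simps)
    also have "\<dots> = scale_mor bp.cat q (bU x)"
      unfolding bU_eq[OF x] by (rule bp.cmp_cls_scale[OF b_ctyp(3) x])
    finally show ?thesis .
  qed
  show "bK (bS 1 (bU x)) = scale_mor bp.cat t x" if n: "1 \<le> n"
  proof -
    have i: "Suc 1 < Suc (Suc n)" using n by simp
    have "bK (bS 1 (bU x)) = Bcmp (Bcls (cap n \<star> sig (n + 2) 2 \<star> cup n)) x"
      unfolding bK_eq[OF bS_hom[OF U i]] unfolding bS_eq[OF U i] unfolding bU_eq[OF x] unfolding bp.cmp_cls_comp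
      by (simp add: numeral_2_eq_2)
    also have "\<dots> = Bcmp (Bcls (CScale t (CId n))) x"
      using n by (intro b_eqI[OF b_rel.intros(11)]) (auto simp: ctyp_simps)
    finally show ?thesis using b_cmp_scale_id[OF x] by simp
  qed
qed

lemma b_skein_operators:
  "skein_operators bp.ends {} bS bSi bU bK (scale_mor bp.cat) q qi t ti \<delta> (add_mor bp.cat)"
proof -
  interpret strand_operators bp.ends "{}" bS bSi bU bK "scale_mor bp.cat" q qi t ti \<delta>
    by (rule b_strand_operators)
  show ?thesis
  proof
    fix x y w :: "'k b_term set" and p :: "nat \<times> nat" and a b :: 'k
    show "add_mor bp.cat (add_mor bp.cat x y) w = add_mor bp.cat x (add_mor bp.cat y w)"
      "add_mor bp.cat x y = add_mor bp.cat y x"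
      by (rule bp.add_assoc_cat bp.add_commute_cat)+
    obtain n s where p: "p = (n, s)" by (cases p)
    show "x = y" if "bp.ends w = Some p" "bp.ends x = Some p" "bp.ends y = Some p"
        "add_mor bp.cat x w = add_mor bp.cat y w"
      using bp.cat.add_right_cancel that by (simp add: p bp.ends_iff)
    show "bp.ends (add_mor bp.cat x y) = Some p" if "bp.ends x = Some p" "bp.ends y = Some p"
      using bp.cat.add_hom that by (simp add: p bp.ends_iff)
    show "scale_mor bp.cat (a + b) x = add_mor bp.cat (scale_mor bp.cat a x) (scale_mor bp.cat b x)"
      if "bp.ends x = Some p"
      using bp.cat.scale_add_left that by (simp add: p bp.ends_iff)
    show "scale_mor bp.cat a (add_mor bp.cat x y) = add_mor bp.cat (scale_mor bp.cat a x) (scale_mor bp.cat a y)"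
      if "bp.ends x = Some p" "bp.ends y = Some p"
      using bp.cat.scale_add_right that by (simp add: p bp.ends_iff)
  next
    show "t = ti + \<delta> * (q - qi)" using delta by (simp add: algebra_simps)
  next
    fix x y :: "'k b_term set" and n s i :: nat
    assume "bp.ends x = Some (n, s)"
    then have x: "x \<in> hom bp.cat s n" by (simp add: bp.ends_iff)
    show "bS i x = add_mor bp.cat (bSi i x) (scale_mor bp.cat (q - qi) x)" if i: "Suc i < n"
    proof -
      have i': "1 \<le> Suc i" by simp
      have "add_mor bp.cat (bS i x) (scale_mor bp.cat (- 1) (bSi i x))
          = Bcmp (Bcls (CAdd (sig n (Suc i)) (CScale (- 1) (sigi n (Suc i))))) x"
        unfolding bp.cmp_cls_add[OF b_ctyp(1)[OF i' i] ctyp.intros(6)[OF b_ctyp(2)[OF i' i]] x]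
          bp.cmp_cls_scale[OF b_ctyp(2)[OF i' i] x] bS_eq[OF x i] bSi_eq[OF x i] ..
      also have "\<dots> = Bcmp (Bcls (CScale (q - qi) (CId n))) x"
        using i by (intro b_eqI[OF b_rel.intros(5)]) (auto simp: ctyp_simps)
      also have "\<dots> = scale_mor bp.cat (q - qi) x" by (rule b_cmp_scale_id[OF x])
      finally have e: "add_mor bp.cat (bS i x) (scale_mor bp.cat (- 1) (bSi i x)) = scale_mor bp.cat (q - qi) x" .
      \<comment> \<open>The defining relation is about a difference; adding \<open>bSi i x\<close>
        back solves it for \<open>bS i x\<close>.\<close>
      note h = bSi_hom[OF x i]
      have "scale_mor bp.cat (- 1 + 1) (bSi i x)
          = add_mor bp.cat (scale_mor bp.cat (- 1) (bSi i x)) (scale_mor bp.cat 1 (bSi i x))"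
        by (rule bp.cat.scale_add_left[OF h])
      then have zero: "add_mor bp.cat (scale_mor bp.cat (- 1) (bSi i x)) (bSi i x) = zero_mor bp.cat s n"
        using bp.cat.scale_zero[OF h] bp.cat.scale_one[OF h] by simp
      have "add_mor bp.cat (bSi i x) (scale_mor bp.cat (q - qi) x)
          = add_mor bp.cat (bS i x) (add_mor bp.cat (scale_mor bp.cat (- 1) (bSi i x)) (bSi i x))"
        unfolding e[symmetric] unfolding bp.add_commute_cat[of "bSi i x"] unfolding bp.add_assoc_cat ..
      also have "\<dots> = bS i x" unfolding zero by (rule bp.cat.add_zero[OF bS_hom[OF x i]])
      finally show ?thesis by (rule HOL.sym)
    qed
    assume "bp.ends y = Some (n, s)"
    then have y: "y \<in> hom bp.cat s n" by (simp add: bp.ends_iff)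
    note add = bp.cat.add_hom[OF x y]
    show "bS i (add_mor bp.cat x y) = add_mor bp.cat (bS i x) (bS i y)" if "Suc i < n"
      using that by (simp add: bS_eq[OF x] bS_eq[OF y] bS_eq[OF add] bp.cat.cmp_add_right[OF x y, of _ n])
    show "bK (add_mor bp.cat x y) = add_mor bp.cat (bK x) (bK y)" if n2: "2 \<le> n"
    proof -
      obtain m where m: "n = Suc (Suc m)" using n2 by (metis Suc_le_D numeral_2_eq_2 Suc_le_mono)
      show ?thesis using x y add unfolding m
        by (simp add: bK_eq bp.cat.cmp_add_right[of _ _ "Suc (Suc m)" _ _ m])
    qed
  qed
qed

text \<open>The presentation contains one sign pattern of each relation. \<open>UU_mirror\<close>
  and \<open>KK_mirror\<close> supply the mirrored ones. The relation between a cup and a cap is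
  given in the form \<open>KU4\<close>; \<open>pass_U\<close> yields \<open>KU1\<close>,
  \<open>pass_U_mirror\<close> yields \<open>KU2\<close>, and the mirror image of
  \<open>pass_U\<close> turns \<open>KU2\<close> into \<open>KU3\<close>.\<close>

lemma b_brauer_operators:
  "brauer_operators bp.ends {} bS bSi bU bK (scale_mor bp.cat) q qi t ti \<delta>"
proof -
  interpret skein_operators bp.ends "{}" bS bSi bU bK "scale_mor bp.cat" q qi t ti \<delta> "add_mor bp.cat"
    by (rule b_skein_operators)
  interpret m: skein_operators bp.ends "{}" bSi bS bU bK "scale_mor bp.cat" qi q ti t \<delta> "add_mor bp.cat"
    by (rule mirror)
  have UU: "bSi 1 (bSi 0 (bS 2 (bS 1 (bU (bU x))))) = bU (bU x)" if "bp.ends x = Some (n, s)" for x n s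
  proof -
    have x: "x \<in> hom bp.cat s n" using that by (simp add: bp.ends_iff)
    note u = bU_hom[OF x] and uu = bU_hom[OF bU_hom[OF x]]
    let ?n = "Suc (Suc (Suc (Suc n)))"
    have i: "Suc 0 < ?n" "Suc 1 < ?n" "Suc 2 < ?n" by simp_all
    note h1 = bS_hom[OF uu i(2)]
    note h2 = bS_hom[OF h1 i(3)]
    note h3 = bSi_hom[OF h2 i(1)]
    have "bSi 1 (bSi 0 (bS 2 (bS 1 (bU (bU x)))))
      = Bcmp (Bcls (sigi (n + 4) 2 \<star> sigi (n + 4) 1 \<star> sig (n + 4) 3 \<star> sig (n + 4) 2 \<star> cup (n + 2) \<star> cup n)) x"
      unfolding bSi_eq[OF h3 i(2)] unfolding bSi_eq[OF h2 i(1)] unfolding bS_eq[OF h1 i(3)]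
      unfolding bS_eq[OF uu i(2)] unfolding bU_eq[OF u] unfolding bU_eq[OF x] unfolding bp.cmp_cls_comp
      by (simp add: numeral_eq_Suc)
    also have "\<dots> = Bcmp (Bcls (cup (n + 2) \<star> cup n)) x"
      by (intro b_eqI[OF b_rel.intros(14)]) (auto simp: ctyp_simps)
    also have "\<dots> = bU (bU x)"
      unfolding bU_eq[OF u] unfolding bU_eq[OF x] unfolding bp.cmp_cls_comp by simp
    finally show ?thesis .
  qed
  have KK: "bK (bK (bSi 1 (bSi 2 (bS 0 (bS 1 x))))) = bK (bK x)"
    if "bp.ends x = Some (Suc (Suc (Suc (Suc n))), s)" for x n s
  proof -
    let ?n = "Suc (Suc (Suc (Suc n)))"
    have x: "x \<in> hom bp.cat s ?n" using that by (simp add: bp.ends_iff)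
    have i: "Suc 0 < ?n" "Suc 1 < ?n" "Suc 2 < ?n" by simp_all
    note h1 = bS_hom[OF x i(2)]
    note h2 = bS_hom[OF h1 i(1)]
    note h3 = bSi_hom[OF h2 i(3)]
    note h4 = bSi_hom[OF h3 i(2)]
    have "bK (bK (bSi 1 (bSi 2 (bS 0 (bS 1 x)))))
      = Bcmp (Bcls (cap n \<star> cap (n + 2) \<star> sigi (n + 4) 2 \<star> sigi (n + 4) 3 \<star> sig (n + 4) 1 \<star> sig (n + 4) 2)) x"
      unfolding bK_eq[OF bK_hom[OF h4]] unfolding bK_eq[OF h4]
      unfolding bSi_eq[OF h3 i(2)] unfolding bSi_eq[OF h2 i(3)] unfolding bS_eq[OF h1 i(1)]
      unfolding bS_eq[OF x i(2)] unfolding bp.cmp_cls_comp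
      by (simp add: numeral_eq_Suc)
    also have "\<dots> = Bcmp (Bcls (cap n \<star> cap (n + 2))) x"
      by (intro b_eqI[OF b_rel.intros(13)]) (auto simp: ctyp_simps)
    also have "\<dots> = bK (bK x)"
      unfolding bK_eq[OF bK_hom[OF x]] unfolding bK_eq[OF x] unfolding bp.cmp_cls_comp by simp
    finally show ?thesis .
  qed
  have Z: "bK (bS 1 (bS 2 (bSi 0 (bSi 1 (bU x))))) = bU (bK x)"
    if "bp.ends x = Some (Suc (Suc n), s)" for x n s
  proof -
    let ?n = "Suc (Suc (Suc (Suc n)))"
    have x: "x \<in> hom bp.cat s (Suc (Suc n))" using that by (simp add: bp.ends_iff)
    have i: "Suc 0 < ?n" "Suc 1 < ?n" "Suc 2 < ?n" by simp_all
    note u = bU_hom[OF x]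
    note h1 = bSi_hom[OF u i(2)]
    note h2 = bSi_hom[OF h1 i(1)]
    note h3 = bS_hom[OF h2 i(3)]
    note h4 = bS_hom[OF h3 i(2)]
    let ?r = "Suc (Suc n)"
    have "bK (bS 1 (bS 2 (bSi 0 (bSi 1 (bU x)))))
      = Bcmp (Bcls (cap ?r \<star> sig (?r + 2) 2 \<star> sig (?r + 2) 3 \<star> sigi (?r + 2) 1 \<star> sigi (?r + 2) 2 \<star> cup ?r)) x"
      unfolding bK_eq[OF h4] unfolding bS_eq[OF h3 i(2)] unfolding bS_eq[OF h2 i(3)]
      unfolding bSi_eq[OF h1 i(1)] unfolding bSi_eq[OF u i(2)] unfolding bU_eq[OF x]
      unfolding bp.cmp_cls_comp by (simp add: numeral_eq_Suc)
    also have "\<dots> = Bcmp (Bcls (cup (?r - 2) \<star> cap (?r - 2))) x"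
      by (intro b_eqI[OF b_rel.intros(12)]) (auto simp: ctyp_simps)
    also have "\<dots> = bU (bK x)"
      unfolding bU_eq[OF bK_hom[OF x]] unfolding bK_eq[OF x] unfolding bp.cmp_cls_comp by simp
    finally show ?thesis .
  qed
  show ?thesis
  proof
    fix x :: "'k b_term set" and n s :: nat
    assume x: "bp.ends x = Some (n, s)"
    show "bSi 1 (bSi 0 (bS 2 (bS 1 (bU (bU x))))) = bU (bU x)" by (rule UU[OF x])
    then show "bS 1 (bS 0 (bSi 2 (bSi 1 (bU (bU x))))) = bU (bU x)" by (rule UU_mirror[OF x])
    show "bK (bSi 1 (bU x)) = scale_mor bp.cat ti x" if "1 \<le> n"
      using that x by (intro K_Si_U) (simp add: ev)
    show "bK (bK (bSi 1 (bSi 2 (bS 0 (bS 1 x))))) = bK (bK x)"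
      and "bK (bK (bS 1 (bS 2 (bSi 0 (bSi 1 x))))) = bK (bK x)" if "4 \<le> n"
    proof -
      have x4: "bp.ends x = Some (Suc (Suc (Suc (Suc (n - 4)))), s)" using x that by simp
      show "bK (bK (bSi 1 (bSi 2 (bS 0 (bS 1 x))))) = bK (bK x)" by (rule KK[OF x4])
      show "bK (bK (bS 1 (bS 2 (bSi 0 (bSi 1 x))))) = bK (bK x)" by (rule KK_mirror[OF x4 KK])
    qed
    assume n: "2 \<le> n"
    then have h: "has 2 x" using x by (simp add: ev)
    obtain m where "n = Suc (Suc m)" using n by (metis Suc_le_D numeral_2_eq_2 Suc_le_mono)
    then have x2: "bp.ends x = Some (Suc (Suc m), s)" using x by simp
    show 4: "bK (bS 1 (bS 2 (bSi 0 (bSi 1 (bU x))))) = bU (bK x)" by (rule Z[OF x2])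
    show "bK (bSi 1 (bSi 0 (bS 2 (bS 1 (bU x))))) = bU (bK x)"
      unfolding pass_U[OF h] by (rule 4)
    show 2: "bK (bS 1 (bS 0 (bSi 2 (bSi 1 (bU x))))) = bU (bK x)"
      unfolding pass_U_mirror[OF h] by (rule 4)
    show "bK (bSi 1 (bSi 2 (bS 0 (bS 1 (bU x))))) = bU (bK x)"
      using 2 m.pass_U[OF h] by simp
  qed
qed

end

section \<open>The iquantum Brauer category as a module\<close>

lemma os_typ: "mtyp os_sig g X Y \<Longrightarrow> os_src g = X \<and> os_tgt g = Y"
  by (induction rule: mtyp.induct) (auto simp: os_sig_def)

lemma b_right_simps [simp]:
  "b_right n (CGen g) = CGen (b_gen_right n g)" "b_right n (CId r) = CId (r + n)"
  "b_right n (u \<star> v) = b_right n u \<star> b_right n v" "b_right n (CZero k l) = CZero (k + n) (l + n)"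
  "b_right n (CAdd u v) = CAdd (b_right n u) (b_right n v)"
  "b_right n (CScale a u) = CScale a (b_right n u)"
  by (simp_all add: b_right_def)

lemma b_right_add: "b_right n (b_right m u) = b_right (m + n) u"
proof (induction u)
  case (CGen g) then show ?case by (cases g) (simp_all add: add.assoc)
qed (simp_all add: add.assoc)

lemma b_right_0 [simp]: "b_right 0 u = u"
proof (induction u)
  case (CGen g) then show ?case by (cases g) simp_all
qed simp_all

lemma ctyp_b_right: "ctyp b_sig u m l \<Longrightarrow> ctyp b_sig (b_right n u) (m + n) (l + n)"
proof (induction u arbitrary: m l)
  case (CGen g) then show ?case by (cases g) (auto simp: ctyp_simps)
qed (fastforce simp: ctyp_simps)+

text \<open>Positions are counted from the left, so strands added on the right only change the index
  \<open>r\<close> of a relation.\<close>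

lemma b_rel_right:
  assumes "b_rel q t \<delta> u v" and "ctyp b_sig u m l" shows "b_rel q t \<delta> (b_right n u) (b_right n v)"
  using assms(1)
proof cases
  case (1 r i) then show ?thesis using b_rel.intros(1)[where r = "r + n"] by simp
next
  case (2 r i) then show ?thesis using b_rel.intros(2)[where r = "r + n"] by simp
next
  case (3 r i) then show ?thesis using b_rel.intros(3)[where r = "r + n"] by simp
next
  case (4 i j r) then show ?thesis using b_rel.intros(4)[of i j q t \<delta> "r + n"] by auto
next
  case (5 r i) then show ?thesis using b_rel.intros(5)[where r = "r + n"] by simp
next
  case (6 r i) then show ?thesis using b_rel.intros(6)[where r = "r + n"] by simp
next
  case (7 r i) then show ?thesis using b_rel.intros(7)[where r = "r + n"] by simp
next
  case (8 r) then show ?thesis using b_rel.intros(8)[where r = "r + n"] by simp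
next
  case (9 r) then show ?thesis using b_rel.intros(9)[where r = "r + n"] by simp
next
  case (10 r) then show ?thesis using b_rel.intros(10)[where r = "r + n"] by simp
next
  case (11 r) then show ?thesis using b_rel.intros(11)[where r = "r + n"] by simp
next
  case (12 r)
  \<comment> \<open>The condition \<open>r \<ge> 2\<close> of this relation rules out truncated
    subtraction.\<close>
  then have "r + n - 2 = r - 2 + n" by simp
  then show ?thesis using 12 b_rel.intros(12)[where r = "r + n"] by simp
next
  case (13 r) then show ?thesis using b_rel.intros(13)[where r = "r + n"] by (simp add: add.assoc add.commute[of n])
next
  case (14 r) then show ?thesis using b_rel.intros(14)[where r = "r + n"] by (simp add: add.assoc add.commute[of n])
qed

lemma b_prod_simps [simp]:
  "b_prod r s [] = CId r" "b_prod r s (k # ks) = s r k \<star> b_prod r s ks"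
  by (simp_all add: b_prod_def)

lemma b_prod_right:
  assumes "\<And>k. b_right n (s r k) = s (r + n) k" shows "b_right n (b_prod r s ks) = b_prod (r + n) s ks"
  by (induction ks) (simp_all add: assms)

lemma ctyp_b_prod:
  assumes "\<And>k. k \<in> set ks \<Longrightarrow> ctyp b_sig (s r k) r r" shows "ctyp b_sig (b_prod r s ks) r r"
  using assms by (induction ks) (auto simp: ctyp_simps)

lemma ctyp_b_act_gen: "ctyp b_sig (b_act_gen q t r g) (r + length (os_dom g)) (r + length (os_cod g))"
proof -
  have P: "ctyp b_sig (b_prod (Suc (Suc r)) s ks) (Suc (Suc r)) (Suc (Suc r))"
    if "s = sig \<or> s = sigi" "set ks \<subseteq> {1..<Suc (Suc r)}" for s :: "nat \<Rightarrow> nat \<Rightarrow> 'a b_term" and ks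
    using that by (intro ctyp_b_prod) (auto simp: ctyp_simps)
  show ?thesis by (cases g) (auto simp: ctyp_simps simp del: upt_Suc intro!: exI P)
qed

lemma ctyp_b_act: "mtyp os_sig g X Y \<Longrightarrow> ctyp b_sig (b_act q t r g) (r + length X) (r + length Y)"
proof (induction g arbitrary: X Y r)
  case (MGen g)
  then show ?case using ctyp_b_act_gen by (simp add: mtyp_simps os_sig_def)
next
  case (MTens g h)
  then obtain X1 Y1 X2 Y2 where t: "mtyp os_sig g X1 Y1" "mtyp os_sig h X2 Y2"
    "X = X1 @ X2" "Y = Y1 @ Y2" by (auto simp: mtyp_simps)
  show ?case using MTens.IH(2)[OF t(2), of "r + length Y1"] ctyp_b_right[OF MTens.IH(1)[OF t(1), of r], of "length X2"]
    by (auto simp: ctyp_simps os_typ[OF t(1)] os_typ[OF t(2)] t add.assoc)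
qed (fastforce simp: mtyp_simps ctyp_simps)+

context brauer_operators begin

text \<open>\<open>pass_cup\<close> proceeds strand by strand, whereas the action of
  \<open>c\<close> applies all positive crossings before all inverse ones; the two agree because
  distant crossings commute.\<close>

lemma C_prod: "C r x = foldr Si (rev [0..<r]) (foldr S (rev [1..<r + 1]) (U x))"
proof (induction r)
  case (Suc r)
  have c: "S (Suc r) (foldr Si ks y) = foldr Si ks (S (Suc r) y)" if "set ks \<subseteq> {0..<r}" for ks y
    using that by (induction ks) (auto simp: far_Si_S[symmetric])
  show ?case using Suc c[of "rev [0..<r]"] by simp
qed simp

lemma E_prod: "E r x = K (foldr Si [1..<r + 1] (foldr S [0..<r] x))"
proof (induction r arbitrary: x)
  case (Suc r)
  have c: "foldr S ks (Si (Suc r) y) = Si (Suc r) (foldr S ks y)" if "set ks \<subseteq> {0..<r}" for ks y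
    using that by (induction ks) (auto simp: far_S_Si)
  show ?case using Suc c[of "[0..<r]"] by simp
qed simp

lemma Cb_prod: "Cb r x = foldr S (rev [0..<r]) (foldr Si (rev [1..<r + 1]) (U x))"
  and Eb_prod: "Eb r x = K (foldr S [1..<r + 1] (foldr Si [0..<r] x))"
  by (rule brauer_operators.C_prod[OF mirror] brauer_operators.E_prod[OF mirror])+

end

context skein_parameters begin

sublocale osp: monoidal_presentation os_sig "os_rel q t \<delta>"
  by unfold_locales (auto simp: os_sig_def)

sublocale bo: brauer_operators bp.ends "{}" bS bSi bU bK "scale_mor bp.cat" q qi t ti \<delta>
  by (rule b_brauer_operators)

sublocale bright: presentation_map b_sig "b_rel q t \<delta>" b_sig "b_rel q t \<delta>" "\<lambda>r. r + n"
    "\<lambda>g. CGen (b_gen_right n g)" for n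
proof
  show "ctyp b_sig (CGen (b_gen_right n g)) (X + n) (Y + n)" if "b_sig g X Y" for g X Y
    using ctyp_b_right[of "CGen g" X Y n] that by (simp add: ctyp_simps)
  show "Bcls (cextend (\<lambda>r. r + n) (\<lambda>g. CGen (b_gen_right n g)) u)
      = Bcls (cextend (\<lambda>r. r + n) (\<lambda>g. CGen (b_gen_right n g)) v)"
    if "b_rel q t \<delta> u v" "ctyp b_sig u X Y" "ctyp b_sig v X Y" for u v X Y
    using b_rel_right[OF that(1,2), of n] ctyp_b_right[OF that(2), of n] ctyp_b_right[OF that(3), of n]
    unfolding b_right_def by (rule bp.cls_rel)
qed

lemma bright_cong: "Bcls u = Bcls v \<Longrightarrow> ctyp b_sig u m l \<Longrightarrow> Bcls (b_right n u) = Bcls (b_right n v)"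
  unfolding b_right_def by (rule bright.cls_extend[OF bp.cls_eqD])

section \<open>Evaluation of the action of the oriented skein category\<close>

abbreviation "b_tgt x \<equiv> map_option fst (bp.ends x)"

fun b_act_op :: "os_gen \<Rightarrow> nat \<Rightarrow> 'k b_term set \<Rightarrow> 'k b_term set" where
  "b_act_op Xpos r x = bS r x"
| "b_act_op Xneg r x = bSi r x"
| "b_act_op Cw r x = bo.C r x"
| "b_act_op Cw' r x = scale_mor bp.cat (qi * t) (bo.Cb r x)"
| "b_act_op Dw r x = scale_mor bp.cat (q * ti) (bo.Eb r x)"
| "b_act_op Dw' r x = bo.E r x"

lemma b_apply_id: "b_tgt x = Some n \<Longrightarrow> Bcmp (Bcls (CId n)) x = x"
  using bp.cmp_cls_id by (auto simp: bp.ends_iff)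

lemma b_apply_prod:
  assumes s: "\<And>k y. bp.ends y = Some (n, m) \<Longrightarrow> Suc k < n \<Longrightarrow> Bcmp (Bcls (s n (Suc k))) y = f k y \<and> bp.ends (f k y) = Some (n, m)"
    and x: "bp.ends x = Some (n, m)" and ks: "\<And>k. k \<in> set ks \<Longrightarrow> Suc k < n"
  shows "Bcmp (Bcls (b_prod n s (map Suc ks))) x = foldr f ks x \<and> bp.ends (foldr f ks x) = Some (n, m)"
  using ks
proof (induction ks)
  case Nil then show ?case using x b_apply_id[of x n] by simp
next
  case (Cons k ks)
  then show ?case using s[of "foldr f ks x" k] by (simp add: bp.cmp_cls_comp)
qed

lemma b_apply_sig:
  "bp.ends x = Some (n, m) \<Longrightarrow> Suc k < n \<Longrightarrow> Bcmp (Bcls (sig n (Suc k))) x = bS k x \<and> bp.ends (bS k x) = Some (n, m)"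
  "bp.ends x = Some (n, m) \<Longrightarrow> Suc k < n \<Longrightarrow> Bcmp (Bcls (sigi n (Suc k))) x = bSi k x \<and> bp.ends (bSi k x) = Some (n, m)"
  unfolding bp.ends_iff by (simp_all only: bS_eq[symmetric] bSi_eq[symmetric] bS_hom bSi_hom simp_thms)

lemma b_apply_sigs:
  assumes "bp.ends x = Some (n, m)" and "\<And>k. k \<in> set ks \<Longrightarrow> Suc k < n"
  shows "Bcmp (Bcls (b_prod n sig (map Suc ks))) x = foldr bS ks x \<and> bp.ends (foldr bS ks x) = Some (n, m)"
    and "Bcmp (Bcls (b_prod n sigi (map Suc ks))) x = foldr bSi ks x \<and> bp.ends (foldr bSi ks x) = Some (n, m)"
  by (rule b_apply_prod[OF _ assms], rule b_apply_sig, assumption+)+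

lemma b_apply_U: "bp.ends x = Some (n, m) \<Longrightarrow> Bcmp (Bcls (cup n)) x = bU x"
  and b_apply_K: "bp.ends x = Some (Suc (Suc n), m) \<Longrightarrow> Bcmp (Bcls (cap n)) x = bK x"
  by (simp_all add: bp.ends_iff bU_eq bK_eq)

text \<open>The \<open>k\<close> strands added on the right do not change the operator. The work
  lies in matching the products of crossings in \<open>b_act_gen\<close>, indexed from
  \<open>1\<close>, with the folds in \<open>C_prod\<close>, \<open>E_prod\<close> and their mirror
  images, indexed from \<open>0\<close>.\<close>

lemma b_apply_gen:
  assumes x: "bp.ends x = Some (r + length (os_dom g) + k, m)"
  shows "Bcmp (Bcls (b_right k (b_act_gen q t r g))) x = b_act_op g r x"
proof -
  let ?n = "Suc (Suc (r + k))"
  have L: "[1..<r + 1] = map Suc [0..<r]" "[2..<r + 2] = map Suc [1..<r + 1]"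
    by (simp_all add: map_Suc_upt numeral_2_eq_2)
  have R: "b_right k (b_prod (r + 2) s ks) = b_prod ?n s ks" if "s = sig \<or> s = sigi"
    for s :: "nat \<Rightarrow> nat \<Rightarrow> 'k b_term" and ks
    using b_prod_right[of k s "r + 2" ks] that by auto
  have two: "r + 2 + k = ?n" by simp
  have P: "Bcmp (Bcls (b_prod ?n sig (map Suc ks))) y = foldr bS ks y"
    "Bcmp (Bcls (b_prod ?n sigi (map Suc ks))) y = foldr bSi ks y"
    "bp.ends (foldr bS ks y) = Some (?n, m)" "bp.ends (foldr bSi ks y) = Some (?n, m)"
    if y: "bp.ends y = Some (?n, m)" and ks: "\<forall>j \<in> set ks. j \<le> r" for y ks
  proof -
    have "Suc j < ?n" if "j \<in> set ks" for j using that ks by fastforce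
    note sigs = b_apply_sigs[OF y this]
    show "Bcmp (Bcls (b_prod ?n sig (map Suc ks))) y = foldr bS ks y"
      "Bcmp (Bcls (b_prod ?n sigi (map Suc ks))) y = foldr bSi ks y"
      "bp.ends (foldr bS ks y) = Some (?n, m)" "bp.ends (foldr bSi ks y) = Some (?n, m)"
      using sigs(1) sigs(2) by simp_all
  qed
  note unf = b_act_gen.simps b_act_op.simps b_right_simps b_gen_right.simps bp.cmp_cls_comp L rev_map
    two
  show ?thesis
  proof (cases g)
    case Xpos
    then show ?thesis using x b_apply_sig(1)[of x ?n m r] by simp
  next
    case Xneg
    then show ?thesis using x b_apply_sig(2)[of x ?n m r] by simp
  next
    case Cw
    then have x': "bp.ends x = Some (r + k, m)" using x by simp
    then have u: "bp.ends (bU x) = Some (?n, m)" by (simp add: bo.ev)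
    show ?thesis
      unfolding Cw unf R[OF disjI1[OF HOL.refl]] R[OF disjI2[OF HOL.refl]] b_apply_U[OF x'] bo.C_prod
      using u by (subst P(1)) (auto simp: P simp del: upt_Suc)
  next
    case Cw'
    then have x': "bp.ends x = Some (r + k, m)" using x by simp
    then have u: "bp.ends (bU x) = Some (?n, m)" by (simp add: bo.ev)
    have t: "ctyp b_sig (b_right k (b_prod (r + 2) sig (rev [1..<r + 1]) \<star> b_prod (r + 2) sigi (rev [2..<r + 2]) \<star> cup r) :: 'k b_term)
      (r + k) ?n"
      using ctyp_b_right[OF ctyp_b_act_gen[of q t r Cw'], of k] by (simp add: ctyp_simps del: upt_Suc)
    show ?thesis
      unfolding Cw' b_act_gen.simps b_right_simps(6)
        bp.cmp_cls_scale[OF t x'[unfolded bp.ends_iff]] b_act_op.simps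
      unfolding unf R[OF disjI1[OF HOL.refl]] R[OF disjI2[OF HOL.refl]] b_apply_U[OF x'] bo.Cb_prod
      using u by (subst P(2)) (auto simp: P simp del: upt_Suc)
  next
    case Dw
    then have x': "bp.ends x = Some (?n, m)" using x by simp
    have t: "ctyp b_sig (b_right k (cap r \<star> b_prod (r + 2) sig [2..<r + 2] \<star> b_prod (r + 2) sigi [1..<r + 1]) :: 'k b_term)
      ?n (r + k)"
      using ctyp_b_right[OF ctyp_b_act_gen[of q t r Dw], of k] by (simp add: ctyp_simps del: upt_Suc)
    show ?thesis
      unfolding Dw b_act_gen.simps b_right_simps(6)
        bp.cmp_cls_scale[OF t x'[unfolded bp.ends_iff]] b_act_op.simps
      unfolding unf R[OF disjI1[OF HOL.refl]] R[OF disjI2[OF HOL.refl]] bo.Eb_prod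
      using x' by (subst P(2), simp, simp, subst P(1)) (auto simp: P b_apply_K simp del: upt_Suc)
  next
    case Dw'
    then have x': "bp.ends x = Some (?n, m)" using x by simp
    show ?thesis
      unfolding Dw' unf R[OF disjI1[OF HOL.refl]] R[OF disjI2[OF HOL.refl]] bo.E_prod
      using x' by (subst P(1), simp, simp, subst P(2)) (auto simp: P b_apply_K simp del: upt_Suc)
  qed
qed

lemma b_act_op_ends:
  assumes "bp.ends x = Some (r + length (os_dom g) + k, m)"
  shows "bp.ends (b_act_op g r x) = Some (r + length (os_cod g) + k, m)"
  using assms by (cases g) (simp_all add: bo.evs)

fun b_gen_op :: "b_gen \<Rightarrow> 'k b_term set \<Rightarrow> 'k b_term set" where
  "b_gen_op (Cup r) = bU"
| "b_gen_op (Cap r) = bK"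
| "b_gen_op (Sig r i) = bS (i - 1)"
| "b_gen_op (SigInv r i) = bSi (i - 1)"

lemma b_apply_gen_right:
  assumes "b_sig f a b" and x: "bp.ends x = Some (a + k, m)"
  shows "Bcmp (Bcls (CGen (b_gen_right k f))) x = b_gen_op f x \<and> bp.ends (b_gen_op f x) = Some (b + k, m)"
proof (cases f)
  case (Sig r i)
  then show ?thesis using assms b_apply_sig(1)[of x "r + k" m "i - 1"] by simp
next
  case (SigInv r i)
  then show ?thesis using assms b_apply_sig(2)[of x "r + k" m "i - 1"] by simp
qed (use assms in \<open>simp_all add: b_apply_U b_apply_K bo.ev\<close>)

text \<open>The interchange law for generators: \<open>f\<close> changes the number of strands on
  the left from \<open>a\<close> to \<open>b\<close>, and with it the position at which
  \<open>g\<close> acts. Each case is one of the rules for moving crossings, cups or caps past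
  \<open>pass_cup\<close> and \<open>pass_cap\<close>.\<close>

lemma b_ops_commute:
  assumes f: "b_sig f a b" and x: "bp.ends x = Some (a + length (os_dom g), m)"
  shows "b_act_op g b (b_gen_op f x) = b_gen_op f (b_act_op g a x)"
proof (cases f)
  case (Cup r)
  then show ?thesis using f x
    by (cases g) (simp_all add: bo.U_S bo.U_Si bo.C_U bo.Cb_U bo.E_U bo.Eb_U bo.U_sc bo.evs
      del: pass_cup.simps pass_cap.simps)
next
  case (Cap r)
  then show ?thesis using f x
    by (cases g) (simp_all add: bo.K_S bo.K_Si bo.K_C bo.K_Cb bo.E_K bo.Eb_K bo.K_sc bo.evs
      del: pass_cup.simps pass_cap.simps)
next
  case (Sig r i)
  then obtain j where "i = Suc j" "Suc j < a" "a = r" "b = r" using f by (cases i) auto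
  then show ?thesis using x Sig bo.far_S[of j r]
    by (cases g) (simp_all add: bo.far_S_Si bo.C_S_less bo.Cb_S_less bo.E_S_less bo.Eb_S_less bo.S_sc bo.evs)
next
  case (SigInv r i)
  then obtain j where "i = Suc j" "Suc j < a" "a = r" "b = r" using f by (cases i) auto
  then show ?thesis using x SigInv bo.far_Si[of j r]
    by (cases g) (simp_all add: bo.far_Si_S bo.C_Si_less bo.Cb_Si_less bo.E_Si_less bo.Eb_Si_less bo.Si_sc bo.evs)
qed

lemma b_ends_id: "bp.ends (ident bp.cat n) = Some (n, n)"
  using bp.cat.ident_hom by (simp add: bp.ends_iff)

text \<open>A morphism is recovered from its operator by applying it to the identity.\<close>

lemma b_eq_apply:
  assumes "ctyp b_sig u n l" "ctyp b_sig v n l"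
    and "\<And>x. bp.ends x = Some (n, n) \<Longrightarrow> Bcmp (Bcls u) x = Bcmp (Bcls v) x"
  shows "Bcls u = Bcls v"
proof -
  have "Bcls w = Bcmp (Bcls w) (ident bp.cat n)" if "ctyp b_sig w n l" for w
    using bp.cmp_ident_right[of "Bcls w" n l] that by simp
  then show ?thesis using assms b_ends_id by metis
qed

abbreviation "BA r u \<equiv> Bcls (b_act q t r u)"
abbreviation "BR n f \<equiv> bright.map_mor n f"

lemma BR_cls: "ctyp b_sig u m l \<Longrightarrow> BR n (Bcls u) = Bcls (b_right n u)"
  unfolding b_right_def by (rule bright.map_cls)

lemma BA_hom: "mtyp os_sig u X Y \<Longrightarrow> BA r u \<in> hom bp.cat (r + length X) (r + length Y)"
  using ctyp_b_act by simp

lemma BA_simps: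
  "BA r (u \<odot> v) = Bcmp (BA r u) (BA r v)"
  "mtyp os_sig u X Y \<Longrightarrow> mtyp os_sig v Z W \<Longrightarrow>
    BA r (u \<boxtimes> v) = Bcmp (BA (r + length Y) v) (BR (length Z) (BA r u))"
  "BA r (MAdd u v) = add_mor bp.cat (BA r u) (BA r v)"
  "BA r (MScale a u) = scale_mor bp.cat a (BA r u)"
  "BA r (MZero X Y) = zero_mor bp.cat (r + length X) (r + length Y)"
  "BA r (MId X) = ident bp.cat (r + length X)"
  by (simp_all add: bp.cmp_cls bp.add_cls bp.scale_cls bp.zero_cls bp.ident_cls BR_cls[OF ctyp_b_act] os_typ)

lemma BR_BR: "f \<in> hom bp.cat m l \<Longrightarrow> BR n (BR k f) = BR (k + n) f"
  by (elim bp.hom_obtain) (simp add: BR_cls[OF ctyp_b_right] BR_cls b_right_add)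

lemma BR_functor: "linear_functor bp.cat bp.cat (\<lambda>r. r + n) (BR n)"
  by (rule bright.functor_map)

lemma BR_hom: "f \<in> hom bp.cat m l \<Longrightarrow> BR n f \<in> hom bp.cat (m + n) (l + n)"
  using cat_functor.fun_hom[OF linear_functor.axioms(1)[OF BR_functor]] .

lemma BR_cmp: "f \<in> hom bp.cat m l \<Longrightarrow> g \<in> hom bp.cat l k \<Longrightarrow> BR n (Bcmp g f) = Bcmp (BR n g) (BR n f)"
  using cat_functor.fun_cmp[OF linear_functor.axioms(1)[OF BR_functor]] .

text \<open>The induction leaves \<open>f\<close> arbitrary, because in a tensor product the right
  factor meets \<open>f\<close> with the strands of \<open>Y1\<close> added on the right.\<close>

lemma BA_natural_gen:
  assumes u: "mtyp os_sig u X Y" and f: "b_sig f a b"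
  shows "Bcmp (BA b u) (BR (length X) (Bcls (CGen f))) = Bcmp (BR (length Y) (Bcls (CGen f))) (BA a u)"
  using u f
proof (induction u arbitrary: X Y a b f)
  case (MGen g)
  then have XY: "X = os_dom g" "Y = os_cod g" by (simp_all add: mtyp_simps os_sig_def)
  let ?f = "CGen f :: 'k b_term"
  have tf: "ctyp b_sig ?f a b" using MGen by (simp add: ctyp_simps)
  show ?case unfolding BR_cls[OF tf] bp.cmp_cls b_act.simps
  proof (rule b_eq_apply)
    show "ctyp b_sig (b_act_gen q t b g \<star> b_right (length X) ?f) (a + length X) (b + length Y)"
      using ctyp_b_right[OF tf, of "length X"] ctyp_b_act_gen[of q t b g] XY by (auto simp: ctyp_simps)
    show "ctyp b_sig (b_right (length Y) ?f \<star> b_act_gen q t a g) (a + length X) (b + length Y)"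
      using ctyp_b_right[OF tf, of "length Y"] ctyp_b_act_gen[of q t a g] XY by (auto simp: ctyp_simps)
    fix x assume x: "bp.ends x = Some (a + length X, a + length X)"
    note fx = b_apply_gen_right[OF MGen.prems(2), of x "length X" "a + length X"]
    note gx = b_apply_gen[of x a g 0 "a + length X"] b_act_op_ends[of x a g 0 "a + length X"]
    show "Bcmp (Bcls (b_act_gen q t b g \<star> b_right (length X) ?f)) x
        = Bcmp (Bcls (b_right (length Y) ?f \<star> b_act_gen q t a g)) x"
      unfolding bp.cmp_cls_comp b_right_simps
      using x fx gx b_apply_gen[of "b_gen_op f x" b g 0 "a + length X"]
        b_apply_gen_right[OF MGen.prems(2), of "b_act_op g a x" "length Y" "a + length X"]
        b_ops_commute[OF MGen.prems(2), of x g "a + length X"]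
      by (simp add: XY)
  qed
next
  case (MId Z)
  then have "X = Z" "Y = Z" by (auto simp: mtyp_simps)
  moreover have "BR (length Z) (Bcls (CGen f)) \<in> hom bp.cat (a + length Z) (b + length Z)"
    using MId by (intro BR_hom) (simp add: ctyp_simps)
  ultimately show ?case by (simp only: BA_simps bp.cmp_ident_left bp.cmp_ident_right)
next
  case (MComp u v)
  then obtain Z where u: "mtyp os_sig u Z Y" and v: "mtyp os_sig v X Z" by (auto simp: mtyp_simps)
  show ?case
    unfolding BA_simps bp.cmp_assoc MComp.IH(2)[OF v MComp.prems(2)]
    unfolding bp.cmp_assoc[symmetric] MComp.IH(1)[OF u MComp.prems(2)] ..
next
  case (MTens u v)
  then obtain X1 X2 Y1 Y2 where u: "mtyp os_sig u X1 Y1" and v: "mtyp os_sig v X2 Y2"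
    and XY: "X = X1 @ X2" "Y = Y1 @ Y2" by (auto simp: mtyp_simps)
  let ?F = "Bcls (CGen f)"
  have F: "?F \<in> hom bp.cat a b" using MTens by (simp add: ctyp_simps)
  have f': "b_sig (b_gen_right (length Y1) f) (a + length Y1) (b + length Y1)"
    using ctyp_b_right[of "CGen f" a b "length Y1"] MTens.prems by (simp add: ctyp_simps)
  have F': "Bcls (CGen (b_gen_right (length Y1) f)) = BR (length Y1) ?F"
    using BR_cls[of "CGen f" a b "length Y1"] MTens.prems by (simp add: ctyp_simps)
  have "Bcmp (BA b (u \<boxtimes> v)) (BR (length X) ?F)
    = Bcmp (BA (b + length Y1) v) (Bcmp (BR (length X2) (BA b u)) (BR (length X2) (BR (length X1) ?F)))"
    unfolding BA_simps(2)[OF u v] XY bp.cmp_assoc length_append BR_BR[OF F] ..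
  also have "\<dots> = Bcmp (BA (b + length Y1) v) (BR (length X2) (Bcmp (BR (length Y1) ?F) (BA a u)))"
    unfolding MTens.IH(1)[OF u MTens.prems(2), symmetric] BR_cmp[OF BR_hom[OF F] BA_hom[OF u]] ..
  also have "\<dots> = Bcmp (Bcmp (BA (b + length Y1) v) (BR (length X2) (BR (length Y1) ?F))) (BR (length X2) (BA a u))"
    unfolding BR_cmp[OF BA_hom[OF u] BR_hom[OF F]] bp.cmp_assoc ..
  also have "\<dots> = Bcmp (BR (length Y) ?F) (BA a (u \<boxtimes> v))"
    unfolding MTens.IH(2)[OF v f', unfolded F'] unfolding BR_BR[OF F] BA_simps(2)[OF u v] bp.cmp_assoc XY
      length_append ..
  finally show ?case .
next
  case (MZero V W)
  then have XY: "X = V" "Y = W" by (simp_all add: mtyp_simps)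
  have F: "Bcls (CGen f) \<in> hom bp.cat a b" using MZero by (simp add: ctyp_simps)
  show ?case unfolding BA_simps XY bp.cat.cmp_zero_left[OF BR_hom[OF F]] bp.cat.cmp_zero_right[OF BR_hom[OF F]] ..
next
  case (MAdd u v)
  then have u: "mtyp os_sig u X Y" and v: "mtyp os_sig v X Y" by (auto simp: mtyp_simps)
  have F: "Bcls (CGen f) \<in> hom bp.cat a b" using MAdd by (simp add: ctyp_simps)
  show ?case unfolding BA_simps bp.cat.cmp_add_left[OF BR_hom[OF F] BA_hom[OF u] BA_hom[OF v]]
      bp.cat.cmp_add_right[OF BA_hom[OF u] BA_hom[OF v] BR_hom[OF F]]
      MAdd.IH(1)[OF u MAdd.prems(2)] MAdd.IH(2)[OF v MAdd.prems(2)] ..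
next
  case (MScale c u)
  then have u: "mtyp os_sig u X Y" by (auto simp: mtyp_simps)
  have F: "Bcls (CGen f) \<in> hom bp.cat a b" using MScale by (simp add: ctyp_simps)
  show ?case unfolding BA_simps bp.cat.cmp_scale_left[OF BR_hom[OF F] BA_hom[OF u]]
      bp.cat.cmp_scale_right[OF BA_hom[OF u] BR_hom[OF F]] MScale.IH[OF u MScale.prems(2)] ..
qed

text \<open>The interchange law for the action. It makes the tensor product well defined in
  \<open>BA_cong\<close> and is itself an axiom of a module.\<close>

lemma BA_natural:
  assumes u: "mtyp os_sig u X Y" and f: "f \<in> hom bp.cat a b"
  shows "Bcmp (BA b u) (BR (length X) f) = Bcmp (BR (length Y) f) (BA a u)"
  by (rule bp.natural_extend[OF bp.linear_category_cat BR_functor BR_functor BA_hom[OF u] _ f])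
    (rule BA_natural_gen[OF u])

lemma b_apply_gen':
  "b_tgt x = Some (r + length (os_dom g)) \<Longrightarrow> Bcmp (Bcls (b_act_gen q t r g)) x = b_act_op g r x"
  "b_tgt x = Some (r + length (os_dom g) + k) \<Longrightarrow> Bcmp (Bcls (b_right k (b_act_gen q t r g))) x = b_act_op g r x"
  using b_apply_gen[of x r g 0] b_apply_gen[of x r g k] by auto

lemma b_apply_scale_id: "b_tgt x = Some n \<Longrightarrow> Bcmp (Bcls (CScale a (CId n))) x = scale_mor bp.cat a x"
  using b_cmp_scale_id by (auto simp: bp.ends_iff)

lemma scalars: "q * ti * (qi * t) = 1" "qi * t * (q * ti) = 1"
proof -
  have "q * ti * (qi * t) = (q * qi) * (t * ti)" by (simp add: mult_ac)
  then show "q * ti * (qi * t) = 1" by (simp add: q_unit t_unit)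
  then show "qi * t * (q * ti) = 1" by (simp add: mult_ac)
qed

lemma scalar_cancel:
  "bp.ends x \<noteq> None \<Longrightarrow> scale_mor bp.cat (q * ti) (scale_mor bp.cat (qi * t) x) = x"
  "bp.ends x \<noteq> None \<Longrightarrow> scale_mor bp.cat (qi * t) (scale_mor bp.cat (q * ti) x) = x"
  by (auto simp: bo.sc_sc bo.sc_1 scalars bo.has_def)

lemma Eb_sc: "bo.has (Suc (Suc r)) x \<Longrightarrow> bo.Eb r (scale_mor bp.cat a x) = scale_mor bp.cat a (bo.Eb r x)"
  using brauer_operators.E_sc[OF bo.mirror, of r x a]
  by (simp add: bo.has_def strand_operators.has_def[OF brauer_operators.axioms(1)[OF bo.mirror]])

lemmas b_apply_simps = bp.cmp_cls_comp b_apply_gen' b_apply_id b_apply_scale_id b_right_add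

text \<open>The scalar of \<open>d\<close> cancels the one in \<open>cross_right\<close>: the action
  of \<open>R_+\<close> is exactly the crossing.\<close>

lemma b_apply_R:
  assumes "bo.has (Suc (Suc r)) x"
  shows "scale_mor bp.cat (q * ti) (bo.Eb (Suc (Suc r)) (bS (Suc r) (bo.C r x))) = bS r x"
proof -
  from assms obtain k m where [simp]: "bp.ends x = Some (Suc (Suc r) + k, m)" by (rule bo.stE)
  show ?thesis using bo.cross_right[OF assms] by (simp add: scalar_cancel bo.ev)
qed

lemma b_apply_L:
  assumes "bo.has (Suc (Suc r)) x"
  shows "scale_mor bp.cat (qi * t) (bo.E r (bSi (Suc r) (bo.Cb (Suc (Suc r)) x))) = bSi r x"
proof -
  from assms obtain k m where [simp]: "bp.ends x = Some (Suc (Suc r) + k, m)" by (rule bo.stE)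
  show ?thesis using bo.cross_left[OF assms]
    by (simp add: scalar_cancel bo.ev)
qed

text \<open>Evaluation on \<open>x\<close> turns both sides into operators. What remains is
  cancellation of crossings, the braid relation, or one of the composites of passing cups and caps
  computed above.\<close>

lemma BA_rel:
  assumes R: "os_rel q t \<delta> u v" and u: "mtyp os_sig u X Y" and v: "mtyp os_sig v X Y"
  shows "BA r u = BA r v"
proof (rule b_eq_apply[OF ctyp_b_act[OF u] ctyp_b_act[OF v]])
  fix x assume x: "bp.ends x = Some (r + length X, r + length X)"
  note S = b_apply_simps b_apply_R b_apply_L bo.evs bo.inv scalar_cancel bo.S_sc bo.Si_sc bo.E_sc Eb_sc
  note D = pass_cup.simps pass_cap.simps b_act_gen.simps
  have src: "X = os_src v" using os_typ[OF v] by simp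
  show "Bcmp (BA r u) x = Bcmp (BA r v) x" using R
  proof cases
    case 1 then show ?thesis using x src by (simp add: S del: D)
  next
    case 2 then show ?thesis using x src by (simp add: S del: D)
  next
    case 3 then show ?thesis using x src bo.S_braid[of r x] by (simp add: S del: D)
  next
    case 4 then show ?thesis using x src by (simp add: os_L_def os_R_def S del: D)
  next
    case 5 then show ?thesis using x src by (simp add: os_L_def os_R_def S del: D)
  next
    case 6
    \<comment> \<open>The skein relation is literally a relation of the Brauer category, so it is
      used on terms and not evaluated.\<close>
    have "b_rel q t \<delta> (b_act q t r u) (b_act q t r v)"
      using 6 b_rel.intros(5)[of q t \<delta> "r + 2" "r + 1"] by simp
    from bp.cls_rel[OF this ctyp_b_act[OF u] ctyp_b_act[OF v]] show ?thesis by simp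
  next
    case 7 then show ?thesis using x src bo.curl1[of r x] by (simp add: S del: D)
  next
    case 8 then show ?thesis using x src bo.curl2[of r x] by (simp add: S del: D)
  next
    case 9 then show ?thesis using x src bo.loop[of r x] by (simp add: S del: D)
  next
    case 10 then show ?thesis using x src bo.zigzag1[of r x] by (simp add: S del: D)
  next
    case 11 then show ?thesis using x src bo.zigzag2[of r x] by (simp add: S del: D)
  qed
qed

end

lemma lincat_extend_simps [simp]:
  "hom (lincat.extend C m) = hom C" "ident (lincat.extend C m) = ident C"
  "cmp (lincat.extend C m) = cmp C" "zero_mor (lincat.extend C m) = zero_mor C"
  "add_mor (lincat.extend C m) = add_mor C" "scale_mor (lincat.extend C m) = scale_mor C"
  by (simp_all add: lincat.defs)

lemma linear_category_extend: "linear_category (lincat.extend C m) \<longleftrightarrow> linear_category C"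
  unfolding linear_category_def by simp

lemma cat_functor_extend:
  "cat_functor (lincat.extend C m) (lincat.extend D m') FO FM \<longleftrightarrow> cat_functor C D FO FM"
  unfolding cat_functor_def by simp

lemma linear_functor_extend:
  "linear_functor (lincat.extend C m) (lincat.extend D m') FO FM \<longleftrightarrow> linear_functor C D FO FM"
  unfolding linear_functor_def linear_functor_axioms_def cat_functor_extend by simp

context skein_parameters begin

text \<open>The axioms of a linear category transfer clause by clause. The clause that carries
  content is \<open>tens_comp\<close>, the interchange law, which rests on
  \<open>BA_natural\<close>.\<close>

lemma BA_cong: "(u, v) \<in> os_cong q t \<delta> \<Longrightarrow> BA r u = BA r v"
proof (induction arbitrary: r rule: mcong.induct)
  case (rel u v X Y) then show ?case by (rule BA_rel)
next
  case (cong_comp s s' t t' Y Z X) then show ?case unfolding BA_simps by simp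
next
  case (cong_tens s s' t t')
  obtain X Y where s: "mtyp os_sig s X Y" "mtyp os_sig s' X Y"
    using osp.mcong_typed[OF cong_tens.hyps(1)] by blast
  obtain Z W where t: "mtyp os_sig t Z W" "mtyp os_sig t' Z W"
    using osp.mcong_typed[OF cong_tens.hyps(2)] by blast
  show ?case unfolding BA_simps(2)[OF s(1) t(1)] BA_simps(2)[OF s(2) t(2)] cong_tens.IH ..
next
  case (cong_add s s' t t' X Y) then show ?case unfolding BA_simps by simp
next
  case (cong_scale s s' a) then show ?case unfolding BA_simps by simp
next
  case (id_left s X Y) then show ?case unfolding BA_simps by (rule bp.cmp_ident_left[OF BA_hom])
next
  case (id_right s X Y) then show ?case unfolding BA_simps by (rule bp.cmp_ident_right[OF BA_hom])
next
  case comp_assoc show ?case unfolding BA_simps by (rule bp.cmp_assoc)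
next
  case add_assoc show ?case unfolding BA_simps by (rule bp.add_assoc_cat)
next
  case add_commute show ?case unfolding BA_simps by (rule bp.add_commute_cat)
next
  case (add_zero s X Y) then show ?case unfolding BA_simps by (rule bp.cat.add_zero[OF BA_hom])
next
  case (add_minus s X Y)
  note h = BA_hom[OF add_minus]
  show ?case unfolding BA_simps
    using bp.cat.scale_add_left[OF h, of 1 "- 1"] bp.cat.scale_zero[OF h] bp.cat.scale_one[OF h] by simp
next
  case (scale_add_right s X Y t a)
  then show ?case unfolding BA_simps by (rule bp.cat.scale_add_right[OF BA_hom BA_hom])
next
  case (scale_add_left s X Y a b)
  then show ?case unfolding BA_simps by (rule bp.cat.scale_add_left[OF BA_hom])
next
  case (scale_scale s X Y a b)
  then show ?case unfolding BA_simps by (rule bp.cat.scale_scale[OF BA_hom])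
next
  case (scale_one s X Y)
  then show ?case unfolding BA_simps by (rule bp.cat.scale_one[OF BA_hom])
next
  case (comp_add_left s Y Z t u X)
  show ?case unfolding BA_simps by (rule bp.cat.cmp_add_left[OF BA_hom[OF comp_add_left(3)] BA_hom[OF comp_add_left(1)] BA_hom[OF comp_add_left(2)]])
next
  case (comp_add_right s Y Z t X u)
  show ?case unfolding BA_simps by (rule bp.cat.cmp_add_right[OF BA_hom[OF comp_add_right(2)] BA_hom[OF comp_add_right(3)] BA_hom[OF comp_add_right(1)]])
next
  case (comp_scale_left s Y Z t X a)
  show ?case unfolding BA_simps by (rule bp.cat.cmp_scale_left[OF BA_hom[OF comp_scale_left(2)] BA_hom[OF comp_scale_left(1)]])
next
  case (comp_scale_right s Y Z t X a)
  show ?case unfolding BA_simps by (rule bp.cat.cmp_scale_right[OF BA_hom[OF comp_scale_right(2)] BA_hom[OF comp_scale_right(1)]])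
next
  case (tens_assoc s X Y t Z W u U V)
  note st = mtyp.intros(4)[OF tens_assoc(1,2)] and tu = mtyp.intros(4)[OF tens_assoc(2,3)]
  show ?case
    unfolding BA_simps(2)[OF st tens_assoc(3)] BA_simps(2)[OF tens_assoc(1) tu]
      BA_simps(2)[OF tens_assoc(1,2)] BA_simps(2)[OF tens_assoc(2,3)]
      BR_cmp[OF BR_hom[OF BA_hom[OF tens_assoc(1)]] BA_hom[OF tens_assoc(2), of "r + length Y"]]
      BR_BR[OF BA_hom[OF tens_assoc(1)]] bp.cmp_assoc by (simp only: length_append add.assoc)
next
  case (tens_unit_left s X Y)
  have "BA r (MId [] \<boxtimes> s) = Bcmp (BA r s) (ident bp.cat (r + length X))"
    unfolding BA_simps(2)[OF mtyp.intros(2) tens_unit_left] BA_simps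
    using cat_functor.fun_ident[OF linear_functor.axioms(1)[OF BR_functor]] by simp
  also have "\<dots> = BA r s" by (rule bp.cmp_ident_right[OF BA_hom[OF tens_unit_left]])
  finally show ?case .
next
  case (tens_unit_right s X Y)
  have "BR 0 (BA r s) = BA r s" unfolding BR_cls[OF ctyp_b_act[OF tens_unit_right]] b_right_0 ..
  then have "BA r (s \<boxtimes> MId []) = Bcmp (ident bp.cat (r + length Y)) (BA r s)"
    unfolding BA_simps(2)[OF tens_unit_right mtyp.intros(2)] BA_simps by simp
  also have "\<dots> = BA r s" by (rule bp.cmp_ident_left[OF BA_hom[OF tens_unit_right]])
  finally show ?case .
next
  case (tens_ident X Y)
  have "BR (length Y) (ident bp.cat (r + length X)) = ident bp.cat (r + length X + length Y)"
    by (rule cat_functor.fun_ident[OF linear_functor.axioms(1)[OF BR_functor]])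
  then show ?case
    unfolding BA_simps(2)[OF mtyp.intros(2) mtyp.intros(2)] BA_simps
    using bp.cmp_ident_left[OF bp.cat.ident_hom] by (simp add: add.assoc)
next
  case (tens_comp s Y Z t X s' V W t' U)
  note h = BA_hom[OF tens_comp(1)] BA_hom[OF tens_comp(2)] BA_hom[OF tens_comp(3)] BA_hom[OF tens_comp(4)]
  have "BA r ((s \<odot> t) \<boxtimes> (s' \<odot> t'))
    = Bcmp (BA (r + length Z) s') (Bcmp (Bcmp (BA (r + length Z) t') (BR (length U) (BA r s))) (BR (length U) (BA r t)))"
    unfolding BA_simps(2)[OF mtyp.intros(3)[OF tens_comp(1,2)] mtyp.intros(3)[OF tens_comp(3,4)]]
      BA_simps(1) BR_cmp[OF h(2,1)] bp.cmp_assoc ..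
  also have "Bcmp (BA (r + length Z) t') (BR (length U) (BA r s))
    = Bcmp (BR (length V) (BA r s)) (BA (r + length Y) t')"
    by (rule BA_natural[OF tens_comp(4) h(1)])
  finally show ?case
    unfolding BA_simps(1) BA_simps(2)[OF tens_comp(1,3)] BA_simps(2)[OF tens_comp(2,4)] bp.cmp_assoc .
next
  case (tens_add_left s X Y t u Z W)
  note h = BA_hom[OF tens_add_left(1)] BA_hom[OF tens_add_left(2)]
  show ?case
    unfolding BA_simps(2)[OF mtyp.intros(6)[OF tens_add_left(1,2)] tens_add_left(3)]
      BA_simps(3) BA_simps(2)[OF tens_add_left(1,3)] BA_simps(2)[OF tens_add_left(2,3)]
      linear_functor.fun_add[OF BR_functor h]
    by (rule bp.cat.cmp_add_right[OF BR_hom[OF h(1)] BR_hom[OF h(2)] BA_hom[OF tens_add_left(3)]])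
next
  case (tens_add_right s X Y t Z W u)
  show ?case
    unfolding BA_simps(2)[OF tens_add_right(1) mtyp.intros(6)[OF tens_add_right(2,3)]]
      BA_simps(3) BA_simps(2)[OF tens_add_right(1,2)] BA_simps(2)[OF tens_add_right(1,3)]
    by (rule bp.cat.cmp_add_left[OF BR_hom[OF BA_hom[OF tens_add_right(1)]]
        BA_hom[OF tens_add_right(2)] BA_hom[OF tens_add_right(3)]])
next
  case (tens_scale_left s X Y t Z W a)
  note h = BA_hom[OF tens_scale_left(1)]
  show ?case
    unfolding BA_simps(2)[OF mtyp.intros(7)[OF tens_scale_left(1)] tens_scale_left(2)]
      BA_simps(4) BA_simps(2)[OF tens_scale_left] linear_functor.fun_scale[OF BR_functor h]
    by (rule bp.cat.cmp_scale_right[OF BR_hom[OF h] BA_hom[OF tens_scale_left(2)]])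
next
  case (tens_scale_right s X Y t Z W a)
  show ?case
    unfolding BA_simps(2)[OF tens_scale_right(1) mtyp.intros(7)[OF tens_scale_right(2)]]
      BA_simps(4) BA_simps(2)[OF tens_scale_right]
    by (rule bp.cat.cmp_scale_left[OF BR_hom[OF BA_hom[OF tens_scale_right(1)]] BA_hom[OF tens_scale_right(2)]])
qed simp_all

lemma BR_0: "f \<in> hom bp.cat a b \<Longrightarrow> BR 0 f = f"
  by (elim bp.hom_obtain) (simp only: BR_cls b_right_0)

lemma iB_simps [simp]:
  "hom (iB q t \<delta>) = hom bp.cat" "ident (iB q t \<delta>) = ident bp.cat" "cmp (iB q t \<delta>) = Bcmp"
  "zero_mor (iB q t \<delta>) = zero_mor bp.cat" "add_mor (iB q t \<delta>) = add_mor bp.cat"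
  "scale_mor (iB q t \<delta>) = scale_mor bp.cat"
  "act_ob (iB q t \<delta>) r \<mu> = r + length \<mu>" "act_mor (iB q t \<delta>) f \<mu> = BR (length \<mu>) f"
  by (simp_all add: iB_def lincat.defs lin_rmodule.defs bright.map_mor_def bp.cls_def b_right_def)

lemma act_nat_iB: "mtyp os_sig u X Y \<Longrightarrow> act_nat (iB q t \<delta>) r (osp.cls u) = BA r u"
proof -
  assume u: "mtyp os_sig u X Y"
  have "act_nat (iB q t \<delta>) r (osp.cls u) = (\<Union>s\<in>osp.cls u. BA r s)"
    by (simp add: iB_def lincat.defs lin_rmodule.defs bp.cls_def)
  moreover have "BA r s = BA r u" if "s \<in> osp.cls u" for s
    using BA_cong[of u s] that by (simp add: osp.in_cls)
  ultimately show ?thesis using osp.self_in_cls[OF u] by blast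
qed

lemma linear_functor_iB: "linear_functor (iB q t \<delta>) (iB q t \<delta>) FO FM \<longleftrightarrow> linear_functor bp.cat bp.cat FO FM"
  unfolding iB_def by (rule linear_functor_extend)

lemma OS_eq: "OS q t \<delta> = osp.cat"
  by (simp add: OS_def)

lemma right_module_iB: "right_module (OS q t \<delta>) (iB q t \<delta>)"
proof -
  have "linear_category (iB q t \<delta>)"
    unfolding iB_def linear_category_extend by (rule bp.linear_category_cat)
  then interpret M: linear_category "iB q t \<delta>" .
  interpret S: linear_monoidal_category "OS q t \<delta>"
    unfolding OS_eq by (rule osp.linear_monoidal_category_cat)
  show ?thesis
  proof (rule right_module.intro[OF S.linear_monoidal_category_axioms M.linear_category_axioms],
      rule right_module_axioms.intro)
    show "linear_functor (iB q t \<delta>) (iB q t \<delta>) (\<lambda>X. act_ob (iB q t \<delta>) X c) (\<lambda>f. act_mor (iB q t \<delta>) f c)" for c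
      unfolding linear_functor_iB iB_simps by (rule BR_functor)
  next
    fix g c d r assume "g \<in> hom (OS q t \<delta>) c d"
    then obtain u where u: "g = osp.cls u" "mtyp os_sig u c d" unfolding OS_eq by (rule osp.hom_obtain)
    show "act_nat (iB q t \<delta>) r g \<in> hom (iB q t \<delta>) (act_ob (iB q t \<delta>) r c) (act_ob (iB q t \<delta>) r d)"
      unfolding u(1) act_nat_iB[OF u(2)] iB_simps by (rule BA_hom[OF u(2)])
    show "act_nat (iB q t \<delta>) r (scale_mor (OS q t \<delta>) a g) = scale_mor (iB q t \<delta>) a (act_nat (iB q t \<delta>) r g)" for a
      unfolding u(1) OS_eq osp.scale_cls act_nat_iB[OF u(2)] act_nat_iB[OF mtyp.intros(7)[OF u(2)]]
        iB_simps BA_simps ..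
    show "cmp (iB q t \<delta>) (act_nat (iB q t \<delta>) b g) (act_mor (iB q t \<delta>) f c)
        = cmp (iB q t \<delta>) (act_mor (iB q t \<delta>) f d) (act_nat (iB q t \<delta>) a g)"
      if "f \<in> hom (iB q t \<delta>) a b" for f a b
      using that BA_natural[OF u(2)] unfolding u(1) act_nat_iB[OF u(2)] iB_simps by blast
    show "act_nat (iB q t \<delta>) r (add_mor (OS q t \<delta>) g h)
        = add_mor (iB q t \<delta>) (act_nat (iB q t \<delta>) r g) (act_nat (iB q t \<delta>) r h)"
      if h: "h \<in> hom (OS q t \<delta>) c d" for h
    proof -
      obtain v where v: "h = osp.cls v" "mtyp os_sig v c d"
        using h unfolding OS_eq by (rule osp.hom_obtain)
      show ?thesis
        unfolding u(1) v(1) OS_eq osp.add_cls act_nat_iB[OF u(2)] act_nat_iB[OF v(2)]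
          act_nat_iB[OF mtyp.intros(6)[OF u(2) v(2)]] iB_simps BA_simps ..
    qed
    show "act_nat (iB q t \<delta>) r (cmp (OS q t \<delta>) h g)
        = cmp (iB q t \<delta>) (act_nat (iB q t \<delta>) r h) (act_nat (iB q t \<delta>) r g)"
      if h: "h \<in> hom (OS q t \<delta>) d e" for h e
    proof -
      obtain v where v: "h = osp.cls v" "mtyp os_sig v d e"
        using h unfolding OS_eq by (rule osp.hom_obtain)
      show ?thesis
        unfolding u(1) v(1) OS_eq osp.cmp_cls act_nat_iB[OF u(2)] act_nat_iB[OF v(2)]
          act_nat_iB[OF mtyp.intros(3)[OF v(2) u(2)]] iB_simps BA_simps ..
    qed
    show "act_nat (iB q t \<delta>) r (tens_mor (OS q t \<delta>) g h)
        = cmp (iB q t \<delta>) (act_nat (iB q t \<delta>) (act_ob (iB q t \<delta>) r d) h)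
            (act_mor (iB q t \<delta>) (act_nat (iB q t \<delta>) r g) e)"
      if h: "h \<in> hom (OS q t \<delta>) e e'" for h e e'
    proof -
      obtain v where v: "h = osp.cls v" "mtyp os_sig v e e'"
        using h unfolding OS_eq by (rule osp.hom_obtain)
      show ?thesis
        unfolding u(1) v(1) OS_eq osp.tens_cls act_nat_iB[OF u(2)] act_nat_iB[OF v(2)]
          act_nat_iB[OF mtyp.intros(4)[OF u(2) v(2)]] iB_simps BA_simps(2)[OF u(2) v(2)] ..
    qed
  next
    show "act_nat (iB q t \<delta>) r (ident (OS q t \<delta>) c) = ident (iB q t \<delta>) (act_ob (iB q t \<delta>) r c)" for r c
      unfolding OS_eq osp.ident_cls act_nat_iB[OF mtyp.intros(2)] iB_simps BA_simps ..
    show "act_ob (iB q t \<delta>) r (unit_ob (OS q t \<delta>)) = r" for r by (simp add: OS_eq osp.unit_ob_cat)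
    show "act_mor (iB q t \<delta>) f (unit_ob (OS q t \<delta>)) = f" if "f \<in> hom (iB q t \<delta>) a b" for f a b
      using that unfolding iB_simps OS_eq osp.unit_ob_cat list.size by (rule BR_0)
    show "act_ob (iB q t \<delta>) r (tens_ob (OS q t \<delta>) c d) = act_ob (iB q t \<delta>) (act_ob (iB q t \<delta>) r c) d" for r c d
      by (simp add: OS_eq osp.tens_ob_cat)
    show "act_mor (iB q t \<delta>) f (tens_ob (OS q t \<delta>) c d) = act_mor (iB q t \<delta>) (act_mor (iB q t \<delta>) f c) d"
      if "f \<in> hom (iB q t \<delta>) a b" for f a b c d
      using that BR_BR by (simp add: OS_eq osp.tens_ob_cat)
  qed
qed

end

section \<open>The disoriented skein category as a module\<close>

context monoidal_presentation begin

lemma cls_tens_assoc: "cls (s \<boxtimes> t \<boxtimes> u) = cls (s \<boxtimes> (t \<boxtimes> u))"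
  by (rule cls_eqI) (auto simp: mtyp_simps intro: mcong.tens_assoc)

lemma cls_tens_ident: "cls (MId X \<boxtimes> MId Y) = cls (MId (X @ Y))"
  by (rule cls_eq[OF mcong.tens_ident])

lemma cls_tens_unit: "mtyp G s X Y \<Longrightarrow> cls (MId [] \<boxtimes> s) = cls s" "mtyp G s X Y \<Longrightarrow> cls (s \<boxtimes> MId []) = cls s"
  by (rule cls_eq, erule mcong.tens_unit_left mcong.tens_unit_right)+

lemma cls_id: "mtyp G s X Y \<Longrightarrow> cls (MId Y \<odot> s) = cls s" "mtyp G s X Y \<Longrightarrow> cls (s \<odot> MId X) = cls s"
  by (rule cls_eq, erule mcong.id_left mcong.id_right)+

lemma cls_interchange:
  assumes "mtyp G s Y Z" "mtyp G t X Y" "mtyp G s' V W" "mtyp G t' U V"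
  shows "cls ((s \<boxtimes> s') \<odot> (t \<boxtimes> t')) = cls ((s \<odot> t) \<boxtimes> (s' \<odot> t'))"
  by (rule cls_eq[OF mcong.sym[OF mcong.tens_comp[OF assms]]])

text \<open>Both composites are instances of the interchange law with an identity in each tensor
  factor.\<close>

lemma cls_slide:
  assumes h: "mtyp G h X Y" and g: "mtyp G g c d"
  shows "cls ((MId Y \<boxtimes> g) \<odot> (h \<boxtimes> MId c)) = cls (h \<boxtimes> g)"
    and "cls ((h \<boxtimes> MId d) \<odot> (MId X \<boxtimes> g)) = cls (h \<boxtimes> g)"
  using cls_interchange[OF mtyp.intros(2) h g mtyp.intros(2)] cls_interchange[OF h mtyp.intros(2) mtyp.intros(2) g]
    cls_cong_tens[OF cls_id(1)[OF h] cls_id(2)[OF g]] cls_cong_tens[OF cls_id(2)[OF h] cls_id(1)[OF g]]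
  by simp_all

lemma cls_tens_comp_right:
  assumes g: "mtyp G g Y Z" and h: "mtyp G h X Y"
  shows "cls ((g \<odot> h) \<boxtimes> MId V) = cls ((g \<boxtimes> MId V) \<odot> (h \<boxtimes> MId V))"
    and "cls (MId V \<boxtimes> (g \<odot> h)) = cls ((MId V \<boxtimes> g) \<odot> (MId V \<boxtimes> h))"
proof -
  have i: "cls (MId V) = cls (MId V \<odot> MId V)" using cls_id(1)[OF mtyp.intros(2)] by simp
  show "cls ((g \<odot> h) \<boxtimes> MId V) = cls ((g \<boxtimes> MId V) \<odot> (h \<boxtimes> MId V))"
    using cls_interchange[OF g h mtyp.intros(2) mtyp.intros(2)] cls_cong_tens[OF HOL.refl i] by simp
  show "cls (MId V \<boxtimes> (g \<odot> h)) = cls ((MId V \<boxtimes> g) \<odot> (MId V \<boxtimes> h))"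
    using cls_interchange[OF mtyp.intros(2) mtyp.intros(2) g h] cls_cong_tens[OF i HOL.refl] by simp
qed

lemma cls_tens_right_linear:
  "mtyp G g X Y \<Longrightarrow> mtyp G h X Y \<Longrightarrow> cls (MAdd g h \<boxtimes> MId V) = cls (MAdd (g \<boxtimes> MId V) (h \<boxtimes> MId V))"
  "mtyp G g X Y \<Longrightarrow> cls (MScale a g \<boxtimes> MId V) = cls (MScale a (g \<boxtimes> MId V))"
  "mtyp G g X Y \<Longrightarrow> mtyp G h X Y \<Longrightarrow> cls (MId V \<boxtimes> MAdd g h) = cls (MAdd (MId V \<boxtimes> g) (MId V \<boxtimes> h))"
  "mtyp G g X Y \<Longrightarrow> cls (MId V \<boxtimes> MScale a g) = cls (MScale a (MId V \<boxtimes> g))"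
  by (rule cls_eq, rule mcong.tens_add_left mcong.tens_scale_left mcong.tens_add_right mcong.tens_scale_right;
      (assumption | rule mtyp.intros(2)))+

end

lemma ds_sig_simps [simp]:
  "ds_sig (Os g) X Y \<longleftrightarrow> mtyp os_sig g X Y"
  "ds_sig (Tog f g) X Y \<longleftrightarrow> (\<exists>X' Y'. X = tog_dom f # X' \<and> Y = tog_cod f # Y' \<and> mtyp os_sig g X' Y')"
  by (auto simp: ds_sig.simps)

lemma ds_right_simps [simp]:
  "ds_right \<nu> (CGen g) = CGen (ds_gen_right \<nu> g)" "ds_right \<nu> (CId X) = CId (X @ \<nu>)"
  "ds_right \<nu> (u \<star> v) = ds_right \<nu> u \<star> ds_right \<nu> v" "ds_right \<nu> (CZero X Y) = CZero (X @ \<nu>) (Y @ \<nu>)"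
  "ds_right \<nu> (CAdd u v) = CAdd (ds_right \<nu> u) (ds_right \<nu> v)"
  "ds_right \<nu> (CScale a u) = CScale a (ds_right \<nu> u)"
  by (simp_all add: ds_right_def)

lemma mtyp_tens_id: "mtyp os_sig g X Y \<Longrightarrow> mtyp os_sig (g \<boxtimes> MId \<nu>) (X @ \<nu>) (Y @ \<nu>)"
  "mtyp os_sig g X Y \<Longrightarrow> mtyp os_sig (MId \<nu> \<boxtimes> g) (\<nu> @ X) (\<nu> @ Y)"
  by (rule mtyp.intros(4), assumption, rule mtyp.intros(2))
    (rule mtyp.intros(4), rule mtyp.intros(2), assumption)

lemma ctyp_ds_right: "ctyp ds_sig u X Y \<Longrightarrow> ctyp ds_sig (ds_right \<nu> u) (X @ \<nu>) (Y @ \<nu>)"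
proof (induction u arbitrary: X Y)
  case (CGen g) then show ?case by (cases g) (auto simp: ctyp_simps intro: mtyp_tens_id)
qed (fastforce simp: ctyp_simps)+

context skein_parameters begin

sublocale dsp: presentation ds_sig "ds_rel q t \<delta>"
proof
  show "X = X' \<and> Y = Y'" if "ds_sig g X Y" "ds_sig g X' Y'" for g :: "'k ds_gen" and X Y X' Y'
    using that by (cases g) (auto dest: osp.mtyp_unique)
qed

abbreviation "Dcls \<equiv> dsp.cls"
abbreviation "Dcmp \<equiv> cmp dsp.cat"
abbreviation "DO g \<equiv> Dcls (os g)"
abbreviation "DT f g \<equiv> Dcls (CGen (Tog f g))"

text \<open>The relation \<open>os_eq\<close> in terms of classes. An ill-typed expression has an
  empty class in both categories.\<close>

lemma DO_cong: assumes "osp.cls g = osp.cls h" shows "DO g = DO h"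
proof (rule dsp.cls_eqI)
  fix X Y assume "ctyp ds_sig (os g) X Y"
  then have g: "mtyp os_sig g X Y" by (simp add: ctyp_simps)
  with osp.cls_eqD[OF assms] have "(g, h) \<in> os_cong q t \<delta>" by blast
  then show "(os g, os h) \<in> ds_cong q t \<delta>"
    using g osp.mcong_typ[of g h X Y]
    by (intro dsp.cls_eqD[OF dsp.cls_rel[OF ds_rel.os_eq, of g h X Y], of X Y]) (simp_all add: ctyp_simps)
next
  fix X Y assume "ctyp ds_sig (os h) X Y"
  then show "\<exists>X' Y'. ctyp ds_sig (os g) X' Y'"
    using osp.cls_eqD[OF assms[symmetric]] osp.mcong_typ[of h g] by (auto simp: ctyp_simps)
qed

lemma DT_cong: assumes "osp.cls g = osp.cls h" shows "DT f g = DT f h"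
proof (rule dsp.cls_eqI)
  fix X Y assume "ctyp ds_sig (CGen (Tog f g)) X Y"
  then obtain X' Y' where g: "mtyp os_sig g X' Y'" "X = tog_dom f # X'" "Y = tog_cod f # Y'"
    by (auto simp: ctyp_simps)
  with osp.cls_eqD[OF assms] have "(g, h) \<in> os_cong q t \<delta>" by blast
  then show "(CGen (Tog f g), CGen (Tog f h)) \<in> ds_cong q t \<delta>"
    using g osp.mcong_typ[of g h X' Y']
    by (intro dsp.cls_eqD[OF dsp.cls_rel[OF ds_rel.tog_eq, of g h f X Y], of X Y]) (simp_all add: ctyp_simps)
next
  fix X Y assume "ctyp ds_sig (CGen (Tog f h)) X Y"
  then show "\<exists>X' Y'. ctyp ds_sig (CGen (Tog f g) :: 'k ds_term) X' Y'"
    using osp.cls_eqD[OF assms[symmetric]] osp.mcong_typ[of h g] by (simp add: ctyp_simps) blast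
qed

lemma DO_id: "DO (MId X) = ident dsp.cat X"
  unfolding dsp.ident_cls by (rule dsp.cls_rel[OF ds_rel.os_id]) (auto simp: ctyp_simps mtyp_simps)

lemma DO_comp: "mtyp os_sig g Y Z \<Longrightarrow> mtyp os_sig h X Y \<Longrightarrow> DO (g \<odot> h) = Dcmp (DO g) (DO h)"
  unfolding dsp.cmp_cls by (rule dsp.cls_rel[OF ds_rel.os_comp]) (auto simp: ctyp_simps mtyp_simps)

lemma DO_add: "mtyp os_sig g X Y \<Longrightarrow> mtyp os_sig h X Y \<Longrightarrow> DO (MAdd g h) = add_mor dsp.cat (DO g) (DO h)"
  unfolding dsp.add_cls by (rule dsp.cls_rel[OF ds_rel.os_add]) (auto simp: ctyp_simps mtyp_simps)

lemma DO_scale: "mtyp os_sig g X Y \<Longrightarrow> DO (MScale a g) = scale_mor dsp.cat a (DO g)"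
  unfolding dsp.scale_cls by (rule dsp.cls_rel[OF ds_rel.os_scale]) (auto simp: ctyp_simps mtyp_simps)

lemma DT_add: "mtyp os_sig g X Y \<Longrightarrow> mtyp os_sig h X Y \<Longrightarrow> DT f (MAdd g h) = add_mor dsp.cat (DT f g) (DT f h)"
  unfolding dsp.add_cls by (rule dsp.cls_rel[OF ds_rel.tog_add]) (auto simp: ctyp_simps mtyp_simps)

lemma DT_scale: "mtyp os_sig g X Y \<Longrightarrow> DT f (MScale a g) = scale_mor dsp.cat a (DT f g)"
  unfolding dsp.scale_cls by (rule dsp.cls_rel[OF ds_rel.tog_scale]) (auto simp: ctyp_simps mtyp_simps)

lemma DT_left:
  assumes g: "mtyp os_sig g Y Z" and h: "mtyp os_sig h X Y"
  shows "Dcmp (DO (MId [tog_cod f] \<boxtimes> g)) (DT f h) = DT f (g \<odot> h)"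
proof -
  have "mtyp os_sig (MId [tog_cod f] \<boxtimes> g) (tog_cod f # Y) (tog_cod f # Z)"
    using mtyp_tens_id(2)[OF g, of "[tog_cod f]"] by simp
  then show ?thesis unfolding dsp.cmp_cls
    using h mtyp.intros(3)[OF g h] by (intro dsp.cls_rel[OF ds_rel.tog_comp_left]) (auto simp: ctyp_simps)
qed

lemma DT_right:
  assumes g: "mtyp os_sig g Y Z" and h: "mtyp os_sig h X Y"
  shows "Dcmp (DT f g) (DO (MId [tog_dom f] \<boxtimes> h)) = DT f (g \<odot> h)"
proof -
  have "mtyp os_sig (MId [tog_dom f] \<boxtimes> h) (tog_dom f # X) (tog_dom f # Y)"
    using mtyp_tens_id(2)[OF h, of "[tog_dom f]"] by simp
  then show ?thesis unfolding dsp.cmp_cls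
    using g mtyp.intros(3)[OF g h] by (intro dsp.cls_rel[OF ds_rel.tog_comp_right]) (auto simp: ctyp_simps)
qed

lemma DO_hom [simp]: "DO g \<in> hom dsp.cat X Y \<longleftrightarrow> mtyp os_sig g X Y"
  by (simp add: ctyp_simps)

lemma DT_hom: "mtyp os_sig g X Y \<Longrightarrow> DT f g \<in> hom dsp.cat (tog_dom f # X) (tog_cod f # Y)"
  by (simp add: ctyp_simps)

text \<open>Unlike \<open>b_right_add\<close> this holds only up to congruence: on one side the
  terms are tensored with two identities, on the other with one.\<close>

lemma ds_right_right: "Dcls (ds_right \<mu> (ds_right \<nu> u)) = Dcls (ds_right (\<nu> @ \<mu>) u)"
proof (induction u)
  case (CGen g)
  have e: "osp.cls (g \<boxtimes> MId \<nu> \<boxtimes> MId \<mu>) = osp.cls (g \<boxtimes> MId (\<nu> @ \<mu>))" for g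
    using osp.cls_tens_assoc osp.cls_cong_tens[OF HOL.refl osp.cls_tens_ident] by simp
  show ?case by (cases g) (simp_all add: DO_cong[OF e] DT_cong[OF e])
next
  case (CComp u v) then show ?case unfolding ds_right_simps by (rule dsp.cls_cong_comp)
next
  case (CAdd u v) then show ?case unfolding ds_right_simps by (rule dsp.cls_cong_add)
next
  case (CScale a u) then show ?case unfolding ds_right_simps by (rule dsp.cls_cong_scale)
qed simp_all

text \<open>The toggle relations are closed under the right action by definition, up to merging two
  words of identity strands. The other relations follow because tensoring with an identity is
  functorial and linear.\<close>

lemma ds_rel_right:
  assumes R: "ds_rel q t \<delta> u v" and u: "ctyp ds_sig u X Y" and v: "ctyp ds_sig v X Y"
  shows "Dcls (ds_right \<nu> u) = Dcls (ds_right \<nu> v)"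
  using R
proof cases
  case (os_eq g h)
  then show ?thesis using DO_cong[OF osp.cls_cong_tens[OF osp.cls_eq HOL.refl]] by simp
next
  case (tog_eq g h f)
  then show ?thesis using DT_cong[OF osp.cls_cong_tens[OF osp.cls_eq HOL.refl]] by simp
next
  case (os_id Z)
  then show ?thesis using DO_cong[OF osp.cls_tens_ident] DO_id by (simp add: dsp.ident_cls)
next
  case (os_comp g h)
  then obtain Z where g: "mtyp os_sig g Z Y" and h: "mtyp os_sig h X Z"
    using v by (auto simp: ctyp_simps)
  show ?thesis
    using DO_cong[OF osp.cls_tens_comp_right(1)[OF g h]] DO_comp[OF mtyp_tens_id(1)[OF g] mtyp_tens_id(1)[OF h]]
    by (simp add: os_comp dsp.cmp_cls)
next
  case (os_add g h)
  then have g: "mtyp os_sig g X Y" and h: "mtyp os_sig h X Y" using v by (auto simp: ctyp_simps)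
  show ?thesis
    using DO_cong[OF osp.cls_tens_right_linear(1)[OF g h]] DO_add[OF mtyp_tens_id(1)[OF g] mtyp_tens_id(1)[OF h]]
    by (simp add: os_add dsp.add_cls)
next
  case (os_scale a g)
  then have g: "mtyp os_sig g X Y" using v by (auto simp: ctyp_simps)
  show ?thesis
    using DO_cong[OF osp.cls_tens_right_linear(2)[OF g]] DO_scale[OF mtyp_tens_id(1)[OF g]]
    by (simp add: os_scale dsp.scale_cls)
next
  case (tog_add f g h)
  then obtain X' Y' where g: "mtyp os_sig g X' Y'" and h: "mtyp os_sig h X' Y'"
    using v by (auto simp: ctyp_simps)
  show ?thesis
    using DT_cong[OF osp.cls_tens_right_linear(1)[OF g h]] DT_add[OF mtyp_tens_id(1)[OF g] mtyp_tens_id(1)[OF h]]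
    by (simp add: tog_add dsp.add_cls)
next
  case (tog_scale f a g)
  then obtain X' Y' where g: "mtyp os_sig g X' Y'" using v by (auto simp: ctyp_simps)
  show ?thesis
    using DT_cong[OF osp.cls_tens_right_linear(2)[OF g]] DT_scale[OF mtyp_tens_id(1)[OF g]]
    by (simp add: tog_scale dsp.scale_cls)
next
  case (tog_comp_left f g h)
  then obtain X' Y' Z where g: "mtyp os_sig g Z Y'" and h: "mtyp os_sig h X' Z"
    using v by (auto simp: ctyp_simps mtyp_simps)
  show ?thesis
    using DT_cong[OF osp.cls_tens_comp_right(1)[OF g h]] DT_left[OF mtyp_tens_id(1)[OF g] mtyp_tens_id(1)[OF h], of f]
      DO_cong[OF osp.cls_tens_assoc[of "MId [tog_cod f]" g "MId \<nu>"]]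
    by (simp add: tog_comp_left dsp.cmp_cls[symmetric])
next
  case (tog_comp_right f g h)
  then obtain X' Y' Z where g: "mtyp os_sig g Z Y'" and h: "mtyp os_sig h X' Z"
    using v by (auto simp: ctyp_simps mtyp_simps)
  show ?thesis
    using DT_cong[OF osp.cls_tens_comp_right(1)[OF g h]] DT_right[OF mtyp_tens_id(1)[OF g] mtyp_tens_id(1)[OF h], of f]
      DO_cong[OF osp.cls_tens_assoc[of "MId [tog_dom f]" h "MId \<nu>"]]
    by (simp add: tog_comp_right dsp.cmp_cls[symmetric])
next
  case (toggle r s \<mu>)
  have "Dcls (ds_right \<nu> (ds_right \<mu> r)) \<in> hom dsp.cat (X @ \<nu>) (Y @ \<nu>)"
    "Dcls (ds_right \<nu> (ds_right \<mu> s)) \<in> hom dsp.cat (X @ \<nu>) (Y @ \<nu>)"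
    using ctyp_ds_right[OF u] ctyp_ds_right[OF v] by (simp_all add: toggle)
  then have "ctyp ds_sig (ds_right (\<mu> @ \<nu>) r) (X @ \<nu>) (Y @ \<nu>)" "ctyp ds_sig (ds_right (\<mu> @ \<nu>) s) (X @ \<nu>) (Y @ \<nu>)"
    unfolding ds_right_right by simp_all
  then show ?thesis
    unfolding toggle(1,2) ds_right_right by (rule dsp.cls_rel[OF ds_rel.toggle[OF toggle(3)]])
qed

sublocale dright: presentation_map ds_sig "ds_rel q t \<delta>" ds_sig "ds_rel q t \<delta>" "\<lambda>X. X @ \<nu>"
    "\<lambda>g. CGen (ds_gen_right \<nu> g)" for \<nu>
proof
  show "ctyp ds_sig (CGen (ds_gen_right \<nu> g)) (X @ \<nu>) (Y @ \<nu>)" if "ds_sig g X Y" for g X Y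
    using ctyp_ds_right[of "CGen g" X Y \<nu>] that by (simp add: ctyp_simps)
  show "Dcls (cextend (\<lambda>X. X @ \<nu>) (\<lambda>g. CGen (ds_gen_right \<nu> g)) u)
      = Dcls (cextend (\<lambda>X. X @ \<nu>) (\<lambda>g. CGen (ds_gen_right \<nu> g)) v)"
    if "ds_rel q t \<delta> u v" "ctyp ds_sig u X Y" "ctyp ds_sig v X Y" for u v X Y
    using ds_rel_right[OF that] unfolding ds_right_def .
qed

abbreviation "DR \<nu> f \<equiv> dright.map_mor \<nu> f"

lemma DR_cls: "ctyp ds_sig u X Y \<Longrightarrow> DR \<nu> (Dcls u) = Dcls (ds_right \<nu> u)"
  unfolding ds_right_def by (rule dright.map_cls)

lemma DR_functor: "linear_functor dsp.cat dsp.cat (\<lambda>X. X @ \<nu>) (DR \<nu>)"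
  by (rule dright.functor_map)

lemma DR_hom: "f \<in> hom dsp.cat X Y \<Longrightarrow> DR \<nu> f \<in> hom dsp.cat (X @ \<nu>) (Y @ \<nu>)"
  using cat_functor.fun_hom[OF linear_functor.axioms(1)[OF DR_functor]] .

lemma DR_cmp: "f \<in> hom dsp.cat X Y \<Longrightarrow> g \<in> hom dsp.cat Y Z \<Longrightarrow> DR \<nu> (Dcmp g f) = Dcmp (DR \<nu> g) (DR \<nu> f)"
  using cat_functor.fun_cmp[OF linear_functor.axioms(1)[OF DR_functor]] .

lemma DR_DR: "f \<in> hom dsp.cat X Y \<Longrightarrow> DR \<mu> (DR \<nu> f) = DR (\<nu> @ \<mu>) f"
  by (elim dsp.hom_obtain) (simp only: DR_cls DR_cls[OF ctyp_ds_right] ds_right_right)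

lemma DR_Nil: assumes "f \<in> hom dsp.cat X Y" shows "DR [] f = f"
proof -
  have "Dcls (ds_right [] u) = Dcls u" if "ctyp ds_sig u X Y" for u :: "'k ds_term" and X Y
    using that
  proof (induction rule: ctyp.induct)
    case (1 g X Y)
    then show ?case
      by (cases g) (auto intro!: DO_cong DT_cong osp.cls_tens_unit(2))
  next
    case 3 then show ?case unfolding ds_right_simps by (intro dsp.cls_cong_comp)
  next
    case 5 then show ?case unfolding ds_right_simps by (intro dsp.cls_cong_add)
  next
    case 6 then show ?case unfolding ds_right_simps by (intro dsp.cls_cong_scale)
  qed simp_all
  with assms show ?thesis by (elim dsp.hom_obtain) (simp only: DR_cls)
qed

abbreviation "DN X u \<equiv> DO (MId X \<boxtimes> u)"

lemma DN_hom: "mtyp os_sig u c d \<Longrightarrow> DN X u \<in> hom dsp.cat (X @ c) (X @ d)"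
  by (simp only: DO_hom mtyp_tens_id)

text \<open>For a generator \<open>f \<otimes> h\<close> with a toggle \<open>f\<close>, the square
  reduces to sliding \<open>u\<close> past \<open>h\<close> inside the second factor; for an
  oriented generator it is the interchange law itself.\<close>

lemma DN_natural:
  assumes u: "mtyp os_sig u c d" and f: "f \<in> hom dsp.cat X Y"
  shows "Dcmp (DN Y u) (DR c f) = Dcmp (DR d f) (DN X u)"
proof (rule dsp.natural_extend[OF dsp.linear_category_cat DR_functor DR_functor DN_hom[OF u] _ f])
  fix g :: "'k ds_gen" and X Y assume g: "ds_sig g X Y"
  then have cg: "ctyp ds_sig (CGen g :: 'k ds_term) X Y" by (simp add: ctyp_simps)
  show "Dcmp (DN Y u) (DR c (Dcls (CGen g))) = Dcmp (DR d (Dcls (CGen g))) (DN X u)"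
  proof (cases g)
    case (Os h)
    then have h: "mtyp os_sig h X Y" using g by simp
    show ?thesis
      using DO_cong[OF osp.cls_slide(1)[OF h u]] DO_cong[OF osp.cls_slide(2)[OF h u]]
      by (simp add: Os DR_cls[OF cg[unfolded Os]] DO_comp[OF mtyp_tens_id(2)[OF u] mtyp_tens_id(1)[OF h]]
          DO_comp[OF mtyp_tens_id(1)[OF h] mtyp_tens_id(2)[OF u]])
  next
    case (Tog f h)
    then obtain X' Y' where h: "mtyp os_sig h X' Y'" and X: "X = [tog_dom f] @ X'" and Y: "Y = [tog_cod f] @ Y'"
      using g by auto
    have e: "DN ([s] @ V) u = DO (MId [s] \<boxtimes> (MId V \<boxtimes> u))" for s V
      using osp.cls_cong_tens[OF osp.cls_tens_ident HOL.refl] osp.cls_tens_assoc by (intro DO_cong) metis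
    have "Dcmp (DN Y u) (DR c (Dcls (CGen g))) = DT f ((MId Y' \<boxtimes> u) \<odot> (h \<boxtimes> MId c))"
      unfolding Tog DR_cls[OF cg[unfolded Tog]] Y e ds_right_simps ds_gen_right.simps
      by (rule DT_left[OF mtyp_tens_id(2)[OF u] mtyp_tens_id(1)[OF h]])
    also have "\<dots> = DT f ((h \<boxtimes> MId d) \<odot> (MId X' \<boxtimes> u))"
      using osp.cls_slide[OF h u] by (intro DT_cong) simp
    also have "\<dots> = Dcmp (DR d (Dcls (CGen g))) (DN X u)"
      unfolding Tog DR_cls[OF cg[unfolded Tog]] X e ds_right_simps ds_gen_right.simps
      by (rule DT_right[OF mtyp_tens_id(1)[OF h] mtyp_tens_id(2)[OF u], symmetric])
    finally show ?thesis .
  qed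
qed

lemma DS_simps [simp]:
  "hom (DS q t \<delta>) = hom dsp.cat" "ident (DS q t \<delta>) = ident dsp.cat" "cmp (DS q t \<delta>) = Dcmp"
  "zero_mor (DS q t \<delta>) = zero_mor dsp.cat" "add_mor (DS q t \<delta>) = add_mor dsp.cat"
  "scale_mor (DS q t \<delta>) = scale_mor dsp.cat"
  "act_ob (DS q t \<delta>) X \<mu> = X @ \<mu>" "act_mor (DS q t \<delta>) f \<mu> = DR \<mu> f"
  by (simp_all add: DS_def lincat.defs lin_rmodule.defs dright.map_mor_def dsp.cls_def ds_right_def)

lemma act_nat_DS: assumes u: "mtyp os_sig u X Y" shows "act_nat (DS q t \<delta>) V (osp.cls u) = DN V u"
proof -
  have "act_nat (DS q t \<delta>) V (osp.cls u) = (\<Union>s\<in>osp.cls u. DN V s)"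
    by (simp add: DS_def lincat.defs lin_rmodule.defs dsp.cls_def)
  moreover have "DN V s = DN V u" if "s \<in> osp.cls u" for s
    using osp.cls_in[OF that] by (intro DO_cong osp.cls_cong_tens HOL.refl)
  ultimately show ?thesis using osp.self_in_cls[OF u] by blast
qed

lemma linear_functor_DS: "linear_functor (DS q t \<delta>) (DS q t \<delta>) FO FM \<longleftrightarrow> linear_functor dsp.cat dsp.cat FO FM"
  unfolding DS_def by (rule linear_functor_extend)

lemma right_module_DS: "right_module (OS q t \<delta>) (DS q t \<delta>)"
proof -
  have "linear_category (DS q t \<delta>)"
    unfolding DS_def linear_category_extend by (rule dsp.linear_category_cat)
  then interpret M: linear_category "DS q t \<delta>" .
  interpret S: linear_monoidal_category "OS q t \<delta>"
    unfolding OS_eq by (rule osp.linear_monoidal_category_cat)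
  show ?thesis
  proof (rule right_module.intro[OF S.linear_monoidal_category_axioms M.linear_category_axioms],
      rule right_module_axioms.intro)
    show "linear_functor (DS q t \<delta>) (DS q t \<delta>) (\<lambda>X. act_ob (DS q t \<delta>) X c) (\<lambda>f. act_mor (DS q t \<delta>) f c)" for c
      unfolding linear_functor_DS DS_simps by (rule DR_functor)
  next
    fix g c d V assume "g \<in> hom (OS q t \<delta>) c d"
    then obtain u where u: "g = osp.cls u" "mtyp os_sig u c d" unfolding OS_eq by (rule osp.hom_obtain)
    show "act_nat (DS q t \<delta>) V g \<in> hom (DS q t \<delta>) (act_ob (DS q t \<delta>) V c) (act_ob (DS q t \<delta>) V d)"
      unfolding u(1) act_nat_DS[OF u(2)] DS_simps by (rule DN_hom[OF u(2)])
    show "act_nat (DS q t \<delta>) V (scale_mor (OS q t \<delta>) a g) = scale_mor (DS q t \<delta>) a (act_nat (DS q t \<delta>) V g)" for a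
      unfolding u(1) OS_eq osp.scale_cls act_nat_DS[OF u(2)] act_nat_DS[OF mtyp.intros(7)[OF u(2)]]
        DS_simps DO_cong[OF osp.cls_tens_right_linear(4)[OF u(2)]] by (rule DO_scale[OF mtyp_tens_id(2)[OF u(2)]])
    show "cmp (DS q t \<delta>) (act_nat (DS q t \<delta>) Y g) (act_mor (DS q t \<delta>) f c)
        = cmp (DS q t \<delta>) (act_mor (DS q t \<delta>) f d) (act_nat (DS q t \<delta>) X g)"
      if "f \<in> hom (DS q t \<delta>) X Y" for f X Y
      using that DN_natural[OF u(2)] unfolding u(1) act_nat_DS[OF u(2)] DS_simps by blast
    show "act_nat (DS q t \<delta>) V (add_mor (OS q t \<delta>) g h)
        = add_mor (DS q t \<delta>) (act_nat (DS q t \<delta>) V g) (act_nat (DS q t \<delta>) V h)"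
      if h: "h \<in> hom (OS q t \<delta>) c d" for h
    proof -
      obtain v where v: "h = osp.cls v" "mtyp os_sig v c d"
        using h unfolding OS_eq by (rule osp.hom_obtain)
      show ?thesis
        unfolding u(1) v(1) OS_eq osp.add_cls act_nat_DS[OF u(2)] act_nat_DS[OF v(2)]
          act_nat_DS[OF mtyp.intros(6)[OF u(2) v(2)]] DS_simps
          DO_cong[OF osp.cls_tens_right_linear(3)[OF u(2) v(2)]]
        by (rule DO_add[OF mtyp_tens_id(2)[OF u(2)] mtyp_tens_id(2)[OF v(2)]])
    qed
    show "act_nat (DS q t \<delta>) V (cmp (OS q t \<delta>) h g)
        = cmp (DS q t \<delta>) (act_nat (DS q t \<delta>) V h) (act_nat (DS q t \<delta>) V g)"
      if h: "h \<in> hom (OS q t \<delta>) d e" for h e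
    proof -
      obtain v where v: "h = osp.cls v" "mtyp os_sig v d e"
        using h unfolding OS_eq by (rule osp.hom_obtain)
      show ?thesis
        unfolding u(1) v(1) OS_eq osp.cmp_cls act_nat_DS[OF u(2)] act_nat_DS[OF v(2)]
          act_nat_DS[OF mtyp.intros(3)[OF v(2) u(2)]] DS_simps
          DO_cong[OF osp.cls_tens_comp_right(2)[OF v(2) u(2)]]
        by (rule DO_comp[OF mtyp_tens_id(2)[OF v(2)] mtyp_tens_id(2)[OF u(2)]])
    qed
    show "act_nat (DS q t \<delta>) V (tens_mor (OS q t \<delta>) g h)
        = cmp (DS q t \<delta>) (act_nat (DS q t \<delta>) (act_ob (DS q t \<delta>) V d) h)
            (act_mor (DS q t \<delta>) (act_nat (DS q t \<delta>) V g) e)"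
      if h: "h \<in> hom (OS q t \<delta>) e e'" for h e e'
    proof -
      obtain v where v: "h = osp.cls v" "mtyp os_sig v e e'"
        using h unfolding OS_eq by (rule osp.hom_obtain)
      \<comment> \<open>The interchange law splits the tensor product into \<open>u\<close> followed
        by \<open>v\<close>, as the module axiom prescribes.\<close>
      have "DN V (u \<boxtimes> v) = DO ((MId (V @ d) \<boxtimes> v) \<odot> (MId V \<boxtimes> u \<boxtimes> MId e))"
        using osp.cls_slide(1)[OF mtyp_tens_id(2)[OF u(2)] v(2), of V] osp.cls_tens_assoc[of "MId V" u v]
        by (intro DO_cong) simp
      also have "\<dots> = Dcmp (DN (V @ d) v) (DO (MId V \<boxtimes> u \<boxtimes> MId e))"
        by (rule DO_comp[OF mtyp_tens_id(2)[OF v(2)] mtyp_tens_id(1)[OF mtyp_tens_id(2)[OF u(2)]]])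
      also have "DO (MId V \<boxtimes> u \<boxtimes> MId e) = DR e (DN V u)"
        using DR_cls[of "os (MId V \<boxtimes> u)" "V @ c" "V @ d" e] mtyp_tens_id(2)[OF u(2)] by (simp add: ctyp_simps)
      finally show ?thesis
        unfolding u(1) v(1) OS_eq osp.tens_cls act_nat_DS[OF u(2)] act_nat_DS[OF v(2)]
          act_nat_DS[OF mtyp.intros(4)[OF u(2) v(2)]] DS_simps .
    qed
  next
    show "act_nat (DS q t \<delta>) V (ident (OS q t \<delta>) c) = ident (DS q t \<delta>) (act_ob (DS q t \<delta>) V c)" for V c
      unfolding OS_eq osp.ident_cls act_nat_DS[OF mtyp.intros(2)] DS_simps DO_id[symmetric]
      by (rule DO_cong[OF osp.cls_tens_ident])
    show "act_ob (DS q t \<delta>) V (unit_ob (OS q t \<delta>)) = V" for V by (simp add: OS_eq osp.unit_ob_cat)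
    show "act_mor (DS q t \<delta>) f (unit_ob (OS q t \<delta>)) = f" if "f \<in> hom (DS q t \<delta>) a b" for f a b
      using that unfolding DS_simps OS_eq osp.unit_ob_cat by (rule DR_Nil)
    show "act_ob (DS q t \<delta>) V (tens_ob (OS q t \<delta>) c d) = act_ob (DS q t \<delta>) (act_ob (DS q t \<delta>) V c) d" for V c d
      by (simp add: OS_eq osp.tens_ob_cat)
    show "act_mor (DS q t \<delta>) f (tens_ob (OS q t \<delta>) c d) = act_mor (DS q t \<delta>) (act_mor (DS q t \<delta>) f c) d"
      if "f \<in> hom (DS q t \<delta>) a b" for f a b c d
      using that DR_DR by (simp add: OS_eq osp.tens_ob_cat)
  qed
qed

end

section \<open>Local operators on the disoriented skein category\<close>

text \<open>With source and target computed by functions, typing of a composite becomes an equation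
  between words that simplification decides; the rules of \<open>mtyp\<close> would require the word
  in the middle.\<close>

definition wt :: "'k os_term \<Rightarrow> bool" where
  "wt u \<longleftrightarrow> mtyp os_sig u (os_src u) (os_tgt u)"

lemma wt_simps [simp]:
  "wt (MGen g)" "wt (MId X)" "wt (u \<odot> v) \<longleftrightarrow> wt u \<and> wt v \<and> os_src u = os_tgt v"
  "wt (u \<boxtimes> v) \<longleftrightarrow> wt u \<and> wt v" "wt (MScale a u) \<longleftrightarrow> wt u"
proof -
  show "wt (u \<odot> v) \<longleftrightarrow> wt u \<and> wt v \<and> os_src u = os_tgt v" "wt (u \<boxtimes> v) \<longleftrightarrow> wt u \<and> wt v"
    "wt (MScale a u) \<longleftrightarrow> wt u"
    unfolding wt_def by (auto simp: mtyp_simps dest: os_typ)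
qed (simp_all add: wt_def mtyp_simps os_sig_def)

context skein_parameters begin

definition AT :: "'k os_term \<Rightarrow> word \<Rightarrow> word \<Rightarrow> 'k ds_term set" where
  "AT u \<kappa> \<mu> = DO (MId \<kappa> \<boxtimes> u \<boxtimes> MId \<mu>)"

lemma AT_hom: "wt u \<Longrightarrow> AT u \<kappa> \<mu> \<in> hom dsp.cat (\<kappa> @ os_src u @ \<mu>) (\<kappa> @ os_tgt u @ \<mu>)"
  using mtyp_tens_id(1)[OF mtyp_tens_id(2)[of u "os_src u" "os_tgt u" \<kappa>], of \<mu>]
  by (simp only: AT_def DO_hom wt_def append_assoc)

lemma AT_comp: "wt u \<Longrightarrow> wt v \<Longrightarrow> os_src u = os_tgt v \<Longrightarrow> AT (u \<odot> v) \<kappa> \<mu> = Dcmp (AT u \<kappa> \<mu>) (AT v \<kappa> \<mu>)"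
proof -
  assume h: "wt u" "wt v" "os_src u = os_tgt v"
  then have u: "mtyp os_sig u (os_tgt v) (os_tgt u)" and v: "mtyp os_sig v (os_src v) (os_tgt v)"
    by (simp_all add: wt_def)
  note u' = mtyp_tens_id(2)[OF u, of \<kappa>] and v' = mtyp_tens_id(2)[OF v, of \<kappa>]
  have "AT (u \<odot> v) \<kappa> \<mu> = DO ((MId \<kappa> \<boxtimes> u \<boxtimes> MId \<mu>) \<odot> (MId \<kappa> \<boxtimes> v \<boxtimes> MId \<mu>))"
    unfolding AT_def
    using osp.cls_cong_tens[OF osp.cls_tens_comp_right(2)[OF u v] HOL.refl] osp.cls_tens_comp_right(1)[OF u' v']
    by (intro DO_cong) simp
  then show ?thesis using DO_comp[OF mtyp_tens_id(1)[OF u'] mtyp_tens_id(1)[OF v']] by (simp add: AT_def)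
qed

lemma AT_cong: "osp.cls u = osp.cls v \<Longrightarrow> AT u \<kappa> \<mu> = AT v \<kappa> \<mu>"
  unfolding AT_def by (intro DO_cong osp.cls_cong_tens HOL.refl)

lemma AT_id: "AT (MId X) \<kappa> \<mu> = ident dsp.cat (\<kappa> @ X @ \<mu>)"
  using osp.cls_cong_tens[OF osp.cls_tens_ident HOL.refl, of \<kappa> X "MId \<mu>"] osp.cls_tens_ident
  unfolding AT_def DO_id[symmetric] by (intro DO_cong) simp

lemma AT_tens_id: "AT (u \<boxtimes> MId Z) \<kappa> \<mu> = AT u \<kappa> (Z @ \<mu>)" "AT (MId Z \<boxtimes> u) \<kappa> \<mu> = AT u (\<kappa> @ Z) \<mu>"
proof -
  have "osp.cls (MId \<kappa> \<boxtimes> (u \<boxtimes> MId Z) \<boxtimes> MId \<mu>) = osp.cls (MId \<kappa> \<boxtimes> u \<boxtimes> (MId Z \<boxtimes> MId \<mu>))"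
    using osp.cls_cong_tens[OF osp.cls_tens_assoc[of "MId \<kappa>" u "MId Z"] HOL.refl] osp.cls_tens_assoc by metis
  then show "AT (u \<boxtimes> MId Z) \<kappa> \<mu> = AT u \<kappa> (Z @ \<mu>)"
    unfolding AT_def using osp.cls_cong_tens[OF HOL.refl osp.cls_tens_ident] by (intro DO_cong) simp
  have "osp.cls (MId \<kappa> \<boxtimes> (MId Z \<boxtimes> u)) = osp.cls (MId (\<kappa> @ Z) \<boxtimes> u)"
    using osp.cls_tens_assoc osp.cls_cong_tens[OF osp.cls_tens_ident HOL.refl] by metis
  then show "AT (MId Z \<boxtimes> u) \<kappa> \<mu> = AT u (\<kappa> @ Z) \<mu>"
    unfolding AT_def by (rule DO_cong[OF osp.cls_cong_tens[OF _ HOL.refl]])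
qed

lemma AT_tens:
  assumes "wt u" "wt v"
  shows "AT (u \<boxtimes> v) \<kappa> \<mu> = Dcmp (AT v (\<kappa> @ os_tgt u) \<mu>) (AT u \<kappa> (os_src v @ \<mu>))"
    and "AT (u \<boxtimes> v) \<kappa> \<mu> = Dcmp (AT u \<kappa> (os_tgt v @ \<mu>)) (AT v (\<kappa> @ os_src u) \<mu>)"
proof -
  have u: "mtyp os_sig u (os_src u) (os_tgt u)" and v: "mtyp os_sig v (os_src v) (os_tgt v)"
    using assms by (simp_all add: wt_def)
  have "AT (u \<boxtimes> v) \<kappa> \<mu> = AT ((MId (os_tgt u) \<boxtimes> v) \<odot> (u \<boxtimes> MId (os_src v))) \<kappa> \<mu>"
    using osp.cls_slide(1)[OF u v] by (intro AT_cong) simp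
  then show "AT (u \<boxtimes> v) \<kappa> \<mu> = Dcmp (AT v (\<kappa> @ os_tgt u) \<mu>) (AT u \<kappa> (os_src v @ \<mu>))"
    using assms by (simp add: AT_comp AT_tens_id)
  have "AT (u \<boxtimes> v) \<kappa> \<mu> = AT ((u \<boxtimes> MId (os_tgt v)) \<odot> (MId (os_src u) \<boxtimes> v)) \<kappa> \<mu>"
    using osp.cls_slide(2)[OF u v] by (intro AT_cong) simp
  then show "AT (u \<boxtimes> v) \<kappa> \<mu> = Dcmp (AT u \<kappa> (os_tgt v @ \<mu>)) (AT v (\<kappa> @ os_src u) \<mu>)"
    using assms by (simp add: AT_comp AT_tens_id)
qed

text \<open>\<open>at [] n x\<close> is not vacuous: it still requires \<open>n\<close> to lie
  within the target word. This is the condition under which a cup can be created there.\<close>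

definition at :: "word \<Rightarrow> nat \<Rightarrow> 'k ds_term set \<Rightarrow> bool" where
  "at p n x \<longleftrightarrow> (case dsp.ends x of None \<Rightarrow> False
    | Some (w, _) \<Rightarrow> n + length p \<le> length w \<and> take (length p) (drop n w) = p)"

lemma atE:
  assumes "at p n x" obtains \<kappa> \<mu> s where "dsp.ends x = Some (\<kappa> @ p @ \<mu>, s)" "n = length \<kappa>"
proof -
  obtain w s where w: "dsp.ends x = Some (w, s)" "n + length p \<le> length w" "take (length p) (drop n w) = p"
    using assms by (auto simp: at_def split: option.splits)
  have "w = take n w @ p @ drop (length p) (drop n w)"
    using w(3) by (metis append_take_drop_id)
  moreover have "n = length (take n w)" using w(2) by simp
  ultimately show thesis using that[of "take n w" "drop (length p) (drop n w)" s] w(1) by simp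
qed

text \<open>The words on both sides are read off from the target of \<open>x\<close>, so that a
  position determines the morphism; \<open>{}\<close> marks a pattern that does not match.\<close>

definition A :: "os_gen \<Rightarrow> nat \<Rightarrow> 'k ds_term set \<Rightarrow> 'k ds_term set" where
  "A g n x = (case dsp.ends x of None \<Rightarrow> {} | Some (w, _) \<Rightarrow>
    if at (os_dom g) n x then Dcmp (AT (MGen g) (take n w) (drop (n + length (os_dom g)) w)) x else {})"

lemma A_out: "\<not> at (os_dom g) n x \<Longrightarrow> A g n x = {}"
  by (auto simp: A_def split: option.splits)

lemma A_eq: "dsp.ends x = Some (\<kappa> @ os_dom g @ \<mu>, s) \<Longrightarrow> A g (length \<kappa>) x = Dcmp (AT (MGen g) \<kappa> \<mu>) x"
  by (simp add: A_def at_def)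

lemma ends_cmp: "dsp.ends x = Some (X, s) \<Longrightarrow> f \<in> hom dsp.cat X Y \<Longrightarrow> dsp.ends (Dcmp f x) = Some (Y, s)"
  unfolding dsp.ends_iff by (rule dsp.cat.cmp_hom)

lemma ends_A: "dsp.ends (A g n x) = (case dsp.ends x of None \<Rightarrow> None | Some (w, s) \<Rightarrow>
  if at (os_dom g) n x then Some (take n w @ os_cod g @ drop (n + length (os_dom g)) w, s) else None)"
proof (cases "at (os_dom g) n x")
  case True
  then obtain \<kappa> \<mu> s where x: "dsp.ends x = Some (\<kappa> @ os_dom g @ \<mu>, s)" "n = length \<kappa>" by (rule atE)
  show ?thesis
    using ends_cmp[OF x(1), of _ "\<kappa> @ os_cod g @ \<mu>"] AT_hom[of "MGen g" \<kappa> \<mu>] x True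
    by (simp add: A_eq)
next
  case False then show ?thesis by (simp add: A_out split: option.splits)
qed

lemma apply_AT: "map_option fst (dsp.ends x) = Some (\<kappa> @ os_dom g @ \<mu>) \<Longrightarrow> Dcmp (AT (MGen g) \<kappa> \<mu>) x = A g (length \<kappa>) x"
  using A_eq by fastforce

text \<open>There is no position: the generating toggles live on the leftmost strand.\<close>

definition Tg :: "toggle \<Rightarrow> 'k ds_term set \<Rightarrow> 'k ds_term set" where
  "Tg f x = (case dsp.ends x of None \<Rightarrow> {} | Some (w, _) \<Rightarrow>
    if at [tog_dom f] 0 x then Dcmp (DT f (MId (tl w))) x else {})"

lemma Tg_out: "\<not> at [tog_dom f] 0 x \<Longrightarrow> Tg f x = {}"
  by (auto simp: Tg_def split: option.splits)

lemma Tg_eq: "dsp.ends x = Some (tog_dom f # \<mu>, s) \<Longrightarrow> Tg f x = Dcmp (DT f (MId \<mu>)) x"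
  by (simp add: Tg_def at_def)

lemma ends_Tg: "dsp.ends (Tg f x) = (case dsp.ends x of None \<Rightarrow> None | Some (w, s) \<Rightarrow>
  if at [tog_dom f] 0 x then Some (tog_cod f # tl w, s) else None)"
proof (cases "at [tog_dom f] 0 x")
  case True
  then obtain \<kappa> \<mu> s where x: "dsp.ends x = Some (tog_dom f # \<mu>, s)" by (auto elim: atE)
  show ?thesis
    using ends_cmp[OF x DT_hom, OF mtyp.intros(2)] x True by (simp add: Tg_eq)
next
  case False then show ?thesis by (simp add: Tg_out split: option.splits)
qed

lemma apply_Tg: "map_option fst (dsp.ends x) = Some (tog_dom f # \<mu>) \<Longrightarrow> Dcmp (DT f (MId \<mu>)) x = Tg f x"
  using Tg_eq by fastforce

lemma ends_scale: assumes "dsp.ends x \<noteq> None" shows "dsp.ends (scale_mor dsp.cat a x) = dsp.ends x"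
proof -
  obtain w s where x: "dsp.ends x = Some (w, s)" using assms by auto
  show ?thesis unfolding x using x dsp.cat.scale_hom unfolding dsp.ends_iff by blast
qed

lemma not_at_empty [simp]: "\<not> at p n {}" by (simp add: at_def)

lemma A_empty [simp]: "A g n {} = {}" and Tg_empty [simp]: "Tg f {} = {}"
  by (simp_all add: A_out Tg_out)

lemmas evd = at_def ends_A ends_Tg ends_scale

lemma apply_AT_id: "map_option fst (dsp.ends x) = Some (\<kappa> @ X @ \<mu>) \<Longrightarrow> Dcmp (AT (MId X) \<kappa> \<mu>) x = x"
  using dsp.cmp_ident_left unfolding AT_id by (auto simp: dsp.ends_iff)

lemma at_A_before:
  assumes "n + length p \<le> m" "at (os_dom h) m x" shows "at p n (A h m x) \<longleftrightarrow> at p n x"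
proof -
  obtain \<kappa> \<mu> s where "dsp.ends x = Some (\<kappa> @ os_dom h @ \<mu>, s)" "m = length \<kappa>" using assms(2) by (rule atE)
  then show ?thesis using assms(1) by (simp add: evd)
qed

lemma at_A_after:
  assumes "n + length (os_dom g) \<le> m" "at (os_dom g) n x"
  shows "at p (m - length (os_dom g) + length (os_cod g)) (A g n x) \<longleftrightarrow> at p m x"
proof -
  obtain \<kappa> \<mu> s where x: "dsp.ends x = Some (\<kappa> @ os_dom g @ \<mu>, s)" "n = length \<kappa>" using assms(2) by (rule atE)
  define k where "k = m - n - length (os_dom g)"
  have m: "m = length \<kappa> + length (os_dom g) + k" using assms(1) x(2) by (simp add: k_def)
  show ?thesis using x by (auto simp: evd m)
qed

text \<open>The interchange law. The position of the right generator shifts by the change of length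
  that the left one causes. If one of the patterns fails, both sides are \<open>{}\<close>, since
  neither generator affects the pattern of the other.\<close>

lemma A_far:
  assumes nm: "n + length (os_dom g) \<le> m"
  shows "A g n (A h m x) = A h (m - length (os_dom g) + length (os_cod g)) (A g n x)"
proof (cases "at (os_dom g) n x \<and> at (os_dom h) m x")
  case True
  then obtain \<kappa> \<mu> s where x: "dsp.ends x = Some (\<kappa> @ os_dom g @ \<mu>, s)" "n = length \<kappa>" by (blast elim: atE)
  \<comment> \<open>\<open>k\<close> is the length of the word \<open>\<sigma>\<close> between the
    two generators.\<close>
  define k where "k = m - n - length (os_dom g)"
  have m: "m = length \<kappa> + length (os_dom g) + k" using nm x(2) by (simp add: k_def)
  have "k + length (os_dom h) \<le> length \<mu>" "take (length (os_dom h)) (drop k \<mu>) = os_dom h"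
    using True x by (simp_all add: at_def m)
  then obtain \<sigma> \<nu> where \<mu>: "\<mu> = \<sigma> @ os_dom h @ \<nu>" "k = length \<sigma>"
    by (metis append_take_drop_id length_take min.absorb2 add_leD1)
  let ?u = "MGen g" and ?v = "MId \<sigma> \<boxtimes> MGen h"
  have e: "dsp.ends x = Some (\<kappa> @ os_dom g @ \<sigma> @ os_dom h @ \<nu>, s)" using x \<mu> by simp
  have 1: "A h m x = Dcmp (AT (MGen h) (\<kappa> @ os_dom g @ \<sigma>) \<nu>) x"
    using apply_AT[of x "\<kappa> @ os_dom g @ \<sigma>" h \<nu>] e by (simp add: m \<mu>(2) add.assoc)
  have e1: "dsp.ends (A h m x) = Some (\<kappa> @ os_dom g @ \<sigma> @ os_cod h @ \<nu>, s)"
    using e by (simp add: evd m \<mu>(2))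
  have 2: "A g n (A h m x) = Dcmp (AT (MGen g) \<kappa> (\<sigma> @ os_cod h @ \<nu>)) (A h m x)"
    using apply_AT[of "A h m x" \<kappa> g] e1 x(2) by simp
  have 3: "A g n x = Dcmp (AT (MGen g) \<kappa> (\<sigma> @ os_dom h @ \<nu>)) x"
    using apply_AT[of x \<kappa> g] e x(2) by simp
  have e3: "dsp.ends (A g n x) = Some (\<kappa> @ os_cod g @ \<sigma> @ os_dom h @ \<nu>, s)"
    using e by (simp add: evd x(2))
  have 4: "A h (m - length (os_dom g) + length (os_cod g)) (A g n x)
      = Dcmp (AT (MGen h) (\<kappa> @ os_cod g @ \<sigma>) \<nu>) (A g n x)"
    using apply_AT[of "A g n x" "\<kappa> @ os_cod g @ \<sigma>" h \<nu>] e3 by (simp add: m \<mu>(2) ac_simps)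
  show ?thesis
    unfolding 2 4 unfolding 1 3 unfolding dsp.cmp_assoc[symmetric]
    using AT_tens[of ?u ?v \<kappa> \<nu>] by (simp add: AT_tens_id)
next
  case False
  have "A g n (A h m x) = {}"
  proof (cases "at (os_dom h) m x")
    case True
    with False at_A_before[OF nm True] show ?thesis by (intro A_out) blast
  qed (simp add: A_out)
  moreover have "A h (m - length (os_dom g) + length (os_cod g)) (A g n x) = {}"
  proof (cases "at (os_dom g) n x")
    case True
    with False at_A_after[OF nm True] show ?thesis by (intro A_out) blast
  qed (simp add: A_out)
  ultimately show ?thesis by simp
qed

text \<open>In the presentation both composites equal \<open>f \<otimes> u\<close> for the same
  oriented morphism \<open>u\<close>.\<close>

lemma Tg_A: "Tg f (A g (Suc n) x) = A g (Suc n) (Tg f x)"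
proof (cases "at [tog_dom f] 0 x \<and> at (os_dom g) (Suc n) x")
  case True
  then obtain \<kappa> \<mu> s where x: "dsp.ends x = Some (\<kappa> @ os_dom g @ \<mu>, s)" "Suc n = length \<kappa>" by (blast elim: atE)
  then obtain \<rho> where \<rho>: "\<kappa> = tog_dom f # \<rho>" "n = length \<rho>" using True by (cases \<kappa>) (auto simp: at_def)
  let ?u = "MId \<rho> \<boxtimes> MGen g \<boxtimes> MId \<mu> :: 'k os_term"
  have g: "mtyp os_sig (MGen g :: 'k os_term) (os_dom g) (os_cod g)" by (simp add: mtyp_simps os_sig_def)
  have u: "mtyp os_sig ?u (\<rho> @ os_dom g @ \<mu>) (\<rho> @ os_cod g @ \<mu>)"
    using mtyp_tens_id(1)[OF mtyp_tens_id(2)[OF g, of \<rho>], of \<mu>] by simp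
  have e: "AT (MGen g) (a # \<rho>) \<mu> = DO (MId [a] \<boxtimes> ?u)" for a
  proof -
    have "osp.cls (MId (a # \<rho>) \<boxtimes> MGen g \<boxtimes> MId \<mu>) = osp.cls (MId [a] \<boxtimes> MId \<rho> \<boxtimes> MGen g \<boxtimes> MId \<mu>)"
      using osp.cls_tens_ident[of "[a]" \<rho>] by (intro osp.cls_cong_tens HOL.refl) simp
    also have "\<dots> = osp.cls (MId [a] \<boxtimes> ?u)"
      using osp.cls_tens_assoc osp.cls_cong_tens[OF osp.cls_tens_assoc HOL.refl] by metis
    finally show ?thesis unfolding AT_def by (rule DO_cong)
  qed
  have 1: "A g (Suc n) x = Dcmp (DO (MId [tog_dom f] \<boxtimes> ?u)) x"
    using apply_AT[of x \<kappa> g \<mu>] x by (simp add: e[symmetric] \<rho>)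
  have e1: "dsp.ends (A g (Suc n) x) = Some (tog_dom f # \<rho> @ os_cod g @ \<mu>, s)"
    using x \<rho> by (simp add: evd)
  have 3: "Tg f x = Dcmp (DT f (MId (\<rho> @ os_dom g @ \<mu>))) x"
    using apply_Tg[of x f] x \<rho> by simp
  have e3: "dsp.ends (Tg f x) = Some (tog_cod f # \<rho> @ os_dom g @ \<mu>, s)"
    using x \<rho> by (simp add: evd)
  have 2: "Tg f (A g (Suc n) x) = Dcmp (DT f (MId (\<rho> @ os_cod g @ \<mu>))) (A g (Suc n) x)"
    using apply_Tg[of "A g (Suc n) x" f] e1 by simp
  have 4: "A g (Suc n) (Tg f x) = Dcmp (DO (MId [tog_cod f] \<boxtimes> ?u)) (Tg f x)"
    using apply_AT[of "Tg f x" "tog_cod f # \<rho>" g \<mu>] e3 by (simp add: e[symmetric] \<rho>)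
  have "DT f (MId (\<rho> @ os_cod g @ \<mu>) \<odot> ?u) = DT f (?u \<odot> MId (\<rho> @ os_dom g @ \<mu>))"
    using osp.cls_id[OF u] by (intro DT_cong) simp
  then show ?thesis
    unfolding 2 4 unfolding 1 3 unfolding dsp.cmp_assoc[symmetric]
    using DT_left[OF u mtyp.intros(2), of f] DT_right[OF mtyp.intros(2) u, of f] by simp
next
  case False
  have "Tg f (A g (Suc n) x) = {}"
  proof (cases "at (os_dom g) (Suc n) x")
    case True
    with False at_A_before[of 0 "[tog_dom f]" "Suc n" g x] show ?thesis by (intro Tg_out) simp
  qed (simp add: A_out)
  moreover have "A g (Suc n) (Tg f x) = {}"
  proof (cases "at [tog_dom f] 0 x")
    case True
    then obtain \<kappa> \<mu> s where "dsp.ends x = Some (tog_dom f # \<mu>, s)" by (auto elim: atE)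
    with False True show ?thesis by (intro A_out) (auto simp: evd)
  qed (simp add: Tg_out)
  ultimately show ?thesis by simp
qed

abbreviation "pX \<equiv> A Xpos"
abbreviation "pY \<equiv> A Xneg"
abbreviation "pc \<equiv> A Cw"
abbreviation "pd \<equiv> A Dw"
abbreviation "pc' \<equiv> A Cw'"
abbreviation "pd' \<equiv> A Dw'"
abbreviation "dsc \<equiv> scale_mor dsp.cat"
abbreviation "dad \<equiv> add_mor dsp.cat"

text \<open>
  The generators at position \<open>n\<close>; \<open>pR\<close>, \<open>pRm\<close>, \<open>pL\<close>, \<open>pD\<close>, \<open>pDm\<close> stand for the composites
  \<open>R\<^sub>+\<close>, \<open>R\<^sub>-\<close>, \<open>L\<^sub>-\<close>, \<open>D\<^sub>+\<close>, \<open>D\<^sub>-\<close>.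
\<close>

definition pR where "pR n x = pd (Suc (Suc n)) (pX (Suc n) (pc n x))"
definition pRm where "pRm n x = pd (Suc (Suc n)) (pY (Suc n) (pc n x))"
definition pL where "pL n x = pd' n (pY (Suc n) (pc' (Suc (Suc n)) x))"
definition pD where "pD n x = pd (Suc (Suc n)) (pR (Suc n) (pc n x))"
definition pDm where "pDm n x = pd (Suc (Suc n)) (pRm (Suc n) (pc n x))"

lemmas p_defs = pR_def pRm_def pL_def pD_def pDm_def

lemma wt_add: "wt u \<Longrightarrow> wt v \<Longrightarrow> os_src u = os_src v \<Longrightarrow> os_tgt u = os_tgt v \<Longrightarrow> wt (MAdd u v)"
  by (simp add: wt_def mtyp_simps)

lemma AT_rel:
  assumes "os_rel q t \<delta> u v" "wt u" "wt v" "os_src u = os_src v" "os_tgt u = os_tgt v"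
  shows "AT u \<kappa> \<mu> = AT v \<kappa> \<mu>"
  using assms by (intro AT_cong osp.cls_eq mcong.rel) (auto simp: wt_def)

lemma AT_scale: "wt u \<Longrightarrow> AT (MScale a u) \<kappa> \<mu> = dsc a (AT u \<kappa> \<mu>)"
proof -
  assume "wt u"
  then have u: "mtyp os_sig u (os_src u) (os_tgt u)" by (simp add: wt_def)
  note u' = mtyp_tens_id(2)[OF u, of \<kappa>]
  have "osp.cls (MId \<kappa> \<boxtimes> MScale a u \<boxtimes> MId \<mu>) = osp.cls (MScale a (MId \<kappa> \<boxtimes> u) \<boxtimes> MId \<mu>)"
    by (rule osp.cls_cong_tens[OF osp.cls_tens_right_linear(4)[OF u] HOL.refl])
  also have "\<dots> = osp.cls (MScale a (MId \<kappa> \<boxtimes> u \<boxtimes> MId \<mu>))" by (rule osp.cls_tens_right_linear(2)[OF u'])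
  finally show ?thesis
    unfolding AT_def using DO_cong DO_scale[OF mtyp_tens_id(1)[OF u']] by metis
qed

lemma AT_add: "wt u \<Longrightarrow> wt v \<Longrightarrow> os_src u = os_src v \<Longrightarrow> os_tgt u = os_tgt v
  \<Longrightarrow> AT (MAdd u v) \<kappa> \<mu> = dad (AT u \<kappa> \<mu>) (AT v \<kappa> \<mu>)"
proof -
  assume h: "wt u" "wt v" "os_src u = os_src v" "os_tgt u = os_tgt v"
  then have u: "mtyp os_sig u (os_src u) (os_tgt u)" and v: "mtyp os_sig v (os_src u) (os_tgt u)"
    by (simp_all add: wt_def)
  note u' = mtyp_tens_id(2)[OF u, of \<kappa>] and v' = mtyp_tens_id(2)[OF v, of \<kappa>]
  have "osp.cls (MId \<kappa> \<boxtimes> MAdd u v \<boxtimes> MId \<mu>) = osp.cls (MAdd (MId \<kappa> \<boxtimes> u) (MId \<kappa> \<boxtimes> v) \<boxtimes> MId \<mu>)"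
    by (rule osp.cls_cong_tens[OF osp.cls_tens_right_linear(3)[OF u v] HOL.refl])
  also have "\<dots> = osp.cls (MAdd (MId \<kappa> \<boxtimes> u \<boxtimes> MId \<mu>) (MId \<kappa> \<boxtimes> v \<boxtimes> MId \<mu>))"
    by (rule osp.cls_tens_right_linear(1)[OF u' v'])
  finally show ?thesis
    unfolding AT_def using DO_cong DO_add[OF mtyp_tens_id(1)[OF u'] mtyp_tens_id(1)[OF v']] by metis
qed

lemma d_scale_left: "dsp.ends x = Some (X, s) \<Longrightarrow> f \<in> hom dsp.cat X Y \<Longrightarrow> Dcmp (dsc a f) x = dsc a (Dcmp f x)"
  unfolding dsp.ends_iff by (rule dsp.cat.cmp_scale_left)

lemma d_scale_right: "dsp.ends x = Some (X, s) \<Longrightarrow> f \<in> hom dsp.cat X Y \<Longrightarrow> Dcmp f (dsc a x) = dsc a (Dcmp f x)"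
  unfolding dsp.ends_iff by (rule dsp.cat.cmp_scale_right)

lemma apply_AT_scale_id:
  assumes "map_option fst (dsp.ends x) = Some (\<kappa> @ X @ \<mu>)"
  shows "Dcmp (AT (MScale a (MId X)) \<kappa> \<mu>) x = dsc a x"
proof -
  obtain s where x: "dsp.ends x = Some (\<kappa> @ X @ \<mu>, s)" using assms by auto
  show ?thesis using d_scale_left[OF x AT_hom[of "MId X" \<kappa> \<mu>, simplified]] apply_AT_id[OF assms]
    by (simp add: AT_scale)
qed

lemma A_scale: "dsp.ends x \<noteq> None \<Longrightarrow> A g n (dsc a x) = dsc a (A g n x)"
proof (cases "at (os_dom g) n x")
  case True
  then obtain \<kappa> \<mu> s where x: "dsp.ends x = Some (\<kappa> @ os_dom g @ \<mu>, s)" "n = length \<kappa>" by (rule atE)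
  then show ?thesis using d_scale_right[OF x(1), of "AT (MGen g) \<kappa> \<mu>"] AT_hom[of "MGen g" \<kappa> \<mu>]
    by (simp add: A_eq[of _ \<kappa>] ends_scale)
next
  case False
  moreover assume "dsp.ends x \<noteq> None"
  ultimately show ?thesis by (simp add: A_out at_def ends_scale)
qed

lemma Tg_scale: "dsp.ends x \<noteq> None \<Longrightarrow> Tg f (dsc a x) = dsc a (Tg f x)"
proof (cases "at [tog_dom f] 0 x")
  case True
  then obtain \<mu> s where x: "dsp.ends x = Some (tog_dom f # \<mu>, s)" by (auto elim: atE)
  then show ?thesis using d_scale_right[OF x DT_hom[OF mtyp.intros(2)]]
    by (simp add: Tg_eq ends_scale)
next
  case False
  moreover assume "dsp.ends x \<noteq> None"
  ultimately show ?thesis by (simp add: Tg_out at_def ends_scale)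
qed

lemma A_add: "dsp.ends x = dsp.ends y \<Longrightarrow> dsp.ends y \<noteq> None \<Longrightarrow> A g n (dad x y) = dad (A g n x) (A g n y)"
  and ends_add: "dsp.ends x = dsp.ends y \<Longrightarrow> dsp.ends y \<noteq> None \<Longrightarrow> dsp.ends (dad x y) = dsp.ends y"
  and Tg_add: "dsp.ends x = dsp.ends y \<Longrightarrow> dsp.ends y \<noteq> None \<Longrightarrow> Tg f (dad x y) = dad (Tg f x) (Tg f y)"
proof -
  assume xy: "dsp.ends x = dsp.ends y" "dsp.ends y \<noteq> None"
  then obtain w s where e: "dsp.ends x = Some (w, s)" "dsp.ends y = Some (w, s)" by auto
  have e': "dsp.ends (dad x y) = Some (w, s)"
    using e unfolding dsp.ends_iff by (rule dsp.cat.add_hom)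
  then show "dsp.ends (dad x y) = dsp.ends y" using e by simp
  show "A g n (dad x y) = dad (A g n x) (A g n y)"
  proof (cases "at (os_dom g) n x")
    case True
    then obtain \<kappa> \<mu> s' where "dsp.ends x = Some (\<kappa> @ os_dom g @ \<mu>, s')" "n = length \<kappa>" by (rule atE)
    with e have w: "w = \<kappa> @ os_dom g @ \<mu>" "n = length \<kappa>" by simp_all
    have "Dcmp (AT (MGen g) \<kappa> \<mu>) (dad x y) = dad (Dcmp (AT (MGen g) \<kappa> \<mu>) x) (Dcmp (AT (MGen g) \<kappa> \<mu>) y)"
      using e AT_hom[of "MGen g" \<kappa> \<mu>] unfolding dsp.ends_iff w(1) by (intro dsp.cat.cmp_add_right) simp_all
    then show ?thesis using e e' w by (simp add: A_eq[of _ \<kappa>])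
  next
    case False
    then show ?thesis using e e' by (simp add: A_out at_def dsp.add_union)
  qed
  show "Tg f (dad x y) = dad (Tg f x) (Tg f y)"
  proof (cases "at [tog_dom f] 0 x")
    case True
    then obtain \<kappa> \<mu> s' where "dsp.ends x = Some (\<kappa> @ [tog_dom f] @ \<mu>, s')" "0 = length \<kappa>" by (rule atE)
    with e have w: "w = tog_dom f # \<mu>" by simp
    have "Dcmp (DT f (MId \<mu>)) (dad x y) = dad (Dcmp (DT f (MId \<mu>)) x) (Dcmp (DT f (MId \<mu>)) y)"
      using e DT_hom[OF mtyp.intros(2), of f \<mu>] unfolding dsp.ends_iff w by (intro dsp.cat.cmp_add_right)
    then show ?thesis using e e' w by (simp add: Tg_eq)
  next
    case False
    then show ?thesis using e e' by (simp add: Tg_out at_def dsp.add_union)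
  qed
qed

lemmas AT_simps = dsp.cmp_assoc AT_comp AT_tens_id AT_tens(1) apply_AT apply_AT_id apply_AT_scale_id

section \<open>Oriented skein relations as operator identities\<close>

lemma XY: assumes "at [Up, Up] n x" shows "pX n (pY n x) = x"
  using assms
proof (rule atE)
  fix \<kappa> \<mu> s assume [simp]: "dsp.ends x = Some (\<kappa> @ [Up, Up] @ \<mu>, s)" and n: "n = length \<kappa>"
  show ?thesis using arg_cong[OF AT_rel[OF os_rel.intros(1), of \<kappa> \<mu>], of "\<lambda>f. Dcmp f x"]
    by (simp add: AT_simps evd n )
qed

lemma YX: assumes "at [Up, Up] n x" shows "pY n (pX n x) = x"
  using assms
proof (rule atE)
  fix \<kappa> \<mu> s assume [simp]: "dsp.ends x = Some (\<kappa> @ [Up, Up] @ \<mu>, s)" and n: "n = length \<kappa>"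
  show ?thesis using arg_cong[OF AT_rel[OF os_rel.intros(2), of \<kappa> \<mu>], of "\<lambda>f. Dcmp f x"]
    by (simp add: AT_simps evd n )
qed

lemma pX_braid: assumes "at [Up, Up, Up] n x" shows "pX n (pX (Suc n) (pX n x)) = pX (Suc n) (pX n (pX (Suc n) x))"
  using assms
proof (rule atE)
  fix \<kappa> \<mu> s assume [simp]: "dsp.ends x = Some (\<kappa> @ [Up, Up, Up] @ \<mu>, s)" and n: "n = length \<kappa>"
  show ?thesis using arg_cong[OF AT_rel[OF os_rel.intros(3), of \<kappa> \<mu>], of "\<lambda>f. Dcmp f x"]
    by (simp add: AT_simps evd n )
qed

lemma LR: assumes "at [Up, Down] n x" shows "pL n (pR n x) = x"
  using assms
proof (rule atE)
  fix \<kappa> \<mu> s assume [simp]: "dsp.ends x = Some (\<kappa> @ [Up, Down] @ \<mu>, s)" and n: "n = length \<kappa>"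
  show ?thesis using arg_cong[OF AT_rel[OF os_rel.intros(4), of \<kappa> \<mu>], of "\<lambda>f. Dcmp f x"]
    by (simp add: AT_simps evd n p_defs os_R_def os_L_def)
qed

lemma RL: assumes "at [Down, Up] n x" shows "pR n (pL n x) = x"
  using assms
proof (rule atE)
  fix \<kappa> \<mu> s assume [simp]: "dsp.ends x = Some (\<kappa> @ [Down, Up] @ \<mu>, s)" and n: "n = length \<kappa>"
  show ?thesis using arg_cong[OF AT_rel[OF os_rel.intros(5), of \<kappa> \<mu>], of "\<lambda>f. Dcmp f x"]
    by (simp add: AT_simps evd n p_defs os_R_def os_L_def)
qed

lemma pcurl1: assumes "at [Up] n x" shows "pd' n (pX (Suc n) (pc n x)) = dsc t x"
  using assms
proof (rule atE)
  fix \<kappa> \<mu> s assume [simp]: "dsp.ends x = Some (\<kappa> @ [Up] @ \<mu>, s)" and n: "n = length \<kappa>"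
  show ?thesis using arg_cong[OF AT_rel[OF os_rel.intros(7), of \<kappa> \<mu>], of "\<lambda>f. Dcmp f x"]
    by (simp add: AT_simps evd n )
qed

lemma pcurl2: assumes "at [Up] n x" shows "pd (Suc n) (pX n (pc' (Suc n) x)) = dsc t x"
  using assms
proof (rule atE)
  fix \<kappa> \<mu> s assume [simp]: "dsp.ends x = Some (\<kappa> @ [Up] @ \<mu>, s)" and n: "n = length \<kappa>"
  show ?thesis using arg_cong[OF AT_rel[OF os_rel.intros(8), of \<kappa> \<mu>], of "\<lambda>f. Dcmp f x"]
    by (simp add: AT_simps evd n )
qed

lemma ploop: assumes "at [] n x" shows "pd n (pc' n x) = dsc \<delta> x"
  using assms
proof (rule atE)
  fix \<kappa> \<mu> s assume [simp]: "dsp.ends x = Some (\<kappa> @ [] @ \<mu>, s)" and n: "n = length \<kappa>"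
  show ?thesis using arg_cong[OF AT_rel[OF os_rel.intros(9), of \<kappa> \<mu>], of "\<lambda>f. Dcmp f x"]
    by (simp add: AT_simps evd n )
qed

lemma zz1: assumes "at [Up] n x" shows "pd n (pc (Suc n) x) = x"
  using assms
proof (rule atE)
  fix \<kappa> \<mu> s assume [simp]: "dsp.ends x = Some (\<kappa> @ [Up] @ \<mu>, s)" and n: "n = length \<kappa>"
  show ?thesis using arg_cong[OF AT_rel[OF os_rel.intros(10), of \<kappa> \<mu>], of "\<lambda>f. Dcmp f x"]
    by (simp add: AT_simps evd n )
qed

lemma zz2: assumes "at [Down] n x" shows "pd (Suc n) (pc n x) = x"
  using assms
proof (rule atE)
  fix \<kappa> \<mu> s assume [simp]: "dsp.ends x = Some (\<kappa> @ [Down] @ \<mu>, s)" and n: "n = length \<kappa>"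
  show ?thesis using arg_cong[OF AT_rel[OF os_rel.intros(11), of \<kappa> \<mu>], of "\<lambda>f. Dcmp f x"]
    by (simp add: AT_simps evd n )
qed

text \<open>The defining relation is about a difference; adding the inverse crossing back solves it
  for the positive one.\<close>

lemma pskein: assumes "at [Up, Up] n x" shows "pX n x = dad (pY n x) (dsc (q - qi) x)"
  using assms
proof (rule atE)
  fix \<kappa> \<mu> s assume x [simp]: "dsp.ends x = Some (\<kappa> @ [Up, Up] @ \<mu>, s)" and n: "n = length \<kappa>"
  have h: "AT (MGen g) \<kappa> \<mu> \<in> hom dsp.cat (\<kappa> @ [Up, Up] @ \<mu>) (\<kappa> @ [Up, Up] @ \<mu>)" if "g = Xpos \<or> g = Xneg" for g
    using that AT_hom[of "MGen g" \<kappa> \<mu>] by auto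
  have x': "x \<in> hom dsp.cat s (\<kappa> @ [Up, Up] @ \<mu>)" using x by (simp only: dsp.ends_iff)
  have "Dcmp (AT (MAdd X\<^sub>p (MScale (- 1) X\<^sub>m)) \<kappa> \<mu>) x = dsc (q - qi) x"
    using arg_cong[OF AT_rel[OF os_rel.intros(6), of \<kappa> \<mu>], of "\<lambda>f. Dcmp f x"]
    by (simp add: apply_AT_scale_id wt_add)
  moreover have "AT (MAdd X\<^sub>p (MScale (- 1) X\<^sub>m)) \<kappa> \<mu> = dad (AT X\<^sub>p \<kappa> \<mu>) (dsc (- 1) (AT X\<^sub>m \<kappa> \<mu>))"
    by (simp add: AT_add AT_scale)
  moreover have "Dcmp (dad (AT X\<^sub>p \<kappa> \<mu>) (dsc (- 1) (AT X\<^sub>m \<kappa> \<mu>))) x = dad (pX n x) (dsc (- 1) (pY n x))"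
    using dsp.cat.cmp_add_left[OF x' h[of Xpos] dsp.cat.scale_hom[OF h[of Xneg]]]
      dsp.cat.cmp_scale_left[OF x' h[of Xneg]] by (simp add: apply_AT n)
  ultimately have e: "dad (pX n x) (dsc (- 1) (pY n x)) = dsc (q - qi) x" by simp
  have Y: "pY n x \<in> hom dsp.cat s (\<kappa> @ [Up, Up] @ \<mu>)" and X: "pX n x \<in> hom dsp.cat s (\<kappa> @ [Up, Up] @ \<mu>)"
    unfolding dsp.ends_iff[symmetric] by (simp_all add: evd n)
  have "dad (dsc (- 1) (pY n x)) (pY n x) = zero_mor dsp.cat s (\<kappa> @ [Up, Up] @ \<mu>)"
    using dsp.cat.scale_add_left[OF Y, of "- 1" 1] dsp.cat.scale_zero[OF Y] dsp.cat.scale_one[OF Y] by simp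
  then have "dad (dad (pX n x) (dsc (- 1) (pY n x))) (pY n x) = pX n x"
    using dsp.cat.add_zero[OF X] by (simp add: dsp.add_assoc_cat)
  then show ?thesis unfolding e using dsp.add_commute_cat by metis
qed

text \<open>An operator on two neighbouring strands that obeys the exchange rules of a generator.
  The notion lets the composites \<open>R\<close> and \<open>D\<close> move past distant generators
  and toggles as one unit.\<close>

definition local2 :: "(nat \<Rightarrow> 'k ds_term set \<Rightarrow> 'k ds_term set) \<Rightarrow> bool" where
  "local2 F \<longleftrightarrow> (\<forall>g n m x. Suc (Suc n) \<le> m \<longrightarrow> F n (A g m x) = A g m (F n x)) \<and>
    (\<forall>g n m x. n + length (os_dom g) \<le> m \<longrightarrow> A g n (F m x) = F (m - length (os_dom g) + length (os_cod g)) (A g n x)) \<and>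
    (\<forall>f n x. Tg f (F (Suc n) x) = F (Suc n) (Tg f x))"

lemma local2_right: "local2 F \<Longrightarrow> Suc (Suc n) \<le> m \<Longrightarrow> F n (A g m x) = A g m (F n x)"
  and local2_left: "local2 F \<Longrightarrow> n + length (os_dom g) \<le> m
    \<Longrightarrow> A g n (F m x) = F (m - length (os_dom g) + length (os_cod g)) (A g n x)"
  and local2_Tg: "local2 F \<Longrightarrow> Tg f (F (Suc n) x) = F (Suc n) (Tg f x)"
  by (auto simp: local2_def)

lemma local2_A: "os_dom g = [Up, Up] \<Longrightarrow> os_cod g = [Up, Up] \<Longrightarrow> local2 (A g)"
  unfolding local2_def
proof (intro conjI allI impI)
  assume g: "os_dom g = [Up, Up]" "os_cod g = [Up, Up]"
  show "A g n (A h m x) = A h m (A g n x)" if "Suc (Suc n) \<le> m" for h n m x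
  proof -
    have "Suc (Suc (m - Suc (Suc 0))) = m" using that by linarith
    then show ?thesis using A_far[of n g m h x] that g by simp
  qed
  show "A h n (A g m x) = A g (m - length (os_dom h) + length (os_cod h)) (A h n x)"
    if "n + length (os_dom h) \<le> m" for h n m x
    using that by (rule A_far)
  show "Tg f (A g (Suc n) x) = A g (Suc n) (Tg f x)" for f n x by (rule Tg_A)
qed

lemma local2_XY: "local2 pX" "local2 pY"
  by (rule local2_A; simp)+

text \<open>The auxiliary cup and cap of a bend move along with \<open>F\<close>, so bending
  preserves locality. One bend leads from crossings to \<open>R\<close>, a second one to
  \<open>D\<close>.\<close>

lemma local2_bend:
  assumes F: "local2 F" shows "local2 (\<lambda>n x. pd (Suc (Suc n)) (F (Suc n) (pc n x)))"
  unfolding local2_def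
proof (intro conjI allI impI)
  fix g n m x assume nm: "Suc (Suc n) \<le> m"
  have "pc n (A g m x) = A g (Suc (Suc m)) (pc n x)" using A_far[of n Cw m g x] nm by simp
  moreover have "F (Suc n) (A g (Suc (Suc m)) (pc n x)) = A g (Suc (Suc m)) (F (Suc n) (pc n x))"
    using local2_right[OF F] nm by simp
  moreover have "pd (Suc (Suc n)) (A g (Suc (Suc m)) y) = A g m (pd (Suc (Suc n)) y)" for y
    using A_far[of "Suc (Suc n)" Dw "Suc (Suc m)" g y] nm by simp
  ultimately show "pd (Suc (Suc n)) (F (Suc n) (pc n (A g m x))) = A g m (pd (Suc (Suc n)) (F (Suc n) (pc n x)))"
    by simp
next
  fix g n m x assume nm: "n + length (os_dom g) \<le> m"
  let ?k = "m - length (os_dom g) + length (os_cod g)"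
  have m: "Suc m - length (os_dom g) = Suc (m - length (os_dom g))"
    "Suc (Suc m) - length (os_dom g) = Suc (Suc (m - length (os_dom g)))" using nm by linarith+
  have "A g n (pc m x) = pc ?k (A g n x)" using A_far[OF nm] .
  moreover have "A g n (F (Suc m) y) = F (Suc ?k) (A g n y)" for y
    using local2_left[OF F, of n g "Suc m"] nm m by simp
  moreover have "A g n (pd (Suc (Suc m)) y) = pd (Suc (Suc ?k)) (A g n y)" for y
    using A_far[of n g "Suc (Suc m)" Dw y] nm m by simp
  ultimately show "A g n (pd (Suc (Suc m)) (F (Suc m) (pc m x))) = pd (Suc (Suc ?k)) (F (Suc ?k) (pc ?k (A g n x)))"
    by simp
next
  fix f n x
  show "Tg f (pd (Suc (Suc (Suc n))) (F (Suc (Suc n)) (pc (Suc n) x)))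
    = pd (Suc (Suc (Suc n))) (F (Suc (Suc n)) (pc (Suc n) (Tg f x)))"
    by (simp add: Tg_A local2_Tg[OF F])
qed

section \<open>Strands that move past bent crossings, cups and caps\<close>

lemma local2_R: "local2 pR" "local2 pRm"
  using local2_bend[OF local2_XY(1)] local2_bend[OF local2_XY(2)] unfolding pR_def[abs_def] pRm_def[abs_def] .

lemma local2_D: "local2 pD" "local2 pDm"
  using local2_bend[OF local2_R(1)] local2_bend[OF local2_R(2)] unfolding pD_def[abs_def] pDm_def[abs_def] .

text \<open>A bend that meets a cup straightens by the zigzag relation \<open>zz1\<close>.\<close>

lemma bend_c:
  assumes F: "local2 F" and u: "at [Up] (Suc (Suc n)) (F (Suc n) (pc n x))"
  shows "pd (Suc (Suc n)) (F (Suc n) (pc n (pc (Suc n) x))) = F (Suc n) (pc n x)"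
proof -
  have "pc n (pc (Suc n) x) = pc (Suc (Suc (Suc n))) (pc n x)" using A_far[of n Cw "Suc n" Cw x] by simp
  then show ?thesis using local2_right[OF F, of "Suc n" "Suc (Suc (Suc n))"] zz1[OF u] by simp
qed

lemma d_bend:
  assumes F: "local2 F" and x: "at [Up] n x"
  shows "pd n (pd (Suc (Suc (Suc n))) (F (Suc (Suc n)) (pc (Suc n) x))) = pd (Suc n) (F n x)"
  using A_far[of n Dw "Suc (Suc (Suc n))" Dw] local2_left[OF F, of n Dw "Suc (Suc n)"] zz1[OF x] by simp

lemma pR_c: assumes "at [Up] n x" shows "pR n (pc (Suc n) x) = pX (Suc n) (pc n x)"
proof -
  from assms obtain \<kappa> \<mu> s where [simp]: "dsp.ends x = Some (\<kappa> @ [Up] @ \<mu>, s)" "n = length \<kappa>" by (rule atE)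
  show ?thesis unfolding pR_def by (rule bend_c[OF local2_XY(1)]) (simp add: evd)
qed

lemma pD_c: assumes "at [Down] n x" shows "pD n (pc (Suc n) x) = pR (Suc n) (pc n x)"
proof -
  from assms obtain \<kappa> \<mu> s where [simp]: "dsp.ends x = Some (\<kappa> @ [Down] @ \<mu>, s)" "n = length \<kappa>" by (rule atE)
  show ?thesis unfolding pD_def by (rule bend_c[OF local2_R(1)]) (simp add: evd p_defs)
qed

lemma d_pR: "at [Up] n x \<Longrightarrow> pd n (pR (Suc n) x) = pd (Suc n) (pX n x)"
  and d_pD: "at [Up] n x \<Longrightarrow> pd n (pD (Suc n) x) = pd (Suc n) (pR n x)"
  unfolding p_defs by (rule d_bend[OF local2_XY(1)] d_bend[OF local2_R(1), unfolded p_defs], assumption)+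

text \<open>Moving a \<open>Down\<close> strand to the left past two \<open>Up\<close> strands takes
  a single bend: the inner cup and cap straighten.\<close>

lemma pR_pR: assumes "at [Up, Up, Down] n y"
  shows "pR n (pR (Suc n) y) = pd (Suc (Suc (Suc n))) (pX (Suc (Suc n)) (pX (Suc n) (pc n y)))"
proof -
  from assms obtain \<kappa> \<mu> s where [simp]: "dsp.ends y = Some (\<kappa> @ [Up, Up, Down] @ \<mu>, s)" and n: "n = length \<kappa>" by (rule atE)
  let ?v = "pX (Suc n) (pc n y)"
  have "pR n (pR (Suc n) y) = pR n (pd (Suc (Suc (Suc n))) (pX (Suc (Suc n)) (pc (Suc n) y)))"
    by (simp add: pR_def)
  also have "\<dots> = pd (Suc (Suc (Suc n))) (pX (Suc (Suc n)) (pR n (pc (Suc n) y)))"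
    using local2_right[OF local2_R(1), of n "Suc (Suc (Suc n))"] local2_right[OF local2_R(1), of n "Suc (Suc n)"]
    by simp
  also have "pR n (pc (Suc n) y) = ?v" by (rule pR_c) (simp add: evd n)
  finally show ?thesis .
qed

text \<open>The braid relation inside the bend of \<open>pR_pR\<close>.\<close>

lemma u_natural_X: assumes "at [Up, Up, Down] n x"
  shows "pR n (pR (Suc n) (pX n x)) = pX (Suc n) (pR n (pR (Suc n) x))"
proof -
  from assms obtain \<kappa> \<mu> s where [simp]: "dsp.ends x = Some (\<kappa> @ [Up, Up, Down] @ \<mu>, s)" and n: "n = length \<kappa>" by (rule atE)
  have a: "at [Up, Up, Down] n (pX n x)" by (simp add: evd n)
  have "pc n (pX n x) = pX (Suc (Suc n)) (pc n x)" using A_far[of n Cw n Xpos x] by simp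
  then have "pR n (pR (Suc n) (pX n x))
    = pd (Suc (Suc (Suc n))) (pX (Suc (Suc n)) (pX (Suc n) (pX (Suc (Suc n)) (pc n x))))"
    unfolding pR_pR[OF a] by simp
  also have "\<dots> = pd (Suc (Suc (Suc n))) (pX (Suc n) (pX (Suc (Suc n)) (pX (Suc n) (pc n x))))"
    by (subst pX_braid[of "Suc n"]) (simp_all add: evd n)
  also have "\<dots> = pX (Suc n) (pR n (pR (Suc n) x))"
    unfolding pR_pR[OF assms] using local2_right[OF local2_XY(1), of "Suc n" "Suc (Suc (Suc n))" Dw] by simp
  finally show ?thesis .
qed

text \<open>The cap closes the crossing inside the bend to the curl of
  \<open>pcurl1\<close>.\<close>

lemma d'_pR: assumes "at [Up, Down] n x" shows "pd' n (pR n x) = dsc t (pd n x)"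
proof -
  from assms obtain \<kappa> \<mu> s where [simp]: "dsp.ends x = Some (\<kappa> @ [Up, Down] @ \<mu>, s)" and n: "n = length \<kappa>" by (rule atE)
  have "pd' n (pR n x) = pd n (pd' n (pX (Suc n) (pc n x)))"
    unfolding pR_def using A_far[of n Dw' "Suc (Suc n)" Dw] by simp
  also have "\<dots> = dsc t (pd n x)" by (subst pcurl1) (simp_all add: evd n A_scale)
  finally show ?thesis .
qed

lemma pR_c': assumes "at [] n x" shows "pR n (pc' n x) = dsc t (pc n x)"
proof -
  from assms obtain \<kappa> \<mu> s where [simp]: "dsp.ends x = Some (\<kappa> @ [] @ \<mu>, s)" and n: "n = length \<kappa>" by (rule atE)
  have "pc n (pc' n x) = pc' (Suc (Suc n)) (pc n x)" using A_far[of n Cw n Cw' x] by simp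
  then show ?thesis unfolding pR_def using pcurl2[of "Suc n" "pc n x"] by (simp add: evd n)
qed

lemma dsc_cancel: "dsp.ends x \<noteq> None \<Longrightarrow> a * b = 1 \<Longrightarrow> dsc a (dsc b x) = x"
  using dsp.cat.scale_scale dsp.cat.scale_one by (fastforce simp: dsp.ends_iff)

lemma dsc_dsc: "dsp.ends x \<noteq> None \<Longrightarrow> dsc a (dsc b x) = dsc (a * b) x"
  using dsp.cat.scale_scale by (fastforce simp: dsp.ends_iff)

text \<open>The presentation gives the value of a loop in the other orientation only. It is
  transferred by \<open>t d' c = d' R_+ c' = t d c'\<close>, since \<open>t\<close> is a
  unit.\<close>

lemma d'_c: assumes "at [] n x" shows "pd' n (pc n x) = dsc \<delta> x"
proof -
  from assms obtain \<kappa> \<mu> s where [simp]: "dsp.ends x = Some (\<kappa> @ [] @ \<mu>, s)" and n: "n = length \<kappa>" by (rule atE)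
  have "dsc t (pd' n (pc n x)) = pd' n (pR n (pc' n x))" by (subst pR_c'[OF assms]) (simp add: A_scale evd n)
  also have "\<dots> = dsc t (dsc \<delta> x)" by (subst d'_pR) (simp_all add: evd n ploop)
  finally have "dsc ti (dsc t (pd' n (pc n x))) = dsc ti (dsc t (dsc \<delta> x))" by simp
  then show ?thesis using t_unit by (simp add: dsc_cancel evd n mult.commute)
qed

text \<open>Bending reverses composition, hence \<open>pD\<close> and \<open>pDm\<close> are mutually inverse.\<close>

lemma pD_inverse:
  assumes fg: "f \<in> {Xpos, Xneg}" "g \<in> {Xpos, Xneg}" "f \<noteq> g" and x: "at [Down, Down] n x"
  defines "F \<equiv> \<lambda>h y. pd (Suc (Suc n)) (pd (Suc (Suc (Suc n))) (A h (Suc (Suc n)) (pc (Suc n) (pc n y))))"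
  shows "F f (F g x) = x"
proof -
  obtain \<kappa> \<mu> s where [simp]: "dsp.ends x = Some (\<kappa> @ [Down, Down] @ \<mu>, s)" and n: "n = length \<kappa>"
    using x by (rule atE)
  have [simp]: "os_dom f = [Up, Up]" "os_cod f = [Up, Up]" "os_dom g = [Up, Up]" "os_cod g = [Up, Up]"
    using fg by auto
  let ?m2 = "Suc (Suc n)" and ?m3 = "Suc (Suc (Suc n))" and ?m4 = "Suc (Suc (Suc (Suc n)))"
    and ?m5 = "Suc (Suc (Suc (Suc (Suc n))))" and ?m6 = "Suc (Suc (Suc (Suc (Suc (Suc n)))))"
    and ?m7 = "Suc (Suc (Suc (Suc (Suc (Suc (Suc n))))))"
  let ?y = "pc (Suc n) (pc n x)"
  have cc: "pc (Suc n) (pc n (A h m z)) = A h (Suc (Suc (Suc (Suc m)))) (pc (Suc n) (pc n z))" if "n \<le> m" for h m z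
    using A_far[of n Cw m h z] A_far[of "Suc n" Cw "Suc (Suc m)" h] that by simp
  have dd: "pd ?m2 (pd ?m3 (A h (Suc (Suc (Suc (Suc m)))) z)) = A h m (pd ?m2 (pd ?m3 z))" if "?m2 \<le> m" for h m z
    using A_far[of ?m3 Dw "Suc (Suc (Suc (Suc m)))" h z] A_far[of ?m2 Dw "Suc (Suc m)" h] that by simp
  have "F f (F g x) = pd ?m2 (pd ?m3 (A f ?m2 (pd ?m6 (pd ?m7 (A g ?m6 (pc (Suc n) (pc n ?y)))))))"
    unfolding F_def by (simp add: cc)
  also have "\<dots> = pd ?m2 (pd ?m3 (pd ?m6 (pd ?m7 (A g ?m6 (A f ?m2 (pc (Suc n) (pc n ?y)))))))"
    using A_far[of ?m2 f ?m6 Dw] A_far[of ?m2 f ?m7 Dw] A_far[of ?m2 f ?m6 g] by simp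
  also have "\<dots> = pd ?m2 (pd ?m3 (A g ?m2 (pd ?m2 (pd ?m3 (A f ?m2 (pc (Suc n) (pc n ?y)))))))"
    by (simp add: dd)
  \<comment> \<open>The later pair of nested cups may equally be placed to the right of the earlier
    pair, where it meets the caps that straighten it.\<close>
  also have "pc (Suc n) (pc n ?y) = pc ?m5 (pc ?m4 ?y)"
    using A_far[of n Cw "Suc n" Cw "pc n x"] A_far[of n Cw n Cw x]
      A_far[of "Suc n" Cw ?m3 Cw] A_far[of "Suc n" Cw ?m2 Cw] by simp
  also have "A f ?m2 (pc ?m5 (pc ?m4 ?y)) = pc ?m5 (pc ?m4 (A f ?m2 ?y))"
    using A_far[of ?m2 f ?m5 Cw] A_far[of ?m2 f ?m4 Cw] by simp
  also have "pd ?m3 (pc ?m5 (pc ?m4 (A f ?m2 ?y))) = pc ?m3 (pd ?m3 (pc ?m4 (A f ?m2 ?y)))"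
    using A_far[of ?m3 Dw ?m5 Cw] by simp
  also have "pd ?m3 (pc ?m4 (A f ?m2 ?y)) = A f ?m2 ?y" by (rule zz1) (simp add: evd n)
  also have "pd ?m2 (pc ?m3 (A f ?m2 ?y)) = A f ?m2 ?y" by (rule zz1) (simp add: evd n)
  also have "A g ?m2 (A f ?m2 ?y) = ?y"
    using fg XY[of ?m2 ?y] YX[of ?m2 ?y] by (auto simp: evd n)
  also have "pd ?m3 ?y = pc (Suc n) (pd (Suc n) (pc n x))"
    using A_far[of "Suc n" Cw "Suc n" Dw "pc n x"] by simp
  also have "pd (Suc n) (pc n x) = x" by (rule zz2) (simp add: evd n)
  also have "pd ?m2 (pc (Suc n) x) = x" by (rule zz2) (simp add: evd n)
  finally show ?thesis .
qed

lemma pDm_pD: "at [Down, Down] n x \<Longrightarrow> pDm n (pD n x) = x"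
  and pD_pDm: "at [Down, Down] n x \<Longrightarrow> pD n (pDm n x) = x"
proof -
  show "at [Down, Down] n x \<Longrightarrow> pDm n (pD n x) = x" "at [Down, Down] n x \<Longrightarrow> pD n (pDm n x) = x"
    using pD_inverse[of Xneg Xpos n x] pD_inverse[of Xpos Xneg n x] by (simp_all add: p_defs)
qed

text \<open>By \<open>pD_c\<close> the argument of \<open>pDm\<close> is \<open>pD\<close> of a cup
  on the other side of the \<open>Down\<close> strand, and \<open>pDm\<close> undoes
  \<open>pD\<close>.\<close>

lemma u_natural_c: assumes "at [Down] n x" shows "pDm n (pR (Suc n) (pc n x)) = pc (Suc n) x"
proof -
  obtain \<kappa> \<mu> s where [simp]: "dsp.ends x = Some (\<kappa> @ [Down] @ \<mu>, s)" and n: "n = length \<kappa>" using assms by (rule atE)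
  show ?thesis unfolding pD_c[OF assms, symmetric] by (rule pDm_pD) (simp add: evd n)
qed

lemma u_natural_d: assumes "at [Up, Down, Down] n x" shows "pd (Suc n) (pR n (pDm (Suc n) x)) = pd n x"
proof -
  obtain \<kappa> \<mu> s where [simp]: "dsp.ends x = Some (\<kappa> @ [Up, Down, Down] @ \<mu>, s)" and n: "n = length \<kappa>"
    using assms by (rule atE)
  have "pd (Suc n) (pR n (pDm (Suc n) x)) = pd n (pD (Suc n) (pDm (Suc n) x))"
    by (rule d_pD[symmetric]) (simp add: evd p_defs n)
  also have "pD (Suc n) (pDm (Suc n) x) = x" by (rule pD_pDm) (simp add: evd n)
  finally show ?thesis .
qed

text \<open>\<open>R\<close> is composed of \<open>c\<close>, \<open>X\<close> and \<open>d\<close>, so the naturality for these gives that for \<open>R\<close>.\<close>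

lemma u_natural_R: assumes "at [Up, Down, Down] n x"
  shows "pDm n (pR (Suc n) (pR n x)) = pR (Suc n) (pR n (pDm (Suc n) x))"
proof -
  obtain \<kappa> \<mu> s where [simp]: "dsp.ends x = Some (\<kappa> @ [Up, Down, Down] @ \<mu>, s)" and n: "n = length \<kappa>"
    using assms by (rule atE)
  let ?m2 = "Suc (Suc n)" and ?m3 = "Suc (Suc (Suc n))" and ?z = "pX (Suc n) (pc n x)" and ?y = "pDm (Suc n) x"
  have "pR n x = pd ?m3 (pR ?m2 (pDm ?m3 ?z))"
    unfolding pR_def[of n] by (rule u_natural_d[symmetric]) (simp add: evd n)
  then have "pDm n (pR (Suc n) (pR n x)) = pd ?m3 (pDm n (pR (Suc n) (pR ?m2 (pDm ?m3 ?z))))"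
    using local2_right[OF local2_R(1), of "Suc n" ?m3] local2_right[OF local2_D(2), of n ?m3] by simp
  also have "pDm ?m3 ?z = pX (Suc n) (pc n ?y)"
    using local2_left[OF local2_D(2), of "Suc n" Xpos ?m3] local2_left[OF local2_D(2), of n Cw "Suc n"] by simp
  also have "pR (Suc n) (pR ?m2 (pX (Suc n) (pc n ?y))) = pX ?m2 (pR (Suc n) (pR ?m2 (pc n ?y)))"
    by (rule u_natural_X) (simp add: evd p_defs n)
  also have "pDm n (pX ?m2 (pR (Suc n) (pR ?m2 (pc n ?y)))) = pX ?m2 (pDm n (pR (Suc n) (pR ?m2 (pc n ?y))))"
    using local2_right[OF local2_D(2), of n ?m2] by simp
  also have "pR ?m2 (pc n ?y) = pc n (pR n ?y)"
    using local2_left[OF local2_R(1), of n Cw n] by simp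
  also have "pDm n (pR (Suc n) (pc n (pR n ?y))) = pc (Suc n) (pR n ?y)"
    by (rule u_natural_c) (simp add: evd p_defs n)
  finally show ?thesis by (simp add: pR_def)
qed

text \<open>Writing \<open>x\<close> as \<open>R_+ y\<close> trades \<open>d'\<close> for
  \<open>t d\<close>, which moves by the bent braid relation and \<open>d_pR\<close>. The same trade
  at the end takes the factor \<open>t\<close> away.\<close>

lemma w_natural_d': assumes "at [Up, Down, Up] n x" shows "pd' n (pY (Suc n) (pR n x)) = pd' (Suc n) x"
proof -
  obtain \<kappa> \<mu> s where [simp]: "dsp.ends x = Some (\<kappa> @ [Up, Down, Up] @ \<mu>, s)" and n: "n = length \<kappa>"
    using assms by (rule atE)
  define y where "y = pL (Suc n) x"
  have [simp]: "dsp.ends y = Some (\<kappa> @ [Up, Up, Down] @ \<mu>, s)" by (simp add: y_def evd p_defs n)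
  have x: "x = pR (Suc n) y" unfolding y_def by (rule RL[symmetric]) (simp add: evd n)
  have "pR n x = pX (Suc n) (pR n (pR (Suc n) (pY n y)))"
  proof -
    have "pR n (pR (Suc n) (pX n (pY n y))) = pX (Suc n) (pR n (pR (Suc n) (pY n y)))"
      by (rule u_natural_X) (simp add: evd n)
    then show ?thesis unfolding x by (subst (asm) XY) (simp_all add: evd n)
  qed
  then have "pY (Suc n) (pR n x) = pR n (pR (Suc n) (pY n y))"
    by (simp only:) (rule YX, simp add: evd p_defs n)
  then have "pd' n (pY (Suc n) (pR n x)) = dsc t (pd n (pR (Suc n) (pY n y)))"
    by (simp only:) (rule d'_pR, simp add: evd p_defs n)
  also have "pd n (pR (Suc n) (pY n y)) = pd (Suc n) (pX n (pY n y))"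
    by (rule d_pR) (simp add: evd n)
  also have "pX n (pY n y) = y" by (rule XY) (simp add: evd n)
  also have "dsc t (pd (Suc n) y) = pd' (Suc n) x"
    unfolding x by (rule d'_pR[symmetric]) (simp add: evd n)
  finally show ?thesis .
qed

text \<open>The device of \<open>w_natural_d'\<close> with \<open>u_natural_R\<close> and
  \<open>u_natural_d\<close>: \<open>d'\<close> is replaced by \<open>t d\<close>, moved, and
  restored.\<close>

lemma u_natural_d': assumes "at [Down, Up, Down] n x" shows "pd' (Suc n) (pDm n (pR (Suc n) x)) = pd' n x"
proof -
  obtain \<kappa> \<mu> s where [simp]: "dsp.ends x = Some (\<kappa> @ [Down, Up, Down] @ \<mu>, s)" and n: "n = length \<kappa>"
    using assms by (rule atE)
  define y where "y = pL n x"
  have [simp]: "dsp.ends y = Some (\<kappa> @ [Up, Down, Down] @ \<mu>, s)" by (simp add: y_def evd p_defs n)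
  have x: "x = pR n y" unfolding y_def by (rule RL[symmetric]) (simp add: evd n)
  have "pDm n (pR (Suc n) x) = pR (Suc n) (pR n (pDm (Suc n) y))"
    unfolding x by (rule u_natural_R) (simp add: evd n)
  then have "pd' (Suc n) (pDm n (pR (Suc n) x)) = dsc t (pd (Suc n) (pR n (pDm (Suc n) y)))"
    by (simp only:) (rule d'_pR, simp add: evd p_defs n)
  also have "pd (Suc n) (pR n (pDm (Suc n) y)) = pd n y" by (rule u_natural_d) (simp add: evd n)
  also have "dsc t (pd n y) = pd' n x" unfolding x by (rule d'_pR[symmetric]) (simp add: evd n)
  finally show ?thesis .
qed

lemma wt_mtyp: "wt u \<Longrightarrow> mtyp os_sig u X Y \<longleftrightarrow> X = os_src u \<and> Y = os_tgt u"
  using os_typ by (auto simp: wt_def)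

lemma DT_id: "DT f (MId X \<boxtimes> MId \<nu>) = DT f (MId (X @ \<nu>))"
  by (rule DT_cong[OF osp.cls_tens_ident])

lemma DO_right: assumes "wt u" shows "DO (u \<boxtimes> MId \<nu>) = AT u [] \<nu>"
  using osp.cls_cong_tens[OF osp.cls_tens_unit(1)[OF assms[unfolded wt_def]] HOL.refl, of "MId \<nu>"]
  unfolding AT_def by (intro DO_cong) simp

section \<open>Toggle relations, and commuting toggles on neighbouring strands\<close>

lemma toggle_rel:
  assumes "ds_toggle_rel q u v" "ctyp ds_sig u X Y" "ctyp ds_sig v X Y"
  shows "Dcmp (Dcls (ds_right \<nu> u)) x = Dcmp (Dcls (ds_right \<nu> v)) x"
  using assms ctyp_ds_right by (intro dsp.cmp_rel[OF ds_rel.toggle]) blast+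

lemma wt_R [simp]: "wt (os_R X\<^sub>p)" "wt (os_R X\<^sub>m)" "os_src (os_R u) = [Up, Down]" "os_tgt (os_R u) = [Down, Up]"
  and wt_D [simp]: "wt (os_D X\<^sub>p)" "wt (os_D X\<^sub>m)" "os_src (os_D u) = [Down, Down]" "os_tgt (os_D u) = [Down, Down]"
  by (simp_all add: os_R_def os_D_def)

lemma apply_R:
  assumes "map_option fst (dsp.ends x) = Some (\<kappa> @ [Up, Down] @ \<mu>)"
  shows "Dcmp (AT (os_R X\<^sub>p) \<kappa> \<mu>) x = pR (length \<kappa>) x" "Dcmp (AT (os_R X\<^sub>m) \<kappa> \<mu>) x = pRm (length \<kappa>) x"
  using assms unfolding os_R_def by (auto simp: AT_simps evd p_defs)

lemma ends_R:
  assumes "dsp.ends x = Some (\<kappa> @ [Up, Down] @ \<mu>, s)"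
  shows "dsp.ends (pR (length \<kappa>) x) = Some (\<kappa> @ [Down, Up] @ \<mu>, s)"
    "dsp.ends (pRm (length \<kappa>) x) = Some (\<kappa> @ [Down, Up] @ \<mu>, s)"
  using assms by (simp_all add: p_defs evd)

lemma ends_D:
  assumes "dsp.ends x = Some (\<kappa> @ [Down, Down] @ \<mu>, s)"
  shows "dsp.ends (pD (length \<kappa>) x) = Some (\<kappa> @ [Down, Down] @ \<mu>, s)"
    "dsp.ends (pDm (length \<kappa>) x) = Some (\<kappa> @ [Down, Down] @ \<mu>, s)"
  using assms by (simp_all add: p_defs evd)

lemma apply_D:
  assumes "map_option fst (dsp.ends x) = Some (\<kappa> @ [Down, Down] @ \<mu>)"
  shows "Dcmp (AT (os_D X\<^sub>p) \<kappa> \<mu>) x = pD (length \<kappa>) x" "Dcmp (AT (os_D X\<^sub>m) \<kappa> \<mu>) x = pDm (length \<kappa>) x"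
  using assms unfolding os_D_def by (auto simp: AT_simps apply_R evd p_defs)

lemma TTb: assumes "at [Up] 0 x" shows "Tg Tau (Tg TauBar x) = x"
proof -
  from assms obtain \<mu> s where [simp]: "dsp.ends x = Some (Up # \<mu>, s)" by (auto elim: atE)
  show ?thesis using toggle_rel[OF ds_toggle_rel.intros(1), of "[Up]" "[Up]" \<mu> x]
    by (simp add: ctyp_simps mtyp_simps dsp.cmp_cls_comp DT_id apply_Tg evd dsp.ident_cls[symmetric]
        dsp.cmp_ident_left dsp.ends_iff[symmetric])
qed

lemma TbT: assumes "at [Down] 0 x" shows "Tg TauBar (Tg Tau x) = x"
proof -
  from assms obtain \<mu> s where [simp]: "dsp.ends x = Some (Down # \<mu>, s)" by (auto elim: atE)
  show ?thesis using toggle_rel[OF ds_toggle_rel.intros(2), of "[Down]" "[Down]" \<mu> x]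
    by (simp add: ctyp_simps mtyp_simps dsp.cmp_cls_comp DT_id apply_Tg evd dsp.ident_cls[symmetric]
        dsp.cmp_ident_left dsp.ends_iff[symmetric])
qed

lemma Tau_D: assumes "at [Down, Down] 0 x"
  shows "Tg Tau (pRm 0 (Tg Tau (pD 0 x))) = pX 0 (Tg Tau (pRm 0 (Tg Tau x)))"
proof -
  from assms obtain \<mu> s where [simp]: "dsp.ends x = Some (Down # Down # \<mu>, s)" by (auto elim: atE)
  note e = ends_D(1)[of _ "[]", simplified] ends_R(2)[of _ "[]", simplified]
  note a = apply_D[of _ "[]", simplified] apply_R[of _ "[]", simplified]
  show ?thesis using toggle_rel[OF ds_toggle_rel.intros(3), of "[Down, Down]" "[Up, Up]" \<mu> x]
    by (simp add: ctyp_simps mtyp_simps os_sig_def wt_mtyp dsp.cmp_cls_comp DT_id DO_right apply_Tg a e evd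
      apply_AT[of _ "[]", simplified])
qed

lemma cap_X: assumes "at [Up, Up] 0 x" shows "pd' 0 (Tg TauBar (pX 0 x)) = dsc q (pd' 0 (Tg TauBar x))"
proof -
  from assms obtain \<mu> s where x [simp]: "dsp.ends x = Some (Up # Up # \<mu>, s)" by (auto elim: atE)
  have "ctyp ds_sig (os d\<^sub>o' \<star> taubar [Up]) [Up, Up] ([] :: word)" by (simp add: ctyp_simps mtyp_simps os_sig_def wt_mtyp)
  from ctyp_ds_right[OF this, of \<mu>]
  have "Dcmp (Dcls (CScale q (ds_right \<mu> (os d\<^sub>o' \<star> taubar [Up])))) x
    = dsc q (Dcmp (Dcls (ds_right \<mu> (os d\<^sub>o' \<star> taubar [Up]))) x)"
    by (intro dsp.cmp_cls_scale[OF _ x[unfolded dsp.ends_iff]]) simp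
  then show ?thesis using toggle_rel[OF ds_toggle_rel.intros(4), of "[Up, Up]" "[]" \<mu> x]
    by (simp add: ctyp_simps mtyp_simps os_sig_def wt_mtyp dsp.cmp_cls_comp DT_id DO_right apply_Tg evd
      apply_AT[of _ "[]", simplified])
qed

lemma X_cup: assumes "at [] 0 x" shows "pX 0 (Tg Tau (pc 0 x)) = dsc q (Tg Tau (pc 0 x))"
proof -
  from assms obtain \<mu> s where x [simp]: "dsp.ends x = Some (\<mu>, s)" by (auto elim: atE)
  have "ctyp ds_sig (tau [Up] \<star> os c\<^sub>o) [] [Up, Up]" by (simp add: ctyp_simps mtyp_simps os_sig_def wt_mtyp)
  from ctyp_ds_right[OF this, of \<mu>]
  have "Dcmp (Dcls (CScale q (ds_right \<mu> (tau [Up] \<star> os c\<^sub>o)))) x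
    = dsc q (Dcmp (Dcls (ds_right \<mu> (tau [Up] \<star> os c\<^sub>o))) x)"
    by (intro dsp.cmp_cls_scale[OF _ x[unfolded dsp.ends_iff]]) simp
  then show ?thesis using toggle_rel[OF ds_toggle_rel.intros(5), of "[]" "[Up, Up]" \<mu> x]
    by (simp add: ctyp_simps mtyp_simps os_sig_def wt_mtyp dsp.cmp_cls_comp DT_id DO_right apply_Tg evd
      apply_AT[of _ "[]", simplified])
qed

text \<open>The skein relation inside the bend. Without its crossing the bend falls apart into the
  cap \<open>d\<close> followed by the cup \<open>c\<close>.\<close>

lemma R_skein: assumes "at [Up, Down] n x" shows "pR n x = dad (pRm n x) (dsc (q - qi) (pc n (pd n x)))"
proof -
  from assms obtain \<kappa> \<mu> s where [simp]: "dsp.ends x = Some (\<kappa> @ [Up, Down] @ \<mu>, s)" and n: "n = length \<kappa>" by (rule atE)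
  have "pX (Suc n) (pc n x) = dad (pY (Suc n) (pc n x)) (dsc (q - qi) (pc n x))"
    by (rule pskein) (simp add: evd n)
  moreover have "pd (Suc (Suc n)) (pc n x) = pc n (pd n x)" using A_far[of n Cw n Dw x] by simp
  ultimately show ?thesis unfolding pR_def pRm_def by (simp add: A_add A_scale evd n)
qed

text \<open>
  The third toggle relation concerns \<open>pE\<close>, while the commutation of toggles on adjacent strands
  concerns \<open>pE'\<close>.  By the skein relation they differ by a multiple of the cup after \<open>pk\<close>, and
  capping \<open>pE\<close> gives \<open>t\<^sup>-\<^sup>1 pk\<close>, whence \<open>D\<^sub>-\<close> acts before \<open>pk\<close> as the scalar \<open>q\<^sup>-\<^sup>1\<close>.
\<close>

definition pE where "pE x = Tg Tau (pRm 0 (Tg Tau x))"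
definition pE' where "pE' x = Tg Tau (pR 0 (Tg Tau x))"
definition pk where "pk x = pd 0 (Tg Tau x)"

lemma pE'_skein: assumes "at [Down, Down] 0 x"
  shows "pE' x = dad (pE x) (dsc (q - qi) (Tg Tau (pc 0 (pk x))))"
proof -
  from assms obtain \<mu> s where [simp]: "dsp.ends x = Some (Down # Down # \<mu>, s)" by (auto elim: atE)
  have "pR 0 (Tg Tau x) = dad (pRm 0 (Tg Tau x)) (dsc (q - qi) (pc 0 (pk x)))"
    unfolding pk_def by (rule R_skein) (simp add: evd)
  then show ?thesis by (simp add: pE'_def pE_def pk_def Tg_add Tg_scale evd p_defs)
qed

text \<open>With \<open>pE'\<close> in place of \<open>pE\<close> the cap produces \<open>t\<close>.
  The term by which the two differ is capped to a loop and contributes \<open>z \<delta>\<close>,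
  and \<open>t - z \<delta>\<close> is \<open>ti\<close>.\<close>

lemma pk_ti: assumes "at [Down, Down] 0 x" shows "pd' 0 (Tg TauBar (pE x)) = dsc ti (pk x)"
proof -
  from assms obtain \<mu> s where [simp]: "dsp.ends x = Some (Down # Down # \<mu>, s)" by (auto elim: atE)
  have k [simp]: "dsp.ends (pk x) = Some (\<mu>, s)" by (simp add: pk_def evd)
  have e [simp]: "dsp.ends (pE x) = Some (Up # Up # \<mu>, s)" by (simp add: pE_def p_defs evd)
  have "dsc t (pk x) = pd' 0 (pR 0 (Tg Tau x))" unfolding pk_def by (rule d'_pR[symmetric]) (simp add: evd)
  also have "pR 0 (Tg Tau x) = Tg TauBar (pE' x)"
    unfolding pE'_def by (rule TbT[symmetric]) (simp add: evd p_defs)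
  also have "pd' 0 (Tg TauBar (pE' x)) = dad (pd' 0 (Tg TauBar (pE x)))
      (dsc (q - qi) (pd' 0 (Tg TauBar (Tg Tau (pc 0 (pk x))))))"
    by (simp add: pE'_skein assms Tg_add Tg_scale A_add A_scale evd)
  also have "Tg TauBar (Tg Tau (pc 0 (pk x))) = pc 0 (pk x)" by (rule TbT) (simp add: evd)
  also have "pd' 0 (pc 0 (pk x)) = dsc \<delta> (pk x)" by (rule d'_c) (simp add: evd)
  finally have 1: "dsc t (pk x) = dad (pd' 0 (Tg TauBar (pE x))) (dsc (q - qi) (dsc \<delta> (pk x)))" .
  have "t = ti + (q - qi) * \<delta>" using delta by (simp add: algebra_simps)
  then have 2: "dsc t (pk x) = dad (dsc ti (pk x)) (dsc (q - qi) (dsc \<delta> (pk x)))"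
    using dsp.cat.scale_add_left[OF k[unfolded dsp.ends_iff], of ti "(q - qi) * \<delta>"] by (simp add: dsc_dsc)
  have "pd' 0 (Tg TauBar (pE x)) \<in> hom dsp.cat s \<mu>" "dsc ti (pk x) \<in> hom dsp.cat s \<mu>"
    "dsc (q - qi) (dsc \<delta> (pk x)) \<in> hom dsp.cat s \<mu>"
    unfolding dsp.ends_iff[symmetric] by (simp_all add: evd)
  from dsp.cat.add_right_cancel[OF this] show ?thesis using 1 2 by simp
qed

text \<open>The base case of \<open>stg_Tau\<close>: on the left the first strand is toggled before
  the second one, on the right after it.\<close>

lemma toggle_pair: assumes "at [Down, Down] 0 x"
  shows "pY 0 (Tg Tau (pR 0 (Tg Tau x))) = Tg Tau (pR 0 (Tg Tau (pDm 0 x)))"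
proof -
  from assms obtain \<mu> s where [simp]: "dsp.ends x = Some (Down # Down # \<mu>, s)" by (auto elim: atE)
  let ?y = "pDm 0 x"
  have [simp]: "dsp.ends ?y = Some (Down # Down # \<mu>, s)" using ends_D(2)[of x "[]"] by simp
  have y: "at [Down, Down] 0 ?y" by (simp add: at_def)
  have k [simp]: "dsp.ends (pk x) = Some (\<mu>, s)" "dsp.ends (pk ?y) = Some (\<mu>, s)" by (simp_all add: pk_def evd)
  have e [simp]: "dsp.ends (pE x) = Some (Up # Up # \<mu>, s)" "dsp.ends (pE ?y) = Some (Up # Up # \<mu>, s)"
    by (simp_all add: pE_def p_defs evd)
  have "pE x = pX 0 (pE ?y)" using Tau_D[OF y] pD_pDm[OF assms] by (simp add: pE_def)
  then have Ey: "pE ?y = pY 0 (pE x)" using YX[of 0 "pE ?y"] by (simp add: at_def)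
  \<comment> \<open>The cap turns the crossing in \<open>pE x = pX 0 (pE ?y)\<close> into
    \<open>q\<close>.\<close>
  have "dsc ti (pk x) = dsc q (pd' 0 (Tg TauBar (pE ?y)))"
    unfolding pk_ti[OF assms, symmetric] using cap_X[of "pE ?y"] \<open>pE x = _\<close> by (simp add: at_def)
  also have "\<dots> = dsc (q * ti) (pk ?y)" by (simp add: pk_ti y dsc_dsc)
  finally have "dsc (qi * t) (dsc ti (pk x)) = dsc (qi * t) (dsc (q * ti) (pk ?y))" by simp
  moreover have "qi * t * ti = qi" using t_unit by (simp add: mult.assoc)
  ultimately have ky: "pk ?y = dsc qi (pk x)" by (simp add: dsc_cancel scalars dsc_dsc)
  let ?u = "Tg Tau (pc 0 (pk x))"
  have [simp]: "dsp.ends ?u = Some (Up # Up # \<mu>, s)" by (simp add: evd)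
  \<comment> \<open>The inverse crossing multiplies the toggled cup by \<open>qi\<close>, the same
    scalar by which \<open>pk\<close> changes from \<open>x\<close> to \<open>?y\<close>; the
    correction terms therefore match.\<close>
  have "dsc qi ?u = pY 0 (pX 0 (dsc qi ?u))" by (rule YX[symmetric]) (simp add: evd)
  also have "pX 0 (dsc qi ?u) = dsc qi (dsc q ?u)" using X_cup[of "pk x"] by (simp add: A_scale at_def)
  also have "dsc qi (dsc q ?u) = ?u" using q_unit by (simp add: dsc_cancel mult.commute)
  finally have Yu: "pY 0 ?u = dsc qi ?u" ..
  have "pY 0 (pE' x) = dad (pE ?y) (dsc (q - qi) (dsc qi ?u))"
    by (simp add: pE'_skein assms A_add A_scale evd Ey Yu)
  also have "dsc qi ?u = Tg Tau (pc 0 (pk ?y))" by (simp add: ky A_scale Tg_scale evd)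
  also have "dad (pE ?y) (dsc (q - qi) (Tg Tau (pc 0 (pk ?y)))) = pE' ?y" by (rule pE'_skein[OF y, symmetric])
  finally show ?thesis by (simp add: pE'_def)
qed

text \<open>
  A \<open>Down\<close> strand is moved to the far left by \<open>pU\<close>, toggled there and moved back by \<open>pW\<close>.
\<close>

definition pU where "pU n x = (if at [Up, Down] n x then pR n x else pDm n x)"
definition pW where "pW n x = (if at [Up, Up] n x then pY n x else pR n x)"

definition stg :: "nat \<Rightarrow> 'k ds_term set \<Rightarrow> 'k ds_term set" where
  "stg n x = foldr pW (rev [0..<n]) (Tg Tau (foldr pU [0..<n] x))"

section \<open>Exchange of the toggle on an arbitrary strand with its surroundings\<close>

lemma stg_simps: "stg 0 x = Tg Tau x" "stg (Suc n) x = pW n (stg n (pU n x))"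
  by (simp_all add: stg_def)

lemma p_empty: "pR n {} = {}" "pDm n {} = {}" "pU n {} = {}" "pW n {} = {}"
  by (simp_all add: p_defs pU_def pW_def)

lemma ends_U: "dsp.ends x = Some (\<kappa> @ [a, Down] @ \<mu>, s) \<Longrightarrow> dsp.ends (pU (length \<kappa>) x) = Some (\<kappa> @ [Down, a] @ \<mu>, s)"
  using ends_R[of x \<kappa> \<mu> s] ends_D[of x \<kappa> \<mu> s] by (cases a) (simp_all add: pU_def at_def)

lemma ends_W: "dsp.ends x = Some (\<kappa> @ [Up, a] @ \<mu>, s) \<Longrightarrow> dsp.ends (pW (length \<kappa>) x) = Some (\<kappa> @ [a, Up] @ \<mu>, s)"
  using ends_R[of x \<kappa> \<mu> s] by (cases a) (simp_all add: pW_def evd)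

lemma ends_stg: "dsp.ends x = Some (\<kappa> @ [Down] @ \<mu>, s) \<Longrightarrow> dsp.ends (stg (length \<kappa>) x) = Some (\<kappa> @ [Up] @ \<mu>, s)"
proof (induction \<kappa> arbitrary: x \<mu> rule: rev_induct)
  case Nil then show ?case by (simp add: stg_simps evd)
next
  case (snoc a \<kappa>)
  from ends_U[of x \<kappa> a \<mu> s] snoc.prems have "dsp.ends (pU (length \<kappa>) x) = Some (\<kappa> @ [Down] @ a # \<mu>, s)" by simp
  from ends_W[of _ \<kappa> a \<mu> s] snoc.IH[OF this] show ?case by (simp add: stg_simps)
qed

text \<open>Generators and toggles elsewhere do not affect whether the pattern occurs, so they
  commute with the choice between \<open>F\<close> and \<open>G\<close>. Where they do not apply,
  both sides must be \<open>{}\<close>; this is the purpose of the assumptions on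
  \<open>{}\<close>.\<close>

lemma local2_if:
  assumes F: "local2 F" "\<And>n. F n {} = {}" and G: "local2 G" "\<And>n. G n {} = {}" and p: "length p = 2"
  shows "local2 (\<lambda>n x. if at p n x then F n x else G n x)"
  unfolding local2_def
proof (intro conjI allI impI)
  fix g n m x assume nm: "Suc (Suc n) \<le> m"
  show "(if at p n (A g m x) then F n (A g m x) else G n (A g m x)) = A g m (if at p n x then F n x else G n x)"
  proof (cases "at (os_dom g) m x")
    case True
    then have "at p n (A g m x) \<longleftrightarrow> at p n x" using nm p by (intro at_A_before) simp_all
    then show ?thesis by (simp add: local2_right[OF F(1) nm] local2_right[OF G(1) nm])
  next
    case False
    then have "A g m x = {}" by (rule A_out)
    then show ?thesis using local2_right[OF F(1) nm, of g x] local2_right[OF G(1) nm, of g x] F(2) G(2) by simp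
  qed
next
  fix g n m x assume nm: "n + length (os_dom g) \<le> m"
  let ?k = "m - length (os_dom g) + length (os_cod g)"
  show "A g n (if at p m x then F m x else G m x) = (if at p ?k (A g n x) then F ?k (A g n x) else G ?k (A g n x))"
  proof (cases "at (os_dom g) n x")
    case True
    then have "at p ?k (A g n x) \<longleftrightarrow> at p m x" by (rule at_A_after[OF nm])
    then show ?thesis by (simp add: local2_left[OF F(1) nm] local2_left[OF G(1) nm])
  next
    case False
    then have "A g n x = {}" by (rule A_out)
    then show ?thesis using local2_left[OF F(1) nm, of x] local2_left[OF G(1) nm, of x] F(2) G(2) by simp
  qed
next
  fix f n x
  show "Tg f (if at p (Suc n) x then F (Suc n) x else G (Suc n) x)
    = (if at p (Suc n) (Tg f x) then F (Suc n) (Tg f x) else G (Suc n) (Tg f x))"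
  proof (cases "at [tog_dom f] 0 x")
    case True
    then obtain \<mu> s where "dsp.ends x = Some (tog_dom f # \<mu>, s)" by (auto elim: atE)
    then have "at p (Suc n) (Tg f x) \<longleftrightarrow> at p (Suc n) x" by (simp add: evd)
    then show ?thesis by (simp add: local2_Tg[OF F(1)] local2_Tg[OF G(1)])
  next
    case False
    then have "Tg f x = {}" by (rule Tg_out)
    then show ?thesis using local2_Tg[OF F(1), of f n x] local2_Tg[OF G(1), of f n x] F(2) G(2) by simp
  qed
qed

lemma local2_UW: "local2 pU" "local2 pW"
  unfolding pU_def[abs_def] pW_def[abs_def]
  by (rule local2_if; simp add: local2_R local2_D local2_XY p_empty)+

lemma stg_right: "Suc n \<le> m \<Longrightarrow> stg n (A g m x) = A g m (stg n x)"
proof (induction n arbitrary: x)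
  case 0 then show ?case using Tg_A[of Tau g "m - 1" x] by (simp add: stg_simps)
next
  case (Suc n)
  then show ?case by (simp add: stg_simps local2_right[OF local2_UW(1)] local2_right[OF local2_UW(2)])
qed

text \<open>Strands between the two toggles are removed by induction from the right, since
  \<open>pU\<close> and \<open>pW\<close> are local. Only adjacent strands remain, and there
  \<open>toggle_pair\<close> applies.\<close>

lemma stg_Tau: "dsp.ends x = Some (Down # \<kappa> @ [Down] @ \<mu>, s)
  \<Longrightarrow> stg (Suc (length \<kappa>)) (Tg Tau x) = Tg Tau (stg (Suc (length \<kappa>)) x)"
proof (induction \<kappa> arbitrary: x \<mu> rule: rev_induct)
  case Nil
  then have x: "dsp.ends x = Some (Down # Down # \<mu>, s)" by simp
  have "dsp.ends (pR 0 (Tg Tau x)) = Some (Down # Up # \<mu>, s)"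
    using ends_R(1)[of "Tg Tau x" "[]" \<mu> s] x by (simp add: evd)
  moreover have "dsp.ends (pDm 0 x) = Some (Down # Down # \<mu>, s)" using ends_D(2)[of x "[]" \<mu> s] x by simp
  ultimately show ?case using toggle_pair[of x] x by (simp add: stg_simps pU_def pW_def evd)
next
  case (snoc a \<kappa>)
  have e: "dsp.ends (pU (Suc (length \<kappa>)) x) = Some (Down # \<kappa> @ [Down] @ a # \<mu>, s)"
    using ends_U[of x "Down # \<kappa>" a \<mu> s] snoc.prems by simp
  show ?case
    using snoc.IH[OF e] by (simp add: stg_simps(2)[of "Suc (length \<kappa>)"] local2_Tg[OF local2_UW(1), symmetric]
      local2_Tg[OF local2_UW(2), symmetric])
qed

text \<open>\<open>stg_Tau\<close> conjugated by the inverse toggle.\<close>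

lemma stg_TauBar: assumes "dsp.ends x = Some (Up # \<kappa> @ [Down] @ \<mu>, s)"
  shows "stg (Suc (length \<kappa>)) (Tg TauBar x) = Tg TauBar (stg (Suc (length \<kappa>)) x)"
proof -
  let ?y = "Tg TauBar x"
  have y: "dsp.ends ?y = Some (Down # \<kappa> @ [Down] @ \<mu>, s)" using assms by (simp add: evd)
  have "dsp.ends (stg (Suc (length \<kappa>)) ?y) = Some (Down # \<kappa> @ [Up] @ \<mu>, s)"
    using ends_stg[of ?y "Down # \<kappa>" \<mu> s] y by simp
  then have "stg (Suc (length \<kappa>)) ?y = Tg TauBar (Tg Tau (stg (Suc (length \<kappa>)) ?y))"
    by (intro TbT[symmetric]) (simp add: at_def)
  also have "Tg Tau (stg (Suc (length \<kappa>)) ?y) = stg (Suc (length \<kappa>)) x"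
    unfolding stg_Tau[OF y, symmetric] using assms by (subst TTb) (simp_all add: at_def)
  finally show ?thesis .
qed

text \<open>By locality the strand may be assumed to stand next to the cup. On its way to the left
  it passes by \<open>u_natural_c\<close>; on its way back the crossings with the two legs of the
  cup cancel by \<open>pR_c\<close> and \<open>YX\<close>.\<close>

lemma stg_c: assumes "dsp.ends x = Some (\<kappa> @ [Down] @ \<mu>, s)"
  shows "stg (Suc (Suc (length \<kappa>))) (pc 0 x) = pc 0 (stg (length \<kappa>) x)"
  using assms
proof (induction \<kappa> arbitrary: x \<mu> rule: rev_induct)
  case Nil
  then have x: "dsp.ends x = Some (Down # \<mu>, s)" by simp
  let ?y = "pDm 0 (pR (Suc 0) (pc 0 x))" and ?z = "Tg Tau x"
  have [simp]: "dsp.ends ?z = Some (Up # \<mu>, s)" using x by (simp add: evd)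
  have "dsp.ends (pR (Suc 0) (pc 0 x)) = Some (Down # Down # Up # \<mu>, s)"
    using ends_R(1)[of "pc 0 x" "[Down]" \<mu> s] x by (simp add: evd)
  then have "pU 0 (pU (Suc 0) (pc 0 x)) = ?y" using x by (simp add: pU_def evd)
  also have "?y = pc (Suc 0) x" using x by (intro u_natural_c) (simp add: at_def)
  finally have "stg (Suc (Suc 0)) (pc 0 x) = pW (Suc 0) (pW 0 (pc (Suc 0) ?z))"
    by (simp add: stg_simps Tg_A)
  also have "pW 0 (pc (Suc 0) ?z) = pR 0 (pc (Suc 0) ?z)" using x by (simp add: pW_def evd)
  also have "pR 0 (pc (Suc 0) ?z) = pX (Suc 0) (pc 0 ?z)" by (rule pR_c) (simp add: at_def)
  also have "pW (Suc 0) (pX (Suc 0) (pc 0 ?z)) = pY (Suc 0) (pX (Suc 0) (pc 0 ?z))" using x by (simp add: pW_def evd)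
  also have "\<dots> = pc 0 ?z" using x by (intro YX) (simp add: evd)
  finally show ?case by (simp add: stg_simps(1))
next
  case (snoc a \<kappa>)
  have e: "dsp.ends (pU (length \<kappa>) x) = Some (\<kappa> @ [Down] @ a # \<mu>, s)"
    using ends_U[of x \<kappa> a \<mu> s] snoc.prems by simp
  show ?case
    using snoc.IH[OF e] local2_left[OF local2_UW(1), of 0 Cw "length \<kappa>"] local2_left[OF local2_UW(2), of 0 Cw "length \<kappa>"]
    by (simp add: stg_simps(2)[of "Suc (Suc (length \<kappa>))"] stg_simps(2)[of "length \<kappa>"])
qed

text \<open>Dual to \<open>stg_c\<close>: the cap is passed by \<open>u_natural_d'\<close> on the
  way to the left and by \<open>w_natural_d'\<close> on the way back.\<close>

lemma stg_d': assumes "dsp.ends x = Some ([Down, Up] @ \<kappa> @ [Down] @ \<mu>, s)"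
  shows "pd' 0 (stg (Suc (Suc (length \<kappa>))) x) = stg (length \<kappa>) (pd' 0 x)"
  using assms
proof (induction \<kappa> arbitrary: x \<mu> rule: rev_induct)
  case Nil
  then have x: "dsp.ends x = Some (Down # Up # Down # \<mu>, s)" by simp
  let ?y = "pDm 0 (pR (Suc 0) x)"
  have [simp]: "dsp.ends (pR (Suc 0) x) = Some (Down # Down # Up # \<mu>, s)"
    using ends_R(1)[of x "[Down]" \<mu> s] x by simp
  have [simp]: "dsp.ends ?y = Some (Down # Down # Up # \<mu>, s)"
    using ends_D(2)[of "pR (Suc 0) x" "[]" "Up # \<mu>" s] by simp
  have [simp]: "dsp.ends (pR 0 (Tg Tau ?y)) = Some (Down # Up # Up # \<mu>, s)"
    using ends_R(1)[of "Tg Tau ?y" "[]" "Up # \<mu>" s] by (simp add: evd)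
  have "stg (Suc (Suc 0)) x = pY (Suc 0) (pR 0 (Tg Tau ?y))"
    using x by (simp add: stg_simps pU_def pW_def evd)
  then have "pd' 0 (stg (Suc (Suc 0)) x) = pd' (Suc 0) (Tg Tau ?y)"
    by (simp only:) (rule w_natural_d', simp add: evd)
  also have "\<dots> = Tg Tau (pd' 0 x)"
    using u_natural_d'[of 0 x] x by (simp add: Tg_A[symmetric] at_def)
  finally show ?case by (simp add: stg_simps(1))
next
  case (snoc a \<kappa>)
  have e: "dsp.ends (pU (Suc (Suc (length \<kappa>))) x) = Some ([Down, Up] @ \<kappa> @ [Down] @ a # \<mu>, s)"
    using ends_U[of x "[Down, Up] @ \<kappa>" a \<mu> s] snoc.prems by simp
  show ?case
    using snoc.IH[OF e] local2_left[OF local2_UW(1), of 0 Dw' "Suc (Suc (length \<kappa>))"]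
      local2_left[OF local2_UW(2), of 0 Dw' "Suc (Suc (length \<kappa>))"]
    by (simp add: stg_simps(2)[of "Suc (Suc (length \<kappa>))"] stg_simps(2)[of "length \<kappa>"])
qed

lemma pY_braid: assumes "at [Up, Up, Up] n x"
  shows "pY (Suc n) (pY n (pX (Suc n) x)) = pX n (pY (Suc n) (pY n x))"
proof -
  from assms obtain \<kappa> \<mu> s where [simp]: "dsp.ends x = Some (\<kappa> @ [Up, Up, Up] @ \<mu>, s)" and n: "n = length \<kappa>" by (rule atE)
  let ?y = "pY (Suc n) (pY n x)"
  have "pX (Suc n) x = pX (Suc n) (pX n (pX (Suc n) ?y))"
    using XY[of "Suc n" "pY n x"] XY[of n x] by (simp add: evd n)
  also have "\<dots> = pX n (pX (Suc n) (pX n ?y))" by (rule pX_braid[symmetric]) (simp add: evd n)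
  finally show ?thesis
    using YX[of n "pX (Suc n) (pX n ?y)"] YX[of "Suc n" "pX n ?y"] by (simp add: evd n)
qed

text \<open>The strand passes the crossing by \<open>u_natural_X\<close> on its way to the left and
  by a mixed braid relation on its way back. In between the crossing lies to its right, where
  \<open>stg_right\<close> applies.\<close>

lemma stg_X: assumes "dsp.ends x = Some (\<kappa> @ [Up, Up] @ \<rho> @ [Down] @ \<mu>, s)"
  shows "stg (length \<kappa> + Suc (Suc (length \<rho>))) (pX (length \<kappa>) x) = pX (length \<kappa>) (stg (length \<kappa> + Suc (Suc (length \<rho>))) x)"
  using assms
proof (induction \<rho> arbitrary: x \<mu> rule: rev_induct)
  case Nil
  let ?n = "length \<kappa>"
  from Nil have x [simp]: "dsp.ends x = Some (\<kappa> @ Up # Up # Down # \<mu>, s)" by simp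
  have X: "dsp.ends (pX ?n x) = Some (\<kappa> @ Up # Up # Down # \<mu>, s)" by (simp add: evd)
  have U: "pU ?n (pU (Suc ?n) y) = pR ?n (pR (Suc ?n) y)" "dsp.ends (pR ?n (pR (Suc ?n) y)) = Some (\<kappa> @ [Down] @ Up # Up # \<mu>, s)"
    if y: "dsp.ends y = Some (\<kappa> @ Up # Up # Down # \<mu>, s)" for y
  proof -
    have 1: "dsp.ends (pR (Suc ?n) y) = Some (\<kappa> @ Up # Down # Up # \<mu>, s)" using ends_R(1)[of y "\<kappa> @ [Up]" \<mu> s] y by simp
    then show "pU ?n (pU (Suc ?n) y) = pR ?n (pR (Suc ?n) y)" using y by (simp add: pU_def at_def)
    show "dsp.ends (pR ?n (pR (Suc ?n) y)) = Some (\<kappa> @ [Down] @ Up # Up # \<mu>, s)"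
      using ends_R(1)[of "pR (Suc ?n) y" \<kappa> "Up # \<mu>" s] 1 by simp
  qed
  have S: "stg (Suc (Suc ?n)) y = pY (Suc ?n) (pY ?n (stg ?n (pR ?n (pR (Suc ?n) y))))"
    and E: "dsp.ends (stg ?n (pR ?n (pR (Suc ?n) y))) = Some (\<kappa> @ [Up] @ Up # Up # \<mu>, s)"
    if y: "dsp.ends y = Some (\<kappa> @ Up # Up # Down # \<mu>, s)" for y
  proof -
    show "dsp.ends (stg ?n (pR ?n (pR (Suc ?n) y))) = Some (\<kappa> @ [Up] @ Up # Up # \<mu>, s)" by (rule ends_stg[OF U(2)[OF y]])
    then show "stg (Suc (Suc ?n)) y = pY (Suc ?n) (pY ?n (stg ?n (pR ?n (pR (Suc ?n) y))))"
      by (simp add: stg_simps U(1)[OF y] pW_def evd)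
  qed
  have "pR ?n (pR (Suc ?n) (pX ?n x)) = pX (Suc ?n) (pR ?n (pR (Suc ?n) x))"
    by (rule u_natural_X) (simp add: at_def)
  moreover have "pY (Suc ?n) (pY ?n (pX (Suc ?n) w)) = pX ?n (pY (Suc ?n) (pY ?n w))"
    if "dsp.ends w = Some (\<kappa> @ [Up] @ Up # Up # \<mu>, s)" for w using that by (intro pY_braid) (simp add: at_def)
  ultimately show ?case using S[OF X] S[OF x] E[OF x] stg_right[of ?n "Suc ?n" Xpos] by simp
next
  case (snoc a \<rho>)
  let ?n = "length \<kappa> + Suc (Suc (length \<rho>))"
  have e: "dsp.ends (pU ?n x) = Some (\<kappa> @ [Up, Up] @ \<rho> @ [Down] @ a # \<mu>, s)"
    using ends_U[of x "\<kappa> @ [Up, Up] @ \<rho>" a \<mu> s] snoc.prems by simp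
  show ?case
    using snoc.IH[OF e] local2_left[OF local2_UW(1), of "length \<kappa>" Xpos ?n] local2_left[OF local2_UW(2), of "length \<kappa>" Xpos ?n]
    by (simp add: stg_simps(2)[of "Suc (Suc (length \<kappa> + length \<rho>))"])
qed

lemma wt_uw1 [simp]:
  "wt (os_u1 a)" "os_src (os_u1 a) = [a, Down]" "os_tgt (os_u1 a) = [Down, a]"
  "wt (os_w1 a)" "os_src (os_w1 a) = [Up, a]" "os_tgt (os_w1 a) = [a, Up]"
  by (cases a; simp)+

lemma os_u_ends [simp]: "os_src (os_u \<rho>) = \<rho> @ [Down]" "os_tgt (os_u \<rho>) = Down # \<rho>"
  and os_w_ends [simp]: "os_src (os_w \<rho>) = Up # \<rho>" "os_tgt (os_w \<rho>) = \<rho> @ [Up]"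
  by (induction \<rho>) simp_all

lemma wt_uw [simp]: "wt (os_u \<rho>)" "wt (os_w \<rho>)"
  by (induction \<rho>) simp_all

lemma apply_uw1:
  "dsp.ends x = Some (\<kappa> @ [a, Down] @ \<mu>, s) \<Longrightarrow> Dcmp (AT (os_u1 a) \<kappa> \<mu>) x = pU (length \<kappa>) x"
  "dsp.ends x = Some (\<kappa> @ [Up, a] @ \<mu>, s) \<Longrightarrow> Dcmp (AT (os_w1 a) \<kappa> \<mu>) x = pW (length \<kappa>) x"
  by (cases a; simp add: apply_R apply_D apply_AT pU_def pW_def at_def)+

lemma apply_u: "dsp.ends x = Some (\<kappa> @ \<rho> @ [Down] @ \<mu>, s)
  \<Longrightarrow> Dcmp (AT (os_u \<rho>) \<kappa> \<mu>) x = foldr pU [length \<kappa>..<length \<kappa> + length \<rho>] x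
    \<and> dsp.ends (foldr pU [length \<kappa>..<length \<kappa> + length \<rho>] x) = Some (\<kappa> @ [Down] @ \<rho> @ \<mu>, s)"
proof (induction \<rho> arbitrary: \<kappa>)
  case Nil then show ?case using apply_AT_id[of x \<kappa> "[Down]" \<mu>] by simp
next
  case (Cons a \<rho>)
  let ?y = "foldr pU [Suc (length \<kappa>)..<Suc (length \<kappa> + length \<rho>)] x"
  have 1: "Dcmp (AT (os_u \<rho>) (\<kappa> @ [a]) \<mu>) x = ?y" "dsp.ends ?y = Some (\<kappa> @ [a, Down] @ \<rho> @ \<mu>, s)"
    using Cons.IH[of "\<kappa> @ [a]"] Cons.prems by simp_all
  show ?case
    using 1 apply_uw1(1)[OF 1(2)] ends_U[OF 1(2)]
    by (simp add: AT_comp AT_tens_id dsp.cmp_assoc upt_conv_Cons del: upt_Suc)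
qed

lemma apply_w: "dsp.ends x = Some (\<kappa> @ [Up] @ \<rho> @ \<mu>, s)
  \<Longrightarrow> Dcmp (AT (os_w \<rho>) \<kappa> \<mu>) x = foldr pW (rev [length \<kappa>..<length \<kappa> + length \<rho>]) x"
proof (induction \<rho> arbitrary: \<kappa> x)
  case Nil then show ?case using apply_AT_id[of x \<kappa> "[Up]" \<mu>] by simp
next
  case (Cons a \<rho>)
  from Cons.prems have x: "dsp.ends x = Some (\<kappa> @ [Up, a] @ \<rho> @ \<mu>, s)" by simp
  have "[length \<kappa>..<length \<kappa> + length (a # \<rho>)] = length \<kappa> # [length (\<kappa> @ [a])..<length (\<kappa> @ [a]) + length \<rho>]"
    by (simp add: upt_conv_Cons del: upt_Suc)
  then show ?case
    using Cons.IH[of "pW (length \<kappa>) x" "\<kappa> @ [a]"] apply_uw1(2)[OF x] ends_W[OF x]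
    by (simp add: AT_comp AT_tens_id dsp.cmp_assoc del: upt_Suc)
qed

text \<open>Identifies \<open>stg\<close>, which moves one strand at a time, with the toggle defined
  through \<open>os_u\<close> and \<open>os_w\<close>.\<close>

lemma apply_strand_toggle:
  assumes x: "dsp.ends x = Some (\<kappa> @ [Down] @ \<mu>, s)"
  shows "Dcmp (Dcls (strand_toggle \<kappa> \<mu>)) x = stg (length \<kappa>) x"
proof -
  let ?y = "foldr pU [0..<length \<kappa>] x"
  have 1: "Dcmp (AT (os_u \<kappa>) [] \<mu>) x = ?y" "dsp.ends ?y = Some (Down # \<kappa> @ \<mu>, s)"
    using apply_u[of x "[]" \<kappa> \<mu> s] x by simp_all
  then have "dsp.ends (Tg Tau ?y) = Some ([] @ [Up] @ \<kappa> @ \<mu>, s)" by (simp add: evd)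
  from apply_w[OF this] show ?thesis
    using 1 by (simp add: strand_toggle_def dsp.cmp_cls_comp DO_right DT_id apply_Tg stg_def)
qed

lemma ctyp_strand_toggle: "ctyp ds_sig (strand_toggle \<kappa> \<mu>) (\<kappa> @ [Down] @ \<mu>) (\<kappa> @ [Up] @ \<mu>)"
proof -
  have "ctyp ds_sig (os (os_w \<kappa>) \<star> tau \<kappa> \<star> os (os_u \<kappa>)) (\<kappa> @ [Down]) (\<kappa> @ [Up])"
    by (simp add: ctyp_simps wt_mtyp)
  from ctyp_ds_right[OF this, of \<mu>] show ?thesis by (simp add: strand_toggle_def)
qed

end

section \<open>The functor from the iquantum Brauer category\<close>

context skein_parameters begin

abbreviation ups :: "nat \<Rightarrow> word" where "ups n \<equiv> replicate n Up"

fun g_op :: "b_gen \<Rightarrow> 'k ds_term set \<Rightarrow> 'k ds_term set" where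
  "g_op (Cup r) x = Tg Tau (pc 0 x)"
| "g_op (Cap r) x = pd' 0 (Tg TauBar x)"
| "g_op (Sig r i) x = pX (i - 1) x"
| "g_op (SigInv r i) x = pY (i - 1) x"

text \<open>The word \<open>\<nu>\<close> may contain \<open>Down\<close> strands. The naturality of
  \<open>eta\<close> needs this generality, because the generator acts there before the strands of
  \<open>\<nu>\<close> are toggled.\<close>

lemma apply_G_gen:
  assumes g: "b_sig g a b" and x: "dsp.ends x = Some (ups a @ \<nu>, s)"
  shows "Dcmp (Dcls (ds_right \<nu> (G_gen g))) x = g_op g x \<and> dsp.ends (g_op g x) = Some (ups b @ \<nu>, s)"
proof -
  have X: "Dcmp (Dcls (ds_right \<nu> (os (MId (ups (i - 1)) \<boxtimes> MGen h \<boxtimes> MId (ups (r - i - 1)))))) x = A h (i - 1) x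
    \<and> dsp.ends (A h (i - 1) x) = Some (ups r @ \<nu>, s)"
    if h: "h = Xpos \<or> h = Xneg" and i: "1 \<le> i" "i < r" and a: "a = r" for h i r
  proof -
    have "ups r = ups (i - 1) @ [Up, Up] @ ups (r - i - 1)"
    proof -
      have "r = (i - 1) + (2 + (r - i - 1))" using i by simp
      then show ?thesis by (metis replicate_add numeral_2_eq_2 replicate_0 replicate_Suc)
    qed
    with x a have x': "dsp.ends x = Some (ups (i - 1) @ [Up, Up] @ ups (r - i - 1) @ \<nu>, s)" and
      e: "ups r @ \<nu> = ups (i - 1) @ [Up, Up] @ ups (r - i - 1) @ \<nu>" by simp_all
    have hh: "os_dom h = [Up, Up]" "os_cod h = [Up, Up]" using h by auto
    from x' show ?thesis unfolding e
      by (simp add: hh DO_right AT_tens_id apply_AT evd)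
  qed
  show ?thesis
  proof (cases g)
    case (Cup r)
    have "Dcls (ds_right \<nu> (G_gen g)) = Dcls (ds_right (ups r @ \<nu>) (tau [Up] \<star> os c\<^sub>o))"
      unfolding Cup G_gen.simps ds_right_right ..
    then show ?thesis using g x Cup
      by (simp add: dsp.cmp_cls_comp DT_id DO_right apply_Tg apply_AT[of _ "[]", simplified] evd)
  next
    case (Cap r)
    have "Dcls (ds_right \<nu> (G_gen g)) = Dcls (ds_right (ups r @ \<nu>) (os d\<^sub>o' \<star> taubar [Up]))"
      unfolding Cap G_gen.simps ds_right_right ..
    then show ?thesis using g x Cap
      by (simp add: dsp.cmp_cls_comp DT_id DO_right apply_Tg apply_AT[of _ "[]", simplified] evd)
  next
    case (Sig r i) then show ?thesis using g X[of Xpos i r] by simp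
  next
    case (SigInv r i) then show ?thesis using g X[of Xneg i r] by simp
  qed
qed

lemma ctyp_G_gen: assumes "b_sig g a b" shows "ctyp ds_sig (G_gen g :: 'k ds_term) (G_ob a) (G_ob b)"
proof -
  have c: "ctyp ds_sig (os d\<^sub>o' \<star> taubar [Up] :: 'k ds_term) [Up, Up] []" "ctyp ds_sig (tau [Up] \<star> os c\<^sub>o :: 'k ds_term) [] [Up, Up]"
    by (simp_all add: ctyp_simps mtyp_simps os_sig_def wt_mtyp)
  have X: "ctyp ds_sig (os (MId (ups (i - 1)) \<boxtimes> MGen h \<boxtimes> MId (ups (r - i - 1))) :: 'k ds_term) (ups r) (ups r)"
    if h: "h = Xpos \<or> h = Xneg" and i: "1 \<le> i" "i < r" for h i r
  proof -
    have "r = (i - 1) + (2 + (r - i - 1))" using i by simp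
    then have "ups r = ups (i - 1) @ [Up, Up] @ ups (r - i - 1)"
      by (metis replicate_add numeral_2_eq_2 replicate_0 replicate_Suc)
    then show ?thesis using h by (auto simp: ctyp_simps wt_mtyp)
  qed
  show ?thesis using assms X ctyp_ds_right[OF c(1)] ctyp_ds_right[OF c(2)]
    by (cases g) (simp_all add: G_ob_def)
qed

lemma G_right: assumes "b_sig g a b" shows "DR \<nu> (Dcls (G_gen g)) = Dcls (ds_right \<nu> (G_gen g))"
  by (rule DR_cls[OF ctyp_G_gen[OF assms]])

lemma apply_G_gen_Nil:
  assumes g: "b_sig g a b" and x: "dsp.ends x = Some (ups a, s)"
  shows "Dcmp (Dcls (G_gen g)) x = g_op g x \<and> dsp.ends (g_op g x) = Some (ups b, s)"
proof -
  have "Dcls (ds_right [] (G_gen g)) = Dcls (G_gen g)"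
    using G_right[OF g, of "[]"] DR_Nil[of "Dcls (G_gen g)" "G_ob a" "G_ob b"] ctyp_G_gen[OF g] by simp
  then show ?thesis using apply_G_gen[OF g, of x "[]"] x by simp
qed

text \<open>The operator calculus counts strands and knows no orientations, so it is used where the
  target consists of \<open>Up\<close> strands; the source may be any word.\<close>

definition ust :: "'k ds_term set \<Rightarrow> (nat \<times> word) option" where
  "ust x = (case dsp.ends x of None \<Rightarrow> None | Some (w, s) \<Rightarrow> if w = ups (length w) then Some (length w, s) else None)"

lemma ust_iff: "ust x = Some (n, s) \<longleftrightarrow> dsp.ends x = Some (ups n, s)"
  by (auto simp: ust_def split: option.splits if_splits)

definition "gS i x = (if ust x = None then {} else pX i x)"
definition "gSi i x = (if ust x = None then {} else pY i x)"
definition "gU x = (if ust x = None then {} else Tg Tau (pc 0 x))"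
definition "gK x = (if ust x = None then {} else pd' 0 (Tg TauBar x))"

lemma at_ups: "dsp.ends x = Some (ups n, s) \<Longrightarrow> p = ups (length p) \<Longrightarrow> at p i x \<longleftrightarrow> i + length p \<le> n"
  by (auto simp: at_def min_def)

lemma ends_XY_ups:
  assumes x: "dsp.ends x = Some (ups n, s)" and i: "Suc i < n"
  shows "dsp.ends (pX i x) = Some (ups n, s)" "dsp.ends (pY i x) = Some (ups n, s)"
  using apply_G_gen_Nil[of "Sig n (Suc i)" n n x s] apply_G_gen_Nil[of "SigInv n (Suc i)" n n x s] x i by simp_all

lemma ends_UK_ups:
  assumes x: "dsp.ends x = Some (ups n, s)"
  shows "dsp.ends (Tg Tau (pc 0 x)) = Some (ups (Suc (Suc n)), s)"
    "n = Suc (Suc m) \<Longrightarrow> dsp.ends (pd' 0 (Tg TauBar x)) = Some (ups m, s)"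
  using apply_G_gen_Nil[of "Cup n" n "Suc (Suc n)" x s] apply_G_gen_Nil[of "Cap m" n m x s] x by simp_all

lemma ust_sc: "ust x = Some (n, s) \<Longrightarrow> ust (dsc a x) = Some (n, s)"
  by (simp add: ust_iff ends_scale)

text \<open>For the cup and the cap the scalar \<open>q\<close> is a toggle relation. In the loop
  and the curl the toggle cancels its inverse, and the oriented relations \<open>d'_c\<close> and
  \<open>pcurl1\<close> remain.\<close>

lemma g_strand_operators: "strand_operators ust {} gS gSi gU gK dsc q qi t ti \<delta>"
proof
  fix x :: "'k ds_term set" and n i :: nat and s
  show "ust {} = None" by (simp add: ust_def)
  show "dsc a {} = {}" for a by simp
  have out: "A h i x = {}" if "\<And>n s. ust x = Some (n, s) \<Longrightarrow> n \<le> Suc i" "ust x \<noteq> None" "h = Xpos \<or> h = Xneg" for h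
  proof -
    from that(2) obtain n s where x: "ust x = Some (n, s)" by auto
    then show ?thesis using that(1)[OF x] that(3) at_ups[of x n s "[Up, Up]" i] by (intro A_out) (auto simp: ust_iff)
  qed
  show "(\<And>n s. ust x = Some (n, s) \<Longrightarrow> n \<le> Suc i) \<Longrightarrow> gS i x = {}"
    "(\<And>n s. ust x = Some (n, s) \<Longrightarrow> n \<le> Suc i) \<Longrightarrow> gSi i x = {}"
    using out by (auto simp: gS_def gSi_def)
  show "ust x = None \<Longrightarrow> gU x = {}" by (simp add: gU_def)
  show "gK x = {}" if "\<And>n s. ust x = Some (n, s) \<Longrightarrow> n \<le> 1"
  proof (cases "ust x")
    case (Some p)
    obtain n s where x: "ust x = Some (n, s)" using Some by (cases p) simp
    have "\<not> at [Down, Up] 0 (Tg TauBar x)" using x that[OF x] by (auto simp: ust_iff evd)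
    then show ?thesis by (simp add: gK_def A_out)
  qed (simp add: gK_def)
  show "q * qi = 1" "t * ti = 1" by (rule q_unit t_unit)+
  assume x: "ust x = Some (n, s)"
  then have e: "dsp.ends x = Some (ups n, s)" by (simp add: ust_iff)
  have K: "\<exists>m. n = Suc (Suc m)" if "2 \<le> n" using that by presburger
  have up: "at [Up, Up] i x" if "Suc i < n" for i using that at_ups[OF e, of "[Up, Up]" i] by simp
  show S: "ust (gS i x) = Some (n, s)" "ust (gSi i x) = Some (n, s)" if "Suc i < n" for i
    using x ends_XY_ups[OF e that] by (simp_all add: gS_def gSi_def ust_iff)
  show U: "ust (gU x) = Some (Suc (Suc n), s)" using x ends_UK_ups(1)[OF e] by (simp add: gU_def ust_iff)
  show "ust (gK x) = Some (n - 2, s)" if "2 \<le> n"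
    using x K[OF that] ends_UK_ups(2)[OF e] by (auto simp: gK_def ust_iff)
  show "ust (dsc a x) = Some (n, s)" for a by (rule ust_sc[OF x])
  show "Suc i < n \<Longrightarrow> gS i (gSi i x) = x" "Suc i < n \<Longrightarrow> gSi i (gS i x) = x"
    using x S XY[OF up] YX[OF up] by (simp_all add: gS_def gSi_def)
  show "Suc i < n \<Longrightarrow> gS i (dsc a x) = dsc a (gS i x)" "gU (dsc a x) = dsc a (gU x)" "2 \<le> n \<Longrightarrow> gK (dsc a x) = dsc a (gK x)" for a
    using x ust_sc[OF x, of a] e K by (auto simp: gS_def gU_def gK_def A_scale Tg_scale evd)
  show "dsc a (dsc b x) = dsc (a * b) x" "dsc 1 x = x" for a b
    using e dsp.cat.scale_one by (simp add: dsc_dsc, simp add: dsp.ends_iff)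
  note S' = S[unfolded gS_def gSi_def x, simplified]
  show "gS i (gS (Suc i) (gS i x)) = gS (Suc i) (gS i (gS (Suc i) x))" if i: "Suc (Suc i) < n"
  proof -
    have "ust (pX i x) = Some (n, s)" "ust (pX (Suc i) x) = Some (n, s)"
      "ust (pX (Suc i) (pX i x)) = Some (n, s)" "ust (pX i (pX (Suc i) x)) = Some (n, s)"
      using i ends_XY_ups(1) e by (simp_all add: ust_iff)
    moreover have "pX i (pX (Suc i) (pX i x)) = pX (Suc i) (pX i (pX (Suc i) x))"
      using at_ups[OF e, of "[Up, Up, Up]" i] i by (intro pX_braid) simp
    ultimately show ?thesis using x by (simp add: gS_def)
  qed
  show "gS i (gS j x) = gS j (gS i x)" if j: "Suc j < n" "Suc i < j" for j
  proof -
    have "ust (pX i x) = Some (n, s)" "ust (pX j x) = Some (n, s)"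
      using j ends_XY_ups(1) e by (simp_all add: ust_iff)
    then show ?thesis using x local2_right[OF local2_XY(1), of i j Xpos x] j by (simp add: gS_def)
  qed
  show "gU (gS i x) = gS (Suc (Suc i)) (gU x)" if i: "Suc i < n"
  proof -
    have "ust (pX i x) = Some (n, s)" "ust (Tg Tau (pc 0 x)) = Some (Suc (Suc n), s)"
      using i ends_XY_ups(1) ends_UK_ups(1) e by (simp_all add: ust_iff)
    then show ?thesis using x A_far[of 0 Cw i Xpos x] by (simp add: gS_def gU_def Tg_A)
  qed
  show "gK (gS (Suc (Suc i)) x) = gS i (gK x)" if i: "Suc (Suc (Suc i)) < n"
  proof -
    obtain m where m: "n = Suc (Suc m)" using i by (metis Suc_lessE)
    have "ust (pX (Suc (Suc i)) x) = Some (n, s)" "ust (pd' 0 (Tg TauBar x)) = Some (m, s)"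
      using i ends_XY_ups(1) ends_UK_ups(2)[OF e m] e by (simp_all add: ust_iff)
    then show ?thesis using x A_far[of 0 Dw' "Suc (Suc i)" Xpos "Tg TauBar x"] by (simp add: gS_def gK_def Tg_A)
  qed
  show "gK (gU x) = dsc \<delta> x"
  proof -
    have "ust (Tg Tau (pc 0 x)) = Some (Suc (Suc n), s)" using ends_UK_ups(1)[OF e] by (simp add: ust_iff)
    moreover have "Tg TauBar (Tg Tau (pc 0 x)) = pc 0 x" using e by (intro TbT) (simp add: evd)
    moreover have "pd' 0 (pc 0 x) = dsc \<delta> x" using e by (intro d'_c) (simp add: at_def)
    ultimately show ?thesis using x by (simp add: gU_def gK_def)
  qed
  show "gK (gS 0 x) = dsc q (gK x)" if "2 \<le> n"
    using cap_X[of x] up[of 0] x S'(1)[of 0] that by (simp add: gK_def gS_def)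
  show "gS 0 (gU x) = dsc q (gU x)"
    using X_cup[of x] U x e by (simp add: gU_def gS_def at_def)
  show "gK (gS 1 (gU x)) = dsc t x" if "1 \<le> n"
  proof -
    have u: "dsp.ends (Tg Tau (pc 0 x)) = Some (ups (Suc (Suc n)), s)" by (rule ends_UK_ups(1)[OF e])
    have "dsp.ends (pX 1 (Tg Tau (pc 0 x))) = Some (ups (Suc (Suc n)), s)" using that by (intro ends_XY_ups(1)[OF u]) simp
    then have "ust (Tg Tau (pc 0 x)) = Some (Suc (Suc n), s)" "ust (pX 1 (Tg Tau (pc 0 x))) = Some (Suc (Suc n), s)"
      using u by (simp_all only: ust_iff)
    then have "gK (gS 1 (gU x)) = pd' 0 (Tg TauBar (Tg Tau (pX 1 (pc 0 x))))"
      using x by (simp add: gK_def gS_def gU_def Tg_A[of Tau Xpos 0])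
    also have "Tg TauBar (Tg Tau (pX 1 (pc 0 x))) = pX 1 (pc 0 x)"
      using e that by (intro TbT) (cases n, auto simp: evd)
    also have "pd' 0 (pX 1 (pc 0 x)) = dsc t x"
      using pcurl1[of 0 x] at_ups[OF e, of "[Up]" 0] that by simp
    finally show ?thesis .
  qed
qed

lemma g_skein_operators: "skein_operators ust {} gS gSi gU gK dsc q qi t ti \<delta> dad"
proof -
  interpret strand_operators ust "{}" gS gSi gU gK dsc q qi t ti \<delta>
    by (rule g_strand_operators)
  show ?thesis
  proof
    fix x y w :: "'k ds_term set" and p :: "nat \<times> word" and a b :: 'k
    show "dad (dad x y) w = dad x (dad y w)" "dad x y = dad y x"
      by (rule dsp.add_assoc_cat dsp.add_commute_cat)+
    obtain n s where p: "p = (n, s)" by (cases p)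
    show "x = y" if "ust w = Some p" "ust x = Some p" "ust y = Some p" "dad x w = dad y w"
      using dsp.cat.add_right_cancel that by (simp add: p ust_iff dsp.ends_iff)
    show "ust (dad x y) = Some p" if "ust x = Some p" "ust y = Some p"
      using dsp.cat.add_hom that by (simp add: p ust_iff dsp.ends_iff)
    show "dsc (a + b) x = dad (dsc a x) (dsc b x)" if "ust x = Some p"
      using dsp.cat.scale_add_left that by (simp add: p ust_iff dsp.ends_iff)
    show "dsc a (dad x y) = dad (dsc a x) (dsc a y)" if "ust x = Some p" "ust y = Some p"
      using dsp.cat.scale_add_right that by (simp add: p ust_iff dsp.ends_iff)
  next
    show "t = ti + \<delta> * (q - qi)" using delta by (simp add: algebra_simps)
  next
    fix x y :: "'k ds_term set" and n i :: nat and s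
    assume x: "ust x = Some (n, s)"
    then have e: "dsp.ends x = Some (ups n, s)" by (simp add: ust_iff)
    show "gS i x = dad (gSi i x) (dsc (q - qi) x)" if "Suc i < n"
      using pskein[of i x] at_ups[OF e, of "[Up, Up]" i] that x by (simp add: gS_def gSi_def)
    assume y: "ust y = Some (n, s)"
    then have e': "dsp.ends y = Some (ups n, s)" by (simp add: ust_iff)
    have "ust (dad x y) = Some (n, s)" using e e' by (simp add: ust_iff ends_add)
    moreover have "dsp.ends (Tg TauBar x) = dsp.ends (Tg TauBar y)" using e e' by (simp add: evd)
    moreover have "dsp.ends (Tg TauBar y) \<noteq> None" if "2 \<le> n" using e' that by (cases n) (auto simp: evd)
    ultimately show "gS i (dad x y) = dad (gS i x) (gS i y)"
      and "2 \<le> n \<Longrightarrow> gK (dad x y) = dad (gK x) (gK y)"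
      using x y e e' by (simp_all add: gS_def gK_def A_add Tg_add)
  qed
qed

sublocale go: skein_operators ust "{}" gS gSi gU gK dsc q qi t ti \<delta> dad
  by (rule g_skein_operators)

text \<open>In each step \<open>pR_c\<close> replaces a cup one position further to the right by a
  positive crossing, and the toggled strand adds an inverse crossing on its way back. Together these
  form one passage.\<close>

lemma stg_pc: assumes "dsp.ends x = Some (ups r @ \<nu>, s)"
  shows "stg r (pc r x) = pass_cup pX pY (\<lambda>x. Tg Tau (pc 0 x)) r x"
  using assms
proof (induction r arbitrary: \<nu>)
  case 0 then show ?case by (simp add: stg_simps)
next
  case (Suc r)
  have x: "dsp.ends x = Some (ups r @ Up # \<nu>, s)" using Suc.prems by (simp add: replicate_app_Cons_same)
  let ?c = "pc (Suc r) x"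
  have "pU r ?c = pR r ?c" using x by (simp add: pU_def evd)
  also have "\<dots> = pX (Suc r) (pc r x)" using x by (intro pR_c) (simp add: at_def)
  finally have s: "stg r (pU r ?c) = pX (Suc r) (stg r (pc r x))" by (simp add: stg_right)
  have "dsp.ends (stg r (pc r x)) = Some (ups r @ Up # Up # Up # \<nu>, s)"
    using ends_stg[of "pc r x" "ups r" "Up # Up # \<nu>" s] x by (simp add: evd)
  then have "pW r (pX (Suc r) (stg r (pc r x))) = pY r (pX (Suc r) (stg r (pc r x)))"
    by (simp add: pW_def evd)
  then show ?case using Suc.IH[OF x] s by (simp add: stg_simps)
qed

text \<open>Dual to \<open>stg_pc\<close>; \<open>w_natural_d'\<close> relates the cap at
  neighbouring positions.\<close>

lemma stg_pd': assumes "dsp.ends x = Some (ups r @ Down # Up # \<nu>, s)"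
  shows "pass_cap pX pY (\<lambda>x. pd' 0 (Tg TauBar x)) r (stg r x) = pd' r x"
  using assms
proof (induction r arbitrary: x \<nu>)
  case 0
  then show ?case using TbT[of x] by (simp add: stg_simps at_def)
next
  case (Suc r)
  have x: "dsp.ends x = Some (ups r @ Up # Down # Up # \<nu>, s)" using Suc.prems by (simp add: replicate_app_Cons_same)
  have U: "pU r x = pR r x" using x by (simp add: pU_def at_def)
  have e: "dsp.ends (pR r x) = Some (ups r @ Down # Up # Up # \<nu>, s)"
    using ends_R(1)[of x "ups r" "Up # \<nu>" s] x by simp
  have "dsp.ends (stg r (pR r x)) = Some (ups r @ Up # Up # Up # \<nu>, s)"
    using ends_stg[of "pR r x" "ups r" "Up # Up # \<nu>" s] e by simp
  then have "pX r (stg (Suc r) x) = stg r (pR r x)"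
    unfolding stg_simps U by (simp add: pW_def at_def XY)
  then have "pass_cap pX pY (\<lambda>x. pd' 0 (Tg TauBar x)) (Suc r) (stg (Suc r) x)
    = pass_cap pX pY (\<lambda>x. pd' 0 (Tg TauBar x)) r (stg r (pY (Suc r) (pR r x)))"
    by (simp add: stg_right)
  also have "\<dots> = pd' r (pY (Suc r) (pR r x))" using e by (intro Suc.IH) (simp add: evd)
  also have "\<dots> = pd' (Suc r) x" using x by (intro w_natural_d') (simp add: at_def)
  finally show ?case .
qed

section \<open>Brauer relations for the images under \<open>G\<close>\<close>

lemma g_raw:
  "ust x \<noteq> None \<Longrightarrow> pX i x = gS i x" "ust x \<noteq> None \<Longrightarrow> pY i x = gSi i x"
  "ust x \<noteq> None \<Longrightarrow> Tg Tau (pc 0 x) = gU x" "ust x \<noteq> None \<Longrightarrow> pd' 0 (Tg TauBar x) = gK x"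
  by (auto simp: gS_def gSi_def gU_def gK_def)

text \<open>By \<open>stg_pc\<close> the left-hand side is a cup at position \<open>2\<close> with
  its \<open>Down\<close> strand toggled, made after another toggled cup. The right cup may equally
  be made before the left one, and its toggle commutes with the toggle and the cup on its
  left.\<close>

lemma g_UU: assumes x: "ust x = Some (n, s)"
  shows "gSi 1 (gSi 0 (gS 2 (gS 1 (gU (gU x))))) = gU (gU x)"
proof -
  have e: "dsp.ends x = Some (ups n, s)" using x by (simp add: ust_iff)
  let ?y = "Tg Tau (pc 0 x)"
  have ey: "dsp.ends ?y = Some (ups (Suc (Suc n)), s)" by (rule ends_UK_ups(1)[OF e])
  have "pass_cup pX pY (\<lambda>x. Tg Tau (pc 0 x)) 2 ?y = stg 2 (pc 2 ?y)"
    using stg_pc[of ?y 2 "ups n" s] ey by (simp add: numeral_2_eq_2)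
  also have "pc 2 ?y = Tg Tau (pc 0 (pc 0 x))"
    using Tg_A[of Tau Cw 1 "pc 0 x"] A_far[of 0 Cw 0 Cw x] by (simp add: numeral_2_eq_2)
  also have "stg 2 (Tg Tau (pc 0 (pc 0 x))) = Tg Tau (stg 2 (pc 0 (pc 0 x)))"
    using stg_Tau[of "pc 0 (pc 0 x)" "[Up]" "Up # ups n" s] e by (simp add: evd numeral_2_eq_2)
  also have "stg 2 (pc 0 (pc 0 x)) = pc 0 (Tg Tau (pc 0 x))"
    using stg_c[of "pc 0 x" "[]" "Up # ups n" s] e by (simp add: evd numeral_2_eq_2 stg_simps(1))
  finally have "pY 1 (pX 2 (pY 0 (pX 1 (Tg Tau (pc 0 ?y))))) = Tg Tau (pc 0 ?y)"
    by (simp add: numeral_2_eq_2)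
  then have "gSi 1 (gS 2 (gSi 0 (gS 1 (gU (gU x))))) = gU (gU x)"
    using x by (simp add: g_raw go.ev)
  then show ?thesis by (simp add: go.far_Si_S)
qed

text \<open>Read through \<open>stg_pc\<close>, the toggle of the new cup commutes with the toggled
  cap on its left, and so does the cup. The sign pattern is not that of the presentation;
  \<open>pass_U\<close> converts it in \<open>G_rel\<close>.\<close>

lemma g_KU: assumes x: "ust x = Some (Suc (Suc n), s)"
  shows "gK (gSi 1 (gSi 0 (gS 2 (gS 1 (gU x))))) = gU (gK x)"
proof -
  have e: "dsp.ends x = Some (Up # Up # ups n, s)" using x by (simp add: ust_iff)
  have ec: "dsp.ends (pc 2 x) = Some (Up # [Up] @ [Down] @ Up # ups n, s)" using e by (simp add: evd numeral_2_eq_2)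
  have "pass_cup pX pY (\<lambda>x. Tg Tau (pc 0 x)) 2 x = stg 2 (pc 2 x)"
    using stg_pc[of x 2 "ups n" s] e by (simp add: numeral_2_eq_2)
  then have "pd' 0 (Tg TauBar (pY 1 (pX 2 (pY 0 (pX 1 (Tg Tau (pc 0 x))))))) = pd' 0 (Tg TauBar (stg 2 (pc 2 x)))"
    by (simp add: numeral_2_eq_2)
  also have "Tg TauBar (stg 2 (pc 2 x)) = stg 2 (Tg TauBar (pc 2 x))"
    using stg_TauBar[OF ec] by (simp add: numeral_2_eq_2)
  also have "pd' 0 (stg 2 (Tg TauBar (pc 2 x))) = Tg Tau (pd' 0 (Tg TauBar (pc 2 x)))"
    using stg_d'[of "Tg TauBar (pc 2 x)" "[]" "Up # ups n" s] ec by (simp add: numeral_2_eq_2 evd stg_simps(1))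
  also have "Tg TauBar (pc 2 x) = pc 2 (Tg TauBar x)" using Tg_A[of TauBar Cw 1 x] by (simp add: numeral_2_eq_2)
  also have "pd' 0 (pc 2 (Tg TauBar x)) = pc 0 (pd' 0 (Tg TauBar x))"
    using A_far[of 0 Dw' 2 Cw] by (simp add: numeral_2_eq_2)
  finally have "gK (gSi 1 (gS 2 (gSi 0 (gS 1 (gU x))))) = gU (gK x)"
    using x by (simp add: g_raw go.ev)
  then show ?thesis by (simp add: go.far_Si_S)
qed

lemma pU_surj:
  assumes x: "dsp.ends x = Some (\<kappa> @ [Down, a] @ \<mu>, s)"
  obtains y where "dsp.ends y = Some (\<kappa> @ [a, Down] @ \<mu>, s)" "pU (length \<kappa>) y = x"
proof (cases a)
  case Up
  have e: "dsp.ends (pL (length \<kappa>) x) = Some (\<kappa> @ [Up, Down] @ \<mu>, s)" using x Up by (simp add: p_defs evd)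
  show thesis
    by (rule that[of "pL (length \<kappa>) x"]) (use x Up e in \<open>simp_all add: RL pU_def at_def\<close>)
next
  case Down
  have e: "dsp.ends (pD (length \<kappa>) x) = Some (\<kappa> @ [Down, Down] @ \<mu>, s)" using x Down ends_D by simp
  show thesis
    by (rule that[of "pD (length \<kappa>) x"]) (use x Down e in \<open>simp_all add: pDm_pD pU_def at_def\<close>)
qed

lemma pW_surj:
  assumes x: "dsp.ends x = Some (\<kappa> @ [a, Up] @ \<mu>, s)"
  obtains y where "dsp.ends y = Some (\<kappa> @ [Up, a] @ \<mu>, s)" "pW (length \<kappa>) y = x"
proof (cases a)
  case Up
  have e: "dsp.ends (pX (length \<kappa>) x) = Some (\<kappa> @ [Up, Up] @ \<mu>, s)" using x Up by (simp add: evd)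
  show thesis
    by (rule that[of "pX (length \<kappa>) x"]) (use x Up e in \<open>simp_all add: YX pW_def at_def\<close>)
next
  case Down
  have e: "dsp.ends (pL (length \<kappa>) x) = Some (\<kappa> @ [Up, Down] @ \<mu>, s)" using x Down by (simp add: p_defs evd)
  show thesis
    by (rule that[of "pL (length \<kappa>) x"]) (use x Down e in \<open>simp_all add: RL pW_def at_def\<close>)
qed

text \<open>Operators act on the target side, so a toggle that precedes a cap has to be split off
  from \<open>x\<close>. This is possible because every step of \<open>stg\<close> is
  invertible.\<close>

lemma stg_surj:
  assumes "dsp.ends x = Some (\<kappa> @ [Up] @ \<mu>, s)"
  shows "\<exists>y. dsp.ends y = Some (\<kappa> @ [Down] @ \<mu>, s) \<and> stg (length \<kappa>) y = x"
  using assms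
proof (induction \<kappa> arbitrary: x \<mu> rule: rev_induct)
  case Nil
  then show ?case using TTb[of x] by (intro exI[of _ "Tg TauBar x"]) (simp add: stg_simps evd)
next
  case (snoc a \<kappa>)
  obtain y where y: "dsp.ends y = Some (\<kappa> @ [Up] @ a # \<mu>, s)" "pW (length \<kappa>) y = x"
    using pW_surj[of x \<kappa> a \<mu> s] snoc.prems by auto
  obtain w where w: "dsp.ends w = Some (\<kappa> @ [Down] @ a # \<mu>, s)" "stg (length \<kappa>) w = y"
    using snoc.IH[OF y(1)] by blast
  obtain v where "dsp.ends v = Some (\<kappa> @ [a, Down] @ \<mu>, s)" "pU (length \<kappa>) v = w"
    using pU_surj[of w \<kappa> a \<mu> s] w(1) by auto
  then show ?case using y w by (intro exI[of _ v]) (simp add: stg_simps)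
qed

text \<open>With \<open>x = stg 2 y\<close> the passing cap becomes \<open>d'\<close> at position
  \<open>2\<close> by \<open>stg_pd'\<close>. It remains to commute this toggle with the inverse
  toggle and the cap on its left.\<close>

lemma g_KK: assumes x: "ust x = Some (Suc (Suc (Suc (Suc n))), s)"
  shows "gK (gK (gSi 1 (gSi 2 (gS 0 (gS 1 x))))) = gK (gK x)"
proof -
  have e: "dsp.ends x = Some ([Up, Up] @ [Up] @ Up # ups n, s)" using x by (simp add: ust_iff)
  obtain y where y: "dsp.ends y = Some (Up # Up # Down # Up # ups n, s)" "stg 2 y = x"
    using stg_surj[OF e] by (auto simp: numeral_2_eq_2)
  have y': "dsp.ends y = Some (Up # [Up] @ [Down] @ Up # ups n, s)" using y by simp
  have ty: "dsp.ends (Tg TauBar y) = Some ([Down, Up] @ [] @ [Down] @ Up # ups n, s)" using y by (simp add: evd)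
  let ?y = "pd' 0 (Tg TauBar y)"
  have ey: "dsp.ends ?y = Some (Down # Up # ups n, s)" using ty by (simp add: evd)
  have "pass_cap pX pY (\<lambda>x. pd' 0 (Tg TauBar x)) 2 x = pd' 2 y"
    using stg_pd'[of y 2 "ups n" s] y by (simp add: numeral_2_eq_2)
  then have "pd' 0 (Tg TauBar (pd' 0 (Tg TauBar (pY 1 (pX 0 (pY 2 (pX 1 x))))))) = pd' 0 (Tg TauBar (pd' 2 y))"
    by (simp add: numeral_2_eq_2)
  also have "\<dots> = pd' 0 ?y"
    using Tg_A[of TauBar Dw' 1 y] A_far[of 0 Dw' 2 Dw'] by (simp add: numeral_2_eq_2)
  also have "?y = Tg TauBar (Tg Tau ?y)" using ey by (intro TbT[symmetric]) (simp add: at_def)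
  also have "Tg Tau ?y = pd' 0 (stg 2 (Tg TauBar y))" using stg_d'[OF ty] by (simp add: stg_simps(1) numeral_2_eq_2)
  also have "stg 2 (Tg TauBar y) = Tg TauBar x" using stg_TauBar[OF y'] y(2) by (simp add: numeral_2_eq_2)
  finally have "gK (gK (gSi 1 (gS 0 (gSi 2 (gS 1 x))))) = gK (gK x)"
    using x by (simp add: g_raw go.ev)
  then show ?thesis by (simp add: go.far_S_Si)
qed

lemma ds_ends_id: "dsp.ends (ident dsp.cat X) = Some (X, X)"
  using dsp.cat.ident_hom by (simp add: dsp.ends_iff)

lemma d_eq_apply:
  assumes "ctyp ds_sig u X Y" "ctyp ds_sig v X Y"
    and "\<And>x. dsp.ends x = Some (X, X) \<Longrightarrow> Dcmp (Dcls u) x = Dcmp (Dcls v) x"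
  shows "Dcls u = Dcls v"
proof -
  have "Dcls w = Dcmp (Dcls w) (ident dsp.cat X)" if "ctyp ds_sig w X Y" for w
    using dsp.cmp_ident_right[of "Dcls w" X Y] that by simp
  then show ?thesis using assms ds_ends_id by metis
qed

abbreviation "u_tgt x \<equiv> map_option fst (ust x)"

lemma apply_G:
  "u_tgt x = Some r \<Longrightarrow> Dcmp (Dcls (G_gen (Cup r))) x = gU x"
  "u_tgt x = Some (Suc (Suc r)) \<Longrightarrow> Dcmp (Dcls (G_gen (Cap r))) x = gK x"
  "u_tgt x = Some r \<Longrightarrow> 1 \<le> i \<Longrightarrow> i < r \<Longrightarrow> Dcmp (Dcls (G_gen (Sig r i))) x = gS (i - 1) x"
  "u_tgt x = Some r \<Longrightarrow> 1 \<le> i \<Longrightarrow> i < r \<Longrightarrow> Dcmp (Dcls (G_gen (SigInv r i))) x = gSi (i - 1) x"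
  "u_tgt x = Some r \<Longrightarrow> Dcmp (Dcls (CId (G_ob r))) x = x"
proof -
  have r: "dsp.ends x = Some (ups r, snd (the (ust x)))" if "u_tgt x = Some r" for r
    using that by (auto simp: ust_iff[symmetric])
  have u: "ust x \<noteq> None" if "u_tgt x = Some r" for r using that by auto
  show "u_tgt x = Some r \<Longrightarrow> Dcmp (Dcls (G_gen (Cup r))) x = gU x"
    using apply_G_gen_Nil[OF _ r, of "Cup r"] u by (auto simp: gU_def)
  show "u_tgt x = Some (Suc (Suc r)) \<Longrightarrow> Dcmp (Dcls (G_gen (Cap r))) x = gK x"
    using apply_G_gen_Nil[OF _ r, of "Cap r"] u by (auto simp: gK_def)
  show "u_tgt x = Some r \<Longrightarrow> 1 \<le> i \<Longrightarrow> i < r \<Longrightarrow> Dcmp (Dcls (G_gen (Sig r i))) x = gS (i - 1) x"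
    using apply_G_gen_Nil[OF _ r, of "Sig r i"] u by (auto simp: gS_def)
  show "u_tgt x = Some r \<Longrightarrow> 1 \<le> i \<Longrightarrow> i < r \<Longrightarrow> Dcmp (Dcls (G_gen (SigInv r i))) x = gSi (i - 1) x"
    using apply_G_gen_Nil[OF _ r, of "SigInv r i"] u by (auto simp: gSi_def)
  show "u_tgt x = Some r \<Longrightarrow> Dcmp (Dcls (CId (G_ob r))) x = x"
    using r[of r] dsp.cmp_cls_id by (simp add: dsp.ends_iff G_ob_def)
qed

lemma apply_scale:
  assumes "ctyp ds_sig v (ups n) Z" "u_tgt x = Some n" shows "Dcmp (Dcls (CScale a v)) x = dsc a (Dcmp (Dcls v) x)"
proof -
  obtain s where "x \<in> hom dsp.cat s (ups n)" using assms(2) by (auto simp: ust_iff dsp.ends_iff)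
  then show ?thesis by (rule dsp.cmp_cls_scale[OF assms(1)])
qed

lemma ctyp_G: "ctyp b_sig u a b \<Longrightarrow> ctyp ds_sig (cextend G_ob G_gen u :: 'k ds_term) (ups a) (ups b)"
  by (induction rule: ctyp.induct) (auto simp: ctyp_G_gen[unfolded G_ob_def] G_ob_def ctyp_simps)

text \<open>Evaluation on \<open>x\<close> reduces each relation to an identity between
  \<open>gS\<close>, \<open>gSi\<close>, \<open>gU\<close> and \<open>gK\<close>. For the last three
  relations these are \<open>g_KU\<close>, \<open>g_KK\<close> and \<open>g_UU\<close>.\<close>

lemma G_rel:
  assumes R: "b_rel q t \<delta> u v" and u: "ctyp b_sig u a b" and v: "ctyp b_sig v a b"
  shows "Dcls (cextend G_ob G_gen u) = Dcls (cextend G_ob G_gen v)"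
proof (rule d_eq_apply[OF ctyp_G[OF u] ctyp_G[OF v]])
  fix x assume e: "dsp.ends x = Some (ups a, ups a)"
  then have x: "ust x = Some (a, ups a)" by (simp add: ust_iff)
  note S = dsp.cmp_cls_comp apply_G go.ev go.inv
  have K: "ctyp ds_sig (G_gen (Cap r) :: 'k ds_term) (ups (Suc (Suc r))) (ups r)"
    "ctyp ds_sig (G_gen (Cup r) :: 'k ds_term) (ups r) (ups (Suc (Suc r)))"
    "ctyp ds_sig (CId (G_ob r) :: 'k ds_term) (ups r) (ups r)" for r
    using ctyp_G_gen[of "Cap r" "Suc (Suc r)" r] ctyp_G_gen[of "Cup r" r "Suc (Suc r)"]
    by (simp_all add: G_ob_def ctyp_simps)
  note T = ctyp_simps b_sig_simps
  show "Dcmp (Dcls (cextend G_ob G_gen u)) x = Dcmp (Dcls (cextend G_ob G_gen v)) x" using R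
  proof cases
    case (1 r i) then show ?thesis using x v u by (auto simp: T S simp del: G_gen.simps)
  next
    case (2 r i) then show ?thesis using x v u by (auto simp: T S simp del: G_gen.simps)
  next
    case (3 r i)
    then obtain j where "i = Suc j" using u by (cases i) (auto simp: T)
    then show ?thesis using 3 x v u go.S_braid[of j x] by (auto simp: T S simp del: G_gen.simps)
  next
    case (4 i j r)
    then obtain i' j' where ij: "i = Suc i'" "j = Suc j'" using u by (cases i; cases j) (auto simp: T)
    then show ?thesis using 4 x v u go.far_S[of i' j' x] go.far_S[of j' i' x] by (auto simp: T S simp del: G_gen.simps)
  next
    case (5 r i)
    then obtain j where j: "i = Suc j" "Suc j < r" "a = r" "b = r" using u by (cases i) (auto simp: T)
    have g: "ctyp ds_sig (G_gen (Sig r i) :: 'k ds_term) (ups r) (ups r)" "ctyp ds_sig (G_gen (SigInv r i) :: 'k ds_term) (ups r) (ups r)"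
      using ctyp_G_gen[of "Sig r i" r r] ctyp_G_gen[of "SigInv r i" r r] j by (simp_all add: G_ob_def)
    have x': "x \<in> hom dsp.cat (ups a) (ups r)" using e j by (simp add: dsp.ends_iff)
    have Y: "gSi j x \<in> hom dsp.cat (ups r) (ups r)" and X: "gS j x \<in> hom dsp.cat (ups r) (ups r)"
      and Z: "dsc (q - qi) x \<in> hom dsp.cat (ups r) (ups r)"
      unfolding dsp.ends_iff[symmetric] ust_iff[symmetric] using x j by (simp_all add: go.ev)
    have "dad (dsc (- 1) (gSi j x)) (gSi j x) = zero_mor dsp.cat (ups r) (ups r)"
      using dsp.cat.scale_add_left[OF Y, of "- 1" 1] dsp.cat.scale_zero[OF Y] dsp.cat.scale_one[OF Y] by simp
    moreover have "gS j x = dad (dsc (q - qi) x) (gSi j x)"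
      using go.skein[of x r "ups r" j] x j dsp.add_commute_cat by simp
    ultimately have "dad (gS j x) (dsc (- 1) (gSi j x)) = dsc (q - qi) x"
      using dsp.cat.add_zero[OF Z] dsp.add_commute_cat[of "dsc (- 1) (gSi j x)"] by (simp add: dsp.add_assoc_cat)
    then show ?thesis
      using 5 x j by (simp add: dsp.cmp_cls_add[OF g(1)[unfolded j(1)] ctyp.intros(6)[OF g(2)[unfolded j(1)]] x'] dsp.cmp_cls_scale[OF g(2)[unfolded j(1)] x']
         apply_scale[OF K(3)] apply_G del: G_gen.simps)
  next
    case (6 r i)
    then obtain j where "i = Suc j" using u by (cases i) (auto simp: T)
    then show ?thesis using 6 x v u go.U_S[of j x] by (auto simp: T S simp del: G_gen.simps)
  next
    case (7 r i)
    then obtain j where "i = Suc j" using v by (cases i) (auto simp: T)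
    then show ?thesis using 7 x v u go.K_S[of j x] by (auto simp: T S simp del: G_gen.simps)
  next
    case (8 r)
    then show ?thesis using x v u by (auto simp: T S apply_scale[OF K(3)] go.KU simp del: G_gen.simps)
  next
    case (9 r)
    then show ?thesis using x v u by (auto simp: T S apply_scale[OF K(1)] go.K_S0 simp del: G_gen.simps)
  next
    case (10 r)
    then show ?thesis using x v u by (auto simp: T S apply_scale[OF K(2)] go.S0_U simp del: G_gen.simps)
  next
    case (11 r)
    then show ?thesis using x v u go.KSU[OF x] by (auto simp: T S apply_scale[OF K(3)] simp del: G_gen.simps)
  next
    case (12 r)
    then have "r = a" using u by (auto simp: T)
    moreover obtain m where "r = Suc (Suc m)" using 12 by (metis Suc_le_D numeral_2_eq_2 Suc_le_mono)
    ultimately show ?thesis using 12 x g_KU[of x m "ups a"] go.pass_U[of x]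
      by (simp add: S numeral_eq_Suc del: G_gen.simps)
  next
    case (13 r)
    then have "a = r + 4" using u by (auto simp: T)
    then show ?thesis using 13 x g_KK[of x r "ups a"]
      by (simp add: S numeral_eq_Suc del: G_gen.simps)
  next
    case (14 r)
    then have "a = r" using u by (auto simp: T)
    then show ?thesis using 14 x g_UU[of x r "ups a"]
      by (simp add: S numeral_eq_Suc del: G_gen.simps)
  qed
qed

sublocale gmap: presentation_map b_sig "b_rel q t \<delta>" ds_sig "ds_rel q t \<delta>" G_ob G_gen
  by unfold_locales (rule ctyp_G_gen, assumption, rule G_rel)

abbreviation "GM \<equiv> gmap.map_mor"

lemma G_mor_eq: "G_mor q t \<delta> f = GM f"
  by (simp add: G_mor_def gmap.map_mor_def dsp.cls_def)

lemma GM_gen: "b_sig g a b \<Longrightarrow> GM (Bcls (CGen g)) = Dcls (G_gen g)"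
  using gmap.map_cls[of "CGen g" a b] by (simp add: ctyp_simps)

end

section \<open>The functor to the iquantum Brauer category\<close>

primrec F_gen :: "'k::{comm_ring,comm_monoid_mult} \<Rightarrow> 'k \<Rightarrow> 'k ds_gen \<Rightarrow> 'k b_term" where
  "F_gen q t (Os g) = b_act q t 0 g"
| "F_gen q t (Tog f g) = b_act q t 1 g"

lemma functor_comp:
  assumes "linear_functor C D FO H" "linear_functor D E GO K"
  shows "linear_functor C E (\<lambda>X. GO (FO X)) (\<lambda>f. K (H f))"
proof -
  interpret F: linear_functor C D FO H by fact
  interpret G: linear_functor D E GO K by fact
  show ?thesis by unfold_locales
    (simp_all add: F.fun_hom G.fun_hom F.fun_ident G.fun_ident F.fun_cmp F.fun_add F.fun_scale,
     (rule G.fun_cmp G.fun_add G.fun_scale; erule F.fun_hom)+)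
qed

context skein_parameters begin

abbreviation "Ft \<equiv> cextend length (F_gen q t)"

lemma BR_ident: "BR n (ident bp.cat r) = ident bp.cat (r + n)"
  by (rule cat_functor.fun_ident[OF linear_functor.axioms(1)[OF BR_functor]])

lemma BA_tens_id:
  assumes u: "mtyp os_sig u X Y"
  shows "BA r (MId V \<boxtimes> u) = BA (r + length V) u" "BA r (u \<boxtimes> MId V) = BR (length V) (BA r u)"
proof -
  show "BA r (MId V \<boxtimes> u) = BA (r + length V) u"
    unfolding BA_simps(2)[OF mtyp.intros(2) u] BA_simps BR_ident using bp.cmp_ident_right[OF BA_hom[OF u]] by simp
  show "BA r (u \<boxtimes> MId V) = BR (length V) (BA r u)"
    unfolding BA_simps(2)[OF u mtyp.intros(2)] BA_simps using bp.cmp_ident_left[OF BR_hom[OF BA_hom[OF u]]] by simp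
qed

lemma ctyp_F_gen: "ds_sig g X Y \<Longrightarrow> ctyp b_sig (F_gen q t g) (length X) (length Y)"
  using ctyp_b_act[of _ _ _ q t 0] ctyp_b_act[of _ _ _ q t 1] by (cases g) force+

lemma ctyp_F: "ctyp ds_sig u X Y \<Longrightarrow> ctyp b_sig (Ft u) (length X) (length Y)"
  by (induction rule: ctyp.induct) (auto simp: ctyp_F_gen ctyp_simps)

lemma F_right: "ctyp ds_sig u X Y \<Longrightarrow> Bcls (Ft (ds_right \<nu> u)) = Bcls (b_right (length \<nu>) (Ft u))"
proof (induction rule: ctyp.induct)
  case (1 g X Y)
  then show ?case by (cases g) (auto simp: BA_tens_id BR_cls[OF ctyp_b_act] simp del: b_act.simps(4))
next
  case 3 then show ?case by (simp add: bp.cmp_cls[symmetric])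
next
  case 5 then show ?case by (simp add: bp.add_cls[symmetric])
next
  case 6 then show ?case by (simp add: bp.scale_cls[symmetric])
qed simp_all

text \<open>The third toggle relation under \<open>F\<close>: toggles become identities and
  \<open>R_+\<close>, \<open>D_+\<close> become the crossing, so the image of \<open>R_-\<close>
  must commute with \<open>bS 0\<close>. By the skein relation this image is \<open>bS 0\<close>
  minus a multiple of the cap followed by the cup, and a crossing before the cap or after the cup
  gives the same scalar \<open>q\<close>.\<close>

lemma b_apply_Rm:
  assumes x: "bp.ends x = Some (Suc (Suc n), s)"
  defines "Rm \<equiv> \<lambda>y. scale_mor bp.cat (q * ti) (bo.Eb (Suc (Suc 0)) (bSi (Suc 0) (bU y)))"
  shows "Rm (bS 0 x) = bS 0 (Rm x)"
proof -
  interpret b: skein_operators bp.ends "{}" bS bSi bU bK "scale_mor bp.cat" q qi t ti \<delta> "add_mor bp.cat"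
    by (rule b_skein_operators)
  let ?a = "q * ti" and ?n = "Suc (Suc (Suc (Suc n)))"
  have Eb_ad: "bo.Eb (Suc (Suc 0)) (add_mor bp.cat v w) = add_mor bp.cat (bo.Eb (Suc (Suc 0)) v) (bo.Eb (Suc (Suc 0)) w)"
    if "bp.ends v = Some (?n, s)" "bp.ends w = Some (?n, s)" for v w
    using that by (simp add: b.lin bo.ev)
  have R: "bS 0 y = add_mor bp.cat (Rm y) (scale_mor bp.cat ((q - qi) * ?a) (bU (bK y)))"
    if y: "bp.ends y = Some (Suc (Suc n), s)" for y
  proof -
    have u: "bp.ends (bU y) = Some (?n, s)" using y by (simp add: bo.ev)
    have k: "bp.ends (bU (bK y)) = Some (Suc (Suc n), s)" using y by (simp add: bo.ev)
    have "bS (Suc 0) (bU y) = add_mor bp.cat (bSi (Suc 0) (bU y)) (scale_mor bp.cat (q - qi) (bU y))"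
      by (rule b.skein[OF u]) simp
    then have "bo.Eb (Suc (Suc 0)) (bS (Suc 0) (bU y)) = add_mor bp.cat (bo.Eb (Suc (Suc 0)) (bSi (Suc 0) (bU y)))
        (scale_mor bp.cat (q - qi) (bo.Eb (Suc (Suc 0)) (bU y)))"
      using Eb_ad[of "bSi (Suc 0) (bU y)" "scale_mor bp.cat (q - qi) (bU y)"] u Eb_sc[of "Suc (Suc 0)" "bU y" "q - qi"]
      by (simp only: bo.ev) (simp add: bo.ev)
    \<comment> \<open>Without the crossing the mirrored cap lies to the right of the cup and is
      independent of it.\<close>
    moreover have "bo.Eb (Suc (Suc 0)) (bU y) = bU (bK y)" using bo.Eb_U[of 0 y] by simp
    moreover have "bS 0 y = scale_mor bp.cat ?a (bo.Eb (Suc (Suc 0)) (bS (Suc 0) (bU y)))"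
      using b_apply_R[of 0 y] y by (simp add: bo.ev)
    moreover have "bp.ends (bo.Eb (Suc (Suc 0)) (bSi (Suc 0) (bU y))) = Some (Suc (Suc n), s)"
      using u by (simp only: bo.evs) simp
    ultimately show ?thesis
      using k by (simp add: Rm_def b.sc_ad[of _ "(Suc (Suc n), s)"] bo.ev bo.sc_sc mult.commute[of ?a])
  qed
  have r: "bp.ends (Rm y) = Some (Suc (Suc n), s)" if "bp.ends y = Some (Suc (Suc n), s)" for y
    unfolding Rm_def using that by (simp add: bo.evs del: pass_cap.simps)
  have x': "bp.ends (bS 0 x) = Some (Suc (Suc n), s)" using x by (simp add: bo.ev)
  let ?w = "scale_mor bp.cat ((q - qi) * ?a) (bU (bK (bS 0 x)))"
  have k: "bp.ends (bU (bK x)) = Some (Suc (Suc n), s)" using x by (simp add: bo.ev)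
  have "add_mor bp.cat (Rm (bS 0 x)) ?w = bS 0 (bS 0 x)" by (rule R[OF x', symmetric])
  also have "bS 0 (bS 0 x) = bS 0 (add_mor bp.cat (Rm x) (scale_mor bp.cat ((q - qi) * ?a) (bU (bK x))))"
    unfolding R[OF x, symmetric] ..
  also have "\<dots> = add_mor bp.cat (bS 0 (Rm x)) (scale_mor bp.cat ((q - qi) * ?a) (bS 0 (bU (bK x))))"
    using r[OF x] k by (simp add: b.lin bo.ev)
  also have "bS 0 (bU (bK x)) = bU (bK (bS 0 x))" using x by (simp add: bo.S0_U bo.K_S0 bo.U_sc bo.ev)
  finally show ?thesis
    by (rule b.ad_cancel[of ?w "(Suc (Suc n), s)", rotated 3]) (use x x' r k in \<open>simp_all add: bo.ev\<close>)
qed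

text \<open>The typing part is what \<open>bright_cong\<close> asks for when strands are added in
  \<open>F_rel\<close>.\<close>

lemma F_toggle_rel:
  assumes "ds_toggle_rel q u v" shows "Bcls (Ft u) = Bcls (Ft v) \<and> (\<exists>m n. ctyp b_sig (Ft u) m n)"
  using assms
proof cases
  case 1 then show ?thesis by (auto simp: ctyp_simps bp.cmp_cls[symmetric] bp.ident_cls[symmetric]
     bp.cmp_ident_left[OF bp.cat.ident_hom])
next
  case 2 then show ?thesis by (auto simp: ctyp_simps bp.cmp_cls[symmetric] bp.ident_cls[symmetric]
     bp.cmp_ident_left[OF bp.cat.ident_hom])
next
  case 3
  then have "ctyp ds_sig u [Down, Down] [Up, Up]" "ctyp ds_sig v [Down, Down] [Up, Up]"
    by (auto simp: ctyp_simps mtyp_simps os_sig_def wt_mtyp)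
  from this[THEN ctyp_F] have c: "ctyp b_sig (Ft u) 2 2" "ctyp b_sig (Ft v) 2 2" by (simp_all add: numeral_2_eq_2)
  have "Bcls (Ft u) = Bcls (Ft v)"
  proof (rule b_eq_apply[OF c])
    fix x assume "bp.ends x = Some (2, 2)"
    then have x: "bp.ends x = Some (Suc (Suc 0), 2)" by (simp add: numeral_2_eq_2)
    show "Bcmp (Bcls (Ft u)) x = Bcmp (Bcls (Ft v)) x"
      using b_apply_Rm[OF x] x 3
      by (simp add: os_R_def os_D_def b_apply_simps b_apply_R[of 0, simplified] b_apply_R[of 1, simplified] bo.evs del: b_act_gen.simps)
  qed
  then show ?thesis using c by blast
next
  case 4
  then have "ctyp ds_sig u [Up, Up] []" "ctyp ds_sig v [Up, Up] []"
    by (auto simp: ctyp_simps mtyp_simps os_sig_def wt_mtyp)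
  from this[THEN ctyp_F] have c: "ctyp b_sig (Ft u) 2 0" "ctyp b_sig (Ft v) 2 0" by (simp_all add: numeral_2_eq_2)
  have c': "ctyp b_sig (Ft (os d\<^sub>o' \<star> taubar [Up])) 2 0" using c(2) 4 by (simp add: ctyp_simps)
  have "Bcls (Ft u) = Bcls (Ft v)"
  proof (rule b_eq_apply[OF c])
    fix x assume x: "bp.ends x = Some (2, 2)"
    show "Bcmp (Bcls (Ft u)) x = Bcmp (Bcls (Ft v)) x"
      using x 4 bp.cmp_cls_scale[OF c', of x 2 q]
      by (simp add: bp.ends_iff[symmetric] b_apply_simps bo.evs bo.K_S0 del: b_act_gen.simps)
  qed
  then show ?thesis using c by blast
next
  case 5
  then have "ctyp ds_sig u [] [Up, Up]" "ctyp ds_sig v [] [Up, Up]"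
    by (auto simp: ctyp_simps mtyp_simps os_sig_def wt_mtyp)
  from this[THEN ctyp_F] have c: "ctyp b_sig (Ft u) 0 2" "ctyp b_sig (Ft v) 0 2" by (simp_all add: numeral_2_eq_2)
  have c': "ctyp b_sig (Ft (tau [Up] \<star> os c\<^sub>o)) 0 2" using c(2) 5 by (simp add: ctyp_simps)
  have "Bcls (Ft u) = Bcls (Ft v)"
  proof (rule b_eq_apply[OF c])
    fix x assume x: "bp.ends x = Some (0, 0)"
    show "Bcmp (Bcls (Ft u)) x = Bcmp (Bcls (Ft v)) x"
      using x 5 bp.cmp_cls_scale[OF c', of x 0 q]
      by (simp add: bp.ends_iff[symmetric] b_apply_simps bo.evs bo.S0_U del: b_act_gen.simps)
  qed
  then show ?thesis using c by blast
qed

lemma F_rel: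
  assumes R: "ds_rel q t \<delta> u v" and u: "ctyp ds_sig u X Y" and v: "ctyp ds_sig v X Y"
  shows "Bcls (Ft u) = Bcls (Ft v)"
  using R
proof cases
  case (os_eq g h) then show ?thesis using BA_cong by simp
next
  case (os_id Z) then show ?thesis by simp
next
  case (os_comp g h) then show ?thesis by simp
next
  case (os_add g h) then show ?thesis by simp
next
  case (os_scale a g) then show ?thesis by simp
next
  case (tog_eq g h f) then show ?thesis using BA_cong by simp
next
  case (tog_add f g h) then show ?thesis by simp
next
  case (tog_scale f a g) then show ?thesis by simp
next
  case (tog_comp_left f g h)
  then obtain A B where "mtyp os_sig g A B" using u by (auto simp: ctyp_simps mtyp_simps)
  then show ?thesis unfolding tog_comp_left
    using BA_tens_id(1)[of g A B 0 "[tog_cod f]"] by (simp add: bp.cmp_cls[symmetric] del: b_act.simps(4))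
next
  case (tog_comp_right f g h)
  then obtain A B where "mtyp os_sig h A B" using u by (auto simp: ctyp_simps mtyp_simps)
  then show ?thesis unfolding tog_comp_right
    using BA_tens_id(1)[of h A B 0 "[tog_dom f]"] by (simp add: bp.cmp_cls[symmetric] del: b_act.simps(4))
next
  case (toggle r s \<nu>)
  have ty: "\<exists>X Y. ctyp ds_sig r X Y \<and> ctyp ds_sig s X Y"
    using toggle(3) by cases (fastforce simp: ctyp_simps mtyp_simps os_sig_def wt_mtyp)+
  then obtain X Y where "ctyp ds_sig r X Y" "ctyp ds_sig s X Y" by blast
  then show ?thesis
    unfolding toggle(1,2) using F_right F_toggle_rel[OF toggle(3)] bright_cong by metis
qed

sublocale fmap: presentation_map ds_sig "ds_rel q t \<delta>" b_sig "b_rel q t \<delta>" length "F_gen q t"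
  by unfold_locales (rule ctyp_F_gen, assumption, rule F_rel)

abbreviation "FM \<equiv> fmap.map_mor"

text \<open>At position \<open>0\<close> the actions of \<open>c\<close> and \<open>d'\<close>
  contain no crossings, so the toggled cup and cap return to \<open>cup\<close> and
  \<open>cap\<close> themselves.\<close>

lemma FM_G_gen: assumes g: "b_sig g a b" shows "FM (Dcls (G_gen g)) = Bcls (CGen g)"
proof -
  have "FM (Dcls (G_gen g)) = Bcls (Ft (G_gen g))" by (rule fmap.map_cls[OF ctyp_G_gen[OF g]])
  also have "\<dots> = Bcls (CGen g)"
  proof (rule b_eq_apply)
    show "ctyp b_sig (Ft (G_gen g)) a b" using ctyp_F[OF ctyp_G_gen[OF g]] by (simp add: G_ob_def)
    show "ctyp b_sig (CGen g) a b" using g by (simp add: ctyp_simps)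
    fix x assume x: "bp.ends x = Some (a, a)"
    have C: "ctyp ds_sig (tau [Up] \<star> os c\<^sub>o :: 'k ds_term) [] [Up, Up]" "ctyp ds_sig (os d\<^sub>o' \<star> taubar [Up] :: 'k ds_term) [Up, Up] []"
      by (simp_all add: ctyp_simps mtyp_simps os_sig_def wt_mtyp)
    show "Bcmp (Bcls (Ft (G_gen g))) x = Bcmp (Bcls (CGen g)) x"
    proof (cases g)
      case (Cup r)
      then show ?thesis using g x F_right[OF C(1), of "ups r"]
        by (simp add: b_apply_simps bo.evs b_apply_U del: b_act_gen.simps ds_right_simps)
    next
      case (Cap r)
      then show ?thesis using g x F_right[OF C(2), of "ups r"]
        by (simp add: b_apply_simps bo.evs b_apply_K del: b_act_gen.simps ds_right_simps)
    next
      case (Sig r i)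
      then show ?thesis using g x b_apply_sig(1)[of x r r "i - 1"]
        by (simp add: b_apply_simps bo.evs del: b_act_gen.simps)
    next
      case (SigInv r i)
      then show ?thesis using g x b_apply_sig(2)[of x r r "i - 1"]
        by (simp add: b_apply_simps bo.evs del: b_act_gen.simps)
    qed
  qed
  finally show ?thesis .
qed

text \<open>Equality, not just isomorphism: \<open>natural_extend\<close> with identities as
  components.\<close>

lemma FM_GM: assumes f: "f \<in> hom bp.cat a b" shows "FM (GM f) = f"
proof -
  have I: "linear_functor bp.cat bp.cat (\<lambda>X. X) (\<lambda>f. f)" by unfold_locales simp_all
  have len: "(\<lambda>X. length (G_ob X)) = (\<lambda>X. X)" by (simp add: G_ob_def)
  have "Bcmp (ident bp.cat b) (FM (GM f)) = Bcmp f (ident bp.cat a)"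
  proof (rule bp.natural_extend[OF bp.linear_category_cat functor_comp[OF gmap.functor_map fmap.functor_map, unfolded len] I bp.cat.ident_hom _ f])
    fix g X Y assume g: "b_sig g X Y"
    then have "Bcls (CGen g) \<in> hom bp.cat X Y" by (simp add: ctyp_simps)
    then show "Bcmp (ident bp.cat Y) (FM (GM (Bcls (CGen g)))) = Bcmp (Bcls (CGen g)) (ident bp.cat X)"
      unfolding GM_gen[OF g] FM_G_gen[OF g] by (simp add: bp.cmp_ident_left bp.cmp_ident_right)
  qed
  moreover have "FM (GM f) \<in> hom bp.cat a b"
    using cat_functor.fun_hom[OF linear_functor.axioms(1)[OF functor_comp[OF gmap.functor_map fmap.functor_map, unfolded len]] f] .
  ultimately show ?thesis using f by (simp add: bp.cmp_ident_left bp.cmp_ident_right)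
qed

end

section \<open>Naturality of the toggles\<close>

context strand_operators begin

lemma has_pass_cup: assumes "has r x" shows "has (Suc (Suc r)) (pass_cup Si S U r x)"
proof -
  obtain n s where x: "st x = Some (n, s)" "r \<le> n" using assms by (rule hasE)
  have "st (pass_cup Si S U k x) = Some (Suc (Suc n), s)" if "k \<le> n" for k
    using that by (induction k) (simp_all add: ev x)
  then show ?thesis using x by (simp add: has_def)
qed

text \<open>An inverse crossing of the legs turns positive passages into mirrored ones at the cost
  of \<open>qi\<close>. For \<open>r = 0\<close> this is \<open>Si0_U\<close>; one more passage is
  absorbed by a braid relation. Here lies the origin of \<open>qi\<close> in the action of
  \<open>c'\<close>.\<close>

lemma Si_pass_cup: "has r x \<Longrightarrow> Si r (pass_cup S Si U r x) = sc qi (pass_cup Si S U r x)"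
proof (induction r)
  case 0 then show ?case by (simp add: Si0_U)
next
  case (Suc r)
  then have r: "has r x" by (auto intro: has_mono)
  let ?c = "pass_cup S Si U r x" and ?d = "pass_cup Si S U r x"
  obtain n s where d: "st ?d = Some (n, s)" "Suc (Suc r) < n"
  proof -
    have "has (Suc (Suc (Suc r))) (pass_cup Si S U (Suc r) x)" using has_pass_cup[OF Suc.prems] .
    then show thesis using that by (auto simp: has_def st_simps split: option.splits if_splits)
  qed
  have "Si (Suc r) (pass_cup S Si U (Suc r) x) = Si (Suc r) (Si r (S (Suc r) ?c))" by simp
  also have "\<dots> = S r (Si (Suc r) (Si r ?c))" by (rule braid5[symmetric])
  also have "Si r ?c = sc qi ?d" by (rule Suc.IH[OF r])
  also have "S r (Si (Suc r) (sc qi ?d)) = sc qi (S r (Si (Suc r) ?d))"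
    using d by (simp add: Si_sc S_sc ev)
  finally show ?case by simp
qed

text \<open>The dual statement for caps, which serves the action of \<open>d\<close>.\<close>

lemma pass_cap_Si: "pass_cap Si S K r (Si r x) = sc qi (pass_cap S Si K r x)"
proof (induction r arbitrary: x)
  case 0 then show ?case by (simp add: K_Si0)
next
  case (Suc r)
  have "pass_cap Si S K (Suc r) (Si (Suc r) x) = pass_cap Si S K r (S (Suc r) (Si r (Si (Suc r) x)))" by simp
  also have "S (Suc r) (Si r (Si (Suc r) x)) = Si r (Si (Suc r) (S r x))" by (rule braid6[symmetric])
  finally show ?case using Suc.IH by simp
qed

end

context skein_parameters begin

fun g_act :: "os_gen \<Rightarrow> nat \<Rightarrow> 'k ds_term set \<Rightarrow> 'k ds_term set" where
  "g_act Xpos r x = gS r x"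
| "g_act Xneg r x = gSi r x"
| "g_act Cw r x = pass_cup gS gSi gU r x"
| "g_act Cw' r x = dsc (qi * t) (pass_cup gSi gS gU r x)"
| "g_act Dw r x = dsc (q * ti) (pass_cap gSi gS gK r x)"
| "g_act Dw' r x = pass_cap gS gSi gK r x"

lemma GM_hom: "f \<in> hom bp.cat a b \<Longrightarrow> GM f \<in> hom dsp.cat (ups a) (ups b)"
  using cat_functor.fun_hom[OF linear_functor.axioms(1)[OF gmap.functor_map], of f a b] by (simp add: G_ob_def)

lemma GM_cmp: "f \<in> hom bp.cat a b \<Longrightarrow> g \<in> hom bp.cat b c \<Longrightarrow> GM (Bcmp g f) = Dcmp (GM g) (GM f)"
  using cat_functor.fun_cmp[OF linear_functor.axioms(1)[OF gmap.functor_map]] .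

lemma GM_ident: "GM (ident bp.cat a) = ident dsp.cat (ups a)"
  using cat_functor.fun_ident[OF linear_functor.axioms(1)[OF gmap.functor_map], of a] by (simp add: G_ob_def)

lemma GM_empty: "GM {} = {}"
  by (simp add: gmap.map_mor_def)

text \<open>\<open>GM\<close> followed by precomposition with \<open>y\<close> intertwines the operators of the two categories.\<close>

lemma apply_GM:
  assumes y: "dsp.ends y = Some (ups (r + length (os_dom g)), s)"
  shows "Dcmp (GM (BA r (MGen g))) y = g_act g r y"
proof -
  let ?m = "r + length (os_dom g)"
  let ?ph = "\<lambda>x. Dcmp (GM x) y" and ?ok = "\<lambda>x. x = {} \<or> (\<exists>n. bp.ends x = Some (n, ?m))"
  have u: "ust (?ph x) = Some (n, s)" if "bp.ends x = Some (n, ?m)" for x n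
    using y GM_hom[of x ?m n] that dsp.cat.cmp_hom unfolding ust_iff bp.ends_iff dsp.ends_iff by blast
  have e0: "?ph {} = {}" by (simp add: GM_empty)
  have gen: "?ph (Bcmp (Bcls (CGen f)) x) = Dcmp (Dcls (G_gen f)) (?ph x)"
    if f: "b_sig f n l" and x: "bp.ends x = Some (n, ?m)" for f x n l
  proof -
    have "Bcls (CGen f) \<in> hom bp.cat n l" using f by (simp add: ctyp_simps)
    then show ?thesis using x by (simp add: GM_cmp[of x ?m n] bp.ends_iff GM_gen[OF f] dsp.cmp_assoc)
  qed
  have S: "?ok (bS i x) \<and> ?ph (bS i x) = gS i (?ph x)" "?ok (bSi i x) \<and> ?ph (bSi i x) = gSi i (?ph x)" if ok: "?ok x" for i x
  proof -
    have "(?ok (bS i x) \<and> ?ph (bS i x) = gS i (?ph x)) \<and> (?ok (bSi i x) \<and> ?ph (bSi i x) = gSi i (?ph x))"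
    proof (cases "x = {}")
      case False
      then obtain n where x: "bp.ends x = Some (n, ?m)" using ok by blast
      show ?thesis
      proof (cases "Suc i < n")
        case True
        then show ?thesis using gen[of "Sig n (Suc i)" n n x] gen[of "SigInv n (Suc i)" n n x] x u[OF x]
            apply_G(3)[of "?ph x" n "Suc i"] apply_G(4)[of "?ph x" n "Suc i"]
            b_apply_sig[OF x True] by simp
      next
        case False
        then have "bS i x = {}" "bSi i x = {}" using x by (auto intro!: bo.outs simp: bo.has_def)
        moreover have "gS i (?ph x) = {}" "gSi i (?ph x) = {}" using u[OF x] False by (auto intro!: go.outs simp: go.has_def)
        ultimately show ?thesis using e0 by simp
      qed
    qed (simp add: e0)
    then show "?ok (bS i x) \<and> ?ph (bS i x) = gS i (?ph x)" "?ok (bSi i x) \<and> ?ph (bSi i x) = gSi i (?ph x)" by blast+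
  qed
  have U: "?ok (bU x) \<and> ?ph (bU x) = gU (?ph x)" and K: "?ok (bK x) \<and> ?ph (bK x) = gK (?ph x)" if ok: "?ok x" for x
  proof -
    have "(?ok (bU x) \<and> ?ph (bU x) = gU (?ph x)) \<and> (?ok (bK x) \<and> ?ph (bK x) = gK (?ph x))"
    proof (cases "x = {}")
      case False
      then obtain n where x: "bp.ends x = Some (n, ?m)" using ok by blast
      have 1: "?ok (bU x) \<and> ?ph (bU x) = gU (?ph x)"
        using gen[of "Cup n" n "Suc (Suc n)" x] x u[OF x] apply_G(1)[of "?ph x" n] b_apply_U[OF x] by (simp add: bo.ev)
      have "?ok (bK x) \<and> ?ph (bK x) = gK (?ph x)"
      proof (cases "2 \<le> n")
        case True
        then obtain k where k: "n = Suc (Suc k)" by (metis Suc_le_D numeral_2_eq_2 Suc_le_mono)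
        show ?thesis
          using gen[of "Cap k" n k x] x u[OF x] apply_G(2)[of "?ph x" k] b_apply_K[of x k ?m] by (simp add: bo.ev k)
      next
        case False
        then have "bK x = {}" using x by (auto intro!: bo.outs simp: bo.has_def)
        moreover have "gK (?ph x) = {}" using u[OF x] False by (auto intro!: go.outs simp: go.has_def)
        ultimately show ?thesis using e0 by simp
      qed
      with 1 show ?thesis by blast
    qed (simp add: e0)
    then show "?ok (bU x) \<and> ?ph (bU x) = gU (?ph x)" "?ok (bK x) \<and> ?ph (bK x) = gK (?ph x)" by blast+
  qed
  have C: "?ok (bo.C k x) \<and> ?ph (bo.C k x) = pass_cup gS gSi gU k (?ph x)"
    "?ok (bo.Cb k x) \<and> ?ph (bo.Cb k x) = pass_cup gSi gS gU k (?ph x)" if "?ok x" for k x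
    by (induction k; simp only: pass_cup.simps S U that)+
  have E: "?ok x \<Longrightarrow> ?ph (bo.E k x) = pass_cap gS gSi gK k (?ph x)"
    "?ok x \<Longrightarrow> ?ph (bo.Eb k x) = pass_cap gSi gS gK k (?ph x)" for k x
    by (induction k arbitrary: x; simp only: pass_cap.simps S K)+
  have sc: "?ph (scale_mor bp.cat a x) = dsc a (?ph x)" if x: "bp.ends x = Some (n, ?m)" for a x n
  proof -
    have x: "x \<in> hom bp.cat ?m n" using x by (simp add: bp.ends_iff)
    show ?thesis using y GM_hom[OF x] dsp.cat.cmp_scale_left[of y s "ups ?m" "GM x" "ups n" a]
      linear_functor.fun_scale[OF gmap.functor_map x] by (simp add: dsp.ends_iff)
  qed
  let ?i = "ident bp.cat ?m"
  have i: "bp.ends ?i = Some (?m, ?m)" "?ok ?i" using b_ends_id by auto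
  have "BA r (MGen g) = Bcmp (BA r (MGen g)) ?i"
    using bp.cmp_ident_right[OF BA_hom[of "MGen g" "os_dom g" "os_cod g" r]] by (simp add: mtyp_simps os_sig_def)
  also have "\<dots> = b_act_op g r ?i" using b_apply_gen'(1)[of ?i r g] i by simp
  finally have "Dcmp (GM (BA r (MGen g))) y = ?ph (b_act_op g r ?i)" by simp
  also have "\<dots> = g_act g r (?ph ?i)"
  proof (cases g)
    case Cw' then show ?thesis using sc[of "bo.Cb r ?i" "Suc (Suc r)" "qi * t"] C(2)[OF i(2)] i
      by (simp add: bo.evs)
  next
    case Dw then show ?thesis using sc[of "bo.Eb r ?i" r "q * ti"] E(2)[OF i(2)] i
      by (simp add: bo.evs)
  qed (use S[OF i(2)] C(1)[OF i(2)] E(1)[OF i(2)] in \<open>simp_all only: b_act_op.simps g_act.simps\<close>)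
  also have "?ph ?i = y" unfolding GM_ident using y dsp.cmp_ident_left by (simp add: dsp.ends_iff)
  finally show ?thesis .
qed

text \<open>\<open>gS\<close>, \<open>gSi\<close>, \<open>gU\<close> and \<open>gK\<close> carry a
  guard on the target word, which is satisfied at every stage of the passages.\<close>

lemma pass_raw:
  "ust x = Some (r + k, s) \<Longrightarrow> pass_cup pX pY (\<lambda>x. Tg Tau (pc 0 x)) r x = pass_cup gS gSi gU r x
    \<and> ust (pass_cup gS gSi gU r x) = Some (Suc (Suc (r + k)), s)"
  "ust x = Some (Suc (Suc (r + k)), s) \<Longrightarrow> pass_cap pX pY (\<lambda>x. pd' 0 (Tg TauBar x)) r x = pass_cap gS gSi gK r x"
proof -
  show "pass_cup pX pY (\<lambda>x. Tg Tau (pc 0 x)) r x = pass_cup gS gSi gU r x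
    \<and> ust (pass_cup gS gSi gU r x) = Some (Suc (Suc (r + k)), s)" if "ust x = Some (r + k, s)"
    using that
  proof (induction r arbitrary: k)
    case (Suc r)
    then show ?case using Suc.IH[of "Suc k"] by (simp add: g_raw go.ev)
  qed (simp add: g_raw go.ev)
  show "pass_cap pX pY (\<lambda>x. pd' 0 (Tg TauBar x)) r x = pass_cap gS gSi gK r x" if "ust x = Some (Suc (Suc (r + k)), s)"
    using that
  proof (induction r arbitrary: x k)
    case (Suc r)
    then show ?case using Suc.IH[of "gSi (Suc r) (gS r x)" "Suc k"] by (simp add: g_raw go.ev)
  qed (simp add: g_raw)
qed

section \<open>Multiplicativity and naturality of \<open>eta\<close>\<close>

abbreviation "Eta r \<mu> \<equiv> Dcls (eta_from r \<mu>)"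

lemma ctyp_eta: "ctyp ds_sig (eta_from r \<mu> :: 'k ds_term) (ups r @ \<mu>) (ups (r + length \<mu>))"
proof (induction \<mu> arbitrary: r)
  case Nil then show ?case by (simp add: ctyp_simps)
next
  case (Cons a \<mu>)
  have e: "ups r @ [Up] @ \<mu> = ups (Suc r) @ \<mu>" by (simp add: replicate_app_Cons_same)
  show ?case
  proof (cases a)
    case Up then show ?thesis using Cons.IH[of "Suc r"] by (simp add: replicate_app_Cons_same)
  next
    case Down
    have "ctyp ds_sig (eta_from (Suc r) \<mu> :: 'k ds_term) (ups r @ [Up] @ \<mu>) (ups (Suc r + length \<mu>))"
      unfolding e by (rule Cons.IH)
    from ctyp.intros(3)[OF this ctyp_strand_toggle] show ?thesis by (simp add: Down)
  qed
qed

text \<open>Leading \<open>Up\<close> strands only advance the counter of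
  \<open>eta_from\<close>.\<close>

lemma eta_eq: "eta q t \<delta> (ups r @ \<mu>) = Eta r \<mu>"
proof -
  have "eta_from n (ups r @ \<mu>) = (eta_from (n + r) \<mu> :: 'k ds_term)" for n :: nat
    by (induction r arbitrary: n) simp_all
  from this[of 0] show ?thesis by (simp add: eta_def dsp.cls_def)
qed

lemma apply_eta_Cons:
  assumes "dsp.ends x = Some (ups r @ a # \<mu>, s)"
  shows "Dcmp (Eta r (a # \<mu>)) x = Dcmp (Eta (Suc r) \<mu>) (case a of Up \<Rightarrow> x | Down \<Rightarrow> stg r x)"
  using assms apply_strand_toggle[of x "ups r" \<mu> s] by (cases a) (simp_all add: dsp.cmp_cls_comp)

lemma apply_eta_Nil: "dsp.ends x = Some (ups r, s) \<Longrightarrow> Dcmp (Eta r []) x = x"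
  using dsp.cmp_cls_id by (simp add: dsp.ends_iff)

text \<open>Toggling from left to right finishes \<open>\<mu>\<close> before it begins with
  \<open>\<nu>\<close>. For the inverses this becomes the compatibility with tensor products that is
  required of \<open>\<omega>\<close>.\<close>

lemma eta_append: "Eta r (\<mu> @ \<nu>) = Dcmp (Eta (r + length \<mu>) \<nu>) (DR \<nu> (Eta r \<mu>))"
proof (induction \<mu> arbitrary: r)
  case Nil
  have "Dcls (ds_right \<nu> (eta_from r [])) = ident dsp.cat (ups r @ \<nu>)" by (simp add: dsp.ident_cls)
  then show ?case using DR_cls[OF ctyp_eta, of \<nu> r "[]"] dsp.cmp_ident_right[of "Eta r \<nu>" "ups r @ \<nu>"] ctyp_eta[of r \<nu>] by simp
next
  case (Cons a \<mu>)
  show ?case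
  proof (cases a)
    case Up then show ?thesis using Cons.IH[of "Suc r"] by simp
  next
    case Down
    have "DR \<nu> (Dcls (strand_toggle (ups r) \<mu>)) = Dcls (strand_toggle (ups r) (\<mu> @ \<nu>))"
      unfolding DR_cls[OF ctyp_strand_toggle] unfolding strand_toggle_def ds_right_right ..
    moreover have "DR \<nu> (Eta r (Down # \<mu>)) = Dcmp (DR \<nu> (Eta (Suc r) \<mu>)) (DR \<nu> (Dcls (strand_toggle (ups r) \<mu>)))"
      using DR_cmp[of "Dcls (strand_toggle (ups r) \<mu>)" "ups r @ [Down] @ \<mu>" "ups r @ [Up] @ \<mu>" "Eta (Suc r) \<mu>" "ups (Suc r + length \<mu>)" \<nu>]
        ctyp_strand_toggle[of "ups r" \<mu>] ctyp_eta[of "Suc r" \<mu>] by (simp add: dsp.cmp_cls[symmetric] replicate_app_Cons_same)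
    ultimately show ?thesis
      using Cons.IH[of "Suc r"] by (simp add: Down dsp.cmp_cls[symmetric] dsp.cmp_assoc)
  qed
qed

lemma g_op_right: "g_op (b_gen_right n g) = g_op g"
  by (cases g) (simp_all add: fun_eq_iff)

text \<open>Collects the commutation of the toggle with cups, caps and crossings on its left. For an
  inverse crossing the positive case is applied at \<open>pY j x\<close> and \<open>pX\<close> is
  cancelled.\<close>

lemma stg_g_op:
  assumes g: "b_sig g a b" and x: "dsp.ends x = Some (ups a @ Down # \<nu>, s)"
  shows "stg b (g_op g x) = g_op g (stg a x)"
proof (cases g)
  case (Cup r)
  have c: "dsp.ends (pc 0 x) = Some (Down # (Up # ups a) @ [Down] @ \<nu>, s)" using x by (simp add: evd)
  then show ?thesis using g Cup stg_Tau[OF c] stg_c[of x "ups a" \<nu> s] x by simp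
next
  case (Cap r)
  then have x': "dsp.ends x = Some (Up # (Up # ups r) @ [Down] @ \<nu>, s)" using g x by simp
  then have "dsp.ends (Tg TauBar x) = Some ([Down, Up] @ ups r @ [Down] @ \<nu>, s)" by (simp add: evd)
  from stg_d'[OF this] show ?thesis using stg_TauBar[OF x'] g Cap by simp
next
  case (Sig r i)
  then obtain j where j: "i = Suc j" "Suc j < r" "a = r" "b = r" using g by (cases i) auto
  have "r = j + (2 + (r - j - 2))" using j by simp
  then have "ups r = ups j @ [Up, Up] @ ups (r - j - 2)"
    by (metis replicate_add numeral_2_eq_2 replicate_0 replicate_Suc)
  then have "dsp.ends x = Some (ups j @ [Up, Up] @ ups (r - j - 2) @ [Down] @ \<nu>, s)" using x j by simp
  from stg_X[OF this] show ?thesis using Sig j by (simp add: Suc_diff_Suc)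
next
  case (SigInv r i)
  then obtain j where j: "i = Suc j" "Suc j < r" "a = r" "b = r" using g by (cases i) auto
  have "r = j + (2 + (r - j - 2))" using j by simp
  then have u: "ups r = ups j @ [Up, Up] @ ups (r - j - 2)"
    by (metis replicate_add numeral_2_eq_2 replicate_0 replicate_Suc)
  have x': "dsp.ends x = Some (ups j @ [Up, Up] @ ups (r - j - 2) @ [Down] @ \<nu>, s)" using x j u by simp
  let ?y = "pY j x"
  have y: "dsp.ends ?y = Some (ups j @ [Up, Up] @ ups (r - j - 2) @ [Down] @ \<nu>, s)" using x' by (simp add: evd)
  have XY': "pX j ?y = x" using x' by (intro XY) (simp add: at_def)
  have "dsp.ends ?y = Some (ups r @ [Down] @ \<nu>, s)" using y unfolding u by simp
  from ends_stg[OF this] have sy: "dsp.ends (stg r ?y) = Some (ups r @ [Up] @ \<nu>, s)" by simp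
  have "pY j (pX j (stg r ?y)) = stg r ?y" using sy u by (intro YX) (simp add: at_def)
  moreover have "pX j (stg r ?y) = stg r x" using stg_X[OF y] XY' j by (simp add: Suc_diff_Suc)
  ultimately show ?thesis using SigInv j by simp
qed

text \<open>Each treated letter of \<open>\<nu>\<close> becomes an \<open>Up\<close> strand, so
  \<open>g\<close> is next regarded with one more strand on its right; its operator stays the same
  by \<open>g_op_right\<close>.\<close>

lemma eta_g_op:
  assumes "b_sig g a b" "dsp.ends x = Some (ups a @ \<nu>, s)"
  shows "Dcmp (Eta b \<nu>) (g_op g x) = g_op g (Dcmp (Eta a \<nu>) x)"
  using assms
proof (induction \<nu> arbitrary: g a b x)
  case Nil
  have "dsp.ends (g_op g x) = Some (ups b @ [], s)" using apply_G_gen[OF Nil] by blast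
  then show ?case using Nil by (simp only: apply_eta_Nil append_Nil2)
next
  case (Cons c \<nu>)
  let ?x = "case c of Up \<Rightarrow> x | Down \<Rightarrow> stg a x"
  have e: "dsp.ends (g_op g x) = Some (ups b @ c # \<nu>, s)" using apply_G_gen[OF Cons.prems] by blast
  have x: "dsp.ends ?x = Some (ups (Suc a) @ \<nu>, s)"
    using Cons.prems(2) ends_stg[of x "ups a" \<nu> s] by (cases c) (simp_all add: replicate_app_Cons_same)
  have g: "b_sig (b_gen_right 1 g) (Suc a) (Suc b)"
    using ctyp_b_right[of "CGen g" a b 1] Cons.prems(1) by (simp add: ctyp_simps)
  have "(case c of Up \<Rightarrow> g_op g x | Down \<Rightarrow> stg b (g_op g x)) = g_op g ?x"
    using stg_g_op[OF Cons.prems(1)] Cons.prems(2) by (cases c) simp_all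
  then show ?case
    using Cons.IH[OF g x] by (simp only: apply_eta_Cons[OF e] apply_eta_Cons[OF Cons.prems(2)] g_op_right)
qed

lemma Eta_hom: "Eta r \<mu> \<in> hom dsp.cat (ups r @ \<mu>) (ups (r + length \<mu>))"
  using ctyp_eta by simp

end

section \<open>The equivalence\<close>

context skein_parameters begin

text \<open>On generators both sides are evaluated at an identity, where they become the two sides
  of \<open>eta_g_op\<close>.\<close>

lemma eta_natural_left:
  assumes f: "f \<in> hom bp.cat a b"
  shows "Dcmp (Eta b \<nu>) (DR \<nu> (GM f)) = Dcmp (GM (BR (length \<nu>) f)) (Eta a \<nu>)"
proof -
  have F: "linear_functor bp.cat dsp.cat (\<lambda>r. ups r @ \<nu>) (\<lambda>f. DR \<nu> (GM f))"
    using functor_comp[OF gmap.functor_map DR_functor[of \<nu>]] by (simp add: G_ob_def)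
  have F': "linear_functor bp.cat dsp.cat (\<lambda>r. ups (r + length \<nu>)) (\<lambda>f. GM (BR (length \<nu>) f))"
    using functor_comp[OF BR_functor[of "length \<nu>"] gmap.functor_map] by (simp add: G_ob_def)
  show ?thesis
  proof (rule bp.natural_extend[OF dsp.linear_category_cat F F' Eta_hom _ f])
    fix g a b assume g: "b_sig g a b"
    have G: "Bcls (CGen g) \<in> hom bp.cat a b" using g by (simp add: ctyp_simps)
    have g': "b_sig (b_gen_right (length \<nu>) g) (a + length \<nu>) (b + length \<nu>)"
      using ctyp_b_right[of "CGen g" a b "length \<nu>"] g by (simp add: ctyp_simps)
    let ?i = "ident dsp.cat (ups a @ \<nu>)"
    have i: "dsp.ends ?i = Some (ups a @ \<nu>, ups a @ \<nu>)" by (rule ds_ends_id)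
    have e: "dsp.ends (Dcmp (Eta a \<nu>) ?i) = Some (ups (a + length \<nu>), ups a @ \<nu>)"
      by (rule ends_cmp[OF i Eta_hom])
    have R: "BR (length \<nu>) (Bcls (CGen g)) = Bcls (CGen (b_gen_right (length \<nu>) g))"
      using BR_cls[of "CGen g" a b "length \<nu>"] g by (simp add: ctyp_simps)
    have "Dcmp (Eta b \<nu>) (DR \<nu> (GM (Bcls (CGen g)))) = Dcmp (Eta b \<nu>) (Dcmp (Dcls (ds_right \<nu> (G_gen g))) ?i)"
      unfolding GM_gen[OF g] G_right[OF g]
      using ctyp_ds_right[OF ctyp_G_gen[OF g], of \<nu>] by (subst dsp.cmp_ident_right) (simp_all add: G_ob_def)
    also have "\<dots> = g_op g (Dcmp (Eta a \<nu>) ?i)"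
      using apply_G_gen[OF g i] eta_g_op[OF g i] by simp
    also have "\<dots> = Dcmp (Dcls (G_gen (b_gen_right (length \<nu>) g))) (Dcmp (Eta a \<nu>) ?i)"
      using apply_G_gen_Nil[OF g' e] by (simp only: g_op_right)
    also have "\<dots> = Dcmp (GM (BR (length \<nu>) (Bcls (CGen g)))) (Eta a \<nu>)"
      unfolding R GM_gen[OF g'] using dsp.cmp_ident_right[OF Eta_hom] by simp
    finally show "Dcmp (Eta b \<nu>) (DR \<nu> (GM (Bcls (CGen g)))) = Dcmp (GM (BR (length \<nu>) (Bcls (CGen g)))) (Eta a \<nu>)" .
  qed
qed

lemma apply_eta2:
  assumes "dsp.ends x = Some (ups r @ [a, b] @ \<nu>, s)" "\<nu> = []"
  shows "a = Up \<Longrightarrow> b = Up \<Longrightarrow> Dcmp (Eta r [a, b]) x = x"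
    "a = Down \<Longrightarrow> b = Up \<Longrightarrow> Dcmp (Eta r [a, b]) x = stg r x"
    "a = Up \<Longrightarrow> b = Down \<Longrightarrow> Dcmp (Eta r [a, b]) x = stg (Suc r) x"
proof -
  have N: "Dcmp (Eta (Suc (Suc r)) []) y = y" if "dsp.ends y = Some (ups r @ [Up, Up], s)" for y
    using that by (intro apply_eta_Nil[of _ _ s]) (simp add: replicate_app_Cons_same)
  show "Dcmp (Eta r [a, b]) x = x" if "a = Up" "b = Up"
    using N[of x] assms that by simp
  show "Dcmp (Eta r [a, b]) x = stg r x" if "a = Down" "b = Up"
    using N[of "stg r x"] ends_stg[of x "ups r" "[Up]" s] assms that apply_eta_Cons[of x r Down "[Up]" s] by simp
  show "Dcmp (Eta r [a, b]) x = stg (Suc r) x" if "a = Up" "b = Down"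
  proof -
    have x: "dsp.ends x = Some (ups (Suc r) @ [Down], s)" using assms that by (simp add: replicate_app_Cons_same)
    have "dsp.ends (stg (Suc r) x) = Some (ups r @ [Up, Up], s)"
      using ends_stg[of x "ups (Suc r)" "[]" s] x by (simp add: replicate_app_Cons_same)
    then show ?thesis using N apply_eta_Cons[OF x] that by simp
  qed
qed

lemma stg_Suc_mixed:
  assumes x: "dsp.ends x = Some (ups r @ [Up, Down] @ \<nu>, s)"
  shows "stg (Suc r) x = pY r (stg r (pR r x))"
    and "dsp.ends (stg r (pR r x)) = Some (ups r @ [Up, Up] @ \<nu>, s)"
proof -
  have "dsp.ends (pR r x) = Some (ups r @ [Down] @ Up # \<nu>, s)" using ends_R(1)[of x "ups r" \<nu> s] x by simp
  from ends_stg[OF this] show e: "dsp.ends (stg r (pR r x)) = Some (ups r @ [Up, Up] @ \<nu>, s)" by simp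
  show "stg (Suc r) x = pY r (stg r (pR r x))" using x e by (simp add: stg_simps pU_def pW_def at_def)
qed

lemma stg_scale: "dsp.ends x = Some (ups r @ Down # \<nu>, s) \<Longrightarrow> stg r (dsc a x) = dsc a (stg r x)"
proof -
  assume x: "dsp.ends x = Some (ups r @ Down # \<nu>, s)"
  have t: "Dcls (strand_toggle (ups r) \<nu>) \<in> hom dsp.cat (ups r @ Down # \<nu>) (ups r @ [Up] @ \<nu>)"
    using ctyp_strand_toggle[of "ups r" \<nu>] by simp
  show ?thesis
    using d_scale_right[OF x t, of a] apply_strand_toggle[of x "ups r" \<nu> s]
      apply_strand_toggle[of "dsc a x" "ups r" \<nu> s] x by (simp add: ends_scale)
qed

lemma ust_ups: "dsp.ends x = Some (ups r @ [Up, Up], s) \<Longrightarrow> ust x = Some (Suc (Suc (r + 0)), s)"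
  by (simp add: ust_iff replicate_app_Cons_same)

text \<open>For \<open>c\<close> and \<open>d'\<close> this is \<open>stg_pc\<close> and
  \<open>stg_pd'\<close>. For \<open>c'\<close> and \<open>d\<close> the \<open>Down\<close> strand
  is the right leg: moving it past the left leg by \<open>R_+\<close> leads to \<open>c\<close> or
  \<open>d'\<close> with a factor \<open>t\<close>, and the inverse crossing on the way back costs
  \<open>qi\<close>. The scalars in \<open>b_act_gen\<close> are the product of these factors for
  \<open>c'\<close> and its inverse for \<open>d\<close>.\<close>

lemma eta_A:
  assumes x: "dsp.ends x = Some (ups r @ os_dom g, s)"
  shows "Dcmp (Eta r (os_cod g)) (A g r x) = g_act g r (Dcmp (Eta r (os_dom g)) x)"
proof -
  have e: "dsp.ends (A g r x) = Some (ups r @ os_cod g, s)" using x by (simp add: evd)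
  have sq: "dsc a (dsc b y) = dsc (a * b) y" if "ust y = Some p" for a b y p
    using that by (intro dsc_dsc) (cases p, simp add: ust_iff)
  show ?thesis
  proof (cases g)
    case Xpos
    then show ?thesis using x e ust_ups[of x r s] apply_eta2(1)[of x r Up Up "[]" s] apply_eta2(1)[of "A g r x" r Up Up "[]" s]
      by (simp add: g_raw)
  next
    case Xneg
    then show ?thesis using x e ust_ups[of x r s] apply_eta2(1)[of x r Up Up "[]" s] apply_eta2(1)[of "A g r x" r Up Up "[]" s]
      by (simp add: g_raw)
  next
    case Cw
    then have x': "dsp.ends x = Some (ups r, s)" using x by simp
    then show ?thesis using Cw e apply_eta2(2)[of "pc r x" r Down Up "[]" s] apply_eta_Nil[of x r s]
        stg_pc[of x r "[]" s] pass_raw(1)[of x r 0 s] by (simp add: ust_iff)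
  next
    case Dw'
    then have x': "dsp.ends x = Some (ups r @ [Down, Up], s)" and e': "dsp.ends (pd' r x) = Some (ups r, s)"
      using x e by simp_all
    have "dsp.ends (stg r x) = Some (ups r @ [Up, Up], s)" using ends_stg[of x "ups r" "[Up]" s] x' by simp
    then show ?thesis using Dw' x' apply_eta2(2)[of x r Down Up "[]" s] apply_eta_Nil[OF e']
        stg_pd'[of x r "[]" s] pass_raw(2)[of "stg r x" r 0 s] ust_ups by simp
  next
    case Cw'
    then have x': "dsp.ends x = Some (ups r, s)" and e': "dsp.ends (pc' r x) = Some (ups r @ [Up, Down], s)"
      using x e by simp_all
    let ?C = "pass_cup gS gSi gU r x" and ?D = "pass_cup gSi gS gU r x"
    have u: "ust x = Some (r + 0, s)" using x' by (simp add: ust_iff)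
    have C: "stg r (pc r x) = ?C" "ust ?C = Some (Suc (Suc r), s)"
      using stg_pc[of x r "[]" s] pass_raw(1)[OF u] x' by simp_all
    have D: "gSi r ?C = dsc qi ?D" using u by (intro go.Si_pass_cup) (simp add: go.has_def)
    have d: "ust ?D \<noteq> None" using go.has_pass_cup[of r x] u by (auto simp: go.has_def split: option.splits)
    have "stg r (pR r (pc' r x)) = dsc t ?C"
      using pR_c'[of r x] x' stg_scale[of "pc r x" r "[Up]" s t] C by (simp add: at_def evd)
    then have "Dcmp (Eta r (os_cod g)) (A g r x) = pY r (dsc t ?C)"
      using apply_eta2(3)[of "pc' r x" r Up Down "[]" s] stg_Suc_mixed(1)[of "pc' r x" r "[]" s] e' Cw' by simp
    also have "\<dots> = dsc t (pY r ?C)" using C(2) by (intro A_scale) (simp add: ust_iff)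
    also have "pY r ?C = gSi r ?C" using C(2) by (simp add: g_raw)
    also have "dsc t (gSi r ?C) = dsc (qi * t) ?D" using d sq by (auto simp: D mult.commute)
    finally show ?thesis using apply_eta_Nil[OF x'] Cw' by simp
  next
    case Dw
    then have x': "dsp.ends x = Some (ups r @ [Up, Down], s)" and e': "dsp.ends (pd r x) = Some (ups r, s)"
      using x e by simp_all
    let ?y = "stg r (pR r x)"
    have y: "dsp.ends ?y = Some (ups r @ [Up, Up], s)" using stg_Suc_mixed(2)[of x r "[]" s] x' by simp
    note u = ust_ups[OF y]
    have "stg (Suc r) x = gSi r ?y" using stg_Suc_mixed(1)[of x r "[]" s] x' u by (simp add: g_raw)
    then have "g_act g r (Dcmp (Eta r (os_dom g)) x) = dsc (q * ti) (pass_cap gSi gS gK r (gSi r ?y))"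
      using apply_eta2(3)[of x r Up Down "[]" s] x' Dw by simp
    also have "\<dots> = dsc (q * ti) (dsc qi (pass_cap gS gSi gK r ?y))" by (simp only: go.pass_cap_Si)
    also have "pass_cap gS gSi gK r ?y = pd' r (pR r x)"
      using pass_raw(2)[OF u] stg_pd'[of "pR r x" r "[]" s] ends_R(1)[of x "ups r" "[]" s] x' by simp
    also have "pd' r (pR r x) = dsc t (pd r x)" using x' by (intro d'_pR) (simp add: at_def)
    also have "dsc (q * ti) (dsc qi (dsc t (pd r x))) = pd r x"
    proof -
      have "dsc qi (dsc t (pd r x)) = dsc (qi * t) (pd r x)" using e' by (intro dsc_dsc) simp
      then show ?thesis using dsc_cancel[OF _ scalars(1)] e' by simp
    qed
    finally show ?thesis using apply_eta_Nil[OF e'] Dw by simp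
  qed
qed

lemma DN_scale: "mtyp os_sig u X Y \<Longrightarrow> DN V (MScale a u) = dsc a (DN V u)"
  using DO_scale[OF mtyp_tens_id(2)] DO_cong[OF osp.cls_tens_right_linear(4)] by metis

text \<open>In the oriented skein category zero is \<open>0\<close> times itself, so scalars
  suffice.\<close>

lemma DN_zero: "DN V (MZero X Y) = zero_mor dsp.cat (V @ X) (V @ Y)"
proof -
  let ?z = "MZero X Y :: 'k os_term"
  have z: "mtyp os_sig ?z X Y" by (rule mtyp.intros)
  interpret O: linear_monoidal_category osp.cat by (rule osp.linear_monoidal_category_cat)
  have "osp.cls (MScale 0 ?z) = osp.cls ?z"
    using O.scale_zero[of "osp.cls ?z" X Y] z by (simp add: osp.scale_cls osp.zero_cls)
  then have "DN V ?z = DN V (MScale 0 ?z)" by (intro DO_cong osp.cls_cong_tens) simp_all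
  then show ?thesis using DN_scale[OF z, of V 0] dsp.cat.scale_zero[OF DN_hom[OF z]] by simp
qed

lemma eta_natural_gen:
  "Dcmp (Eta r (os_cod g)) (DN (ups r) (MGen g)) = Dcmp (GM (BA r (MGen g))) (Eta r (os_dom g))"
proof -
  let ?x = "ident dsp.cat (ups r @ os_dom g)"
  have x: "dsp.ends ?x = Some (ups r @ os_dom g, ups r @ os_dom g)" by (rule ds_ends_id)
  have A: "AT (MGen g) (ups r) [] = DN (ups r) (MGen g)"
    using DO_cong[OF osp.cls_tens_unit(2)[OF mtyp_tens_id(2)[of "MGen g" "os_dom g" "os_cod g" "ups r"]]]
    by (simp add: AT_def mtyp_simps os_sig_def)
  have L: "DN (ups r) (MGen g) = A g r ?x"
    using A_eq[of ?x "ups r" g "[]"] x dsp.cmp_ident_right[OF DN_hom[of "MGen g" "os_dom g" "os_cod g" "ups r"]]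
    by (simp add: A mtyp_simps os_sig_def)
  have E: "Eta r (os_dom g) = Dcmp (Eta r (os_dom g)) ?x" using dsp.cmp_ident_right[OF Eta_hom] by simp
  have e: "dsp.ends (Dcmp (Eta r (os_dom g)) ?x) = Some (ups (r + length (os_dom g)), ups r @ os_dom g)"
    by (rule ends_cmp[OF x Eta_hom])
  obtain s where s: "dsp.ends ?x = Some (ups r @ os_dom g, s)" using x by simp
  have "Dcmp (Eta r (os_cod g)) (A g r ?x) = g_act g r (Dcmp (Eta r (os_dom g)) ?x)"
    by (rule eta_A[OF s])
  then show ?thesis unfolding L apply_GM[OF e, folded E] by (simp only: E[symmetric])
qed

text \<open>In the tensor case \<open>eta_append\<close> splits the toggles. The right factor moves
  past the toggles of the left one by \<open>DN_natural\<close>, and the image of the left factor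
  past the toggles of \<open>X2\<close> by \<open>eta_natural_left\<close>.\<close>

lemma eta_natural_right: "mtyp os_sig u X Y
  \<Longrightarrow> Dcmp (Eta r Y) (DN (ups r) u) = Dcmp (GM (BA r u)) (Eta r X)"
proof (induction u arbitrary: X Y r)
  case (MGen g)
  then show ?case using eta_natural_gen by (simp add: mtyp_simps os_sig_def)
next
  case (MId Z)
  then have XY: "X = Z" "Y = Z" by (auto simp: mtyp_simps)
  have "DN (ups r) (MId Z) = ident dsp.cat (ups r @ Z)"
    unfolding DO_id[symmetric] by (rule DO_cong[OF osp.cls_tens_ident])
  then show ?case using dsp.cmp_ident_left[OF Eta_hom] dsp.cmp_ident_right[OF Eta_hom]
    by (simp only: XY BA_simps GM_ident)
next
  case (MComp u v)
  then obtain Z where u: "mtyp os_sig u Z Y" and v: "mtyp os_sig v X Z" by (auto simp: mtyp_simps)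
  have "DN (ups r) (u \<odot> v) = Dcmp (DN (ups r) u) (DN (ups r) v)"
    unfolding DO_comp[OF mtyp_tens_id(2)[OF u] mtyp_tens_id(2)[OF v], symmetric]
    by (rule DO_cong[OF osp.cls_tens_comp_right(2)[OF u v]])
  then show ?case
    unfolding BA_simps GM_cmp[OF BA_hom[OF v] BA_hom[OF u]] dsp.cmp_assoc MComp.IH(2)[OF v, symmetric]
    by (simp only: dsp.cmp_assoc[symmetric] MComp.IH(1)[OF u])
next
  case (MTens u v)
  then obtain X1 X2 Y1 Y2 where u: "mtyp os_sig u X1 Y1" and v: "mtyp os_sig v X2 Y2"
    and XY: "X = X1 @ X2" "Y = Y1 @ Y2" by (auto simp: mtyp_simps)
  note Hu = DN_hom[OF u, of "ups r"] and Bu = BA_hom[OF u, of r] and Bv = BA_hom[OF v, of "r + length Y1"]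
  have DRu: "DR X2 (DN (ups r) u) = DO (MId (ups r) \<boxtimes> u \<boxtimes> MId X2)"
    using DR_cls[of "os (MId (ups r) \<boxtimes> u)" "ups r @ X1" "ups r @ Y1" X2] mtyp_tens_id(2)[OF u] by (simp add: ctyp_simps)
  have "DN (ups r) (u \<boxtimes> v) = DO ((MId (ups r @ Y1) \<boxtimes> v) \<odot> (MId (ups r) \<boxtimes> u \<boxtimes> MId X2))"
    using osp.cls_slide(1)[OF mtyp_tens_id(2)[OF u] v, of "ups r"] osp.cls_tens_assoc[of "MId (ups r)" u v]
    by (intro DO_cong) simp
  also have "\<dots> = Dcmp (DN (ups r @ Y1) v) (DR X2 (DN (ups r) u))"
    unfolding DRu by (rule DO_comp[OF mtyp_tens_id(2)[OF v] mtyp_tens_id(1)[OF mtyp_tens_id(2)[OF u]]])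
  finally have uv: "DN (ups r) (u \<boxtimes> v) = Dcmp (DN (ups r @ Y1) v) (DR X2 (DN (ups r) u))" .
  have "Dcmp (Eta r Y) (DN (ups r) (u \<boxtimes> v))
    = Dcmp (Eta (r + length Y1) Y2) (Dcmp (Dcmp (DR Y2 (Eta r Y1)) (DN (ups r @ Y1) v)) (DR X2 (DN (ups r) u)))"
    unfolding XY eta_append uv dsp.cmp_assoc ..
  also have "Dcmp (DR Y2 (Eta r Y1)) (DN (ups r @ Y1) v) = Dcmp (DN (ups (r + length Y1)) v) (DR X2 (Eta r Y1))"
    by (rule DN_natural[OF v Eta_hom, symmetric])
  also have "Dcmp (Eta (r + length Y1) Y2) (Dcmp (Dcmp (DN (ups (r + length Y1)) v) (DR X2 (Eta r Y1))) (DR X2 (DN (ups r) u)))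
    = Dcmp (GM (BA (r + length Y1) v)) (Dcmp (Eta (r + length Y1) X2) (DR X2 (Dcmp (Eta r Y1) (DN (ups r) u))))"
    unfolding DR_cmp[OF Hu Eta_hom] by (simp only: dsp.cmp_assoc[symmetric] MTens.IH(2)[OF v])
  also have "\<dots> = Dcmp (GM (BA (r + length Y1) v)) (Dcmp (Dcmp (Eta (r + length Y1) X2) (DR X2 (GM (BA r u)))) (DR X2 (Eta r X1)))"
    unfolding MTens.IH(1)[OF u] DR_cmp[OF Eta_hom GM_hom[OF Bu]] dsp.cmp_assoc ..
  also have "Dcmp (Eta (r + length Y1) X2) (DR X2 (GM (BA r u)))
    = Dcmp (GM (BR (length X2) (BA r u))) (Eta (r + length X1) X2)"
    by (rule eta_natural_left[OF Bu])
  also have "Dcmp (GM (BA (r + length Y1) v)) (Dcmp (Dcmp (GM (BR (length X2) (BA r u))) (Eta (r + length X1) X2)) (DR X2 (Eta r X1)))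
    = Dcmp (GM (BA r (u \<boxtimes> v))) (Eta r X)"
    unfolding BA_simps(2)[OF u v] GM_cmp[OF BR_hom[OF Bu] Bv] XY eta_append dsp.cmp_assoc ..
  finally show ?case .
next
  case (MZero V W)
  then have XY: "X = V" "Y = W" by (simp_all add: mtyp_simps)
  have "GM (zero_mor bp.cat (r + length V) (r + length W)) = zero_mor dsp.cat (ups (r + length V)) (ups (r + length W))"
    using linear_functor_zero[OF bp.linear_category_cat dsp.linear_category_cat gmap.functor_map] by (simp add: G_ob_def)
  then show ?case
    by (simp only: XY BA_simps DN_zero dsp.cat.cmp_zero_right[OF Eta_hom] dsp.cat.cmp_zero_left[OF Eta_hom])
next
  case (MAdd u v)
  then have u: "mtyp os_sig u X Y" and v: "mtyp os_sig v X Y" by (auto simp: mtyp_simps)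
  have "DN (ups r) (MAdd u v) = dad (DN (ups r) u) (DN (ups r) v)"
    unfolding DO_add[OF mtyp_tens_id(2)[OF u] mtyp_tens_id(2)[OF v], symmetric]
    by (rule DO_cong[OF osp.cls_tens_right_linear(3)[OF u v]])
  then show ?case
    unfolding BA_simps linear_functor.fun_add[OF gmap.functor_map BA_hom[OF u] BA_hom[OF v]]
    by (simp only: dsp.cat.cmp_add_right[OF DN_hom[OF u] DN_hom[OF v] Eta_hom]
        dsp.cat.cmp_add_left[OF Eta_hom GM_hom[OF BA_hom[OF u]] GM_hom[OF BA_hom[OF v]]] MAdd.IH(1)[OF u] MAdd.IH(2)[OF v])
next
  case (MScale a u)
  then have u: "mtyp os_sig u X Y" by (auto simp: mtyp_simps)
  then show ?case
    unfolding BA_simps DN_scale[OF u] linear_functor.fun_scale[OF gmap.functor_map BA_hom[OF u]]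
    by (simp only: dsp.cat.cmp_scale_right[OF DN_hom[OF u] Eta_hom]
        dsp.cat.cmp_scale_left[OF Eta_hom GM_hom[OF BA_hom[OF u]]] MScale.IH[OF u])
qed

end

section \<open>Inverses, and invertibility of \<open>eta\<close>\<close>

context linear_category begin

lemma inverse_mors_cmp:
  assumes "inverse_mors C X Y f g" "inverse_mors C Y Z f' g'"
  shows "inverse_mors C X Z (cmp C f' f) (cmp C g g')"
proof -
  have h: "f \<in> hom C X Y" "g \<in> hom C Y X" "f' \<in> hom C Y Z" "g' \<in> hom C Z Y"
    and e: "cmp C g f = ident C X" "cmp C f g = ident C Y" "cmp C g' f' = ident C Y" "cmp C f' g' = ident C Z"
    using assms by (auto simp: inverse_mors_def)
  have "cmp C (cmp C g g') (cmp C f' f) = cmp C g (cmp C (cmp C g' f') f)"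
    using cmp_assoc[OF cmp_hom[OF h(1,3)] h(4,2)] cmp_assoc[OF h(1,3,4)] by simp
  moreover have "cmp C (cmp C f' f) (cmp C g g') = cmp C f' (cmp C (cmp C f g) g')"
    using cmp_assoc[OF cmp_hom[OF h(4,2)] h(1,3)] cmp_assoc[OF h(4,2,1)] by simp
  ultimately show ?thesis
    using h e cmp_hom[OF h(1,3)] cmp_hom[OF h(4,2)] cmp_ident_left[OF h(1)] cmp_ident_left[OF h(4)]
    by (simp add: inverse_mors_def)
qed

lemma inverse_mors_unique:
  assumes "inverse_mors C X Y f g" "inverse_mors C X Y f g'" shows "g = g'"
proof -
  have h: "f \<in> hom C X Y" "g \<in> hom C Y X" "g' \<in> hom C Y X"
    and e: "cmp C g f = ident C X" "cmp C f g' = ident C Y"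
    using assms by (auto simp: inverse_mors_def)
  have "g = cmp C g (cmp C f g')" using cmp_ident_right[OF h(2)] e by simp
  also have "\<dots> = g'" using cmp_assoc[OF h(3,1,2)] cmp_ident_left[OF h(3)] e by simp
  finally show ?thesis .
qed

text \<open>Turns the commuting squares of \<open>eta\<close> into those of its inverse
  \<open>\<omega>\<close>.\<close>

lemma inverse_mors_natural:
  assumes e: "inverse_mors C X Y e w" and e': "inverse_mors C X' Y' e' w'"
    and f: "f \<in> hom C X X'" and h: "h \<in> hom C Y Y'" and n: "cmp C e' f = cmp C h e"
  shows "cmp C w' h = cmp C f w"
proof -
  have m: "e \<in> hom C X Y" "w \<in> hom C Y X" "e' \<in> hom C X' Y'" "w' \<in> hom C Y' X'"
    and i: "cmp C e w = ident C Y" "cmp C w' e' = ident C X'"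
    using e e' by (auto simp: inverse_mors_def)
  have "cmp C w' h = cmp C w' (cmp C h (cmp C e w))" using cmp_ident_right[OF h] i by simp
  also have "\<dots> = cmp C w' (cmp C (cmp C h e) w)" using cmp_assoc[OF m(2,1) h] by simp
  also have "\<dots> = cmp C (cmp C w' (cmp C e' f)) w"
    unfolding n[symmetric] by (rule cmp_assoc[OF m(2) cmp_hom[OF f m(3)] m(4), symmetric])
  also have "cmp C w' (cmp C e' f) = f" using cmp_assoc[OF f m(3,4)] cmp_ident_left[OF f] i by simp
  finally show ?thesis .
qed

end

lemma inverse_mors_sym: "inverse_mors C X Y f g \<Longrightarrow> inverse_mors C Y X g f"
  by (auto simp: inverse_mors_def)

lemma (in cat_functor) inverse_mors_map:
  "inverse_mors C X Y f g \<Longrightarrow> inverse_mors D (FO X) (FO Y) (FM f) (FM g)"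
  unfolding inverse_mors_def
  using fun_cmp[of f X Y g X] fun_cmp[of g Y X f Y] fun_hom[of f X Y] fun_hom[of g Y X] by (simp add: fun_ident)

context skein_parameters begin

text \<open>The crossings, \<open>R_+\<close> and \<open>D_-\<close> have left inverses, so the
  argument is recovered strand by strand.\<close>

lemma stg_inj:
  assumes "dsp.ends x = Some (\<kappa> @ [Down] @ \<mu>, s)" "dsp.ends y = Some (\<kappa> @ [Down] @ \<mu>, s)"
    and "stg (length \<kappa>) x = stg (length \<kappa>) y"
  shows "x = y"
  using assms
proof (induction \<kappa> arbitrary: x y \<mu> rule: rev_induct)
  case Nil
  then have "at [Down] 0 x" "at [Down] 0 y" by (simp_all add: at_def)
  note xy = TbT[OF this(1), symmetric] TbT[OF this(2)]
  have e: "Tg Tau x = Tg Tau y" using Nil(3) unfolding list.size stg_simps .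
  show ?case by (rule HOL.trans[OF xy(1)]) (unfold e, rule xy(2))
next
  case (snoc a \<kappa>)
  let ?n = "length \<kappa>"
  have x: "dsp.ends x = Some (\<kappa> @ [a, Down] @ \<mu>, s)" and y: "dsp.ends y = Some (\<kappa> @ [a, Down] @ \<mu>, s)"
    using snoc.prems by simp_all
  have ux: "dsp.ends (pU ?n x) = Some (\<kappa> @ [Down] @ a # \<mu>, s)" and uy: "dsp.ends (pU ?n y) = Some (\<kappa> @ [Down] @ a # \<mu>, s)"
    using ends_U[OF x] ends_U[OF y] by simp_all
  have W: "(case a of Up \<Rightarrow> pX ?n (pW ?n v) | Down \<Rightarrow> pL ?n (pW ?n v)) = v"
    if "dsp.ends v = Some (\<kappa> @ [Up, a] @ \<mu>, s)" for v
    using that by (cases a) (simp_all add: pW_def at_def XY LR)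
  have U: "(case a of Up \<Rightarrow> pL ?n (pU ?n v) | Down \<Rightarrow> pD ?n (pU ?n v)) = v"
    if "dsp.ends v = Some (\<kappa> @ [a, Down] @ \<mu>, s)" for v
    using that by (cases a) (simp_all add: pU_def at_def pD_pDm LR)
  have e: "pW ?n (stg ?n (pU ?n x)) = pW ?n (stg ?n (pU ?n y))" using snoc.prems(3) by (simp add: stg_simps)
  have "stg ?n (pU ?n x) = stg ?n (pU ?n y)"
  proof (rule HOL.trans[OF W[symmetric]])
    show "dsp.ends (stg ?n (pU ?n x)) = Some (\<kappa> @ [Up, a] @ \<mu>, s)" using ends_stg[OF ux] by simp
    show "(case a of Up \<Rightarrow> pX ?n (pW ?n (stg ?n (pU ?n x))) | Down \<Rightarrow> pL ?n (pW ?n (stg ?n (pU ?n x)))) = stg ?n (pU ?n y)"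
      unfolding e by (rule W) (use ends_stg[OF uy] in simp)
  qed
  from snoc.IH[OF ux uy this] have "pU ?n x = pU ?n y" .
  then show ?case by (intro HOL.trans[OF U[OF x, symmetric]]) (simp only: U[OF y])
qed

text \<open>Surjectivity of \<open>stg\<close> at the identity provides a right inverse, and
  injectivity shows that it is a left inverse as well.\<close>

lemma strand_toggle_iso:
  "\<exists>w. inverse_mors dsp.cat (\<kappa> @ [Down] @ \<mu>) (\<kappa> @ [Up] @ \<mu>) (Dcls (strand_toggle \<kappa> \<mu>)) w"
proof -
  let ?X = "\<kappa> @ [Down] @ \<mu>" and ?Y = "\<kappa> @ [Up] @ \<mu>" and ?E = "Dcls (strand_toggle \<kappa> \<mu>)"
  have E: "?E \<in> hom dsp.cat ?X ?Y" using ctyp_strand_toggle by simp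
  obtain w where w: "dsp.ends w = Some (?X, ?Y)" "stg (length \<kappa>) w = ident dsp.cat ?Y"
    using stg_surj[OF ds_ends_id] by blast
  have wh: "w \<in> hom dsp.cat ?Y ?X" using w(1) by (simp only: dsp.ends_iff)
  have Ew: "Dcmp ?E w = ident dsp.cat ?Y" using apply_strand_toggle[OF w(1)] w(2) by simp
  have wE: "dsp.ends (Dcmp w ?E) = Some (?X, ?X)"
    unfolding dsp.ends_iff by (rule dsp.cat.cmp_hom[OF E wh])
  have "stg (length \<kappa>) (Dcmp w ?E) = Dcmp ?E (ident dsp.cat ?X)"
    unfolding apply_strand_toggle[OF wE, symmetric] dsp.cmp_assoc[symmetric] Ew
    using dsp.cmp_ident_left[OF E] dsp.cmp_ident_right[OF E] by simp
  also have "\<dots> = stg (length \<kappa>) (ident dsp.cat ?X)" by (rule apply_strand_toggle[OF ds_ends_id])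
  finally have "Dcmp w ?E = ident dsp.cat ?X" by (rule stg_inj[OF wE ds_ends_id])
  then show ?thesis using E wh Ew by (auto simp: inverse_mors_def)
qed

lemma eta_iso: "\<exists>w. inverse_mors dsp.cat (ups r @ \<mu>) (ups (r + length \<mu>)) (Eta r \<mu>) w"
proof (induction \<mu> arbitrary: r)
  case Nil
  have "inverse_mors dsp.cat (ups r) (ups r) (ident dsp.cat (ups r)) (ident dsp.cat (ups r))"
    using dsp.cat.ident_hom dsp.cmp_ident_left[OF dsp.cat.ident_hom] by (simp add: inverse_mors_def)
  then show ?case by (auto simp: dsp.ident_cls)
next
  case (Cons a \<mu>)
  have e: "ups r @ [Up] @ \<mu> = ups (Suc r) @ \<mu>" by (simp add: replicate_app_Cons_same)
  from Cons.IH[of "Suc r"] obtain w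
    where w: "inverse_mors dsp.cat (ups r @ [Up] @ \<mu>) (ups (Suc r + length \<mu>)) (Eta (Suc r) \<mu>) w"
    unfolding e by blast
  show ?case
  proof (cases a)
    case Up then show ?thesis using w by auto
  next
    case Down
    obtain v where "inverse_mors dsp.cat (ups r @ [Down] @ \<mu>) (ups r @ [Up] @ \<mu>) (Dcls (strand_toggle (ups r) \<mu>)) v"
      using strand_toggle_iso by blast
    from dsp.cat.inverse_mors_cmp[OF this w] show ?thesis by (auto simp: Down dsp.cmp_cls)
  qed
qed

text \<open>The value does not depend on the choice, by \<open>inverse_mors_unique\<close>; this is
  what makes \<open>omega_append\<close> provable.\<close>

definition omega :: "nat \<Rightarrow> word \<Rightarrow> 'k ds_term set" where
  "omega r \<mu> = (SOME w. inverse_mors dsp.cat (ups r @ \<mu>) (ups (r + length \<mu>)) (Eta r \<mu>) w)"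

lemma omega: "inverse_mors dsp.cat (ups r @ \<mu>) (ups (r + length \<mu>)) (Eta r \<mu>) (omega r \<mu>)"
  unfolding omega_def using eta_iso by (rule someI_ex)

lemma omega_append: "Dcmp (DR \<nu> (omega r \<mu>)) (omega (r + length \<mu>) \<nu>) = omega r (\<mu> @ \<nu>)"
proof -
  interpret R: linear_functor dsp.cat dsp.cat "\<lambda>X. X @ \<nu>" "DR \<nu>" by (rule DR_functor)
  have "inverse_mors dsp.cat (ups r @ \<mu> @ \<nu>) (ups (r + length (\<mu> @ \<nu>))) (Eta r (\<mu> @ \<nu>))
    (Dcmp (DR \<nu> (omega r \<mu>)) (omega (r + length \<mu>) \<nu>))"
    using dsp.cat.inverse_mors_cmp[OF R.inverse_mors_map[OF omega[of r \<mu>]] omega[of "r + length \<mu>" \<nu>]]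
    by (simp add: eta_append add.assoc)
  then show ?thesis by (rule dsp.cat.inverse_mors_unique) (rule omega)
qed

lemma FM_DO: "mtyp os_sig g X Y \<Longrightarrow> FM (DO g) = BA 0 g"
  and FM_DT: "mtyp os_sig g X Y \<Longrightarrow> FM (DT f g) = BA (Suc 0) g"
  using fmap.map_cls[of "os g" X Y] fmap.map_cls[of "CGen (Tog f g)" "tog_dom f # X" "tog_cod f # Y"]
  by (simp_all add: ctyp_simps)

text \<open>For oriented generators this is \<open>eta_natural_right\<close> at
  \<open>r = 0\<close>. A toggle of the first strand is sent to an identity; it is absorbed by
  \<open>eta\<close>, which toggles that strand anyway, and \<open>eta_natural_right\<close> at
  \<open>r = 1\<close> deals with the second tensor factor.\<close>

lemma eta_natural_F:
  assumes f: "f \<in> hom dsp.cat X Y" shows "Dcmp (Eta 0 Y) f = Dcmp (GM (FM f)) (Eta 0 X)"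
proof -
  have I: "linear_functor dsp.cat dsp.cat (\<lambda>X. X) (\<lambda>f. f)" by unfold_locales simp_all
  have GF: "linear_functor dsp.cat dsp.cat (\<lambda>X. ups (length X)) (\<lambda>f. GM (FM f))"
    using functor_comp[OF fmap.functor_map gmap.functor_map] by (simp add: G_ob_def)
  have E: "Eta 0 X \<in> hom dsp.cat X (ups (length X))" for X using Eta_hom[of 0 X] by simp
  show ?thesis
  proof (rule dsp.natural_extend[OF dsp.linear_category_cat I GF E _ f])
    fix g :: "'k ds_gen" and X Y assume g: "ds_sig g X Y"
    show "Dcmp (Eta 0 Y) (Dcls (CGen g)) = Dcmp (GM (FM (Dcls (CGen g)))) (Eta 0 X)"
    proof (cases g)
      case (Os h)
      then have h: "mtyp os_sig h X Y" using g by simp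
      have "DN (ups 0) h = DO h" using DO_cong[OF osp.cls_tens_unit(1)[OF h]] by simp
      then show ?thesis using eta_natural_right[OF h, of 0] FM_DO[OF h] Os by simp
    next
      case (Tog f h)
      then obtain X' Y' where h: "mtyp os_sig h X' Y'" and XY: "X = tog_dom f # X'" "Y = tog_cod f # Y'"
        using g by auto
      have toggle: "Dcmp (Eta 0 (tog_cod f # Z)) (DT f (MId Z)) = Eta 0 (tog_dom f # Z)" for f Z
      proof -
        let ?i = "ident dsp.cat (tog_dom f # Z)"
        have i: "dsp.ends ?i = Some (tog_dom f # Z, tog_dom f # Z)" by (rule ds_ends_id)
        have T: "DT f (MId Z) = Tg f ?i"
          using dsp.cmp_ident_right[OF DT_hom[OF mtyp.intros(2), of f Z]] Tg_eq[OF i] by simp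
        have eT: "dsp.ends (Tg f ?i) = Some (ups 0 @ tog_cod f # Z, tog_dom f # Z)" using i by (simp add: evd)
        have "Eta 0 (tog_dom f # Z) = Dcmp (Eta 0 (tog_dom f # Z)) ?i" by (rule dsp.cmp_ident_right[OF E, symmetric])
        also have "\<dots> = Dcmp (Eta (Suc 0) Z) (case tog_dom f of Up \<Rightarrow> ?i | Down \<Rightarrow> stg 0 ?i)"
          by (rule apply_eta_Cons) (simp add: i)
        \<comment> \<open>For \<open>TauBar\<close> the new \<open>Down\<close> strand is toggled
          back by \<open>eta\<close>, which gives the identity by \<open>TTb\<close>.\<close>
        also have "(case tog_dom f of Up \<Rightarrow> ?i | Down \<Rightarrow> stg 0 ?i) = (case tog_cod f of Up \<Rightarrow> Tg f ?i | Down \<Rightarrow> stg 0 (Tg f ?i))"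
          using TTb[of ?i] i by (cases f) (simp_all add: stg_simps at_def)
        also have "Dcmp (Eta (Suc 0) Z) \<dots> = Dcmp (Eta 0 (tog_cod f # Z)) (Tg f ?i)"
          by (rule apply_eta_Cons[OF eT, symmetric])
        finally show ?thesis unfolding T by simp
      qed
      have up: "Dcmp (DN [Up] h) (DT Tau (MId X')) = Dcmp (DT Tau (MId Y')) (DN [Down] h)"
        using DT_left[OF h mtyp.intros(2), of Tau] DT_right[OF mtyp.intros(2) h, of Tau]
          DT_cong[OF osp.cls_id(1)[OF h]] DT_cong[OF osp.cls_id(2)[OF h]] by simp
      have R: "Dcmp (Eta 0 (Up # Y')) (DN [Up] h) = Dcmp (GM (BA (Suc 0) h)) (Eta 0 (Up # X'))"
        using eta_natural_right[OF h, of "Suc 0"] by simp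
      \<comment> \<open>If the first letter is \<open>Down\<close>, the square for \<open>Up\<close>
        is transported along the toggle \<open>Tau\<close>, which commutes with \<open>h\<close> on
        the other strands.\<close>
      have R': "Dcmp (Eta 0 (a # Y')) (DN [a] h) = Dcmp (GM (BA (Suc 0) h)) (Eta 0 (a # X'))" for a
      proof (cases a)
        case Up then show ?thesis using R by simp
      next
        case Down
        have T: "Eta 0 (Down # Z) = Dcmp (Eta 0 (Up # Z)) (DT Tau (MId Z))" for Z
          using toggle[of Tau Z] by simp
        show ?thesis
          unfolding Down T dsp.cmp_assoc up[symmetric]
          unfolding dsp.cmp_assoc[symmetric] R ..
      qed
      have "DT f h = Dcmp (DN [tog_cod f] h) (DT f (MId X'))"
        using DT_left[OF h mtyp.intros(2), of f] DT_cong[OF osp.cls_id(2)[OF h]] by simp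
      then show ?thesis unfolding Tog FM_DT[OF h] XY
        using R'[of "tog_cod f"] toggle[of f X'] by (simp only: dsp.cmp_assoc[symmetric]) (simp only: dsp.cmp_assoc)
    qed
  qed
qed

lemma skein_equivalence:
  "(\<forall>r \<nu>. inverse_mors (DS q t \<delta>)
        (act_ob (DS q t \<delta>) (G_ob r) \<nu>) (G_ob (act_ob (iB q t \<delta>) r \<nu>))
        (eta q t \<delta> (act_ob (DS q t \<delta>) (G_ob r) \<nu>)) (omega r \<nu>)) \<and>
    module_equivalence (OS q t \<delta>) (iB q t \<delta>) (DS q t \<delta>) G_ob (G_mor q t \<delta>) omega"
proof (intro conjI allI)
  have inv: "inverse_mors (DS q t \<delta>) = inverse_mors dsp.cat" "inverse_mors (iB q t \<delta>) = inverse_mors bp.cat"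
    by (simp_all add: fun_eq_iff inverse_mors_def)
  have isoD: "is_iso (DS q t \<delta>) (ups (r + length \<mu>)) (ups r @ \<mu>) (omega r \<mu>)" for r \<mu>
    unfolding is_iso_def inv using inverse_mors_sym[OF omega] by blast
  show "inverse_mors (DS q t \<delta>) (act_ob (DS q t \<delta>) (G_ob r) \<nu>) (G_ob (act_ob (iB q t \<delta>) r \<nu>))
      (eta q t \<delta> (act_ob (DS q t \<delta>) (G_ob r) \<nu>)) (omega r \<nu>)" for r \<nu>
    using omega[of r \<nu>] by (simp add: inv G_ob_def eta_eq)
  have H: "linear_functor (iB q t \<delta>) (DS q t \<delta>) G_ob (G_mor q t \<delta>)"
    unfolding iB_def DS_def linear_functor_extend using gmap.functor_map by (simp add: G_mor_eq[abs_def])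
  have "module_morphism (OS q t \<delta>) (iB q t \<delta>) (DS q t \<delta>) G_ob (G_mor q t \<delta>) omega"
  proof (rule module_morphism.intro[OF right_module_iB right_module_DS H], rule module_morphism_axioms.intro)
    show "is_iso (DS q t \<delta>) (G_ob (act_ob (iB q t \<delta>) X c)) (act_ob (DS q t \<delta>) (G_ob X) c) (omega X c)" for X c
      using isoD by (simp add: G_ob_def)
    show "cmp (DS q t \<delta>) (omega Y c) (G_mor q t \<delta> (act_mor (iB q t \<delta>) f c))
        = cmp (DS q t \<delta>) (act_mor (DS q t \<delta>) (G_mor q t \<delta> f) c) (omega X c)"
      if "f \<in> hom (iB q t \<delta>) X Y" for f X Y c
    proof -
      have f: "f \<in> hom bp.cat X Y" using that by simp
      show ?thesis unfolding DS_simps iB_simps G_mor_eq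
        by (rule dsp.cat.inverse_mors_natural[OF omega omega DR_hom[OF GM_hom[OF f]] GM_hom[OF BR_hom[OF f]] eta_natural_left[OF f]])
    qed
    show "cmp (DS q t \<delta>) (omega X d) (G_mor q t \<delta> (act_nat (iB q t \<delta>) X g))
        = cmp (DS q t \<delta>) (act_nat (DS q t \<delta>) (G_ob X) g) (omega X c)"
      if g: "g \<in> hom (OS q t \<delta>) c d" for g c d X
    proof -
      obtain u where u: "g = osp.cls u" "mtyp os_sig u c d" using g unfolding OS_eq by (rule osp.hom_obtain)
      have G: "G_ob X = ups X" by (simp add: G_ob_def)
      show ?thesis unfolding DS_simps G_mor_eq u(1) act_nat_iB[OF u(2)] act_nat_DS[OF u(2)] G
        by (rule dsp.cat.inverse_mors_natural[OF omega omega DN_hom[OF u(2)] GM_hom[OF BA_hom[OF u(2)]] eta_natural_right[OF u(2)]])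
    qed
    show "cmp (DS q t \<delta>) (act_mor (DS q t \<delta>) (omega X c) d) (omega (act_ob (iB q t \<delta>) X c) d)
        = omega X (tens_ob (OS q t \<delta>) c d)" for X c d
      by (simp add: OS_eq osp.tens_ob_cat omega_append)
  qed
  moreover have "equivalence_of_categories (iB q t \<delta>) (DS q t \<delta>) G_ob (G_mor q t \<delta>)"
    unfolding equivalence_of_categories_def
  proof (intro conjI exI)
    show "cat_functor (iB q t \<delta>) (DS q t \<delta>) G_ob (G_mor q t \<delta>)" using H by (rule linear_functor.axioms)
    show "cat_functor (DS q t \<delta>) (iB q t \<delta>) length FM"
      unfolding iB_def DS_def cat_functor_extend using fmap.functor_map by (rule linear_functor.axioms)
    have i: "inverse_mors bp.cat X X (ident bp.cat X) (ident bp.cat X)" for X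
      using bp.cat.ident_hom bp.cmp_ident_left[OF bp.cat.ident_hom] by (simp add: inverse_mors_def)
    show "natural_iso (iB q t \<delta>) (iB q t \<delta>) (\<lambda>X. X) (\<lambda>f. f) (length \<circ> G_ob) (FM \<circ> G_mor q t \<delta>) (ident bp.cat)"
      unfolding natural_iso_def
    proof (intro conjI allI ballI)
      show "is_iso (iB q t \<delta>) X ((length \<circ> G_ob) X) (ident bp.cat X)" for X
        unfolding is_iso_def inv using i[of X] by (auto simp: G_ob_def)
      show "cmp (iB q t \<delta>) (ident bp.cat Y) f = cmp (iB q t \<delta>) ((FM \<circ> G_mor q t \<delta>) f) (ident bp.cat X)"
        if "f \<in> hom (iB q t \<delta>) X Y" for X Y f
        using that by (simp add: FM_GM G_mor_eq bp.cmp_ident_left bp.cmp_ident_right)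
    qed
    show "natural_iso (DS q t \<delta>) (DS q t \<delta>) (G_ob \<circ> length) (G_mor q t \<delta> \<circ> FM) (\<lambda>X. X) (\<lambda>f. f) (omega 0)"
      unfolding natural_iso_def
    proof (intro conjI allI ballI)
      show "is_iso (DS q t \<delta>) ((G_ob \<circ> length) X) X (omega 0 X)" for X using isoD[of 0 X] by (simp add: G_ob_def)
      fix X Y f assume "f \<in> hom (DS q t \<delta>) X Y"
      then have f: "f \<in> hom dsp.cat X Y" by simp
      note o = omega[of 0, unfolded replicate_0 append_Nil add_0]
      have "GM (FM f) \<in> hom dsp.cat (ups (length X)) (ups (length Y))"
        using f GM_hom cat_functor.fun_hom[OF linear_functor.axioms(1)[OF fmap.functor_map]] by blast
      from dsp.cat.inverse_mors_natural[OF o o f this eta_natural_F[OF f]]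
      show "cmp (DS q t \<delta>) (omega 0 Y) ((G_mor q t \<delta> \<circ> FM) f) = cmp (DS q t \<delta>) f (omega 0 X)"
        by (simp add: G_mor_eq)
    qed
  qed
  ultimately show "module_equivalence (OS q t \<delta>) (iB q t \<delta>) (DS q t \<delta>) G_ob (G_mor q t \<delta>) omega"
    by (simp add: module_equivalence_def)
qed

end

theorem corollary4p6:
  fixes q t \<delta> :: "'k::{comm_ring,comm_monoid_mult}"
  assumes "q dvd 1" and "t dvd 1"
    and "t - unit_inv t = \<delta> * (q - unit_inv q)"
  shows "\<exists>\<omega>.
    (\<forall>r \<nu>. inverse_mors (DS q t \<delta>)
        (act_ob (DS q t \<delta>) (G_ob r) \<nu>) (G_ob (act_ob (iB q t \<delta>) r \<nu>))
        (eta q t \<delta> (act_ob (DS q t \<delta>) (G_ob r) \<nu>)) (\<omega> r \<nu>)) \<and>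
    module_equivalence (OS q t \<delta>) (iB q t \<delta>) (DS q t \<delta>) G_ob (G_mor q t \<delta>) \<omega>"
proof -
  have unit: "a * unit_inv a = 1" if "a dvd 1" for a :: 'k
  proof -
    from that obtain b where b: "a * b = 1" unfolding dvd_def by metis
    \<comment> \<open>Uniqueness of inverses gives \<open>unit_inv\<close>, a definite description,
      its value.\<close>
    have "c = b" if c: "a * c = 1" for c
    proof -
      have "c = a * b * c" using b by simp
      also have "\<dots> = a * c * b" by (simp only: mult_ac)
      finally show ?thesis using c by simp
    qed
    with b have "unit_inv a = b" unfolding unit_inv_def by (intro the_equality)
    with b show ?thesis by simp
  qed
  interpret skein_parameters q t \<delta> by unfold_locales (rule unit assms)+
  show ?thesis using skein_equivalence by blast
qed

end
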